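(* Let $M$ be an Abelian subgroup of maximal order of $W=W(E_8)$; then $M\cong\mathbb{Z}_2^8$ and $M$ is generated by the reflections $s_{\beta_1},\dots,s_{\beta_8}$ in eight pairwise (strongly) orthogonal roots, these being the only reflections in $M$. Consider the action of $M$ on the $240$ roots of $E_8$. Then: (i) $M$ has exactly eight orbits of size $2$, namely $\{\pm\beta_i\}$, and $14$ further orbits, each of size $16$; the incidence structure whose points are the eight reflections $s_{\beta_i}$ and whose lines are these $14$ orbits, with $s_{\beta_i}$ incident to an orbit $O$ iff $\langle\beta_i,\gamma\rangle\ne0$ for the roots $\gamma\in O$, has four points on each line and seven lines through each point and is the one-point extension of the Fano plane (isomorphic to the design of points and affine planes of the affine space $\mathbb{F}_2^3$). (ii) The discrete Weyl group $N_W(M)/M$ is isomorphic to $2^3:PSL(2,7)$, a semidirect product of an elementary Abelian group of order $8$ by $PSL(2,7)$.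
   Context: $\langle\cdot,\cdot\rangle$ is the $W$-invariant inner product on the ambient space of the root system. $N_W(M)$ denotes the normalizer of $M$ in $W$. The one-point extension of the Fano plane has $8$ points (the $7$ points of the Fano plane plus one new point) and $14$ lines: each Fano line together with the new point, and the $7$ complements (in the $8$ points) of these. *)

theory Defs
  imports "HOL-Analysis.Analysis" "HOL-Algebra.Algebra"
begin

definition E8_roots :: "(real^8) set" where
  "E8_roots = {x. ((\<forall>i. x $ i \<in> \<int>) \<or> (\<forall>i. x $ i - 1/2 \<in> \<int>))
                 \<and> (\<exists>k::int. (\<Sum>i\<in>UNIV. x $ i) = 2 * of_int k)
                 \<and> x \<bullet> x = 2}"

definition reflection :: "real^8 \<Rightarrow> real^8 \<Rightarrow> real^8" where
  "reflection a = (\<lambda>x. x - (2 * (x \<bullet> a) / (a \<bullet> a)) *\<^sub>R a)"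

inductive_set W_E8_carrier :: "(real^8 \<Rightarrow> real^8) set" where
  W_id: "id \<in> W_E8_carrier"
| W_refl: "a \<in> E8_roots \<Longrightarrow> w \<in> W_E8_carrier \<Longrightarrow> reflection a \<circ> w \<in> W_E8_carrier"

definition W_E8 :: "(real^8 \<Rightarrow> real^8) monoid" where
  "W_E8 = \<lparr>carrier = W_E8_carrier, mult = (\<circ>), one = id\<rparr>"

definition abelian_subgroup_W :: "(real^8 \<Rightarrow> real^8) set \<Rightarrow> bool" where
  "abelian_subgroup_W M \<longleftrightarrow> subgroup M W_E8 \<and> (\<forall>x\<in>M. \<forall>y\<in>M. x \<circ> y = y \<circ> x)"

definition root_orbits :: "(real^8 \<Rightarrow> real^8) set \<Rightarrow> (real^8) set set" where
  "root_orbits M = {(\<lambda>w. w \<gamma>) ` M | \<gamma>. \<gamma> \<in> E8_roots}"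

definition Z2_pow :: "nat \<Rightarrow> (nat \<Rightarrow> int) monoid" where
  "Z2_pow n = product_group {..<n} (\<lambda>_. integer_mod_group 2)"

definition SL27_mult :: "int \<times> int \<times> int \<times> int \<Rightarrow> int \<times> int \<times> int \<times> int \<Rightarrow> int \<times> int \<times> int \<times> int" where
  "SL27_mult x y = (case x of (a1,b1,c1,d1) \<Rightarrow> case y of (a2,b2,c2,d2) \<Rightarrow>
     ((a1 * a2 + b1 * c2) mod 7, (a1 * b2 + b1 * d2) mod 7, (c1 * a2 + d1 * c2) mod 7, (c1 * b2 + d1 * d2) mod 7))"

definition SL27 :: "(int \<times> int \<times> int \<times> int) monoid" where
  "SL27 = \<lparr>carrier = {(a1,b1,c1,d1). a1 \<in> {0..6} \<and> b1 \<in> {0..6} \<and> c1 \<in> {0..6} \<and> d1 \<in> {0..6}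
                                   \<and> (a1 * d1 - b1 * c1) mod 7 = 1},
           mult = SL27_mult,
           one = (1,0,0,1)\<rparr>"

definition PSL27 :: "(int \<times> int \<times> int \<times> int) set monoid" where
  "PSL27 = SL27 Mod {(1,0,0,1), (6,0,0,6)}"

text \<open>Fano plane on points 1..7 (nonzero vectors of F_2^3, lines = {a,b,a xor b});
  the new point is 0.\<close>
definition fano_lines :: "nat set set" where
  "fano_lines = {{1,2,3},{1,4,5},{1,6,7},{2,4,6},{2,5,7},{3,4,7},{3,5,6}}"

definition fano_ext_points :: "nat set" where
  "fano_ext_points = {0..7}"

definition fano_ext_lines :: "nat set set" where
  "fano_ext_lines = (\<lambda>L. insert 0 L) ` fano_lines \<union> (\<lambda>L. fano_ext_points - insert 0 L) ` fano_lines"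

end

(* The sign changes of a frame of eight orthogonal roots form an Abelian group of order 256, so a
   maximal M has at least that order.  If a is an element of M and v a lattice vector that separates
   the operators of the group ring Z[M], the vectors of the orbit M v are incongruent modulo twice the lattice unless
   the operators agree up to parity; counting classes modulo 2 bounds a 2-group of isometries of a
   rank d sublattice by 2^d and, when M contains elements of odd order whose sum acts
   nontrivially, gives |M| < 256.  If that sum is zero, the design properties of the 240 roots
   produce a root with small orbit and stabiliser, giving |M| <= 240.  So M is a 2-group
   of order 256, and a minimal (-1)-eigenspace argument finds eight orthogonal reflections in M.

   The remaining roots are half sums of four frame roots with signs; their supports are 14 blocks
   with pairwise even intersections, which three blocks in general position identify with the
   extended Fano plane.  N(M)/M permutes the frame lines faithfully and preserves the blocks, and
   a block automorphism is determined by four points, so its order is at most 1344.  Products of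
   two reflections lift the elations, and these generate the translations and a copy of PSL(2,7)
   acting on the projective line over F_7 by Moebius maps; orders 8 and 168 fill the bound. *)
theory Submission
  imports Defs
begin

section \<open>The E8 lattice\<close>

text \<open>Congruence modulo 2 cannot separate an operator from its negative, so counting orbit
  classes alone loses a factor 2. The augmentation modulo 2 recovers it: orbit points have odd
  augmentation, their differences have even augmentation, and every class of orbit points pays for
  two classes. This requires that an operator of odd augmentation never kills the separating vector
  v, which Frobenius supplies: a 2^k-th power of such an operator is the identity modulo 2 wherever
  the odd-order elements act trivially. That part is cut out by the sum over the odd-order elements;
  if the sum is zero, nothing remains to count on, and geometry of the roots has to replace the
  count. Self-duality of the lattice is used again and again in one form: a vector that pairs
  integrally with the lattice lies in it and so has norm at least 2. Isometries that move too small
  a space would produce shorter vectors. The complement PSL(2,7) is taken as the Moebius group on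
  the 8 points of the projective line, where matrices modulo 7 act naturally; permutations are lists
  so that the finite facts can be evaluated.\<close>

lemma exhaust_8:
  fixes x :: 8
  shows "x = 1 \<or> x = 2 \<or> x = 3 \<or> x = 4 \<or> x = 5 \<or> x = 6 \<or> x = 7 \<or> x = 8"
proof (induct x)
  case (of_int z)
  then have "z = 0 \<or> z = 1 \<or> z = 2 \<or> z = 3 \<or> z = 4 \<or> z = 5 \<or> z = 6 \<or> z = 7" by fastforce
  then show ?case by auto
qed

lemma UNIV_8: "UNIV = {1, 2, 3, 4, 5, 6, 7, 8::8}"
  using exhaust_8 by auto

lemma forall_8: "(\<forall>i::8. P i) \<longleftrightarrow> P 1 \<and> P 2 \<and> P 3 \<and> P 4 \<and> P 5 \<and> P 6 \<and> P 7 \<and> P 8"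
  using exhaust_8 by (smt (verit, best))

lemma sum_8: "sum f (UNIV::8 set) = f 1 + f 2 + f 3 + f 4 + f 5 + f 6 + f 7 + f 8"
  unfolding UNIV_8 by (simp add: ac_simps)

definition E8_lattice :: "(real^8) set" where
  "E8_lattice = {x. ((\<forall>i. x $ i \<in> \<int>) \<or> (\<forall>i. x $ i - 1/2 \<in> \<int>))
                 \<and> (\<exists>k::int. (\<Sum>i\<in>UNIV. x $ i) = 2 * of_int k)}"

lemma E8_roots_eq: "E8_roots = {x \<in> E8_lattice. x \<bullet> x = 2}"
  by (auto simp: E8_roots_def E8_lattice_def)

lemma E8_lattice_zero [simp]: "0 \<in> E8_lattice"
  by (auto simp: E8_lattice_def intro!: exI[of _ 0])

lemma half_add_Ints:
  fixes a b :: real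
  shows "a - 1/2 \<in> \<int> \<Longrightarrow> b \<in> \<int> \<Longrightarrow> a + b - 1/2 \<in> \<int>"
    and "b \<in> \<int> \<Longrightarrow> a - 1/2 \<in> \<int> \<Longrightarrow> b + a - 1/2 \<in> \<int>"
    and "a - 1/2 \<in> \<int> \<Longrightarrow> b - 1/2 \<in> \<int> \<Longrightarrow> a + b \<in> \<int>"
    and "a - 1/2 \<in> \<int> \<Longrightarrow> - a - 1/2 \<in> \<int>"
proof -
  show "a + b - 1/2 \<in> \<int>" if "a - 1/2 \<in> \<int>" "b \<in> \<int>"
    using Ints_add[OF that] by (simp add: algebra_simps)
  show "b + a - 1/2 \<in> \<int>" if "b \<in> \<int>" "a - 1/2 \<in> \<int>"
    using Ints_add[OF that] by (simp add: algebra_simps)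
  show "a + b \<in> \<int>" if "a - 1/2 \<in> \<int>" "b - 1/2 \<in> \<int>"
  proof -
    have "a + b = (a - 1/2) + (b - 1/2) + 1" by simp
    then show ?thesis using that by (metis Ints_1 Ints_add)
  qed
  show "- a - 1/2 \<in> \<int>" if "a - 1/2 \<in> \<int>"
  proof -
    have "- a - 1/2 = - (a - 1/2) - 1" by simp
    then show ?thesis using that by (metis Ints_1 Ints_diff Ints_minus)
  qed
qed

lemma E8_lattice_add [simp]: "x \<in> E8_lattice \<Longrightarrow> y \<in> E8_lattice \<Longrightarrow> x + y \<in> E8_lattice"
proof -
  assume x: "x \<in> E8_lattice" and y: "y \<in> E8_lattice"
  then obtain k l :: int where "(\<Sum>i\<in>UNIV. x $ i) = 2 * of_int k" "(\<Sum>i\<in>UNIV. y $ i) = 2 * of_int l"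
    by (auto simp: E8_lattice_def)
  then have "\<exists>k::int. (\<Sum>i\<in>UNIV. (x + y) $ i) = 2 * of_int k"
    by (intro exI[of _ "k + l"]) (simp add: sum.distrib)
  moreover have "(\<forall>i. (x + y) $ i \<in> \<int>) \<or> (\<forall>i. (x + y) $ i - 1/2 \<in> \<int>)"
    using x y unfolding E8_lattice_def by (auto intro: half_add_Ints)
  ultimately show ?thesis unfolding E8_lattice_def by blast
qed

lemma E8_lattice_minus [simp]: "x \<in> E8_lattice \<Longrightarrow> - x \<in> E8_lattice"
proof -
  assume x: "x \<in> E8_lattice"
  then obtain k :: int where "(\<Sum>i\<in>UNIV. x $ i) = 2 * of_int k"
    by (auto simp: E8_lattice_def)
  then have "\<exists>k::int. (\<Sum>i\<in>UNIV. (- x) $ i) = 2 * of_int k"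
    by (intro exI[of _ "- k"]) (simp add: sum_negf)
  moreover have "(\<forall>i. (- x) $ i \<in> \<int>) \<or> (\<forall>i. (- x) $ i - 1/2 \<in> \<int>)"
    using x unfolding E8_lattice_def by (auto intro!: half_add_Ints(4))
  ultimately show ?thesis unfolding E8_lattice_def by blast
qed

lemma E8_lattice_diff [simp]: "x \<in> E8_lattice \<Longrightarrow> y \<in> E8_lattice \<Longrightarrow> x - y \<in> E8_lattice"
  using E8_lattice_add[of x "- y"] by simp

definition add_closed :: "'a::ab_group_add set \<Rightarrow> bool" where
  "add_closed S \<longleftrightarrow> 0 \<in> S \<and> (\<forall>x\<in>S. \<forall>y\<in>S. x - y \<in> S)"

lemma add_closedD:
  assumes "add_closed S"
  shows "0 \<in> S" "x \<in> S \<Longrightarrow> y \<in> S \<Longrightarrow> x - y \<in> S" "x \<in> S \<Longrightarrow> - x \<in> S" "x \<in> S \<Longrightarrow> y \<in> S \<Longrightarrow> x + y \<in> S"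
proof -
  show z: "0 \<in> S" and d: "\<And>x y. x \<in> S \<Longrightarrow> y \<in> S \<Longrightarrow> x - y \<in> S"
    using assms by (auto simp: add_closed_def)
  show m: "- x \<in> S" if "x \<in> S" for x using d[OF z that] by simp
  show "x + y \<in> S" if "x \<in> S" "y \<in> S" using d[OF that(1) m[OF that(2)]] by simp
qed

lemma add_closed_sum:
  assumes "add_closed S" "\<And>i. i \<in> I \<Longrightarrow> f i \<in> S"
  shows "sum f I \<in> S"
  using assms(2) by (induction I rule: infinite_finite_induct) (auto intro: add_closedD[OF assms(1)])

lemma add_closed_scale_nat:
  fixes S :: "'a::real_vector set"
  assumes "add_closed S" "x \<in> S"
  shows "real n *\<^sub>R x \<in> S"
proof (induction n)
  case (Suc n)
  then show ?case using add_closedD(4)[OF assms(1) assms(2) Suc.IH] by (simp add: algebra_simps)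
qed (simp add: add_closedD[OF assms(1)])

lemma add_closed_scale_int:
  fixes S :: "'a::real_vector set"
  assumes "add_closed S" "x \<in> S"
  shows "real_of_int n *\<^sub>R x \<in> S"
proof (cases "n \<ge> 0")
  case True
  then show ?thesis using add_closed_scale_nat[OF assms, of "nat n"] by simp
next
  case False
  then have "real_of_int n *\<^sub>R x = - (real (nat (- n)) *\<^sub>R x)" by simp
  then show ?thesis using add_closed_scale_nat[OF assms, of "nat (-n)"] add_closedD(3)[OF assms(1)] by metis
qed

lemma add_closed_E8_lattice: "add_closed E8_lattice"
  by (simp add: add_closed_def)

lemma even_square_plus: "even ((n::int) * n + n)"
  by simp

text \<open>For integral coordinates n, norm and coordinate sum together are a sum of terms n(n +
  1), which are even. For coordinates n + 1/2 the norm is such a sum plus 8 * 1/4 = 2.\<close>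

lemma E8_lattice_even:
  assumes "x \<in> E8_lattice"
  obtains k :: int where "x \<bullet> x = 2 * of_int k"
proof -
  obtain s :: int where s: "(\<Sum>i\<in>UNIV. x $ i) = 2 * of_int s" using assms by (auto simp: E8_lattice_def)
  have ip: "x \<bullet> x = (\<Sum>i\<in>UNIV. x $ i * x $ i)" by (simp add: inner_vec_def)
  have dbl: "\<exists>m. (\<Sum>i\<in>UNIV. n i * n i + n i) = 2 * (m::int)" for n :: "8 \<Rightarrow> int"
  proof -
    have "2 dvd (\<Sum>i\<in>UNIV. n i * n i + n i)" by (intro dvd_sum) simp
    then show ?thesis by (rule dvdE) blast
  qed
  consider "\<forall>i. x $ i \<in> \<int>" | "\<forall>i. x $ i - 1/2 \<in> \<int>" using assms by (auto simp: E8_lattice_def)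
  then show ?thesis
  proof cases
    case 1
    define n where "n i = \<lfloor>x $ i\<rfloor>" for i
    have n: "x $ i = real_of_int (n i)" for i using 1 by (simp add: n_def of_int_floor)
    obtain m where m: "(\<Sum>i\<in>UNIV. n i * n i + n i) = 2 * (m::int)" using dbl by blast
    have "x \<bullet> x + (\<Sum>i\<in>UNIV. x $ i) = real_of_int (\<Sum>i\<in>UNIV. n i * n i + n i)"
      by (simp add: ip n sum.distrib)
    then have "x \<bullet> x = 2 * of_int (m - s)" using s m by simp
    then show ?thesis using that by blast
  next
    case 2
    define n where "n i = \<lfloor>x $ i - 1/2\<rfloor>" for i
    have "x $ i - 1/2 = real_of_int (n i)" for i unfolding n_def using 2 by (subst of_int_floor) auto
    then have n: "x $ i = real_of_int (n i) + 1/2" for i by (metis diff_add_cancel)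
    obtain m where m: "(\<Sum>i\<in>UNIV. n i * n i + n i) = 2 * (m::int)" using dbl by blast
    have "x \<bullet> x = real_of_int (\<Sum>i\<in>UNIV. n i * n i + n i) + 2"
      by (simp add: ip n algebra_simps sum.distrib flip: sum_distrib_left)
    then have "x \<bullet> x = 2 * of_int (m + 1)" using m by simp
    then show ?thesis using that by blast
  qed
qed

lemma E8_lattice_inner:
  assumes "x \<in> E8_lattice" "y \<in> E8_lattice" shows "x \<bullet> y \<in> \<int>"
proof -
  obtain k l m :: int where k: "x \<bullet> x = 2 * of_int k" and l: "y \<bullet> y = 2 * of_int l"
    and m: "(x + y) \<bullet> (x + y) = 2 * of_int m"
    using assms E8_lattice_even by (metis E8_lattice_add)
  have "x \<bullet> y = of_int (m - k - l)"
    using k l m by (simp add: inner_add_left inner_add_right inner_commute)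
  then show ?thesis by simp
qed

lemma E8_lattice_axis:
  assumes "i \<noteq> j" shows "axis i 1 + axis j 1 \<in> E8_lattice" "axis i 1 - axis j 1 \<in> E8_lattice"
proof -
  have *: "(\<Sum>k\<in>UNIV. axis i (1::real) $ k) = 1" for i :: 8
    by (simp add: axis_def if_distrib cong: if_cong)
  have "(\<Sum>k\<in>UNIV. (axis i 1 + axis j 1 :: real^8) $ k) = 2 * of_int 1"
    by (simp add: sum.distrib *)
  then show "axis i 1 + axis j 1 \<in> E8_lattice"
    unfolding E8_lattice_def by (auto simp: axis_def)
  have "(\<Sum>k\<in>UNIV. (axis i 1 - axis j 1 :: real^8) $ k) = 2 * of_int 0"
    by (simp add: sum_subtractf *)
  then show "axis i 1 - axis j 1 \<in> E8_lattice"
    unfolding E8_lattice_def by (auto simp: axis_def)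
qed

lemma E8_lattice_half: "(\<chi> i. 1/2) \<in> E8_lattice"
  by (auto simp: E8_lattice_def intro!: exI[of _ 2])

text \<open>Self-duality. Pairing with sums and differences of two unit vectors makes the
  coordinates congruent modulo 1 and their doubles integral; pairing with the all-halves vector
  makes the coordinate sum even. Together with \<open>E8_lattice_norm_ge\<close> this is the source
  of most contradictions about short vectors.\<close>

lemma E8_lattice_unimodular:
  assumes "\<And>y. y \<in> E8_lattice \<Longrightarrow> x \<bullet> y \<in> \<int>"
  shows "x \<in> E8_lattice"
proof -
  have p: "x $ i + x $ j \<in> \<int>" "x $ i - x $ j \<in> \<int>" if "i \<noteq> j" for i j
    using assms[OF E8_lattice_axis(1)[OF that]] assms[OF E8_lattice_axis(2)[OF that]]
    by (simp_all add: inner_add_right inner_diff_right inner_axis)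
  have d: "x $ i - x $ 1 \<in> \<int>" for i using p(2)[of i 1] by (cases "i = 1") auto
  have "(x $ 1 + x $ 2) + (x $ 1 - x $ 2) \<in> \<int>" by (intro Ints_add p) simp_all
  then obtain m :: int where m: "2 * x $ 1 = of_int m" by (auto elim: Ints_cases)
  have h: "(\<forall>i. x $ i \<in> \<int>) \<or> (\<forall>i. x $ i - 1/2 \<in> \<int>)"
  proof (cases "even m")
    case True
    then obtain r where "m = 2 * r" by auto
    then have "x $ 1 \<in> \<int>" using m by simp
    then have "x $ i \<in> \<int>" for i using Ints_add[OF d[of i], of "x $ 1"] by simp
    then show ?thesis by blast
  next
    case False
    then obtain r where "m = 2 * r + 1" using oddE by blast
    then have "x $ 1 - 1/2 = of_int r" using m by simp
    then have "(x $ i - x $ 1) + (x $ 1 - 1/2) \<in> \<int>" for i by (intro Ints_add d) simp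
    then have "x $ i - 1/2 \<in> \<int>" for i by (simp add: algebra_simps)
    then show ?thesis by blast
  qed
  have "x \<bullet> (\<chi> i. 1/2) = (\<Sum>i\<in>UNIV. x $ i) / 2"
    by (simp add: inner_vec_def sum_divide_distrib)
  moreover obtain k :: int where "x \<bullet> (\<chi> i. 1/2) = of_int k"
    using assms[OF E8_lattice_half] by (rule Ints_cases)
  ultimately have "(\<Sum>i\<in>UNIV. x $ i) = 2 * of_int k" by simp
  then show ?thesis using h by (auto simp: E8_lattice_def)
qed

lemma E8_lattice_norm_ge:
  assumes "x \<in> E8_lattice" "x \<noteq> 0" shows "x \<bullet> x \<ge> 2"
proof -
  obtain k :: int where k: "x \<bullet> x = 2 * of_int k" using E8_lattice_even[OF assms(1)] .
  have "x \<bullet> x > 0" using assms(2) by simp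
  then have "k \<ge> 1" using k by simp
  then show ?thesis using k by simp
qed

lemma span_E8_lattice: "span E8_lattice = UNIV"
proof -
  have "axis i 1 \<in> span E8_lattice" for i :: 8
  proof -
    define j :: 8 where "j = (if i = 1 then 2 else 1)"
    then have j: "j \<noteq> i" by auto
    have "axis i 1 = (1/2) *\<^sub>R ((axis i 1 + axis j 1) + (axis i 1 - axis j 1) :: real^8)" by simp
    also have "\<dots> \<in> span E8_lattice"
      by (intro span_scale span_add span_base E8_lattice_axis) (use j in auto)
    finally show ?thesis .
  qed
  then have "Basis \<subseteq> span E8_lattice" by (auto simp: Basis_vec_def)
  then have "span Basis \<subseteq> span E8_lattice" by (metis span_mono span_span)
  then show ?thesis by auto
qed

section \<open>Orthogonal projections and congruences modulo 2\<close>

text \<open>Characterised by orthogonality instead of a basis, so that commutation with isometries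
  follows from uniqueness alone. The choice is meaningful for subspaces, as in
  \<open>proj_props\<close>.\<close>

definition proj :: "'a::euclidean_space set \<Rightarrow> 'a \<Rightarrow> 'a" where
  "proj S x = (SOME y. y \<in> S \<and> (\<forall>w\<in>S. (x - y) \<bullet> w = 0))"

lemma proj_props:
  assumes "subspace S"
  shows "proj S x \<in> S" "w \<in> S \<Longrightarrow> (x - proj S x) \<bullet> w = 0"
proof -
  obtain y z where "y \<in> span S" "\<And>w. w \<in> span S \<Longrightarrow> orthogonal z w" "x = y + z"
    using orthogonal_subspace_decomp_exists[of S x] by metis
  then have "y \<in> S \<and> (\<forall>w\<in>S. (x - y) \<bullet> w = 0)"
    using assms by (auto simp: orthogonal_def span_eq_iff[THEN iffD2])
  then have "proj S x \<in> S \<and> (\<forall>w\<in>S. (x - proj S x) \<bullet> w = 0)"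
    unfolding proj_def by (rule someI)
  then show "proj S x \<in> S" "w \<in> S \<Longrightarrow> (x - proj S x) \<bullet> w = 0" by auto
qed

lemma proj_unique:
  assumes "subspace S" "y \<in> S" "\<And>w. w \<in> S \<Longrightarrow> (x - y) \<bullet> w = 0"
  shows "proj S x = y"
proof -
  have d: "proj S x - y \<in> S" using assms proj_props(1) subspace_diff by blast
  have "(proj S x - y) \<bullet> (proj S x - y) = (x - y) \<bullet> (proj S x - y) - (x - proj S x) \<bullet> (proj S x - y)"
    by (simp add: inner_diff_left)
  then have "(proj S x - y) \<bullet> (proj S x - y) = 0"
    using assms(3)[OF d] proj_props(2)[OF assms(1) d, of x] by simp
  then show ?thesis by simp
qed

lemma linear_proj: "subspace S \<Longrightarrow> linear (proj S)"
proof (intro linearI)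
  assume S: "subspace S"
  show "proj S (x + y) = proj S x + proj S y" for x y
  proof (intro proj_unique[OF S] subspace_add[OF S] proj_props(1)[OF S])
    fix w assume "w \<in> S"
    have "(x + y - (proj S x + proj S y)) \<bullet> w = (x - proj S x) \<bullet> w + (y - proj S y) \<bullet> w"
      by (simp add: inner_diff_left inner_add_left)
    then show "(x + y - (proj S x + proj S y)) \<bullet> w = 0" using proj_props(2)[OF S \<open>w \<in> S\<close>] by simp
  qed
  show "proj S (r *\<^sub>R x) = r *\<^sub>R proj S x" for r x
  proof (intro proj_unique[OF S] subspace_scale[OF S] proj_props(1)[OF S])
    fix w assume "w \<in> S"
    have "(r *\<^sub>R x - r *\<^sub>R proj S x) \<bullet> w = r * ((x - proj S x) \<bullet> w)"
      by (simp add: inner_diff_left algebra_simps)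
    then show "(r *\<^sub>R x - r *\<^sub>R proj S x) \<bullet> w = 0" using proj_props(2)[OF S \<open>w \<in> S\<close>] by simp
  qed
qed

lemma proj_self: "subspace S \<Longrightarrow> x \<in> S \<Longrightarrow> proj S x = x"
  by (rule proj_unique) auto

lemma proj_orthogonal: "subspace S \<Longrightarrow> (\<And>w. w \<in> S \<Longrightarrow> x \<bullet> w = 0) \<Longrightarrow> proj S x = 0"
  by (rule proj_unique) (auto simp: subspace_0)

text \<open>The reals are a vector space over the rationals, and a functional with value 1 at r
  extends from the independent set {r}. Applied to the coefficients of a real relation among vectors
  with rational coordinates, it gives a rational relation that is nonzero at a chosen
  coefficient.\<close>

lemma ex_rational_functional:
  fixes r :: real assumes "r \<noteq> 0"
  obtains \<phi> :: "real \<Rightarrow> rat" where "\<And>x y. \<phi> (x + y) = \<phi> x + \<phi> y" "\<And>q x. \<phi> (of_rat q * x) = q * \<phi> x" "\<phi> r \<noteq> 0"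
proof -
  interpret vector_space_pair "\<lambda>(q::rat) (x::real). of_rat q * x" "(*) :: rat \<Rightarrow> rat \<Rightarrow> rat"
    by unfold_locales (auto simp: algebra_simps of_rat_add of_rat_mult)
  have "vs1.independent {r}" using assms by simp
  from linear_independent_extend[OF this, of "\<lambda>_. 1"] obtain g
    where g: "Vector_Spaces.linear (\<lambda>(q::rat) (x::real). of_rat q * x) (*) g" and "g r = 1" by auto
  interpret g: Vector_Spaces.linear "\<lambda>(q::rat) (x::real). of_rat q * x" "(*)" g by (rule g)
  show ?thesis using that[of g] g.add g.scale \<open>g r = 1\<close> by auto
qed

lemma common_denominator:
  fixes f :: "'a \<Rightarrow> rat"
  assumes "finite Y"
  shows "\<exists>N::int. N > 0 \<and> (\<forall>y\<in>Y. \<exists>m::int. of_int N * f y = of_int m)"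
  using assms
proof induction
  case (insert y Y)
  then obtain N :: int where N: "N > 0" "\<forall>y\<in>Y. \<exists>m::int. of_int N * f y = of_int m" by blast
  obtain a b where ab: "quotient_of (f y) = (a, b)" by force
  have b: "b > 0" using quotient_of_denom_pos[OF ab] .
  have fy: "f y = of_int a / of_int b" using quotient_of_div[OF ab] .
  have "\<exists>m::int. of_int (N * b) * f z = of_int m" if "z \<in> insert y Y" for z
  proof (cases "z = y")
    case True
    then have "of_int (N * b) * f z = of_int (N * a)" using b fy by simp
    then show ?thesis by (rule exI)
  next
    case False
    then have "z \<in> Y" using that by simp
    from bspec[OF N(2) this] obtain m :: int where "of_int N * f z = of_int m" by (rule exE)
    moreover have "of_int (N * b) * f z = of_int N * f z * of_int b" by simp
    ultimately have "of_int (N * b) * f z = of_int (m * b)" by simp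
    then show ?thesis by (rule exI)
  qed
  moreover have "N * b > 0" using N b by simp
  ultimately show ?case by blast
next
  case empty
  then show ?case by (intro exI[of _ 1]) simp
qed

text \<open>All coefficients are halved as long as they are all even; this stops because the nonzero
  one at \<open>y0\<close> shrinks each time.\<close>

lemma odd_multiple:
  fixes c :: "'a \<Rightarrow> int"
  assumes "y0 \<in> Y" "c y0 \<noteq> 0"
  shows "\<exists>c' d. d \<noteq> 0 \<and> (\<forall>y\<in>Y. c y = d * c' y) \<and> (\<exists>y\<in>Y. odd (c' y))"
  using assms(2)
proof (induction "nat \<bar>c y0\<bar>" arbitrary: c rule: less_induct)
  case less
  show ?case
  proof (cases "\<exists>y\<in>Y. odd (c y)")
    case True
    then show ?thesis by (intro exI[of _ c] exI[of _ 1]) auto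
  next
    case False
    define b where "b y = c y div 2" for y
    have cb: "c y = 2 * b y" if "y \<in> Y" for y using False that by (simp add: b_def)
    have "b y0 \<noteq> 0" "nat \<bar>b y0\<bar> < nat \<bar>c y0\<bar>" using cb[OF assms(1)] less.prems by auto
    then obtain c' d where "d \<noteq> 0" "\<forall>y\<in>Y. b y = d * c' y" "\<exists>y\<in>Y. odd (c' y)"
      using less.hyps[of b] by blast
    then show ?thesis using cb by (intro exI[of _ c'] exI[of _ "2 * d"]) auto
  qed
qed

lemma E8_lattice_coord_Rats: assumes "x \<in> E8_lattice" shows "x $ i \<in> \<rat>"
proof -
  have "x $ i \<in> \<int> \<or> x $ i - 1/2 \<in> \<int>" using assms by (auto simp: E8_lattice_def)
  then show ?thesis
  proof
    assume "x $ i - 1/2 \<in> \<int>"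
    then have "(x $ i - 1/2) + 1/2 \<in> \<rat>" by (intro Rats_add) (auto intro: subsetD[OF Ints_subset_Rats])
    then show ?thesis by simp
  qed (auto intro: subsetD[OF Ints_subset_Rats])
qed

text \<open>A real dependence is pushed through a rational functional, cleared of denominators and
  stripped of common factors 2. The odd coefficient is what keeps the relation nontrivial modulo
  2.\<close>

lemma integer_relation:
  assumes "finite Y" "Y \<subseteq> E8_lattice" "dim Y < card Y"
  shows "\<exists>c::real^8\<Rightarrow>int. (\<exists>y\<in>Y. odd (c y)) \<and> (\<Sum>y\<in>Y. real_of_int (c y) *\<^sub>R y) = 0"
proof -
  have "dependent Y" using assms(3) dim_eq_card_independent by fastforce
  then obtain u y0 where u: "(\<Sum>y\<in>Y. u y *\<^sub>R y) = 0" "y0 \<in> Y" "u y0 \<noteq> 0"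
    using dependent_finite[OF assms(1)] by auto
  obtain \<phi> :: "real \<Rightarrow> rat" where phi: "\<And>x y. \<phi> (x + y) = \<phi> x + \<phi> y" "\<And>q x. \<phi> (of_rat q * x) = q * \<phi> x" "\<phi> (u y0) \<noteq> 0"
    using ex_rational_functional[OF u(3)] by metis
  have phi0: "\<phi> 0 = 0" using phi(1)[of 0 0] by simp
  have phi_sum: "\<phi> (sum g Y) = (\<Sum>y\<in>Y. \<phi> (g y))" for g
    using assms(1) by (induction Y rule: finite_induct) (auto simp: phi phi0)
  define q where "q y i = (SOME r. y $ i = real_of_rat r)" for y :: "real^8" and i
  have q: "y $ i = real_of_rat (q y i)" if "y \<in> Y" for y i
  proof -
    have "y $ i \<in> \<rat>" using E8_lattice_coord_Rats assms(2) that by blast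
    then have "\<exists>r. y $ i = real_of_rat r" by (rule Rats_cases) blast
    then show ?thesis unfolding q_def by (rule someI_ex)
  qed
  have rel: "(\<Sum>y\<in>Y. q y i * \<phi> (u y)) = 0" for i
  proof -
    have "(\<Sum>y\<in>Y. of_rat (q y i) * u y) = (\<Sum>y\<in>Y. u y *\<^sub>R y) $ i"
      using q by (simp add: mult.commute)
    also have "\<dots> = 0" using u by simp
    finally have "\<phi> (\<Sum>y\<in>Y. of_rat (q y i) * u y) = 0" by (simp add: phi0)
    then show ?thesis by (simp add: phi_sum phi)
  qed
  obtain N :: int where N: "N > 0" "\<And>y. y \<in> Y \<Longrightarrow> \<exists>m::int. of_int N * \<phi> (u y) = of_int m"
    using common_denominator[OF assms(1), of "\<lambda>y. \<phi> (u y)"] by blast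
  define c where "c y = \<lfloor>of_int N * \<phi> (u y)\<rfloor>" for y
  have c: "of_int (c y) = of_int N * \<phi> (u y)" if "y \<in> Y" for y
    using N(2)[OF that] by (auto simp: c_def)
  have "c y0 \<noteq> 0" using c[OF u(2)] N(1) phi(3) by auto
  from odd_multiple[where c=c, OF u(2) this] obtain c' d where d: "d \<noteq> 0" "\<And>y. y \<in> Y \<Longrightarrow> c y = d * c' y" "\<exists>y\<in>Y. odd (c' y)"
    by blast
  have "(\<Sum>y\<in>Y. real_of_int (c' y) *\<^sub>R y) $ i = 0" for i
  proof -
    have "(\<Sum>y\<in>Y. of_int (c y) * q y i) = of_int N * (\<Sum>y\<in>Y. q y i * \<phi> (u y))"
      by (simp add: c sum_distrib_left algebra_simps)
    then have "(\<Sum>y\<in>Y. of_int (c y) * q y i) = 0" using rel by simp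
    then have "of_int d * (\<Sum>y\<in>Y. of_int (c' y) * q y i) = 0"
      by (simp add: d sum_distrib_left algebra_simps)
    then have "(\<Sum>y\<in>Y. of_int (c' y) * q y i) = 0" using d(1) by simp
    then have "real_of_rat (\<Sum>y\<in>Y. of_int (c' y) * q y i) = 0" by simp
    then show ?thesis by (simp add: of_rat_sum of_rat_mult q)
  qed
  then have "(\<Sum>y\<in>Y. real_of_int (c' y) *\<^sub>R y) = 0" by (simp only: vec_eq_iff zero_index) blast
  then show ?thesis using d(3) by blast
qed

text \<open>Linear independence over F_2 of the classes of Y in \<Lambda> / 2\<Lambda>; a linear
  combination over F_2 is a subset sum.\<close>

definition indep_mod2 :: "(real^8) set \<Rightarrow> (real^8) set \<Rightarrow> bool" where
  "indep_mod2 \<Lambda> Y \<longleftrightarrow> finite Y \<and> Y \<subseteq> \<Lambda> \<and> (\<forall>S\<subseteq>Y. S \<noteq> {} \<longrightarrow> (1/2) *\<^sub>R \<Sum>S \<notin> \<Lambda>)"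

text \<open>Too many vectors satisfy an integral relation with an odd coefficient, and read modulo 2
  it puts half the sum of the odd-coefficient vectors into \<Lambda>.\<close>

lemma card_indep_mod2_le:
  assumes "add_closed \<Lambda>" "\<Lambda> \<subseteq> E8_lattice" "indep_mod2 \<Lambda> Y"
  shows "card Y \<le> dim \<Lambda>"
proof (rule ccontr)
  assume a: "\<not> card Y \<le> dim \<Lambda>"
  have Y: "finite Y" "Y \<subseteq> \<Lambda>" "\<And>S. S \<subseteq> Y \<Longrightarrow> S \<noteq> {} \<Longrightarrow> (1/2) *\<^sub>R \<Sum>S \<notin> \<Lambda>" using assms(3) by (auto simp: indep_mod2_def)
  have "dim Y < card Y" using a dim_subset[OF Y(2)] by simp
  then obtain c :: "real^8 \<Rightarrow> int" where c: "\<exists>y\<in>Y. odd (c y)" "(\<Sum>y\<in>Y. real_of_int (c y) *\<^sub>R y) = 0"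
    using integer_relation[OF Y(1) subset_trans[OF Y(2) assms(2)]] by blast
  define S where "S = {y\<in>Y. odd (c y)}"
  have dec: "real_of_int (c y) = (if odd (c y) then 1 else 0) + 2 * real_of_int (c y div 2)" for y
  proof -
    have "c y = (if odd (c y) then 1 else 0) + 2 * (c y div 2)" by (auto elim!: oddE)
    then have "real_of_int (c y) = real_of_int ((if odd (c y) then 1 else 0) + 2 * (c y div 2))" by simp
    then show ?thesis by simp
  qed
  have "(\<Sum>y\<in>Y. real_of_int (c y) *\<^sub>R y) = (\<Sum>y\<in>Y. (if odd (c y) then y else 0) + 2 *\<^sub>R (real_of_int (c y div 2) *\<^sub>R y))"
    by (intro sum.cong refl, subst dec) (simp add: scaleR_add_left)
  also have "\<dots> = \<Sum>S + 2 *\<^sub>R (\<Sum>y\<in>Y. real_of_int (c y div 2) *\<^sub>R y)"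
    by (simp add: sum.distrib scaleR_right.sum S_def Y(1) sum.inter_filter)
  finally have "\<Sum>S + 2 *\<^sub>R (\<Sum>y\<in>Y. real_of_int (c y div 2) *\<^sub>R y) = 0" using c(2) by simp
  then have "\<Sum>S = - (2 *\<^sub>R (\<Sum>y\<in>Y. real_of_int (c y div 2) *\<^sub>R y))" by (simp add: eq_neg_iff_add_eq_0)
  then have "(1/2) *\<^sub>R \<Sum>S = - (\<Sum>y\<in>Y. real_of_int (c y div 2) *\<^sub>R y)" by simp
  moreover have "(\<Sum>y\<in>Y. real_of_int (c y div 2) *\<^sub>R y) \<in> \<Lambda>"
    using Y(2) by (intro add_closed_sum[OF assms(1)] add_closed_scale_int[OF assms(1)]) auto
  ultimately have "(1/2) *\<^sub>R \<Sum>S \<in> \<Lambda>" using add_closedD(3)[OF assms(1)] by simp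
  moreover have "S \<subseteq> Y" "S \<noteq> {}" using c(1) by (auto simp: S_def)
  ultimately show False using Y(3) by blast
qed

text \<open>By maximality, a largest independent set Y modulo 2 represents every class by a subset
  sum, so the classes are no more numerous than the subsets of Y.\<close>

lemma card_incongruent_mod2_le:
  assumes \<Lambda>: "add_closed \<Lambda>" "\<Lambda> \<subseteq> E8_lattice" and T: "T \<subseteq> \<Lambda>" "finite T"
    and inc: "\<And>x y. x \<in> T \<Longrightarrow> y \<in> T \<Longrightarrow> x \<noteq> y \<Longrightarrow> (1/2) *\<^sub>R (x - y) \<notin> \<Lambda>"
  shows "card T \<le> 2 ^ dim \<Lambda>"
proof -
  have "indep_mod2 \<Lambda> {}" by (simp add: indep_mod2_def)
  moreover have "\<forall>Y. indep_mod2 \<Lambda> Y \<longrightarrow> card Y < Suc (dim \<Lambda>)"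
    using card_indep_mod2_le[OF \<Lambda>] by (simp add: less_Suc_eq_le)
  ultimately have "\<exists>Y. indep_mod2 \<Lambda> Y \<and> (\<forall>Z. indep_mod2 \<Lambda> Z \<longrightarrow> card Z \<le> card Y)"
    by (rule ex_has_greatest_nat)
  then obtain Y where Y: "indep_mod2 \<Lambda> Y" and max: "\<And>Z. indep_mod2 \<Lambda> Z \<Longrightarrow> card Z \<le> card Y"
    by blast
  have fY: "finite Y" and YL: "Y \<subseteq> \<Lambda>" using Y by (auto simp: indep_mod2_def)
  have ex: "\<exists>S. S \<subseteq> Y \<and> (1/2) *\<^sub>R (t - \<Sum>S) \<in> \<Lambda>" if t: "t \<in> \<Lambda>" for t
  proof (cases "t \<in> Y")
    case True
    then show ?thesis by (intro exI[of _ "{t}"]) (simp add: add_closedD[OF \<Lambda>(1)])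
  next
    case False
    then have "card (insert t Y) > card Y" using fY by simp
    then have "\<not> indep_mod2 \<Lambda> (insert t Y)" using max by fastforce
    then obtain S where S: "S \<subseteq> insert t Y" "S \<noteq> {}" "(1/2) *\<^sub>R \<Sum>S \<in> \<Lambda>"
      using fY YL t by (auto simp: indep_mod2_def)
    have tS: "t \<in> S"
    proof (rule ccontr)
      assume "t \<notin> S" then have "S \<subseteq> Y" using S by blast
      then show False using S Y by (auto simp: indep_mod2_def)
    qed
    define S' where "S' = S - {t}"
    have S': "S' \<subseteq> Y" "finite S'" using S fY by (auto simp: S'_def intro: finite_subset)
    have "\<Sum>S = t + \<Sum>S'" unfolding S'_def using sum.remove[of S t "\<lambda>x. x"] tS finite_subset[OF S(1)] fY by simp
    then have "(1/2) *\<^sub>R (t - \<Sum>S') = (1/2) *\<^sub>R \<Sum>S - \<Sum>S'"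
      by (simp add: algebra_simps flip: scaleR_add_left)
    moreover have "\<Sum>S' \<in> \<Lambda>" using S' YL by (intro add_closed_sum[OF \<Lambda>(1)]) auto
    ultimately have "(1/2) *\<^sub>R (t - \<Sum>S') \<in> \<Lambda>" using S(3) add_closedD(2)[OF \<Lambda>(1)] by simp
    then show ?thesis using S'(1) by blast
  qed
  define f where "f t = (SOME S. S \<subseteq> Y \<and> (1/2) *\<^sub>R (t - \<Sum>S) \<in> \<Lambda>)" for t
  have f: "f t \<subseteq> Y" "(1/2) *\<^sub>R (t - \<Sum>(f t)) \<in> \<Lambda>" if "t \<in> T" for t
    using someI_ex[OF ex, of t] that T(1) unfolding f_def by auto
  have "inj_on f T"
  proof (rule inj_onI, rule ccontr)
    fix x y assume xy: "x \<in> T" "y \<in> T" "f x = f y" "x \<noteq> y"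
    have "(1/2) *\<^sub>R (x - y) = (1/2) *\<^sub>R (x - \<Sum>(f x)) - (1/2) *\<^sub>R (y - \<Sum>(f y))"
      by (simp add: xy(3) algebra_simps)
    moreover have "(1/2) *\<^sub>R (x - \<Sum>(f x)) - (1/2) *\<^sub>R (y - \<Sum>(f y)) \<in> \<Lambda>"
      by (intro add_closedD(2)[OF \<Lambda>(1)] f xy(1,2))
    ultimately show False using inc[OF xy(1,2,4)] by simp
  qed
  then have "card T = card (f ` T)" by (simp add: card_image)
  also have "\<dots> \<le> card (Pow Y)" using f fY by (intro card_mono) auto
  also have "\<dots> = 2 ^ card Y" by (simp add: card_Pow fY)
  also have "\<dots> \<le> 2 ^ dim \<Lambda>" using card_indep_mod2_le[OF \<Lambda> Y] by simp
  finally show ?thesis .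
qed

section \<open>Group rings of Abelian groups of lattice isometries\<close>

text \<open>The image of the integral group ring of A among the operators, with the augmentation
  modulo 2 as flag. The flag belongs to the expression, so a priori one operator may carry both
  values; ruling this out at a separating vector is the purpose of \<open>odd_nz\<close> in
  \<open>restrict_orbit_bound\<close>.\<close>

inductive zring :: "('a::real_vector \<Rightarrow> 'a) set \<Rightarrow> bool \<Rightarrow> ('a \<Rightarrow> 'a) \<Rightarrow> bool" for A where
  zring_base: "a \<in> A \<Longrightarrow> zring A True a"
| zring_zero: "zring A False (\<lambda>x. 0)"
| zring_add: "zring A p S \<Longrightarrow> zring A q T \<Longrightarrow> zring A (p \<noteq> q) (\<lambda>x. S x + T x)"
| zring_neg: "zring A p S \<Longrightarrow> zring A p (\<lambda>x. - S x)"

locale abelian_isometries =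
  fixes A :: "(real^8 \<Rightarrow> real^8) set"
  assumes finite_A: "finite A"
    and id_A: "id \<in> A"
    and comp_A: "a \<in> A \<Longrightarrow> b \<in> A \<Longrightarrow> a \<circ> b \<in> A"
    and inv_A: "a \<in> A \<Longrightarrow> \<exists>b\<in>A. b \<circ> a = id \<and> a \<circ> b = id"
    and comm_A: "a \<in> A \<Longrightarrow> b \<in> A \<Longrightarrow> a \<circ> b = b \<circ> a"
    and linear_A: "a \<in> A \<Longrightarrow> linear a"
    and isometry_A: "a \<in> A \<Longrightarrow> a x \<bullet> a y = x \<bullet> y"
    and lattice_A: "a \<in> A \<Longrightarrow> x \<in> E8_lattice \<Longrightarrow> a x \<in> E8_lattice"
begin

lemma comm_app: "a \<in> A \<Longrightarrow> b \<in> A \<Longrightarrow> a (b x) = b (a x)"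
  using comm_A by (metis comp_apply)

lemma inv_app:
  assumes "a \<in> A" obtains b where "b \<in> A" "\<And>x. b (a x) = x" "\<And>x. a (b x) = x"
proof -
  obtain b where "b \<in> A" "b \<circ> a = id" "a \<circ> b = id" using inv_A[OF assms] by blast
  then show ?thesis using that by (metis comp_apply id_apply)
qed

lemma comp_app: "a \<in> A \<Longrightarrow> b \<in> A \<Longrightarrow> (\<lambda>x. a (b x)) \<in> A"
  using comp_A[of a b] by (simp add: comp_def)

lemma pow_A: "a \<in> A \<Longrightarrow> a ^^ n \<in> A"
  by (induction n) (simp_all add: id_A[unfolded id_def] id_A comp_A)

definition inv_set :: "(real^8) set \<Rightarrow> bool" where "inv_set S \<longleftrightarrow> (\<forall>a\<in>A. \<forall>x\<in>S. a x \<in> S)"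

lemma inv_setD: "inv_set S \<Longrightarrow> a \<in> A \<Longrightarrow> x \<in> S \<Longrightarrow> a x \<in> S"
  by (simp add: inv_set_def)

lemma inv_set_lattice: "inv_set E8_lattice"
  by (simp add: inv_set_def lattice_A)

definition zop :: "(real^8 \<Rightarrow> real^8) \<Rightarrow> bool" where "zop T \<longleftrightarrow> (\<exists>p. zring A p T)"

lemma zring_linear: "zring A p T \<Longrightarrow> linear T"
  by (induction rule: zring.induct)
    (auto simp: linear_A linear_zero intro: linear_compose_add linear_compose_neg)

lemma zring_closed:
  assumes "zring A p T" "add_closed \<Lambda>" "inv_set \<Lambda>" "x \<in> \<Lambda>"
  shows "T x \<in> \<Lambda>"
  using assms(1)
  by (induction rule: zring.induct) (auto intro: inv_setD[OF assms(3)] assms(4) add_closedD(1,3,4)[OF assms(2)])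

lemma zring_comp_base:
  assumes a: "a \<in> A" and T: "zring A q T" shows "zring A q (\<lambda>x. a (T x))"
  using T
proof (induction rule: zring.induct)
  case (zring_base b)
  then show ?case using zring.zring_base[OF comp_app[of a b]] a by simp
next
  case zring_zero
  show ?case using zring.zring_zero by (simp add: linear_0[OF linear_A[OF a]])
next
  case (zring_add p S q T)
  show ?case using zring.zring_add[OF zring_add.IH] by (simp add: linear_add[OF linear_A[OF a]])
next
  case (zring_neg p S)
  show ?case using zring.zring_neg[OF zring_neg.IH] by (simp add: linear_neg[OF linear_A[OF a]])
qed

lemma zring_comp:
  assumes T: "zring A q T" and S: "zring A p S" shows "zring A (p \<and> q) (\<lambda>x. S (T x))"
  using S
proof (induction rule: zring.induct)
  case (zring_base a)
  then show ?case using zring_comp_base[OF _ T] by simp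
next
  case zring_zero
  show ?case using zring.zring_zero by simp
next
  case (zring_add p S r U)
  have "((p \<noteq> r) \<and> q) = ((p \<and> q) \<noteq> (r \<and> q))" by blast
  then show ?case using zring.zring_add[OF zring_add.IH] by simp
next
  case (zring_neg p S)
  show ?case using zring.zring_neg[OF zring_neg.IH] .
qed

lemma zring_comm_base:
  assumes a: "a \<in> A" and S: "zring A p S" shows "S (a x) = a (S x)"
  using S
  by (induction rule: zring.induct)
    (auto simp: comm_app[OF _ a] linear_0[OF linear_A[OF a]] linear_add[OF linear_A[OF a]] linear_neg[OF linear_A[OF a]])

lemma zring_comm:
  assumes T: "zring A q T" and S: "zring A p S" shows "S (T x) = T (S x)"
  using S
  by (induction rule: zring.induct)
    (auto simp: zring_comm_base[OF _ T] linear_0[OF zring_linear[OF T]] linear_add[OF zring_linear[OF T]] linear_neg[OF zring_linear[OF T]])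

text \<open>The adjoint of an isometry is its inverse, which is again in A; the rest is
  additivity.\<close>

lemma zring_adjoint: "zring A p T \<Longrightarrow> \<exists>T'. zring A p T' \<and> (\<forall>x y. T x \<bullet> y = x \<bullet> T' y)"
proof (induction rule: zring.induct)
  case (zring_base a)
  then obtain b where b: "b \<in> A" "\<And>x. b (a x) = x" "\<And>x. a (b x) = x" using inv_app by blast
  have "a x \<bullet> y = x \<bullet> b y" for x y using isometry_A[OF zring_base, of x "b y"] b by simp
  then show ?case using b zring.zring_base by blast
next
  case zring_zero
  show ?case by (intro exI[of _ "\<lambda>x. 0"]) (simp add: zring.zring_zero)
next
  case (zring_add p S q T)
  then obtain S' T' where "zring A p S'" "zring A q T'" "\<And>x y. S x \<bullet> y = x \<bullet> S' y" "\<And>x y. T x \<bullet> y = x \<bullet> T' y"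
    by blast
  then show ?case by (intro exI[of _ "\<lambda>x. S' x + T' x"]) (use zring.zring_add in \<open>auto simp only: inner_add_left inner_add_right\<close>)
next
  case (zring_neg p S)
  then obtain S' where "zring A p S'" "\<And>x y. S x \<bullet> y = x \<bullet> S' y" by blast
  then show ?case by (intro exI[of _ "\<lambda>x. - S' x"]) (simp add: zring.zring_neg)
qed

lemma zring_id: "zring A True (\<lambda>x. x)"
  using zring_base[OF id_A] by (simp add: id_def)

lemma zop_base: "a \<in> A \<Longrightarrow> zop a"
  using zring_base by (auto simp: zop_def)

lemma zop_comp: "zop S \<Longrightarrow> zop T \<Longrightarrow> zop (\<lambda>x. S (T x))"
  unfolding zop_def using zring_comp by blast

lemma zop_id: "zop (\<lambda>x. x)"
  using zring_id by (auto simp: zop_def)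

lemma zop_zero: "zop (\<lambda>x. 0)"
  using zring_zero by (auto simp: zop_def)

lemma zop_add: "zop S \<Longrightarrow> zop T \<Longrightarrow> zop (\<lambda>x. S x + T x)"
  unfolding zop_def using zring_add by blast

lemma zop_neg: "zop S \<Longrightarrow> zop (\<lambda>x. - S x)"
  unfolding zop_def using zring_neg by blast

lemma zop_diff: "zop S \<Longrightarrow> zop T \<Longrightarrow> zop (\<lambda>x. S x - T x)"
  using zop_add[of S "\<lambda>x. - T x"] zop_neg[of T] by simp

lemma zop_double: "zop S \<Longrightarrow> zop (\<lambda>x. 2 *\<^sub>R S x)"
  using zop_add[of S S] by (simp add: scaleR_2)

lemma zop_linear: "zop T \<Longrightarrow> linear T"
  using zring_linear by (auto simp: zop_def)

lemma zop_comm: "zop S \<Longrightarrow> zop T \<Longrightarrow> S (T x) = T (S x)"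
  unfolding zop_def using zring_comm by blast

lemma zop_pow: "zop T \<Longrightarrow> zop (T ^^ n)"
proof (induction n)
  case 0
  show ?case using zop_id by (simp add: id_def)
next
  case (Suc n)
  show ?case using zop_comp[OF Suc.prems Suc.IH[OF Suc.prems]] by (simp add: comp_def)
qed

lemma zop_closed:
  assumes "zop T" "add_closed \<Lambda>" "inv_set \<Lambda>" "x \<in> \<Lambda>"
  shows "T x \<in> \<Lambda>"
  using zring_closed assms by (auto simp: zop_def)

lemma zop_lattice: "zop T \<Longrightarrow> x \<in> E8_lattice \<Longrightarrow> T x \<in> E8_lattice"
  by (rule zop_closed[OF _ add_closed_E8_lattice inv_set_lattice])

lemma zring_even_double:
  assumes "zop T" shows "zring A False (\<lambda>x. 2 *\<^sub>R T x)"
proof -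
  obtain p where "zring A p T" using assms by (auto simp: zop_def)
  from zring_add[OF this this] show ?thesis by (simp add: scaleR_2)
qed

text \<open>Iteration gives u = 2^n S^n u with S^n u a nonzero lattice vector of norm at least 2, so
  the norm of u would exceed every bound. This plays the role of Nakayama's lemma for the prime
  2.\<close>

lemma infinitely_divisible_zero:
  assumes "zop S" "u \<in> E8_lattice" "u = 2 *\<^sub>R S u"
  shows "u = 0"
proof (rule ccontr)
  assume nz: "u \<noteq> 0"
  have pow: "u = (2 ^ n) *\<^sub>R (S ^^ n) u" for n
  proof (induction n)
    case (Suc n)
    have "(S ^^ n) u = (S ^^ n) (2 *\<^sub>R S u)" using arg_cong[where f="S ^^ n", OF assms(3)] .
    also have "\<dots> = 2 *\<^sub>R (S ^^ n) (S u)" by (rule linear_cmul[OF zop_linear[OF zop_pow[OF assms(1)]]])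
    also have "(S ^^ n) (S u) = (S ^^ Suc n) u" by (simp only: funpow_Suc_right comp_apply)
    finally have "(S ^^ n) u = 2 *\<^sub>R (S ^^ Suc n) u" .
    then have "(2 ^ n) *\<^sub>R (S ^^ n) u = (2 ^ Suc n) *\<^sub>R (S ^^ Suc n) u"
      by (simp only: scaleR_scaleR power_Suc mult.commute)
    with Suc.IH show ?case by (rule trans)
  qed simp
  obtain n where n: "u \<bullet> u < 2 ^ n" using real_arch_pow[of 2 "u \<bullet> u"] by auto
  let ?w = "(S ^^ n) u"
  have "?w \<in> E8_lattice" by (rule zop_lattice[OF zop_pow[OF assms(1)] assms(2)])
  moreover have "?w \<noteq> 0"
  proof
    assume "?w = 0"
    with pow[of n] have "u = (2 ^ n) *\<^sub>R 0" by (rule back_subst[of "\<lambda>z. u = (2 ^ n) *\<^sub>R z"])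
    with nz show False by simp
  qed
  ultimately have w: "?w \<bullet> ?w \<ge> 2" by (rule E8_lattice_norm_ge)
  have "u \<bullet> u = (2 ^ n *\<^sub>R ?w) \<bullet> (2 ^ n *\<^sub>R ?w)" using pow[of n] by (rule arg_cong[where f="\<lambda>z. z \<bullet> z"])
  also have "\<dots> = (2 ^ n * 2 ^ n) * (?w \<bullet> ?w)" by simp
  also have "\<dots> \<ge> (2 ^ n * 1) * 1" using w by (intro mult_mono) auto
  finally show False using n by simp
qed

text \<open>v is chosen with the largest possible orbit span. If T kills v but not w, then w' = T'
  w, with T' the adjoint of T, has an orbit orthogonal to that of v, and the orbit of v + w' spans
  strictly more.\<close>

lemma ex_separating_vector:
  assumes \<Lambda>: "add_closed \<Lambda>" "inv_set \<Lambda>"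
  shows "\<exists>v\<in>\<Lambda>. \<forall>T. zop T \<longrightarrow> T v = 0 \<longrightarrow> (\<forall>x\<in>\<Lambda>. T x = 0)"
proof -
  define d where "d v = dim ((\<lambda>a. a v) ` A)" for v
  have "d v < 9" for v
    using dim_subset_UNIV[of "(\<lambda>a. a v) ` A"] by (simp add: d_def)
  then have "\<forall>v. v \<in> \<Lambda> \<longrightarrow> d v < 9" by blast
  from ex_has_greatest_nat[of "\<lambda>v. v \<in> \<Lambda>" 0, OF add_closedD(1)[OF \<Lambda>(1)] this]
  obtain v where v: "v \<in> \<Lambda>" and max: "\<And>w. w \<in> \<Lambda> \<Longrightarrow> d w \<le> d v" by blast
  have "T w = 0" if T: "zop T" "T v = 0" and w: "w \<in> \<Lambda>" for T w
  proof (rule ccontr)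
    assume nz: "T w \<noteq> 0"
    obtain T' where T': "zop T'" "\<And>x y. T x \<bullet> y = x \<bullet> T' y"
      using zring_adjoint T(1) unfolding zop_def by blast
    define w' where "w' = T' w"
    have w'\<Lambda>: "w' \<in> \<Lambda>" unfolding w'_def by (rule zop_closed[OF T'(1) \<Lambda> w])
    have orth: "w' \<bullet> S v = 0" if "zop S" for S
    proof -
      have "w' \<bullet> S v = S v \<bullet> T' w" unfolding w'_def by (rule inner_commute)
      also have "\<dots> = T (S v) \<bullet> w" by (rule T'(2)[symmetric])
      also have "T (S v) = 0" using zop_comm[OF T(1) that] T(2) linear_0[OF zop_linear[OF that]] by simp
      finally show ?thesis by simp
    qed
    have orth2: "S w' \<bullet> R v = 0" if SR: "zop S" "zop R" for S R
    proof -
      obtain S' where S': "zop S'" "\<And>x y. S x \<bullet> y = x \<bullet> S' y"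
        using zring_adjoint SR(1) unfolding zop_def by blast
      have "S w' \<bullet> R v = w' \<bullet> S' (R v)" by (rule S'(2))
      also have "\<dots> = 0" by (rule orth[OF zop_comp[OF S'(1) SR(2)]])
      finally show ?thesis .
    qed
    define V where "V = span ((\<lambda>a. a v) ` A)"
    define V' where "V' = span ((\<lambda>a. a (v + w')) ` A)"
    define y where "y = T w'"
    have "y \<bullet> w = T w \<bullet> T w"
    proof -
      have "y \<bullet> w = T' w \<bullet> T' w" by (simp add: y_def w'_def T'(2))
      also have "\<dots> = T (T' w) \<bullet> w" by (simp add: T'(2))
      also have "T (T' w) = T' (T w)" by (rule zop_comm[OF T(1) T'(1)])
      also have "T' (T w) \<bullet> w = w \<bullet> T' (T w)" by (rule inner_commute)
      also have "\<dots> = T w \<bullet> T w" by (simp add: T'(2))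
      finally show ?thesis .
    qed
    then have y0: "y \<noteq> 0" using nz by auto
    have U_orth: "S w' \<bullet> x = 0" if S: "zop S" and x: "x \<in> V" for S x
      using x unfolding V_def
    proof (induction rule: span_induct_alt)
      case (step c z u)
      then show ?case using orth2[OF S zop_base] by (auto simp: inner_add_right)
    qed simp
    have zV': "S (v + w') \<in> V'" if S: "zring A p S" for S p
      using S
    proof (induction rule: zring.induct)
      case (zring_base a) then show ?case by (auto simp: V'_def intro: span_base)
    next
      case zring_zero show ?case by (simp add: V'_def span_zero)
    next
      case (zring_add p S q T) then show ?case unfolding V'_def by (intro span_add)
    next
      case (zring_neg p S) then show ?case unfolding V'_def by (intro span_neg)
    qed
    have subV: "subspace V" "subspace V'" by (auto simp: V_def V'_def)
    have "y = T (v + w')" using T(2) by (simp add: y_def linear_add[OF zop_linear[OF T(1)]])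
    then have yV': "y \<in> V'" using zV' T(1) by (auto simp: zop_def)
    define f where "f = proj V"
    have lf: "linear f" unfolding f_def by (rule linear_proj[OF subV(1)])
    have fy: "f y = 0" unfolding f_def y_def by (rule proj_orthogonal[OF subV(1) U_orth[OF T(1)]])
    have fa: "f (a (v + w')) = a v" if a: "a \<in> A" for a
    proof -
      have "f (a v) = a v" unfolding f_def using a by (intro proj_self subV) (auto simp: V_def intro: span_base)
      moreover have "f (a w') = 0" unfolding f_def by (rule proj_orthogonal[OF subV(1) U_orth[OF zop_base[OF a]]])
      ultimately show ?thesis by (simp add: linear_add[OF linear_A[OF a]] linear_add[OF lf])
    qed
    have "f ` V' = span (f ` (\<lambda>a. a (v + w')) ` A)" unfolding V'_def by (rule linear_span_image[OF lf, symmetric])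
    also have "f ` (\<lambda>a. a (v + w')) ` A = (\<lambda>a. a v) ` A" using fa by (auto simp: image_iff)
    finally have fV': "f ` V' = V" by (simp add: V_def)
    \<comment> \<open>Projection onto V maps V' onto V and kills the nonzero vector y of V'. The
      hyperplane Z of V' orthogonal to y therefore still maps onto V, since a multiple of y may be
      subtracted freely; so dim V < dim V'.\<close>
    define Z where "Z = {z \<in> V'. z \<bullet> y = 0}"
    have subZ: "subspace Z" using subV(2) by (auto simp: Z_def subspace_def inner_add_left)
    have "V \<subseteq> f ` Z"
    proof
      fix x assume "x \<in> V"
      then obtain x' where x': "x' \<in> V'" "x = f x'" using fV' by blast
      define t where "t = (x' \<bullet> y) / (y \<bullet> y)"
      have "x' - t *\<^sub>R y \<in> Z" using x'(1) yV' y0 subV(2)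
        by (auto simp: Z_def t_def inner_diff_left intro: subspace_diff subspace_scale)
      moreover have "f (x' - t *\<^sub>R y) = x" using fy by (simp add: linear_diff[OF lf] linear_cmul[OF lf] x')
      ultimately show "x \<in> f ` Z" by blast
    qed
    then have "dim V \<le> dim (f ` Z)" by (rule dim_subset)
    also have "\<dots> \<le> dim Z" by (rule dim_image_le[OF lf])
    also have "dim Z < dim V'"
    proof (rule dim_psubset)
      have "y \<notin> Z" using y0 by (simp add: Z_def)
      moreover have "Z \<subseteq> V'" by (auto simp: Z_def)
      ultimately have "Z \<subset> V'" using yV' by blast
      then show "span Z \<subset> span V'" using subZ subV(2) by (simp add: span_eq_iff[THEN iffD2])
    qed
    finally have "d v < d (v + w')" by (simp add: V_def V'_def d_def)
    then show False using max[of "v + w'"] v w'\<Lambda> add_closedD(4)[OF \<Lambda>(1)] by fastforce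
  qed
  then show ?thesis using v by blast
qed

text \<open>Squaring is additive modulo 2 in a commutative ring. The error is kept as an explicit
  operator R of the group ring because congruences here are equations between operators, not
  identities in a quotient.\<close>

lemma frobenius_add:
  assumes "zop S" "zop T"
  shows "\<exists>R. zop R \<and> (\<forall>x. ((\<lambda>x. S x + T x) ^^ (2 ^ j)) x = (S ^^ (2 ^ j)) x + (T ^^ (2 ^ j)) x + 2 *\<^sub>R R x)"
proof (induction j)
  case 0
  show ?case by (intro exI[of _ "\<lambda>x. 0"]) (simp add: zop_zero)
next
  case (Suc j)
  let ?F = "(\<lambda>x. S x + T x) ^^ (2 ^ j)" and ?P = "S ^^ (2 ^ j)" and ?Q = "T ^^ (2 ^ j)"
  obtain R where R: "zop R" "\<And>x. ?F x = ?P x + ?Q x + 2 *\<^sub>R R x" using Suc.IH by blast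
  have P: "zop ?P" and Q: "zop ?Q" using assms zop_pow by auto
  have dbl: "(f ^^ (2 ^ Suc j)) x = (f ^^ (2 ^ j)) ((f ^^ (2 ^ j)) x)" for f :: "real^8 \<Rightarrow> real^8" and x
    by (simp add: funpow_add mult_2)
  define R' where "R' x = ?P (?Q x) + ?P (R x) + ?Q (R x) + R (?P x + ?Q x + 2 *\<^sub>R R x)" for x
  have "zop R'" unfolding R'_def
    by (intro zop_add zop_double P Q R(1) zop_comp[OF P Q] zop_comp[OF P R(1)] zop_comp[OF Q R(1)] zop_comp[OF R(1)])
  moreover have "((\<lambda>x. S x + T x) ^^ (2 ^ Suc j)) x = (S ^^ (2 ^ Suc j)) x + (T ^^ (2 ^ Suc j)) x + 2 *\<^sub>R R' x" for x
  proof -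
    have "((\<lambda>x. S x + T x) ^^ (2 ^ Suc j)) x = ?P (?P x) + ?P (?Q x) + 2 *\<^sub>R ?P (R x)
       + (?Q (?P x) + ?Q (?Q x) + 2 *\<^sub>R ?Q (R x)) + 2 *\<^sub>R R (?P x + ?Q x + 2 *\<^sub>R R x)"
      unfolding dbl R(2)
      by (simp only: linear_add[OF zop_linear[OF P]] linear_add[OF zop_linear[OF Q]]
          linear_cmul[OF zop_linear[OF P]] linear_cmul[OF zop_linear[OF Q]])
    also have "?Q (?P x) = ?P (?Q x)" by (rule zop_comm[OF Q P])
    finally show ?thesis unfolding dbl R'_def by (simp add: scaleR_2 scaleR_add_right)
  qed
  ultimately show ?case by blast
qed

text \<open>Modulo 2, the 2^k-th power of a group ring element is the sum of the 2^k-th powers of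
  its group elements; e absorbs these, so only the augmentation survives. With k >= 1 the exponent
  is even and signs disappear.\<close>

lemma frobenius_parity:
  assumes e: "zop e" and k: "k \<ge> 1" and ek: "\<And>a x. a \<in> A \<Longrightarrow> e ((a ^^ (2 ^ k)) x) = e x"
    and T: "zring A p T"
  shows "\<exists>S. zop S \<and> (\<forall>x. e ((T ^^ (2 ^ k)) x) = (if p then e x else 0) + 2 *\<^sub>R e (S x))"
  using T
proof (induction rule: zring.induct)
  case (zring_base a)
  show ?case by (intro exI[of _ "\<lambda>x. 0"]) (simp add: zop_zero ek[OF zring_base] linear_0[OF zop_linear[OF e]])
next
  case zring_zero
  have "((\<lambda>x. 0 :: real^8) ^^ (2 ^ k)) x = 0" for x :: "real^8"
    by (metis funpow_simps_right(2) comp_apply gr0_conv_Suc funpow.simps(2) zero_less_numeral zero_less_power)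
  then show ?case by (intro exI[of _ "\<lambda>x. 0"]) (simp add: zop_zero linear_0[OF zop_linear[OF e]])
next
  case (zring_add p S q T)
  have ST: "zop S" "zop T" using zring_add.hyps by (auto simp: zop_def)
  obtain S1 where S1: "zop S1" "\<And>x. e ((S ^^ (2 ^ k)) x) = (if p then e x else 0) + 2 *\<^sub>R e (S1 x)"
    using zring_add.IH(1) by blast
  obtain T1 where T1: "zop T1" "\<And>x. e ((T ^^ (2 ^ k)) x) = (if q then e x else 0) + 2 *\<^sub>R e (T1 x)"
    using zring_add.IH(2) by blast
  obtain R where R: "zop R" "\<And>x. ((\<lambda>x. S x + T x) ^^ (2 ^ k)) x = (S ^^ (2 ^ k)) x + (T ^^ (2 ^ k)) x + 2 *\<^sub>R R x"
    using frobenius_add[OF ST] by blast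
  define U where "U x = S1 x + T1 x + R x + (if p \<and> q then x else 0)" for x
  have "zop U" unfolding U_def by (cases "p \<and> q") (auto intro!: zop_add zop_id zop_zero S1 T1 R)
  moreover have "e (((\<lambda>x. S x + T x) ^^ (2 ^ k)) x) = (if p \<noteq> q then e x else 0) + 2 *\<^sub>R e (U x)" for x
    unfolding R(2) linear_add[OF zop_linear[OF e]] linear_cmul[OF zop_linear[OF e]] S1(2) T1(2) U_def
    by (auto simp: algebra_simps scaleR_2 linear_0[OF zop_linear[OF e]])
  ultimately show ?case by blast
next
  case (zring_neg p S)
  have "((\<lambda>x. - S x) ^^ (2 * n)) x = (S ^^ (2 * n)) x" for n x
    by (induction n arbitrary: x) (auto simp: linear_neg[OF zring_linear[OF zring_neg.hyps]])
  moreover have "(2::nat) ^ k = 2 * 2 ^ (k - 1)" using k by (cases k) auto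
  ultimately show ?case using zring_neg.IH by metis
qed

end

section \<open>Counting orbits modulo 2\<close>

context abelian_isometries
begin

lemma zop_scale_nat: "zop T \<Longrightarrow> zop (\<lambda>x. real n *\<^sub>R T x)"
proof (induction n)
  case 0
  show ?case using zop_zero by simp
next
  case (Suc n)
  show ?case using zop_add[OF Suc.prems Suc.IH[OF Suc.prems]] by (simp add: scaleR_add_left add.commute)
qed

lemma zring_sum: "finite B \<Longrightarrow> B \<subseteq> A \<Longrightarrow> zring A (odd (card B)) (\<lambda>x. \<Sum>b\<in>B. b x)"
proof (induction B rule: finite_induct)
  case empty
  show ?case using zring_zero by simp
next
  case (insert b B)
  then show ?case using zring_add[OF zring_base[of b A] insert.IH] by simp
qed

text \<open>The classes modulo 2 of L' = Z[A] v are counted. Elements whose orbit points are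
  congruent agree up to sign on \<Lambda> by hypothesis K, so there are at most twice as many
  restrictions as orbit classes; the differences a v - v supply equally many classes of even
  augmentation. W makes room for one odd class outside the orbit, which later turns the bound into a
  strict one.\<close>

lemma restrict_orbit_bound:
  assumes \<Lambda>: "add_closed \<Lambda>" "\<Lambda> \<subseteq> E8_lattice" "inv_set \<Lambda>"
    and v: "v \<in> \<Lambda>" and sep: "\<And>T x. zop T \<Longrightarrow> T v = 0 \<Longrightarrow> x \<in> \<Lambda> \<Longrightarrow> T x = 0"
    and e: "zop e" "e v \<noteq> 0" and k: "k \<ge> 1" and ek: "\<And>a x. a \<in> A \<Longrightarrow> e ((a ^^ (2 ^ k)) x) = e x"
    and K: "\<And>c R. c \<in> A \<Longrightarrow> zop R \<Longrightarrow> \<forall>x\<in>\<Lambda>. c x = x + 2 *\<^sub>R R x \<Longrightarrow> (\<forall>x\<in>\<Lambda>. c x = x) \<or> (\<forall>x\<in>\<Lambda>. c x = - x)"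
    and W: "finite W" "card W \<le> 1" "\<And>w. w \<in> W \<Longrightarrow> \<exists>T. zring A True T \<and> w = T v"
      "\<And>w a R. w \<in> W \<Longrightarrow> a \<in> A \<Longrightarrow> zop R \<Longrightarrow> a v - w \<noteq> 2 *\<^sub>R R v"
  shows "card ((\<lambda>a. restrict a \<Lambda>) ` A) + card W \<le> 2 ^ dim \<Lambda>"
proof -
  \<comment> \<open>If T v = 0, Frobenius yields e v = -2 S (e v), and infinite divisibility by 2
    forces e v = 0.\<close>
  have odd_nz: "T v \<noteq> 0" if T: "zring A True T" for T
  proof
    assume T0: "T v = 0"
    obtain S where S: "zop S" "\<And>x. e ((T ^^ (2 ^ k)) x) = e x + 2 *\<^sub>R e (S x)"
      using frobenius_parity[OF e(1) k ek T] by auto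
    have pow0: "(T ^^ n) 0 = 0" for n using linear_0[OF zring_linear[OF T]] by (induction n) auto
    obtain m where m: "(2::nat) ^ k = Suc m" by (metis gr0_conv_Suc zero_less_numeral zero_less_power)
    have "(T ^^ (2 ^ k)) v = 0" unfolding m by (simp only: funpow_Suc_right comp_apply T0 pow0)
    then have "0 = e v + 2 *\<^sub>R e (S v)" using S(2)[of v] linear_0[OF zop_linear[OF e(1)]] by simp
    moreover have "e (S v) = S (e v)" by (rule zop_comm[OF e(1) S(1)])
    ultimately have "e v = 2 *\<^sub>R (- S (e v))" by (simp add: eq_neg_iff_add_eq_0)
    moreover have "e v \<in> E8_lattice" using zop_lattice[OF e(1)] v \<Lambda>(2) by blast
    ultimately have "e v = 0" using infinitely_divisible_zero[OF zop_neg[OF S(1)], of "e v"] by simp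
    then show False using e(2) by simp
  qed
  define L' where "L' = {T v | T. zop T}"
  have L'_closed: "add_closed L'"
    unfolding add_closed_def
  proof (intro conjI ballI)
    show "0 \<in> L'" using zop_zero by (auto simp: L'_def)
    fix x y assume "x \<in> L'" "y \<in> L'"
    then obtain S T where ST: "zop S" "zop T" "x = S v" "y = T v" by (auto simp: L'_def)
    show "x - y \<in> L'" unfolding L'_def ST(3,4)
      by (rule CollectI, rule exI[of _ "\<lambda>x. S x - T x"]) (simp add: zop_diff[OF ST(1,2)])
  qed
  have L'_sub: "L' \<subseteq> \<Lambda>" using zop_closed[OF _ \<Lambda>(1,3) v] unfolding L'_def by blast
  define cong where "cong x y \<longleftrightarrow> (\<exists>R. zop R \<and> x - y = 2 *\<^sub>R R v)" for x y
  have cong_iff: "(1/2) *\<^sub>R (x - y) \<in> L' \<longleftrightarrow> cong x y" for x y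
  proof -
    have "(1/2) *\<^sub>R z = w \<longleftrightarrow> z = 2 *\<^sub>R w" for z w :: "real^8" by auto
    then show ?thesis unfolding L'_def cong_def by blast
  qed
  \<comment> \<open>A congruence between different parities would be an operator of odd augmentation
    that kills v; adding 2R does not change the augmentation modulo 2.\<close>
  have parity: "\<not> cong (S v) (T v)" if S: "zring A p S" and T: "zring A q T" and pq: "p \<noteq> q" for S T p q
  proof
    assume "cong (S v) (T v)"
    then obtain R where R: "zop R" "S v - T v = 2 *\<^sub>R R v" unfolding cong_def by blast
    have "zring A True (\<lambda>x. (S x + - T x) + - (2 *\<^sub>R R x))"
      using zring_add[OF zring_add[OF S zring_neg[OF T]] zring_neg[OF zring_even_double[OF R(1)]]] pq by auto
    from odd_nz[OF this] show False using R(2) by simp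
  qed
  define P where "P T \<longleftrightarrow> T \<subseteq> A \<and> (\<forall>a\<in>T. \<forall>b\<in>T. a \<noteq> b \<longrightarrow> \<not> cong (a v) (b v))" for T
  have "P {}" by (simp add: P_def)
  moreover have "\<forall>T. P T \<longrightarrow> card T < Suc (card A)"
    using card_mono[OF finite_A] by (auto simp: P_def less_Suc_eq_le)
  ultimately have "\<exists>T. P T \<and> (\<forall>T'. P T' \<longrightarrow> card T' \<le> card T)" by (rule ex_has_greatest_nat)
  then obtain T where PT: "P T" and Tmax: "\<And>T'. P T' \<Longrightarrow> card T' \<le> card T" by blast
  have TA: "T \<subseteq> A" and Tinc: "\<And>a b. a \<in> T \<Longrightarrow> b \<in> T \<Longrightarrow> a \<noteq> b \<Longrightarrow> \<not> cong (a v) (b v)"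
    using PT by (auto simp: P_def)
  have fT: "finite T" using TA finite_A by (rule finite_subset)
  have cong_sym: "cong x y \<Longrightarrow> cong y x" for x y
  proof -
    assume "cong x y"
    then obtain R where "zop R" "x - y = 2 *\<^sub>R R v" unfolding cong_def by blast
    then have "zop (\<lambda>x. - R x)" "y - x = 2 *\<^sub>R (- R v)" by (auto simp: zop_neg algebra_simps)
    then show "cong y x" unfolding cong_def by blast
  qed
  have cong_refl: "cong x x" for x unfolding cong_def using zop_zero by (intro exI[of _ "\<lambda>x. 0"]) simp
  have cover: "\<exists>t\<in>T. cong (a v) (t v)" if a: "a \<in> A" for a
  proof (rule ccontr)
    assume none: "\<not> (\<exists>t\<in>T. cong (a v) (t v))"
    then have "a \<notin> T" using cong_refl by blast
    moreover have "P (insert a T)" using none Tinc TA a cong_sym unfolding P_def by blast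
    ultimately show False using Tmax[of "insert a T"] fT by simp
  qed
  \<comment> \<open>With c = t^(-1) a, the congruence at v says that an operator of the group ring
    kills v; separation extends it to all of \<Lambda>, where K applies to c.\<close>
  have fibre: "(\<forall>x\<in>\<Lambda>. a x = t x) \<or> (\<forall>x\<in>\<Lambda>. a x = - t x)"
    if a: "a \<in> A" and t: "t \<in> A" and c: "cong (a v) (t v)" for a t
  proof -
    obtain R where R: "zop R" "a v - t v = 2 *\<^sub>R R v" using c unfolding cong_def by blast
    obtain s where s: "s \<in> A" "\<And>x. s (t x) = x" "\<And>x. t (s x) = x" using inv_app[OF t] by metis
    let ?c = "\<lambda>x. s (a x)"
    have z: "zop (\<lambda>x. ?c x - (x + 2 *\<^sub>R s (R x)))"
      by (rule zop_diff[OF zop_comp[OF zop_base[OF s(1)] zop_base[OF a]]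
            zop_add[OF zop_id zop_double[OF zop_comp[OF zop_base[OF s(1)] R(1)]]]])
    have "a v = t v + 2 *\<^sub>R R v" using R(2) by (simp add: algebra_simps)
    then have "?c v = v + 2 *\<^sub>R s (R v)"
      by (simp only: linear_add[OF linear_A[OF s(1)]] linear_cmul[OF linear_A[OF s(1)]] s(2))
    then have "\<forall>x\<in>\<Lambda>. ?c x = x + 2 *\<^sub>R s (R x)" using sep[OF z] by simp
    from K[OF comp_app[OF s(1) a] zop_comp[OF zop_base[OF s(1)] R(1)] this]
    have d: "(\<forall>x\<in>\<Lambda>. ?c x = x) \<or> (\<forall>x\<in>\<Lambda>. ?c x = - x)" .
    have tc: "t (?c x) = a x" for x by (rule s(3))
    from d show ?thesis
    proof
      assume "\<forall>x\<in>\<Lambda>. ?c x = x"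
      then have "\<forall>x\<in>\<Lambda>. a x = t x" using tc by metis
      then show ?thesis by blast
    next
      assume "\<forall>x\<in>\<Lambda>. ?c x = - x"
      then have "\<forall>x\<in>\<Lambda>. a x = t (- x)" using tc by metis
      then show ?thesis by (simp add: linear_neg[OF linear_A[OF t]])
    qed
  qed
  have "(\<lambda>a. restrict a \<Lambda>) ` A \<subseteq> (\<Union>t\<in>T. {restrict t \<Lambda>, restrict (\<lambda>x. - t x) \<Lambda>})"
  proof (rule image_subsetI)
    fix a assume a: "a \<in> A"
    obtain t where t: "t \<in> T" "cong (a v) (t v)" using cover[OF a] by blast
    then have "(\<forall>x\<in>\<Lambda>. a x = t x) \<or> (\<forall>x\<in>\<Lambda>. a x = - t x)" using fibre[OF a] TA by blast
    then have "restrict a \<Lambda> = restrict t \<Lambda> \<or> restrict a \<Lambda> = restrict (\<lambda>x. - t x) \<Lambda>"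
      by (auto simp: restrict_def fun_eq_iff)
    then show "restrict a \<Lambda> \<in> (\<Union>t\<in>T. {restrict t \<Lambda>, restrict (\<lambda>x. - t x) \<Lambda>})" using t(1) by blast
  qed
  then have "card ((\<lambda>a. restrict a \<Lambda>) ` A) \<le> card (\<Union>t\<in>T. {restrict t \<Lambda>, restrict (\<lambda>x. - t x) \<Lambda>})"
    by (rule card_mono[rotated]) (use fT in auto)
  also have "\<dots> \<le> (\<Sum>t\<in>T. card {restrict t \<Lambda>, restrict (\<lambda>x. - t x) \<Lambda>})"
    by (rule card_UN_le[OF fT])
  also have "\<dots> \<le> (\<Sum>t\<in>T. 2)" by (intro sum_mono) (simp add: card_insert_if)
  finally have c1: "card ((\<lambda>a. restrict a \<Lambda>) ` A) \<le> 2 * card T" by simp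
  define U1 where "U1 = (\<lambda>a. a v) ` T"
  \<comment> \<open>Subtracting v leaves all differences unchanged but switches the parity, so this
    is a second system of incongruent vectors, disjoint from the odd one.\<close>
  define U0 where "U0 = (\<lambda>a. a v + - v) ` T"
  have p1: "\<exists>S. zring A True S \<and> x = S v" if "x \<in> U1 \<union> W" for x
    using that W(3) zring_base TA unfolding U1_def by blast
  have p0: "\<exists>S. zring A False S \<and> x = S v" if x: "x \<in> U0" for x
  proof -
    obtain a where "a \<in> T" "x = a v + - v" using x unfolding U0_def by blast
    then show ?thesis using zring_add[OF zring_base[of a A] zring_neg[OF zring_id]] TA by auto
  qed
  have inc1: "\<not> cong x y" if "x \<in> U1 \<union> W" "y \<in> U1 \<union> W" "x \<noteq> y" for x y
  proof -
    have w: "\<not> cong z w" if "z \<in> U1" "w \<in> W" for z w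
      using that W(4) TA unfolding U1_def cong_def by blast
    have ww: "x \<in> W \<Longrightarrow> y \<in> W \<Longrightarrow> x = y" using W(1,2) by (metis card_le_Suc0_iff_eq One_nat_def)
    have "x \<in> U1 \<Longrightarrow> y \<in> U1 \<Longrightarrow> \<not> cong x y" using Tinc that(3) unfolding U1_def by blast
    then show ?thesis using that w ww cong_sym by blast
  qed
  have inc0: "\<not> cong x y" if xy: "x \<in> U0" "y \<in> U0" "x \<noteq> y" for x y
  proof -
    obtain a b where "a \<in> T" "b \<in> T" "x = a v + - v" "y = b v + - v" using xy unfolding U0_def by blast
    then show ?thesis using Tinc[of a b] xy(3) by (auto simp: cong_def)
  qed
  have inc01: "\<not> cong x y" if "x \<in> U1 \<union> W" "y \<in> U0" for x y
    using p1[OF that(1)] p0[OF that(2)] parity[of True _ False] by blast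
  have inj1: "inj_on (\<lambda>a. a v) T"
  proof (rule inj_onI, rule ccontr)
    fix a b assume "a \<in> T" "b \<in> T" "a v = b v" "a \<noteq> b"
    then show False using Tinc[of a b] cong_refl[of "b v"] by simp
  qed
  have cU1: "card U1 = card T" unfolding U1_def by (rule card_image[OF inj1])
  have cU0: "card U0 = card T" unfolding U0_def by (rule card_image) (use inj1 in \<open>auto simp: inj_on_def\<close>)
  have "x \<notin> W" if x: "x \<in> U1" for x
  proof
    assume "x \<in> W"
    moreover obtain a where "a \<in> T" "x = a v" using x unfolding U1_def by blast
    ultimately show False using W(4)[OF _ _ zop_zero, of x a] TA by auto
  qed
  then have "U1 \<inter> W = {}" by blast
  moreover have "(U1 \<union> W) \<inter> U0 = {}" using inc01 cong_refl by blast
  moreover have fin: "finite U1" "finite U0" using fT by (auto simp: U1_def U0_def)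
  ultimately have cU: "card ((U1 \<union> W) \<union> U0) = 2 * card T + card W"
    using W(1) cU1 cU0 by (simp add: card_Un_disjoint)
  have "card ((U1 \<union> W) \<union> U0) \<le> 2 ^ dim L'"
  proof (rule card_incongruent_mod2_le[OF L'_closed])
    show "L' \<subseteq> E8_lattice" using L'_sub \<Lambda>(2) by blast
    show "U1 \<union> W \<union> U0 \<subseteq> L'" using p0 p1 unfolding L'_def zop_def by blast
    show "finite (U1 \<union> W \<union> U0)" using fin W(1) by simp
    show "(1/2) *\<^sub>R (x - y) \<notin> L'" if "x \<in> U1 \<union> W \<union> U0" "y \<in> U1 \<union> W \<union> U0" "x \<noteq> y" for x y
      using that inc0 inc1 inc01 cong_sym unfolding cong_iff by blast
  qed
  also have "\<dots> \<le> 2 ^ dim \<Lambda>" using dim_subset[OF L'_sub] by simp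
  finally show ?thesis using cU c1 by simp
qed

text \<open>A 2-adic argument shows that an element congruent to 1 modulo 2 squares to 1 on
  \<Lambda>. Such an element is 1 - 2p with p idempotent, and Frobenius leaves no idempotents but 0
  and 1.\<close>

lemma two_group_congruent_id:
  assumes k: "k \<ge> 1" and two: "\<And>a. a \<in> A \<Longrightarrow> a ^^ (2 ^ k) = id"
    and \<Lambda>: "add_closed \<Lambda>" "\<Lambda> \<subseteq> E8_lattice" "inv_set \<Lambda>"
    and c: "c \<in> A" "zop R" "\<forall>x\<in>\<Lambda>. c x = x + 2 *\<^sub>R R x"
  shows "(\<forall>x\<in>\<Lambda>. c x = x) \<or> (\<forall>x\<in>\<Lambda>. c x = - x)"
proof -
  have closed: "T x \<in> \<Lambda>" if "zop T" "x \<in> \<Lambda>" for T x by (rule zop_closed[OF that(1) \<Lambda>(1,3) that(2)])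
  have pow: "\<exists>r. zop r \<and> (\<forall>x\<in>\<Lambda>. (c ^^ n) x = x + 2 *\<^sub>R r x)" for n
  proof (induction n)
    case 0
    show ?case by (intro exI[of _ "\<lambda>x. 0"]) (simp add: zop_zero)
  next
    case (Suc n)
    then obtain r where r: "zop r" "\<And>x. x \<in> \<Lambda> \<Longrightarrow> (c ^^ n) x = x + 2 *\<^sub>R r x" by blast
    have "(c ^^ Suc n) x = x + 2 *\<^sub>R (R x + c (r x))" if x: "x \<in> \<Lambda>" for x
    proof -
      have "(c ^^ Suc n) x = c (x + 2 *\<^sub>R r x)" using r(2)[OF x] by simp
      also have "\<dots> = c x + 2 *\<^sub>R c (r x)"
        by (simp only: linear_add[OF linear_A[OF c(1)]] linear_cmul[OF linear_A[OF c(1)]])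
      finally show ?thesis using c(3) x by (simp add: scaleR_add_right)
    qed
    moreover have "zop (\<lambda>x. R x + c (r x))" by (rule zop_add[OF c(2) zop_comp[OF zop_base[OF c(1)] r(1)]])
    ultimately show ?case by blast
  qed
  define Q where "Q j \<longleftrightarrow> (\<forall>x\<in>\<Lambda>. (c ^^ (2 ^ j)) x = x)" for j :: nat
  have "Q k" using two[OF c(1)] by (simp add: Q_def)
  define j where "j = (LEAST j. Q j)"
  have Qj: "Q j" unfolding j_def by (rule LeastI[of Q, OF \<open>Q k\<close>])
  have notQ: "\<not> Q i" if "i < j" for i using that unfolding j_def by (rule not_less_Least)
  \<comment> \<open>Otherwise g = c^(2^i) has exact order 4 on \<Lambda> and g = 1 + 2r. Then g^2 =
    1 + 4t with t = r + r^2, and g^4 = 1 gives t = -2 t^2, so t = 0 and g^2 = 1.\<close>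
  have "j \<le> 1"
  proof (rule ccontr)
    assume "\<not> j \<le> 1"
    then obtain i where i: "j = Suc (Suc i)" by (metis One_nat_def Suc_le_D not_less_eq_eq)
    obtain r where r: "zop r" "\<And>x. x \<in> \<Lambda> \<Longrightarrow> (c ^^ (2 ^ i)) x = x + 2 *\<^sub>R r x" using pow by blast
    define t where "t x = r x + r (r x)" for x
    have t: "zop t" unfolding t_def by (rule zop_add[OF r(1) zop_comp[OF r(1) r(1)]])
    have dbl: "(c ^^ (2 ^ Suc m)) x = (c ^^ (2 ^ m)) ((c ^^ (2 ^ m)) x)" for m x
      by (simp add: funpow_add mult_2)
    have g: "(c ^^ (2 ^ Suc i)) x = x + 4 *\<^sub>R t x" if x: "x \<in> \<Lambda>" for x
    proof -
      have "x + 2 *\<^sub>R r x \<in> \<Lambda>" by (rule closed[OF zop_add[OF zop_id zop_double[OF r(1)]] x])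
      then have "(c ^^ (2 ^ Suc i)) x = x + 2 *\<^sub>R r x + 2 *\<^sub>R r (x + 2 *\<^sub>R r x)"
        unfolding dbl r(2)[OF x] by (rule r(2))
      also have "r (x + 2 *\<^sub>R r x) = r x + 2 *\<^sub>R r (r x)"
        by (simp only: linear_add[OF zop_linear[OF r(1)]] linear_cmul[OF zop_linear[OF r(1)]])
      finally show ?thesis unfolding t_def by (simp add: vec_eq_iff)
    qed
    have "(c ^^ (2 ^ Suc i)) x = x" if x: "x \<in> \<Lambda>" for x
    proof -
      have tx: "t x \<in> \<Lambda>" by (rule closed[OF t x])
      have "x + 4 *\<^sub>R t x = (c ^^ (2 ^ Suc i)) x" using g[OF x] by simp
      also have "(c ^^ (2 ^ Suc i)) ((c ^^ (2 ^ Suc i)) x) = x" using Qj x unfolding i Q_def by (simp only: dbl)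
      then have "(c ^^ (2 ^ Suc i)) (x + 4 *\<^sub>R t x) = x" using g[OF x] by simp
      moreover have "(c ^^ (2 ^ Suc i)) (x + 4 *\<^sub>R t x) = (c ^^ (2 ^ Suc i)) x + 4 *\<^sub>R (c ^^ (2 ^ Suc i)) (t x)"
        using linear_A[OF pow_A[OF c(1)]] by (simp only: linear_add linear_cmul)
      ultimately have "x + 4 *\<^sub>R t x + 4 *\<^sub>R (t x + 4 *\<^sub>R t (t x)) = x" by (simp only: g[OF x] g[OF tx])
      then have "8 *\<^sub>R (t x + 2 *\<^sub>R t (t x)) = 0" by (simp add: vec_eq_iff algebra_simps)
      then have "t x = 2 *\<^sub>R (- t (t x))" by (simp add: eq_neg_iff_add_eq_0)
      moreover have "t x \<in> E8_lattice" using tx \<Lambda>(2) by blast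
      ultimately have "t x = 0" using infinitely_divisible_zero[OF zop_neg[OF t], of "t x"] by simp
      then show ?thesis using g[OF x] by simp
    qed
    then have "Q (Suc i)" by (simp add: Q_def)
    then show False using notQ[of "Suc i"] i by simp
  qed
  have cc: "c (c x) = x" if x: "x \<in> \<Lambda>" for x
  proof (cases "j = 0")
    case True
    then have "c y = y" if "y \<in> \<Lambda>" for y using Qj that by (simp add: Q_def)
    then show ?thesis using x by simp
  next
    case False
    then have "j = 1" using \<open>j \<le> 1\<close> by simp
    then show ?thesis using Qj x by (simp add: Q_def numeral_2_eq_2)
  qed
  \<comment> \<open>c = 1 - 2p, so c^2 = 1 makes p idempotent. Being its own 2^k-th power, p is
    congruent to its augmentation modulo 2, and infinite divisibility kills p or 1 - p.\<close>
  define p where "p x = - R x" for x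
  have p: "zop p" unfolding p_def by (rule zop_neg[OF c(2)])
  have pp: "p (p x) = p x" if x: "x \<in> \<Lambda>" for x
  proof -
    have Rx: "R x \<in> \<Lambda>" by (rule closed[OF c(2) x])
    have "x = c (x + 2 *\<^sub>R R x)" using cc[OF x] c(3) x by simp
    also have "\<dots> = c x + 2 *\<^sub>R c (R x)"
      by (simp only: linear_add[OF linear_A[OF c(1)]] linear_cmul[OF linear_A[OF c(1)]])
    also have "\<dots> = x + 2 *\<^sub>R R x + 2 *\<^sub>R (R x + 2 *\<^sub>R R (R x))" using c(3) x Rx by simp
    finally have "4 *\<^sub>R (R (R x) + R x) = 0" by (simp add: vec_eq_iff algebra_simps)
    then have "R (R x) = - R x" by (simp add: eq_neg_iff_add_eq_0)
    then show ?thesis unfolding p_def by (simp add: linear_neg[OF zop_linear[OF c(2)]])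
  qed
  obtain q where q: "zring A q p" using p by (auto simp: zop_def)
  obtain S where S: "zop S" "\<And>x. (p ^^ (2 ^ k)) x = (if q then x else 0) + 2 *\<^sub>R S x"
    using frobenius_parity[OF zop_id k _ q] two by auto
  have pn: "(p ^^ Suc n) x = p x" if x: "x \<in> \<Lambda>" for n x
    by (induction n) (simp_all add: pp[OF x])
  obtain m where m: "(2::nat) ^ k = Suc m" by (metis gr0_conv_Suc zero_less_numeral zero_less_power)
  have pS: "p x = (if q then x else 0) + 2 *\<^sub>R S x" if x: "x \<in> \<Lambda>" for x
    using S(2)[of x] pn[OF x, of m] unfolding m by simp
  show ?thesis
  proof (cases q)
    case False
    have "c x = x" if x: "x \<in> \<Lambda>" for x
    proof -
      have px: "p x \<in> \<Lambda>" by (rule closed[OF p x])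
      have "p x = 2 *\<^sub>R S (p x)" using pS[OF px] pp[OF x] False by simp
      then have "p x = 0" using infinitely_divisible_zero[OF S(1), of "p x"] px \<Lambda>(2) by blast
      then show ?thesis using c(3) x unfolding p_def by simp
    qed
    then show ?thesis by blast
  next
    case True
    have "c x = - x" if x: "x \<in> \<Lambda>" for x
    proof -
      let ?u = "x - p x"
      have u: "?u \<in> \<Lambda>" by (rule closed[OF zop_diff[OF zop_id p] x])
      have "p ?u = 0" by (simp add: linear_diff[OF zop_linear[OF p]] pp[OF x])
      then have "?u = 2 *\<^sub>R (- S ?u)" using pS[OF u] True by (simp add: eq_neg_iff_add_eq_0)
      then have "?u = 0" using infinitely_divisible_zero[OF zop_neg[OF S(1)], of ?u] u \<Lambda>(2) by blast
      then have "R x = - x" unfolding p_def by (simp add: add_eq_0_iff)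
      then show ?thesis using c(3) x by (simp add: scaleR_2)
    qed
    then show ?thesis by blast
  qed
qed

text \<open>Every 2^k-th power is trivial, so the count works with e = 1. The version for invariant
  sublattices of smaller dimension is what controls the action on an eigenspace in
  \<open>ex_reflection\<close>.\<close>

theorem two_group_bound:
  assumes k: "k \<ge> 1" and two: "\<And>a. a \<in> A \<Longrightarrow> a ^^ (2 ^ k) = id"
    and \<Lambda>: "add_closed \<Lambda>" "\<Lambda> \<subseteq> E8_lattice" "inv_set \<Lambda>"
  shows "card ((\<lambda>a. restrict a \<Lambda>) ` A) \<le> 2 ^ dim \<Lambda>"
proof -
  obtain v where v: "v \<in> \<Lambda>" "\<And>T x. zop T \<Longrightarrow> T v = 0 \<Longrightarrow> x \<in> \<Lambda> \<Longrightarrow> T x = 0"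
    using ex_separating_vector[OF \<Lambda>(1) \<Lambda>(3)] by blast
  show ?thesis
  proof (cases "v = 0")
    case True
    then have "x = 0" if "x \<in> \<Lambda>" for x using v(2)[OF zop_id _ that] by simp
    then have "restrict a \<Lambda> = restrict id \<Lambda>" if "a \<in> A" for a
      using linear_0[OF linear_A[OF that]] by (auto simp: restrict_def fun_eq_iff)
    then have "(\<lambda>a. restrict a \<Lambda>) ` A \<subseteq> {restrict id \<Lambda>}" by blast
    then have "card ((\<lambda>a. restrict a \<Lambda>) ` A) \<le> card {restrict (id :: real^8 \<Rightarrow> real^8) \<Lambda>}" by (rule card_mono[rotated]) simp
    also have "\<dots> \<le> 2 ^ dim \<Lambda>" by simp
    finally show ?thesis .
  next
    case False
    have "card ((\<lambda>a. restrict a \<Lambda>) ` A) + card ({} :: (real^8) set) \<le> 2 ^ dim \<Lambda>"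
    proof (rule restrict_orbit_bound[where e="\<lambda>x. x" and k=k and v=v])
      show "(\<forall>x\<in>\<Lambda>. c x = x) \<or> (\<forall>x\<in>\<Lambda>. c x = - x)"
        if "c \<in> A" "zop R" "\<forall>x\<in>\<Lambda>. c x = x + 2 *\<^sub>R R x" for c R
        by (rule two_group_congruent_id[OF k two \<Lambda> that])
    qed (use \<Lambda> v zop_id False k two in auto)
    then show ?thesis by simp
  qed
qed

end

text \<open>For a root x the lattice vector (c x - x)/2 has norm between 0 and 2; evenness leaves 0
  and 2, that is, c x = x or c x = -x. Nonorthogonal roots must share the sign, and chains of roots
  built from unit vectors carry one sign to the whole space.\<close>

lemma isometry_congruent_id:
  fixes c :: "real^8 \<Rightarrow> real^8"
  assumes c: "linear c" "\<And>x y. c x \<bullet> c y = x \<bullet> y"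
    and cong: "\<And>x. x \<in> E8_lattice \<Longrightarrow> (1/2) *\<^sub>R (c x - x) \<in> E8_lattice"
  shows "c = (\<lambda>x. x) \<or> c = (\<lambda>x. - x)"
proof -
  have root: "c x = x \<or> c x = - x" if x: "x \<in> E8_roots" for x
  proof -
    have xx: "x \<in> E8_lattice" "x \<bullet> x = 2" using x by (auto simp: E8_roots_eq)
    let ?w = "(1/2) *\<^sub>R (c x - x)"
    have nx: "norm (c x) = norm x" by (simp add: norm_eq_sqrt_inner c(2))
    have ww: "?w \<bullet> ?w = 1 - (c x \<bullet> x) / 2"
      by (simp add: inner_diff_left inner_diff_right c(2) xx(2) inner_commute field_simps)
    obtain k :: int where k: "?w \<bullet> ?w = 2 * of_int k" using E8_lattice_even[OF cong[OF xx(1)]] .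
    have "\<bar>c x \<bullet> x\<bar> \<le> 2" using Cauchy_Schwarz_ineq2[of "c x" x] nx xx(2) by (simp add: power2_norm_eq_inner flip: power2_eq_square)
    then have "0 \<le> ?w \<bullet> ?w" "?w \<bullet> ?w \<le> 2" using ww by (auto simp: abs_le_iff)
    then have "0 \<le> k" "k \<le> 1" using k by linarith+
    then have "k = 0 \<or> k = 1" by linarith
    then show ?thesis
    proof
      assume "k = 0"
      then have "?w \<bullet> ?w = 0" using k by simp
      then show ?thesis by simp
    next
      assume "k = 1"
      then have cx: "c x \<bullet> x = - 2" using ww k by simp
      have "(c x + x) \<bullet> (c x + x) = 0"
        using cx inner_commute[of x "c x"] by (simp add: inner_add_left inner_add_right c(2) xx(2))
      then have "c x + x = 0" by (simp only: inner_eq_zero_iff)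
      then show ?thesis by (simp add: eq_neg_iff_add_eq_0)
    qed
  qed
  have same: "c y = s *\<^sub>R y" if "x \<in> E8_roots" "y \<in> E8_roots" "x \<bullet> y \<noteq> 0" "c x = s *\<^sub>R x" "s = 1 \<or> s = -1" for x y s
  proof -
    have "x \<noteq> 0" "y \<noteq> 0" using that(1,2) by (auto simp: E8_roots_eq)
    then show ?thesis using root[OF that(2)] that(3-5) c(2)[of x y] by auto
  qed
  define p where "p i j = (axis i 1 + axis j 1 :: real^8)" for i j
  define m where "m i j = (axis i 1 - axis j 1 :: real^8)" for i j
  have ax: "axis i (1::real) \<bullet> axis j 1 = (if i = j then 1 else 0)" for i j :: 8
    by (auto simp: inner_axis_axis)
  have pr: "p i j \<in> E8_roots" "m i j \<in> E8_roots" if "i \<noteq> j" for i j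
    using that E8_lattice_axis[OF that]
    by (auto simp: E8_roots_eq p_def m_def inner_add_left inner_add_right inner_diff_left inner_diff_right ax)
  obtain s :: real where s: "c (p 1 2) = s *\<^sub>R p 1 2" "s = 1 \<or> s = -1"

  proof (cases "c (p 1 2) = p 1 2")
    case True
    then show ?thesis using that[of 1] by simp
  next
    case False
    then have "c (p 1 2) = - p 1 2" using root[OF pr(1)[of 1 2]] by simp
    then show ?thesis using that[of "-1"] by simp
  qed
  have p1: "c (p 1 k) = s *\<^sub>R p 1 k" if k: "k \<noteq> 1" for k
  proof (cases "k = 2")
    case False
    have "p 1 2 \<bullet> p 1 k = 1" using k False by (simp add: p_def inner_add_left inner_add_right ax)
    then show ?thesis using same[OF pr(1)[of 1 2] pr(1)[of 1 k] _ s] k by simp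
  qed (use s in simp)
  have pij: "c (p i j) = s *\<^sub>R p i j" if ij: "i \<noteq> j" for i j
  proof (cases "i = 1")
    case True
    then show ?thesis using p1 ij by simp
  next
    case False
    have "p 1 i \<bullet> p i j \<noteq> 0" using ij False by (simp add: p_def inner_add_left inner_add_right ax)
    then show ?thesis using same[OF pr(1)[of 1 i] pr(1)[OF ij] _ p1[OF False] s(2)] False by simp
  qed
  have ci: "c (axis i 1) = s *\<^sub>R axis i 1" for i
  proof -
    have "(1::8) \<noteq> 2" "(1::8) \<noteq> 3" "(2::8) \<noteq> 3" by simp_all
    then obtain j k where jk: "j \<noteq> i" "k \<noteq> i" "k \<noteq> j" by metis
    have "p i k \<bullet> m i j \<noteq> 0" using jk by (simp add: p_def m_def inner_add_left inner_diff_right ax)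
    then have mij: "c (m i j) = s *\<^sub>R m i j"
      using same[OF pr(1)[of i k] pr(2)[of i j] _ pij[of i k] s(2)] jk by auto
    have "axis i 1 = (1/2) *\<^sub>R (p i j + m i j)" by (simp add: p_def m_def)
    then have "c (axis i 1) = (1/2) *\<^sub>R (c (p i j) + c (m i j))"
      by (simp only: linear_cmul[OF c(1)] linear_add[OF c(1)])
    also have "\<dots> = (1/2) *\<^sub>R (s *\<^sub>R p i j + s *\<^sub>R m i j)" using pij[of i j] mij jk by simp
    also have "\<dots> = s *\<^sub>R axis i 1" by (simp add: p_def m_def vec_eq_iff algebra_simps)
    finally show ?thesis .
  qed
  have "c = (\<lambda>x. s *\<^sub>R x)"
    by (rule linear_eq_stdbasis[OF c(1)]) (auto simp: ci Basis_vec_def linear_scaleR)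
  then show ?thesis using s(2) by auto
qed

section \<open>The bound in the presence of elements of odd order\<close>

context abelian_isometries
begin

lemma eq_if_eq_on_lattice:
  assumes "a \<in> A" "b \<in> A" "\<And>x. x \<in> E8_lattice \<Longrightarrow> a x = b x" shows "a = b"
  using linear_eq_on_span[OF linear_A[OF assms(1)] linear_A[OF assms(2)], of E8_lattice] assms(3)
  by (auto simp: span_E8_lattice)

lemma card_restrict_lattice: "card ((\<lambda>a. restrict a E8_lattice) ` A) = card A"
proof (rule card_image, rule inj_onI)
  fix a b assume ab: "a \<in> A" "b \<in> A" "restrict a E8_lattice = restrict b E8_lattice"
  show "a = b"
  proof (rule eq_if_eq_on_lattice[OF ab(1,2)])
    fix x assume "x \<in> E8_lattice"
    then show "a x = b x" using fun_cong[OF ab(3), of x] by simp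
  qed
qed

lemma dim_E8_lattice: "dim E8_lattice = 8"
  using dim_span[of E8_lattice] by (simp add: span_E8_lattice)

text \<open>The sum e over B has odd augmentation, so e v lies in an odd class. Were it congruent to
  an orbit point, 1 - e and with it o1 - 1 would vanish modulo 2, forcing o1 to be 1 or -1. The
  orbit misses this class, so the order stays below 2^8.\<close>

theorem odd_part_bound:
  assumes k: "k \<ge> 1" and B: "B \<subseteq> A" "id \<in> B" "odd (card B)" "\<And>a b. a \<in> B \<Longrightarrow> b \<in> B \<Longrightarrow> a \<circ> b \<in> B"
    and pow: "\<And>a. a \<in> A \<Longrightarrow> a ^^ (2 ^ k) \<in> B"
    and nontriv: "o1 \<in> B" "o1 \<noteq> id" "o1 \<noteq> (\<lambda>x. - x)"
    and fixed: "x1 \<in> E8_lattice" "(\<Sum>b\<in>B. b x1) \<noteq> 0"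
  shows "card A < 256"
proof -
  have finB: "finite B" using B(1) finite_A by (rule finite_subset)
  define e where "e x = (\<Sum>b\<in>B. b x)" for x :: "real^8"
  have ze: "zring A True e" unfolding e_def using zring_sum[OF finB B(1)] B(3) by simp
  then have e: "zop e" by (auto simp: zop_def)
  have eb: "e (b x) = e x" if b: "b \<in> B" for b x
  proof -
    have inj: "inj_on (\<lambda>a. a \<circ> b) B"
    proof (rule inj_onI)
      fix a a' assume "a \<circ> b = a' \<circ> b"
      moreover obtain b' where "b \<circ> b' = id" using inv_A[of b] b B(1) by blast
      ultimately show "a = a'" by (metis comp_assoc comp_id)
    qed
    have "(\<lambda>a. a \<circ> b) ` B \<subseteq> B" using B(4) b by blast
    then have "(\<lambda>a. a \<circ> b) ` B = B" using inj finB by (simp add: endo_inj_surj)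
    then have "e x = (\<Sum>a\<in>(\<lambda>a. a \<circ> b) ` B. a x)" by (simp add: e_def)
    also have "\<dots> = e (b x)" by (simp add: sum.reindex[OF inj] e_def)
    finally show ?thesis by simp
  qed
  have be: "b (e x) = e x" if b: "b \<in> B" for b x
    using zop_comm[OF e zop_base, of b x] eb[OF b] b B(1) by auto
  have ee: "e (e x) = real (card B) *\<^sub>R e x" for x
  proof -
    have "e (e x) = (\<Sum>b\<in>B. b (e x))" by (subst e_def) (rule refl)
    also have "\<dots> = (\<Sum>b\<in>B. e x)" using be by (intro sum.cong) auto
    finally show ?thesis by (simp only: sum_constant_scaleR)
  qed
  obtain m where m: "card B = 2 * m + 1" using B(3) oddE by blast
  obtain v where v: "v \<in> E8_lattice" "\<And>T x. zop T \<Longrightarrow> T v = 0 \<Longrightarrow> x \<in> E8_lattice \<Longrightarrow> T x = 0"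
    using ex_separating_vector[OF add_closed_E8_lattice inv_set_lattice] by blast
  have ev: "e v \<noteq> 0" using v(2)[OF e _ fixed(1)] fixed(2) unfolding e_def by blast
  have K: "c = (\<lambda>x. x) \<or> c = (\<lambda>x. - x)"
    if c: "c \<in> A" "zop R" "\<forall>x\<in>E8_lattice. c x = x + 2 *\<^sub>R R x" for c R
  proof (rule isometry_congruent_id[OF linear_A[OF c(1)] isometry_A[OF c(1)]])
    show "(1/2) *\<^sub>R (c x - x) \<in> E8_lattice" if "x \<in> E8_lattice" for x
      using c(3) that zop_lattice[OF c(2) that] by simp
  qed
  have "card ((\<lambda>a. restrict a E8_lattice) ` A) + card {e v} \<le> 2 ^ dim E8_lattice"
  proof (rule restrict_orbit_bound[where e=e and k=k and v=v])
    show "e ((a ^^ (2 ^ k)) x) = e x" if "a \<in> A" for a x using eb[OF pow[OF that]] .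
    show "(\<forall>x\<in>E8_lattice. c x = x) \<or> (\<forall>x\<in>E8_lattice. c x = - x)"
      if "c \<in> A" "zop R" "\<forall>x\<in>E8_lattice. c x = x + 2 *\<^sub>R R x" for c R
      using K[OF that] by auto
    show "\<exists>T. zring A True T \<and> w = T v" if "w \<in> {e v}" for w using ze that by auto
    show "a v - w \<noteq> 2 *\<^sub>R R v" if w: "w \<in> {e v}" and a: "a \<in> A" and R: "zop R" for w a R
    proof
      assume "a v - w = 2 *\<^sub>R R v"
      then have av: "a v = e v + 2 *\<^sub>R R v" using w by (simp add: algebra_simps)
      define g where "g x = x - e x" for x
      have g: "zop g" unfolding g_def by (rule zop_diff[OF zop_id e])
      define Q where "Q x = g (R x) - real m *\<^sub>R e x" for x
      have Q: "zop Q" unfolding Q_def by (rule zop_diff[OF zop_comp[OF g R] zop_scale_nat[OF e]])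
      \<comment> \<open>Since |B| = 2m + 1, the product (1 - e) e equals (1 - |B|) e = -2m e, which
        is even.\<close>
      have "g (e v) = - (2 *\<^sub>R (real m *\<^sub>R e v))" by (simp add: g_def ee m scaleR_add_left)
      then have "g (a v) = 2 *\<^sub>R Q v"
        by (simp add: av linear_add[OF zop_linear[OF g]] linear_cmul[OF zop_linear[OF g]] Q_def scaleR_diff_right)
      moreover have "g (a v) = a (g v)" by (rule zop_comm[OF g zop_base[OF a]])
      ultimately have "a (g v) - 2 *\<^sub>R Q v = 0" by simp
      then have agQ: "a (g x) = 2 *\<^sub>R Q x" if "x \<in> E8_lattice" for x
        using v(2)[OF zop_diff[OF zop_comp[OF zop_base[OF a] g] zop_double[OF Q]] _ that] by simp
      obtain a' where a': "a' \<in> A" "\<And>x. a' (a x) = x" using inv_app[OF a] by metis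
      have gQ: "g x = 2 *\<^sub>R a' (Q x)" if "x \<in> E8_lattice" for x
        using arg_cong[OF agQ[OF that], of a'] by (simp add: a'(2) linear_cmul[OF linear_A[OF a'(1)]])
      have o1A: "o1 \<in> A" using nontriv(1) B(1) by blast
      define P where "P x = o1 (a' (Q x)) - a' (Q x)" for x
      have P: "zop P" unfolding P_def
        by (rule zop_diff[OF zop_comp[OF zop_base[OF o1A] zop_comp[OF zop_base[OF a'(1)] Q]] zop_comp[OF zop_base[OF a'(1)] Q]])
      have "o1 x = x + 2 *\<^sub>R P x" if x: "x \<in> E8_lattice" for x
      proof -
        \<comment> \<open>o1 fixes every vector e x, so e drops out of o1 g - g.\<close>
        have "o1 (g x) - g x = o1 x - x" unfolding g_def
          by (simp add: linear_diff[OF linear_A[OF o1A]] be[OF nontriv(1)])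
        moreover have "o1 (g x) - g x = 2 *\<^sub>R P x"
          unfolding gQ[OF x] by (simp add: linear_cmul[OF linear_A[OF o1A]] P_def scaleR_diff_right)
        ultimately have "o1 x - x = 2 *\<^sub>R P x" by simp
        then show ?thesis by (simp add: algebra_simps)
      qed
      then have "o1 = (\<lambda>x. x) \<or> o1 = (\<lambda>x. - x)" using K[OF o1A P] by blast
      then show False using nontriv by (auto simp: id_def)
    qed
  qed (use v e ev k add_closed_E8_lattice inv_set_lattice in auto)
  then show ?thesis by (simp add: card_restrict_lattice dim_E8_lattice)
qed

end

section \<open>Frames of orthogonal roots\<close>

locale root_frame =
  fixes \<beta> :: "nat \<Rightarrow> real^8"
  assumes frame_root: "i < 8 \<Longrightarrow> \<beta> i \<in> E8_roots"
    and frame_orth: "i < 8 \<Longrightarrow> j < 8 \<Longrightarrow> i \<noteq> j \<Longrightarrow> \<beta> i \<bullet> \<beta> j = 0"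
begin

lemma frame_lattice: "i < 8 \<Longrightarrow> \<beta> i \<in> E8_lattice"
  using frame_root by (auto simp: E8_roots_eq)

lemma frame_inner: "i < 8 \<Longrightarrow> j < 8 \<Longrightarrow> \<beta> i \<bullet> \<beta> j = (if i = j then 2 else 0)"
  using frame_root frame_orth by (auto simp: E8_roots_eq)

lemma frame_nonzero: "i < 8 \<Longrightarrow> \<beta> i \<noteq> 0"
  using frame_inner[of i i] by auto

lemma inj_frame: "inj_on \<beta> {..<8}"
proof (rule inj_onI, rule ccontr)
  fix i j assume "i \<in> {..<8}" "j \<in> {..<8}" "\<beta> i = \<beta> j" "i \<noteq> j"
  then show False using frame_inner[of i i] frame_inner[of i j] by simp
qed

lemma span_frame: "span (\<beta> ` {..<8}) = UNIV"
proof -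
  have "independent (\<beta> ` {..<8})"
    by (rule pairwise_orthogonal_independent)
      (use frame_orth frame_nonzero in \<open>auto simp: pairwise_def orthogonal_def\<close>)
  moreover have "card (\<beta> ` {..<8}) = DIM(real^8)" by (simp add: card_image[OF inj_frame])
  ultimately show ?thesis using card_eq_dim[of "\<beta> ` {..<8}" UNIV] by (auto simp: dim_UNIV)
qed

lemma frame_expansion: "x = (\<Sum>i<8. ((x \<bullet> \<beta> i) / 2) *\<^sub>R \<beta> i)"
proof -
  let ?y = "x - (\<Sum>i<8. ((x \<bullet> \<beta> i) / 2) *\<^sub>R \<beta> i)"
  have y0: "\<beta> j \<bullet> ?y = 0" if "j < 8" for j
  proof -
    have "\<beta> j \<bullet> (\<Sum>i<8. ((x \<bullet> \<beta> i) / 2) *\<^sub>R \<beta> i) = (\<Sum>i<8. if i = j then x \<bullet> \<beta> j else 0)"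
      unfolding inner_sum_right using that by (intro sum.cong) (auto simp: frame_inner)
    also have "\<dots> = x \<bullet> \<beta> j" using that by simp
    finally show ?thesis by (simp add: inner_diff_right inner_commute)
  qed
  have "orthogonal ?y z" if z: "z \<in> \<beta> ` {..<8}" for z
  proof -
    obtain j where "z = \<beta> j" "j < 8" using z by blast
    then show ?thesis unfolding orthogonal_def using y0[of j] by (simp only: inner_commute)
  qed
  moreover have "?y \<in> span (\<beta> ` {..<8})" unfolding span_frame by (rule UNIV_I)
  ultimately have "orthogonal ?y ?y" using orthogonal_to_span by blast
  then have "?y = 0" by (simp only: orthogonal_self)
  then show ?thesis by (simp only: right_minus_eq)
qed

lemma frame_inner_expansion: "x \<bullet> y = (\<Sum>i<8. (x \<bullet> \<beta> i) * (y \<bullet> \<beta> i)) / 2"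
proof -
  have "x \<bullet> y = (\<Sum>i<8. ((x \<bullet> \<beta> i) / 2) *\<^sub>R \<beta> i) \<bullet> y"
    using arg_cong[OF frame_expansion[of x], of "\<lambda>z. z \<bullet> y"] .
  also have "\<dots> = (\<Sum>i<8. (x \<bullet> \<beta> i) * (y \<bullet> \<beta> i)) / 2"
    unfolding inner_sum_left sum_divide_distrib by (intro sum.cong) (auto simp: inner_commute)
  finally show ?thesis .
qed

lemma frame_eqI:
  assumes "\<And>i. i < 8 \<Longrightarrow> x \<bullet> \<beta> i = y \<bullet> \<beta> i" shows "x = y"
proof -
  have "x = (\<Sum>i<8. ((x \<bullet> \<beta> i) / 2) *\<^sub>R \<beta> i)" by (rule frame_expansion)
  also have "\<dots> = (\<Sum>i<8. ((y \<bullet> \<beta> i) / 2) *\<^sub>R \<beta> i)" using assms by (intro sum.cong) auto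
  also have "\<dots> = y" by (rule frame_expansion[symmetric])
  finally show ?thesis .
qed

definition supp :: "real^8 \<Rightarrow> nat set" where "supp x = {i. i < 8 \<and> x \<bullet> \<beta> i \<noteq> 0}"

definition half :: "nat set \<Rightarrow> real^8" where "half S = (1/2) *\<^sub>R (\<Sum>i\<in>S. \<beta> i)"

text \<open>The product of the reflections in the \<beta> i with i in S, in closed form: roots have
  norm 2, so the reflection coefficient is just the inner product.\<close>

definition flip :: "nat set \<Rightarrow> real^8 \<Rightarrow> real^8" where "flip S x = x - (\<Sum>i\<in>S. (x \<bullet> \<beta> i) *\<^sub>R \<beta> i)"

text \<open>The supports of the roots outside the frame (see \<open>root_cases\<close>); in coding
  terms, the words of weight 4 of the binary code that describes the lattice over the frame.\<close>

definition blocks :: "nat set set" where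
  "blocks = {S. S \<subseteq> {..<8} \<and> card S = 4 \<and> half S \<in> E8_lattice}"

lemma half_inner: "S \<subseteq> {..<8} \<Longrightarrow> j < 8 \<Longrightarrow> half S \<bullet> \<beta> j = (if j \<in> S then 1 else 0)"
proof -
  assume S: "S \<subseteq> {..<8}" and j: "j < 8"
  have "(\<Sum>i\<in>S. \<beta> i) \<bullet> \<beta> j = (\<Sum>i\<in>S. if i = j then 2 else 0)"
    unfolding inner_sum_left using S j by (intro sum.cong) (auto simp: frame_inner)
  then show ?thesis using finite_subset[OF S] by (simp add: half_def)
qed

lemma flip_inner: "S \<subseteq> {..<8} \<Longrightarrow> j < 8 \<Longrightarrow> flip S x \<bullet> \<beta> j = (if j \<in> S then - (x \<bullet> \<beta> j) else x \<bullet> \<beta> j)"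
proof -
  assume S: "S \<subseteq> {..<8}" and j: "j < 8"
  have "(\<Sum>i\<in>S. (x \<bullet> \<beta> i) *\<^sub>R \<beta> i) \<bullet> \<beta> j = (\<Sum>i\<in>S. if i = j then 2 * (x \<bullet> \<beta> j) else 0)"
    unfolding inner_sum_left using S j by (intro sum.cong) (auto simp: frame_inner)
  then show ?thesis using finite_subset[OF S] by (simp add: flip_def inner_diff_left)
qed

lemma flip_lattice: "S \<subseteq> {..<8} \<Longrightarrow> x \<in> E8_lattice \<Longrightarrow> flip S x \<in> E8_lattice"
proof -
  assume S: "S \<subseteq> {..<8}" and x: "x \<in> E8_lattice"
  have "(x \<bullet> \<beta> i) *\<^sub>R \<beta> i \<in> E8_lattice" if i: "i \<in> S" for i
  proof -
    have b: "\<beta> i \<in> E8_lattice" using frame_lattice S i by auto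
    obtain n where "x \<bullet> \<beta> i = of_int n" using E8_lattice_inner[OF x b] by (rule Ints_cases)
    then show ?thesis using add_closed_scale_int[OF add_closed_E8_lattice b] by simp
  qed
  then have "(\<Sum>i\<in>S. (x \<bullet> \<beta> i) *\<^sub>R \<beta> i) \<in> E8_lattice" by (rule add_closed_sum[OF add_closed_E8_lattice])
  then show ?thesis using x by (simp add: flip_def)
qed

lemma flip_norm: assumes S: "S \<subseteq> {..<8}" shows "flip S x \<bullet> flip S y = x \<bullet> y"
proof -
  have "flip S x \<bullet> flip S y = (\<Sum>i<8. (flip S x \<bullet> \<beta> i) * (flip S y \<bullet> \<beta> i)) / 2"
    by (rule frame_inner_expansion)
  also have "\<dots> = (\<Sum>i<8. (x \<bullet> \<beta> i) * (y \<bullet> \<beta> i)) / 2"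
    by (intro arg_cong[where f="\<lambda>z. z / 2"] sum.cong) (auto simp: flip_inner[OF S])
  also have "\<dots> = x \<bullet> y" by (rule frame_inner_expansion[symmetric])
  finally show ?thesis .
qed

lemma flip_root: "S \<subseteq> {..<8} \<Longrightarrow> x \<in> E8_roots \<Longrightarrow> flip S x \<in> E8_roots"
  by (simp add: E8_roots_eq flip_lattice flip_norm)

lemma flip_empty: "flip {} = id"
  by (simp add: flip_def fun_eq_iff)

lemma flip_insert:
  assumes "i < 8" "S \<subseteq> {..<8}" "i \<notin> S" shows "flip (insert i S) = reflection (\<beta> i) \<circ> flip S"
proof (rule ext, rule frame_eqI)
  fix x j assume j: "(j::nat) < 8"
  have "(reflection (\<beta> i) \<circ> flip S) x = flip S x - (flip S x \<bullet> \<beta> i) *\<^sub>R \<beta> i"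
    using assms(1) by (simp add: reflection_def frame_inner)
  then show "flip (insert i S) x \<bullet> \<beta> j = (reflection (\<beta> i) \<circ> flip S) x \<bullet> \<beta> j"
    using assms j by (auto simp: flip_inner inner_diff_left frame_inner)
qed

lemma flip_singleton: "i < 8 \<Longrightarrow> flip {i} = reflection (\<beta> i)"
  using flip_insert[of i "{}"] by (simp add: flip_empty)

lemma flip_comp: "S \<subseteq> {..<8} \<Longrightarrow> T \<subseteq> {..<8} \<Longrightarrow> flip S \<circ> flip T = flip ((S - T) \<union> (T - S))"
proof (rule ext, rule frame_eqI)
  fix x j assume S: "S \<subseteq> {..<8}" and T: "T \<subseteq> {..<8}" and j: "(j::nat) < 8"
  have "(S - T) \<union> (T - S) \<subseteq> {..<8}" using S T by blast
  then show "(flip S \<circ> flip T) x \<bullet> \<beta> j = flip ((S - T) \<union> (T - S)) x \<bullet> \<beta> j"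
    using S T j by (simp add: flip_inner)
qed

lemma inj_flip: "inj_on flip (Pow {..<8})"
proof (rule inj_onI)
  fix S T assume S: "S \<in> Pow {..<8}" and T: "T \<in> Pow {..<8}" and eq: "flip S = flip T"
  have "j \<in> S \<longleftrightarrow> j \<in> T" if "j < 8" for j
    using fun_cong[OF eq, of "\<beta> j"] flip_inner[of S j "\<beta> j"] flip_inner[of T j "\<beta> j"] S T that
    by (auto simp: frame_inner split: if_splits)
  then show "S = T" using S T by blast
qed

lemma supp_eq_singleton:
  assumes "supp x = {i}" "x \<in> E8_roots" shows "x = \<beta> i \<or> x = - \<beta> i"
proof -
  have i: "i < 8" and oth: "\<And>j. j < 8 \<Longrightarrow> j \<noteq> i \<Longrightarrow> x \<bullet> \<beta> j = 0" using assms(1) by (auto simp: supp_def set_eq_iff)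
  have "(\<Sum>j<8. (x \<bullet> \<beta> j) * (x \<bullet> \<beta> j)) = (\<Sum>j<8. if j = i then (x \<bullet> \<beta> i) * (x \<bullet> \<beta> i) else 0)"
    using oth by (intro sum.cong) auto
  then have "x \<bullet> x = (x \<bullet> \<beta> i)^2 / 2" using i by (simp add: frame_inner_expansion[of x x] power2_eq_square)
  then have "(x \<bullet> \<beta> i)^2 = 2^2" using assms(2) by (simp add: E8_roots_eq)
  then have "x \<bullet> \<beta> i = 2 \<or> x \<bullet> \<beta> i = - 2" by (simp only: power2_eq_iff)
  then show ?thesis
  proof
    assume "x \<bullet> \<beta> i = 2"
    then have "x = \<beta> i" by (intro frame_eqI) (use oth i in \<open>auto simp: frame_inner\<close>)
    then show ?thesis ..
  next
    assume "x \<bullet> \<beta> i = - 2"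
    then have "x = - \<beta> i" by (intro frame_eqI) (use oth i in \<open>auto simp: frame_inner\<close>)
    then show ?thesis ..
  qed
qed

text \<open>The integers c i = x \<bullet> \<beta> i have squares with sum 4: either one of them is
  2 or -2, or exactly four are 1 or -1. In the second case sign changes carry x to
  \<open>half (supp x)\<close>, which therefore lies in the lattice.\<close>

lemma root_cases:
  assumes x: "x \<in> E8_roots"
  shows "(\<exists>i<8. x = \<beta> i \<or> x = - \<beta> i) \<or> (supp x \<in> blocks \<and> (\<forall>i\<in>supp x. x \<bullet> \<beta> i = 1 \<or> x \<bullet> \<beta> i = -1))"
proof -
  have xl: "x \<in> E8_lattice" using x by (simp add: E8_roots_eq)
  define c where "c i = \<lfloor>x \<bullet> \<beta> i\<rfloor>" for i
  have c: "x \<bullet> \<beta> i = of_int (c i)" if "i < 8" for i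
    unfolding c_def using E8_lattice_inner[OF xl frame_lattice[OF that]] by (simp add: of_int_floor)
  have "(\<Sum>i<8. (x \<bullet> \<beta> i) * (x \<bullet> \<beta> i)) = 4"
    using x frame_inner_expansion[of x x] by (simp add: E8_roots_eq)
  then have "real_of_int (\<Sum>i<8. c i * c i) = 4" using c by simp
  then have s4: "(\<Sum>i<8. c i * c i) = 4" by linarith
  have supp_c: "supp x = {i. i < 8 \<and> c i \<noteq> 0}" using c by (auto simp: supp_def)
  show ?thesis
  proof (cases "\<exists>i<8. \<bar>c i\<bar> \<ge> 2")
    case True
    then obtain i where i: "i < 8" "\<bar>c i\<bar> \<ge> 2" by blast
    have ci: "c i * c i \<ge> 4" using mult_mono[OF i(2) i(2)] by simp
    have "(\<Sum>j<8. c j * c j) = c i * c i + (\<Sum>j\<in>{..<8} - {i}. c j * c j)"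
      using i by (intro sum.remove) auto
    then have "(\<Sum>j\<in>{..<8} - {i}. c j * c j) \<le> 0" using ci s4 by simp
    moreover have "(\<Sum>j\<in>{..<8} - {i}. c j * c j) \<ge> 0" by (intro sum_nonneg) simp
    ultimately have "(\<Sum>j\<in>{..<8} - {i}. c j * c j) = 0" by simp
    then have "c j = 0" if "j < 8" "j \<noteq> i" for j
      using that by (subst (asm) sum_nonneg_eq_0_iff) auto
    then have "supp x = {i}" using i unfolding supp_c by auto
    then show ?thesis using supp_eq_singleton[OF _ x] i by blast
  next
    case False
    then have b: "c i = 0 \<or> c i = 1 \<or> c i = -1" if "i < 8" for i using that by fastforce
    have "(\<Sum>i<8. c i * c i) = (\<Sum>i<8. if c i \<noteq> 0 then 1 else 0)"
    proof (intro sum.cong refl)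
      fix i assume "i \<in> {..<8::nat}"
      then show "c i * c i = (if c i \<noteq> 0 then 1 else 0)" using b[of i] by auto
    qed
    also have "\<dots> = int (card (supp x))" unfolding supp_c by (simp add: sum.If_cases Int_def)
    finally have card4: "card (supp x) = 4" using s4 by simp
    have pm: "\<forall>i\<in>supp x. x \<bullet> \<beta> i = 1 \<or> x \<bullet> \<beta> i = -1" using b c by (force simp: supp_c)
    define T where "T = {i. i < 8 \<and> c i = -1}"
    have T: "T \<subseteq> {..<8}" by (auto simp: T_def)
    have "flip T x = half (supp x)"
    proof (rule frame_eqI)
      fix j assume j: "(j::nat) < 8"
      have "supp x \<subseteq> {..<8}" by (auto simp: supp_def)
      then show "flip T x \<bullet> \<beta> j = half (supp x) \<bullet> \<beta> j"
        using j b[OF j] c[OF j] flip_inner[OF T j, of x] half_inner[of "supp x" j] by (auto simp: T_def supp_c)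
    qed
    then have "half (supp x) \<in> E8_lattice" using flip_lattice[OF T xl] by simp
    then have "supp x \<in> blocks" using card4 by (auto simp: blocks_def supp_def)
    then show ?thesis using pm by blast
  qed
qed

lemma flip_half_root: "S \<in> blocks \<Longrightarrow> T \<subseteq> {..<8} \<Longrightarrow> flip T (half S) \<in> E8_roots"
proof (rule flip_root)
  assume S: "S \<in> blocks"
  then have S8: "S \<subseteq> {..<8}" and c4: "card S = 4" by (auto simp: blocks_def)
  have "half S \<bullet> half S = (\<Sum>i<8. if i \<in> S then 1 else 0) / 2"
    unfolding frame_inner_expansion[of "half S" "half S"]
    by (intro arg_cong[where f="\<lambda>z. z / 2"] sum.cong) (auto simp: half_inner[OF S8])
  also have "\<dots> = 2" using S8 c4 by (simp add: sum.If_cases Int_absorb1)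
  finally show "half S \<in> E8_roots" using S by (simp add: E8_roots_eq blocks_def)
qed

lemma supp_flip_half:
  assumes S: "S \<in> blocks" and T: "T \<subseteq> {..<8}" shows "supp (flip T (half S)) = S"
proof -
  have S8: "S \<subseteq> {..<8}" using S by (auto simp: blocks_def)
  have "flip T (half S) \<bullet> \<beta> j \<noteq> 0 \<longleftrightarrow> j \<in> S" if "j < 8" for j
    using flip_inner[OF T that, of "half S"] half_inner[OF S8 that] by auto
  then show ?thesis using S8 by (auto simp: supp_def)
qed

lemma inj_flip_half: "S \<in> blocks \<Longrightarrow> inj_on (\<lambda>T. flip T (half S)) (Pow S)"
proof (rule inj_onI)
  fix T T' assume S: "S \<in> blocks" and T: "T \<in> Pow S" "T' \<in> Pow S" and eq: "flip T (half S) = flip T' (half S)"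
  have S8: "S \<subseteq> {..<8}" using S by (auto simp: blocks_def)
  have T8: "T \<subseteq> {..<8}" "T' \<subseteq> {..<8}" using T S8 by auto
  have "j \<in> T \<longleftrightarrow> j \<in> T'" if j: "j \<in> S" for j
  proof -
    have "j < 8" using j S8 by auto
    then show ?thesis using arg_cong[OF eq, of "\<lambda>z. z \<bullet> \<beta> j"] j
      by (auto simp: flip_inner[OF T8(1)] flip_inner[OF T8(2)] half_inner[OF S8] split: if_splits)
  qed
  then show "T = T'" using T by blast
qed

text \<open>For a given support a root is determined by the set T of its negative coefficients, and
  every T occurs because sign changes preserve the lattice.\<close>

lemma roots_with_supp:
  assumes S: "S \<in> blocks"
  shows "{x \<in> E8_roots. supp x = S} = (\<lambda>T. flip T (half S)) ` Pow S"
proof (intro subset_antisym subsetI)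
  have S8: "S \<subseteq> {..<8}" and c4: "card S = 4" using S by (auto simp: blocks_def)
  fix x assume "x \<in> {x \<in> E8_roots. supp x = S}"
  then have x: "x \<in> E8_roots" "supp x = S" by auto
  have "\<not> (\<exists>i<8. x = \<beta> i \<or> x = - \<beta> i)"
  proof
    assume "\<exists>i<8. x = \<beta> i \<or> x = - \<beta> i"
    then obtain i where "i < 8" "x = \<beta> i \<or> x = - \<beta> i" by blast
    then have "supp x = {i}" by (auto simp: supp_def frame_inner split: if_splits)
    then show False using x c4 by simp
  qed
  then have pm: "\<And>i. i \<in> S \<Longrightarrow> x \<bullet> \<beta> i = 1 \<or> x \<bullet> \<beta> i = -1" using root_cases[OF x(1)] x(2) by blast
  define T where "T = {i \<in> S. x \<bullet> \<beta> i = -1}"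
  have T8: "T \<subseteq> {..<8}" using S8 by (auto simp: T_def)
  have "x = flip T (half S)"
  proof (rule frame_eqI)
    fix j assume j: "(j::nat) < 8"
    have "j \<notin> S \<Longrightarrow> x \<bullet> \<beta> j = 0" using x(2) j by (auto simp: supp_def)
    then show "x \<bullet> \<beta> j = flip T (half S) \<bullet> \<beta> j"
      using pm[of j] flip_inner[OF T8 j, of "half S"] half_inner[OF S8 j] by (auto simp: T_def)
  qed
  then show "x \<in> (\<lambda>T. flip T (half S)) ` Pow S" by (auto simp: T_def)
next
  fix x assume "x \<in> (\<lambda>T. flip T (half S)) ` Pow S"
  then obtain T where T: "T \<subseteq> S" "x = flip T (half S)" by blast
  moreover have "T \<subseteq> {..<8}" using T(1) S by (auto simp: blocks_def)
  ultimately show "x \<in> {x \<in> E8_roots. supp x = S}" using flip_half_root[OF S] supp_flip_half[OF S] by simp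
qed

lemma finite_blocks: "finite blocks"
  by (rule finite_subset[of _ "Pow {..<8}"]) (auto simp: blocks_def)

text \<open>Both the count of the roots and their design identities are evaluated through this
  decomposition into frame roots and signed half sums.\<close>

lemma sum_roots:
  fixes f :: "real^8 \<Rightarrow> 'a::comm_monoid_add"
  shows "sum f E8_roots = (\<Sum>i<8. f (\<beta> i) + f (- \<beta> i)) + (\<Sum>S\<in>blocks. \<Sum>T\<in>Pow S. f (flip T (half S)))"
    and finite_roots: "finite E8_roots"
proof -
  define R1 where "R1 = (\<Union>i<8. {\<beta> i, - \<beta> i})"
  define R2 where "R2 = (\<Union>S\<in>blocks. {x \<in> E8_roots. supp x = S})"
  have fS: "finite {x \<in> E8_roots. supp x = S}" if "S \<in> blocks" for S
    using that roots_with_supp[OF that] by (auto simp: blocks_def intro: finite_subset)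
  have s1: "supp x = {i}" if "i < 8" "x \<in> {\<beta> i, - \<beta> i}" for i x
    using that by (auto simp: supp_def frame_inner split: if_splits)
  have "- \<beta> i \<in> E8_roots" if "i < 8" for i using frame_root[OF that] by (simp add: E8_roots_eq)
  then have R: "E8_roots = R1 \<union> R2" using root_cases frame_root unfolding R1_def R2_def by blast
  have fin: "finite R1" "finite R2" using finite_blocks fS by (auto simp: R1_def R2_def)
  show "finite E8_roots" unfolding R using fin by (rule finite_UnI)
  have disj: "R1 \<inter> R2 = {}"
  proof -
    have "x \<notin> R2" if x: "x \<in> R1" for x
    proof
      obtain i where "i < 8" "x \<in> {\<beta> i, - \<beta> i}" using x unfolding R1_def by blast
      then have "card (supp x) = 1" using s1 by simp
      moreover assume "x \<in> R2"
      ultimately show False unfolding R2_def blocks_def by auto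
    qed
    then show ?thesis by blast
  qed
  have "sum f R1 = (\<Sum>i<8. sum f {\<beta> i, - \<beta> i})" unfolding R1_def
  proof (rule sum.UNION_disjoint)
    show "\<forall>i\<in>{..<8}. \<forall>j\<in>{..<8}. i \<noteq> j \<longrightarrow> {\<beta> i, - \<beta> i} \<inter> {\<beta> j, - \<beta> j} = {}"
    proof (intro ballI impI)
      fix i j assume "i \<in> {..<8::nat}" "j \<in> {..<8}" "i \<noteq> j"
      then show "{\<beta> i, - \<beta> i} \<inter> {\<beta> j, - \<beta> j} = {}" using s1[of i] s1[of j] by fastforce
    qed
  qed auto
  also have "\<dots> = (\<Sum>i<8. f (\<beta> i) + f (- \<beta> i))"
  proof (intro sum.cong refl)
    fix i assume i: "i \<in> {..<8::nat}"
    have "\<beta> i \<noteq> - \<beta> i"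
    proof
      assume "\<beta> i = - \<beta> i"
      then have "\<beta> i + \<beta> i = 0" by (simp only: eq_neg_iff_add_eq_0)
      then have "2 *\<^sub>R \<beta> i = 0" by (simp only: scaleR_2)
      then show False using i frame_nonzero[of i] by simp
    qed
    then show "sum f {\<beta> i, - \<beta> i} = f (\<beta> i) + f (- \<beta> i)" by simp
  qed
  finally have sR1: "sum f R1 = (\<Sum>i<8. f (\<beta> i) + f (- \<beta> i))" .
  have "sum f R2 = (\<Sum>S\<in>blocks. sum f {x \<in> E8_roots. supp x = S})"
    unfolding R2_def by (rule sum.UNION_disjoint) (use finite_blocks fS in auto)
  also have "\<dots> = (\<Sum>S\<in>blocks. \<Sum>T\<in>Pow S. f (flip T (half S)))"
    by (intro sum.cong refl) (simp add: roots_with_supp sum.reindex[OF inj_flip_half])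
  finally show "sum f E8_roots = (\<Sum>i<8. f (\<beta> i) + f (- \<beta> i)) + (\<Sum>S\<in>blocks. \<Sum>T\<in>Pow S. f (flip T (half S)))"
    using sR1 fin disj by (simp add: R sum.union_disjoint)
qed

lemma card_roots: "card E8_roots = 16 + 16 * card blocks"
proof -
  have "card E8_roots = (\<Sum>i<(8::nat). 1 + 1) + (\<Sum>S\<in>blocks. \<Sum>T\<in>Pow S. 1::nat)"
    using sum_roots(1)[of "\<lambda>_. 1::nat"] by simp
  also have "(\<Sum>S\<in>blocks. \<Sum>T\<in>Pow S. 1::nat) = (\<Sum>S\<in>blocks. 16)"
    by (intro sum.cong refl) (auto simp: card_Pow blocks_def card_ge_0_finite)
  finally show ?thesis by simp
qed

text \<open>The inner product of two half sums is half the size of the intersection, and it must be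
  an integer.\<close>

lemma blocks_even_inter: "S \<in> blocks \<Longrightarrow> S' \<in> blocks \<Longrightarrow> even (card (S \<inter> S'))"
proof -
  assume S: "S \<in> blocks" and S': "S' \<in> blocks"
  then have S8: "S \<subseteq> {..<8}" and S8': "S' \<subseteq> {..<8}" by (auto simp: blocks_def)
  have "half S \<bullet> half S' = (\<Sum>i<8. if i \<in> S \<inter> S' then 1 else 0) / 2"
    unfolding frame_inner_expansion[of "half S" "half S'"]
    by (intro arg_cong[where f="\<lambda>z. z / 2"] sum.cong) (auto simp: half_inner[OF S8] half_inner[OF S8'])
  also have "\<dots> = real (card (S \<inter> S')) / 2" using S8 by (subst sum.If_cases) (auto intro!: arg_cong[where f=card])
  finally have eq: "half S \<bullet> half S' = real (card (S \<inter> S')) / 2" .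
  have "half S \<bullet> half S' \<in> \<int>" using E8_lattice_inner[of "half S" "half S'"] S S' by (simp add: blocks_def)
  then have "real (card (S \<inter> S')) / 2 \<in> \<int>" unfolding eq .
  then obtain k where "real (card (S \<inter> S')) / 2 = of_int k" by (rule Ints_cases)
  then have "int (card (S \<inter> S')) = 2 * k" by linarith
  then show ?thesis by presburger
qed

end

section \<open>The extended Fano plane and design properties of the roots\<close>

text \<open>Twice the inner product of x with the root of support S and negative set T, when u i = x
  \<bullet> \<beta> i; see \<open>flip_half_inner\<close>.\<close>

definition signed_sum :: "nat set \<Rightarrow> nat set \<Rightarrow> (nat \<Rightarrow> real) \<Rightarrow> real" where
  "signed_sum S T u = (\<Sum>i\<in>S. if i \<in> T then - u i else u i)"

lemma sum_Pow_insert: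
  fixes f :: "nat set \<Rightarrow> 'a::comm_monoid_add"
  assumes "finite S" "a \<notin> S"
  shows "(\<Sum>T\<in>Pow (insert a S). f T) = (\<Sum>T\<in>Pow S. f T + f (insert a T))"
proof -
  have inj: "inj_on (insert a) (Pow S)" using assms(2) by (auto simp: inj_on_def)
  have "(\<Sum>T\<in>Pow (insert a S). f T) = (\<Sum>T\<in>Pow S. f T) + (\<Sum>T\<in>insert a ` Pow S. f T)"
    unfolding Pow_insert using assms by (intro sum.union_disjoint) auto
  also have "\<dots> = (\<Sum>T\<in>Pow S. f T + f (insert a T))"
    by (simp add: sum.reindex[OF inj] sum.distrib)
  finally show ?thesis .
qed

lemma signed_sum_insert:
  assumes "finite S" "a \<notin> S" "T \<subseteq> S"
  shows "signed_sum (insert a S) T u = signed_sum S T u + u a"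
    and "signed_sum (insert a S) (insert a T) u = signed_sum S T u - u a"
proof -
  have "(\<Sum>i\<in>S. if i \<in> insert a T then - u i else u i) = signed_sum S T u"
    unfolding signed_sum_def using assms by (intro sum.cong) auto
  then show "signed_sum (insert a S) (insert a T) u = signed_sum S T u - u a"
    using assms by (simp add: signed_sum_def)
  show "signed_sum (insert a S) T u = signed_sum S T u + u a"
    using assms by (auto simp: signed_sum_def)
qed

lemma sum_signed_square:
  "finite S \<Longrightarrow> (\<Sum>T\<in>Pow S. (signed_sum S T u)^2) = 2 ^ card S * (\<Sum>i\<in>S. (u i)^2)"
proof (induction S rule: finite_induct)
  case empty
  show ?case by (simp add: signed_sum_def)
next
  case (insert a S)
  have "(\<Sum>T\<in>Pow (insert a S). (signed_sum (insert a S) T u)^2)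
      = (\<Sum>T\<in>Pow S. 2 * (signed_sum S T u)^2 + 2 * (u a)^2)"
    unfolding sum_Pow_insert[OF insert.hyps]
    by (intro sum.cong refl) (simp add: signed_sum_insert[OF insert.hyps] power2_eq_square algebra_simps)
  also have "\<dots> = 2 * (\<Sum>T\<in>Pow S. (signed_sum S T u)^2) + 2 ^ card S * (2 * (u a)^2)"
    using insert.hyps by (simp add: sum.distrib card_Pow flip: sum_distrib_left)
  finally show ?case using insert by (simp add: algebra_simps)
qed

text \<open>The fourth moment of a sum with independent random signs. Adding one index pairs the two
  signs of the new term, so its odd powers cancel and only second and fourth moments of the old sum
  enter.\<close>

lemma sum_signed_fourth:
  "finite S \<Longrightarrow> (\<Sum>T\<in>Pow S. (signed_sum S T u)^4) = 2 ^ card S * (3 * (\<Sum>i\<in>S. (u i)^2)^2 - 2 * (\<Sum>i\<in>S. (u i)^4))"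
proof (induction S rule: finite_induct)
  case empty
  show ?case by (simp add: signed_sum_def)
next
  case (insert a S)
  have q: "(s + t)^4 + (s - t)^4 = 2 * s^4 + 12 * t^2 * s^2 + 2 * t^4" for s t :: real
    by (simp add: power4_eq_xxxx power2_eq_square algebra_simps)
  have "(\<Sum>T\<in>Pow (insert a S). (signed_sum (insert a S) T u)^4)
      = (\<Sum>T\<in>Pow S. 2 * (signed_sum S T u)^4 + 12 * (u a)^2 * (signed_sum S T u)^2 + 2 * (u a)^4)"
    unfolding sum_Pow_insert[OF insert.hyps]
    by (intro sum.cong refl) (simp add: signed_sum_insert[OF insert.hyps] q)
  also have "\<dots> = 2 * (\<Sum>T\<in>Pow S. (signed_sum S T u)^4) + 12 * (u a)^2 * (\<Sum>T\<in>Pow S. (signed_sum S T u)^2)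
      + 2 ^ card S * (2 * (u a)^4)"
    using insert.hyps by (simp add: sum.distrib card_Pow flip: sum_distrib_left)
  also have "\<dots> = 2 ^ card S * (2 * (3 * (\<Sum>i\<in>S. (u i)^2)^2 - 2 * (\<Sum>i\<in>S. (u i)^4))
      + 12 * (u a)^2 * (\<Sum>i\<in>S. (u i)^2) + 2 * (u a)^4)"
    unfolding insert.IH sum_signed_square[OF insert.hyps(1)] by (simp add: algebra_simps)
  also have "\<dots> = 2 ^ card (insert a S) * (3 * (\<Sum>i\<in>insert a S. (u i)^2)^2 - 2 * (\<Sum>i\<in>insert a S. (u i)^4))"
    using insert.hyps by (simp add: power4_eq_xxxx power2_eq_square algebra_simps)
  finally show ?case .
qed

context root_frame
begin

lemma flip_half_inner:
  assumes S: "S \<in> blocks" and T: "T \<subseteq> S"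
  shows "flip T (half S) \<bullet> x = signed_sum S T (\<lambda>i. x \<bullet> \<beta> i) / 2"
proof -
  have S8: "S \<subseteq> {..<8}" and T8: "T \<subseteq> {..<8}" using S T by (auto simp: blocks_def)
  have "flip T (half S) \<bullet> x = (\<Sum>i<8. (flip T (half S) \<bullet> \<beta> i) * (x \<bullet> \<beta> i)) / 2"
    by (rule frame_inner_expansion)
  also have "(\<Sum>i<8. (flip T (half S) \<bullet> \<beta> i) * (x \<bullet> \<beta> i))
      = (\<Sum>i<8. if i \<in> S then (if i \<in> T then - (x \<bullet> \<beta> i) else x \<bullet> \<beta> i) else 0)"
    using T by (intro sum.cong refl) (auto simp: flip_inner[OF T8] half_inner[OF S8])
  also have "\<dots> = signed_sum S T (\<lambda>i. x \<bullet> \<beta> i)"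
    using S8 by (simp add: signed_sum_def sum.If_cases Int_absorb1)
  finally show ?thesis .
qed

lemma sum_roots_square:
  "(\<Sum>r\<in>E8_roots. (r \<bullet> x)^2) = (\<Sum>i<8. 2 * (x \<bullet> \<beta> i)^2) + (\<Sum>S\<in>blocks. 4 * (\<Sum>i\<in>S. (x \<bullet> \<beta> i)^2))"
proof -
  have "(\<Sum>T\<in>Pow S. (flip T (half S) \<bullet> x)^2) = 4 * (\<Sum>i\<in>S. (x \<bullet> \<beta> i)^2)" if S: "S \<in> blocks" for S
  proof -
    have f: "finite S" "card S = 4" using S by (auto simp: blocks_def intro: card_ge_0_finite)
    have "(\<Sum>T\<in>Pow S. (flip T (half S) \<bullet> x)^2) = (\<Sum>T\<in>Pow S. (signed_sum S T (\<lambda>i. x \<bullet> \<beta> i))^2) / 4"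
      unfolding sum_divide_distrib by (intro sum.cong refl) (simp add: flip_half_inner[OF S] power_divide)
    then show ?thesis by (simp add: sum_signed_square f)
  qed
  then show ?thesis unfolding sum_roots(1) by (simp add: inner_commute)
qed

lemma sum_roots_fourth:
  "(\<Sum>r\<in>E8_roots. (r \<bullet> x)^4) = (\<Sum>i<8. 2 * (x \<bullet> \<beta> i)^4)
    + (\<Sum>S\<in>blocks. 3 * (\<Sum>i\<in>S. (x \<bullet> \<beta> i)^2)^2 - 2 * (\<Sum>i\<in>S. (x \<bullet> \<beta> i)^4))"
proof -
  have "(\<Sum>T\<in>Pow S. (flip T (half S) \<bullet> x)^4) = 3 * (\<Sum>i\<in>S. (x \<bullet> \<beta> i)^2)^2 - 2 * (\<Sum>i\<in>S. (x \<bullet> \<beta> i)^4)"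
    if S: "S \<in> blocks" for S
  proof -
    have f: "finite S" "card S = 4" using S by (auto simp: blocks_def intro: card_ge_0_finite)
    have "(\<Sum>T\<in>Pow S. (flip T (half S) \<bullet> x)^4) = (\<Sum>T\<in>Pow S. (signed_sum S T (\<lambda>i. x \<bullet> \<beta> i))^4) / 16"
      unfolding sum_divide_distrib by (intro sum.cong refl) (simp add: flip_half_inner[OF S] power_divide)
    then show ?thesis by (simp add: sum_signed_fourth f)
  qed
  then show ?thesis unfolding sum_roots(1) by (simp add: inner_commute)
qed

end

text \<open>The roots e1 + e2, e1 - e2, e3 + e4, e3 - e4 and so on. In this numbering the blocks are
  literally \<open>fano_ext_lines\<close>, see \<open>std_blocks\<close>.\<close>

definition std_frame :: "nat \<Rightarrow> real^8" where
  "std_frame i = (let a = axis (of_nat (2 * (i div 2) + 1)) 1; b = axis (of_nat (2 * (i div 2) + 2)) 1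
     in if even i then a + b else a - b)"

lemma less_8_cases: "(i::nat) < 8 \<longleftrightarrow> i = 0 \<or> i = 1 \<or> i = 2 \<or> i = 3 \<or> i = 4 \<or> i = 5 \<or> i = 6 \<or> i = 7"
  by auto

lemma std_frame_simps:
  "std_frame 0 = axis 1 1 + axis 2 1" "std_frame 1 = axis 1 1 - axis 2 1"
  "std_frame 2 = axis 3 1 + axis 4 1" "std_frame 3 = axis 3 1 - axis 4 1"
  "std_frame 4 = axis 5 1 + axis 6 1" "std_frame 5 = axis 5 1 - axis 6 1"
  "std_frame 6 = axis 7 1 + axis 8 1" "std_frame 7 = axis 7 1 - axis 8 1"
  by (simp_all add: std_frame_def)

lemma inner_axis_one: "axis i (1::real) \<bullet> axis j 1 = (if i = j then 1 else 0)" for i j :: 8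
  by (auto simp: inner_axis_axis)

interpretation std: root_frame std_frame
proof
  have sum_root: "axis a 1 + axis b 1 \<in> E8_roots" "axis a 1 - axis b 1 \<in> E8_roots" if "a \<noteq> b" for a b :: 8
    using E8_lattice_axis[OF that] that
    by (auto simp: E8_roots_eq inner_add_left inner_add_right inner_diff_left inner_diff_right inner_axis_one)
  show "std_frame i \<in> E8_roots" if "i < 8" for i
    using that unfolding less_8_cases by (elim disjE) (simp_all add: std_frame_simps[simplified] sum_root)
  show "std_frame i \<bullet> std_frame j = 0" if "i < 8" "j < 8" "i \<noteq> j" for i j
    using that unfolding less_8_cases
    by (elim disjE) (simp_all add: std_frame_simps[simplified] inner_add_left inner_add_right inner_diff_left inner_diff_right inner_axis_one)
qed

lemma fano_ext_lines_eq:
  "fano_ext_lines = {{0,1,2,3},{0,1,4,5},{0,1,6,7},{0,2,4,6},{0,2,5,7},{0,3,4,7},{0,3,5,6},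
     {4,5,6,7},{2,3,6,7},{2,3,4,5},{1,3,5,7},{1,3,4,6},{1,2,5,6},{1,2,4,7}}"
proof -
  have p: "fano_ext_points = {0,1,2,3,4,5,6,7}" by (auto simp: fano_ext_points_def)
  have c: "fano_ext_points - {0,1,2,3} = {4,5,6,7}" "fano_ext_points - {0,1,4,5} = {2,3,6,7}"
    "fano_ext_points - {0,1,6,7} = {2,3,4,5}" "fano_ext_points - {0,2,4,6} = {1,3,5,7}"
    "fano_ext_points - {0,2,5,7} = {1,3,4,6}" "fano_ext_points - {0,3,4,7} = {1,2,5,6}"
    "fano_ext_points - {0,3,5,6} = {1,2,4,7}"
    unfolding p by auto
  show ?thesis
    unfolding fano_ext_lines_def fano_lines_def image_insert image_empty c
    by (simp only: Un_insert_left Un_empty_left)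
qed

text \<open>The three sets consist of the labels with a given binary digit. A word of even weight
  meeting them evenly lies in the dual of the extended Hamming code of length 8; that code is
  self-dual, and its words of weight 4 are the 14 lines.\<close>

lemma sorted_block_list:
  "\<forall>xs\<in>set (subseqs [0,1,2,3,4,5,6,7::nat]). length xs = 4 \<and> even (length (filter (\<lambda>i. i \<in> set [1,3,5,7]) xs))
     \<and> even (length (filter (\<lambda>i. i \<in> set [2,3,6,7]) xs)) \<and> even (length (filter (\<lambda>i. i \<in> set [4,5,6,7]) xs)) \<longrightarrow>
     xs \<in> set [[0,1,2,3],[0,1,4,5],[0,1,6,7],[0,2,4,6],[0,2,5,7],[0,3,4,7],[0,3,5,6],
     [4,5,6,7],[2,3,6,7],[2,3,4,5],[1,3,5,7],[1,3,4,6],[1,2,5,6],[1,2,4,7]]"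
  by code_simp

lemma fano_ext_linesI:
  assumes S: "S \<subseteq> {..<8}" "card S = 4" "even (card (S \<inter> {1,3,5,7}))" "even (card (S \<inter> {2,3,6,7}))" "even (card (S \<inter> {4,5,6,7}))"
  shows "S \<in> fano_ext_lines"
proof -
  have "set [0,1,2,3,4,5,6,7::nat] = {..<8}" by (auto simp: less_8_cases)
  then have "S \<in> set ` set (subseqs [0,1,2,3,4,5,6,7::nat])" using S(1) by (simp only: subseqs_powset Pow_iff)
  then obtain xs where xs: "xs \<in> set (subseqs [0,1,2,3,4,5,6,7::nat])" "S = set xs" by blast
  have d: "distinct xs" using subseqs_distinctD[OF xs(1)] by simp
  have i: "card (S \<inter> set ys) = length (filter (\<lambda>i. i \<in> set ys) xs)" for ys
    using distinct_card[OF distinct_filter[OF d, of "\<lambda>i. i \<in> set ys"]] by (simp add: xs(2) Int_def)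
  have "length xs = 4" using S(2) xs(2) distinct_card[OF d] by simp
  moreover have "even (length (filter (\<lambda>i. i \<in> set [1,3,5,7]) xs))" "even (length (filter (\<lambda>i. i \<in> set [2,3,6,7]) xs))"
     "even (length (filter (\<lambda>i. i \<in> set [4,5,6,7]) xs))"
    using S(3-5) i[of "[1,3,5,7]"] i[of "[2,3,6,7]"] i[of "[4,5,6,7]"] by (simp_all del: filter.simps)
  ultimately have "xs \<in> set [[0,1,2,3],[0,1,4,5],[0,1,6,7],[0,2,4,6],[0,2,5,7],[0,3,4,7],[0,3,5,6],
     [4,5,6,7],[2,3,6,7],[2,3,4,5],[1,3,5,7],[1,3,4,6],[1,2,5,6],[1,2,4,7]]"
    using bspec[OF sorted_block_list xs(1)] by blast
  then have "set xs \<in> set ` set [[0,1,2,3],[0,1,4,5],[0,1,6,7],[0,2,4,6],[0,2,5,7],[0,3,4,7],[0,3,5,6],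
     [4,5,6,7],[2,3,6,7],[2,3,4,5],[1,3,5,7],[1,3,4,6],[1,2,5,6],[1,2,4,7]]" by (rule imageI)
  then show ?thesis unfolding xs(2) fano_ext_lines_eq by (simp only: list.set image_insert image_empty)
qed

lemma card_fano_ext_lines: "card fano_ext_lines = 14"
proof -
  have "card (set (map set [[0,1,2,3],[0,1,4,5],[0,1,6,7],[0,2,4,6],[0,2,5,7],[0,3,4,7],[0,3,5,6],
     [4,5,6,7],[2,3,6,7],[2,3,4,5],[1,3,5,7],[1,3,4,6],[1,2,5,6],[1,2,4,7::nat]])) = 14"
    by code_simp
  then show ?thesis by (simp only: fano_ext_lines_eq list.map list.set)
qed

lemma (in root_frame) blocks_subset_fano:
  assumes "{1,3,5,7} \<in> blocks" "{2,3,6,7} \<in> blocks" "{4,5,6,7} \<in> blocks"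
  shows "blocks \<subseteq> fano_ext_lines"
proof
  fix S assume S: "S \<in> blocks"
  then show "S \<in> fano_ext_lines"
    using blocks_even_inter[OF S assms(1)] blocks_even_inter[OF S assms(2)] blocks_even_inter[OF S assms(3)]
    by (intro fano_ext_linesI) (auto simp: blocks_def)
qed

lemma E8_latticeI:
  assumes "(\<forall>i. x $ i \<in> \<int>) \<or> (\<forall>i. x $ i - 1/2 \<in> \<int>)" "(\<Sum>i\<in>UNIV. x $ i) / 2 \<in> \<int>"
  shows "x \<in> E8_lattice"
proof -
  obtain k where "(\<Sum>i\<in>UNIV. x $ i) / 2 = of_int k" using assms(2) by (rule Ints_cases)
  then have "(\<Sum>i\<in>UNIV. x $ i) = 2 * of_int k" by simp
  then show ?thesis using assms(1) by (auto simp: E8_lattice_def)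
qed

text \<open>One inclusion is a check of 14 half sums in coordinates; it supplies the three blocks
  through which evenness of intersections yields the other inclusion.\<close>

lemma std_blocks: "std.blocks = fano_ext_lines"
proof -
  have sub: "fano_ext_lines \<subseteq> std.blocks"
  proof
    fix S assume S: "S \<in> fano_ext_lines"
    have "std.half S \<in> E8_lattice"
      using S unfolding fano_ext_lines_eq
      by (elim insertE emptyE; hypsubst; intro E8_latticeI)
        (simp_all add: std.half_def std_frame_simps[simplified] forall_8 sum_8 axis_def)
    moreover have "S \<subseteq> {..<8}" "card S = 4" using S unfolding fano_ext_lines_eq by auto
    ultimately show "S \<in> std.blocks" by (simp add: std.blocks_def)
  qed
  moreover have "{1,3,5,7} \<in> fano_ext_lines" "{2,3,6,7} \<in> fano_ext_lines" "{4,5,6,7} \<in> fano_ext_lines"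
    by (simp_all add: fano_ext_lines_eq)
  ultimately show ?thesis using std.blocks_subset_fano by blast
qed

lemma card_E8_roots: "card E8_roots = 240"
  using std.card_roots by (simp add: std_blocks card_fano_ext_lines)

lemma finite_E8_roots: "finite E8_roots"
  by (rule std.finite_roots)

lemma sum_fano_ext_lines:
  fixes g :: "nat set \<Rightarrow> real"
  shows "sum g fano_ext_lines = g {0,1,2,3} + g {0,1,4,5} + g {0,1,6,7} + g {0,2,4,6} + g {0,2,5,7} + g {0,3,4,7} + g {0,3,5,6}
     + g {4,5,6,7} + g {2,3,6,7} + g {2,3,4,5} + g {1,3,5,7} + g {1,3,4,6} + g {1,2,5,6} + g {1,2,4,7}"
proof -
  let ?L = "map set [[0,1,2,3],[0,1,4,5],[0,1,6,7],[0,2,4,6],[0,2,5,7],[0,3,4,7],[0,3,5,6],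
     [4,5,6,7],[2,3,6,7],[2,3,4,5],[1,3,5,7],[1,3,4,6],[1,2,5,6],[1,2,4,7::nat]]"
  have L: "fano_ext_lines = set ?L" by (simp only: fano_ext_lines_eq list.map list.set)
  have "card (set ?L) = 14" using card_fano_ext_lines unfolding L .
  moreover have "length ?L = 14" by simp
  ultimately have "distinct ?L" by (intro card_distinct) (simp only:)
  then have "sum g fano_ext_lines = sum_list (map g ?L)" unfolding L by (rule sum.distinct_set_conv_list)
  then show ?thesis by (simp add: ac_simps)
qed

lemma sum_less_8: "(\<Sum>i<(8::nat). g i) = g 0 + g 1 + g 2 + g 3 + g 4 + g 5 + g 6 + (g 7 :: real)"
proof -
  have "{..<(8::nat)} = {0,1,2,3,4,5,6,7}" by auto
  then show ?thesis by simp
qed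

text \<open>With p i = (x \<bullet> \<beta> i)^2 each p i receives 2 from the frame and 4 from each
  of the seven blocks through i, together 30, and the p i sum to twice the norm.\<close>

lemma roots_design2: "(\<Sum>r\<in>E8_roots. (r \<bullet> x)^2) = 60 * (x \<bullet> x)"
proof -
  define p where "p i = (x \<bullet> std_frame i)^2" for i
  have xx: "x \<bullet> x = (\<Sum>i<8. p i) / 2"
    using std.frame_inner_expansion[of x x] by (simp add: p_def power2_eq_square)
  have "(\<Sum>r\<in>E8_roots. (r \<bullet> x)^2) = (\<Sum>i<8. 2 * p i) + (\<Sum>S\<in>fano_ext_lines. 4 * (\<Sum>i\<in>S. p i))"
    unfolding std.sum_roots_square std_blocks p_def ..
  also have "\<dots> = 60 * ((\<Sum>i<8. p i) / 2)"
    unfolding sum_fano_ext_lines sum_less_8 by simp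
  finally show ?thesis unfolding xx .
qed

text \<open>In terms of the same p i, a square receives 2 + 7 = 9, because seven blocks contain a
  point, and a mixed product 3 * 6 = 18, because three blocks contain a pair. So the sum is 9 times
  the square of the sum of the p i.\<close>

lemma roots_design4: "(\<Sum>r\<in>E8_roots. (r \<bullet> x)^4) = 36 * (x \<bullet> x)^2"
proof -
  define p where "p i = (x \<bullet> std_frame i)^2" for i
  have p4: "(x \<bullet> std_frame i)^4 = p i * p i" for i
    by (simp add: p_def power4_eq_xxxx power2_eq_square)
  have xx: "x \<bullet> x = (\<Sum>i<8. p i) / 2"
    using std.frame_inner_expansion[of x x] by (simp add: p_def power2_eq_square)
  have "(\<Sum>r\<in>E8_roots. (r \<bullet> x)^4) = (\<Sum>i<8. 2 * (p i * p i)) + (\<Sum>S\<in>fano_ext_lines. 3 * (\<Sum>i\<in>S. p i)^2 - 2 * (\<Sum>i\<in>S. p i * p i))"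
    unfolding std.sum_roots_fourth std_blocks p4 p_def ..
  also have "\<dots> = 36 * ((\<Sum>i<8. p i) / 2)^2"
  proof -
    define r where "r i j = p i * p j" for i j
    have sq4: "(\<Sum>i\<in>{a,b,c,d}. p i)^2 = r a a + r b b + r c c + r d d + 2 * r a b + 2 * r a c + 2 * r a d + 2 * r b c + 2 * r b d + 2 * r c d"
      if "a < b" "b < c" "c < d" for a b c d
      using that by (simp add: r_def power2_eq_square algebra_simps)
    have dg4: "(\<Sum>i\<in>{a,b,c,d}. p i * p i) = r a a + r b b + r c c + r d d"
      if "a < b" "b < c" "c < d" for a b c d
      using that by (simp add: r_def)
    have pp: "p i * p i = r i i" for i by (simp add: r_def)
    have split8: "{..<(8::nat)} = {0,1,2,3} \<union> {4,5,6,7}" by auto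
    have s8: "(\<Sum>i<8. p i) = (\<Sum>i\<in>{0,1,2,3}. p i) + (\<Sum>i\<in>{4,5,6,7}. p i)"
      unfolding split8 by (rule sum.union_disjoint) auto
    have cross: "(\<Sum>i\<in>{0,1,2,3}. p i) * (\<Sum>i\<in>{4,5,6,7}. p i) = r 0 4 + r 0 5 + r 0 6 + r 0 7
      + r 1 4 + r 1 5 + r 1 6 + r 1 7 + r 2 4 + r 2 5 + r 2 6 + r 2 7 + r 3 4 + r 3 5 + r 3 6 + r 3 7"
      by (simp add: r_def distrib_left distrib_right)
    have sq: "36 * ((x + y) / 2)^2 = 9 * x^2 + 18 * (x * y) + 9 * y^2" for x y :: real
      by (simp add: power2_eq_square algebra_simps)
    have "(\<Sum>i<8. 2 * (p i * p i)) + (\<Sum>S\<in>fano_ext_lines. 3 * (\<Sum>i\<in>S. p i)^2 - 2 * (\<Sum>i\<in>S. p i * p i))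
      = 9 * (\<Sum>i\<in>{0,1,2,3}. p i)^2
       + 18 * ((\<Sum>i\<in>{0,1,2,3}. p i) * (\<Sum>i\<in>{4,5,6,7}. p i)) + 9 * (\<Sum>i\<in>{4,5,6,7}. p i)^2"
      unfolding sum_fano_ext_lines cross
      by (simp only: sum_less_8 sq4 dg4 pp numeral_less_iff less_num_simps le_num_simps zero_less_numeral zero_less_one one_less_numeral_iff)
        simp
    also have "\<dots> = 36 * ((\<Sum>i<8. p i) / 2)^2"
      unfolding s8 by (rule sq[symmetric])
    finally show ?thesis .
  qed
  finally show ?thesis unfolding xx .
qed

section \<open>Groups of odd order without fixed vectors\<close>

text \<open>Polarisation of the fourth moment: the values at u + v and u - v add up to 288, of which
  144 come from u and v alone, leaving 12 times the mixed sum.\<close>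

lemma roots_design22:
  assumes "u \<bullet> u = 1" "v \<bullet> v = 1" "u \<bullet> v = 0"
  shows "(\<Sum>r\<in>E8_roots. (r \<bullet> u)^2 * (r \<bullet> v)^2) = 12"
proof -
  have q: "(s + t)^4 + (s - t)^4 = 2 * s^4 + 12 * (s^2 * t^2) + 2 * t^4" for s t :: real
    by (simp add: power4_eq_xxxx power2_eq_square algebra_simps)
  have "(\<Sum>r\<in>E8_roots. (r \<bullet> (u + v))^4) + (\<Sum>r\<in>E8_roots. (r \<bullet> (u - v))^4)
    = 2 * (\<Sum>r\<in>E8_roots. (r \<bullet> u)^4) + 12 * (\<Sum>r\<in>E8_roots. (r \<bullet> u)^2 * (r \<bullet> v)^2) + 2 * (\<Sum>r\<in>E8_roots. (r \<bullet> v)^4)"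
  proof -
    have "(\<Sum>r\<in>E8_roots. (r \<bullet> (u + v))^4) + (\<Sum>r\<in>E8_roots. (r \<bullet> (u - v))^4)
      = (\<Sum>r\<in>E8_roots. (r \<bullet> u + r \<bullet> v)^4 + (r \<bullet> u - r \<bullet> v)^4)"
      by (simp only: inner_add_right inner_diff_right sum.distrib)
    also have "\<dots> = (\<Sum>r\<in>E8_roots. 2 * (r \<bullet> u)^4 + 12 * ((r \<bullet> u)^2 * (r \<bullet> v)^2) + 2 * (r \<bullet> v)^4)"
      by (simp only: q)
    finally show ?thesis by (simp only: sum.distrib sum_distrib_left)
  qed
  moreover have "(u + v) \<bullet> (u + v) = 2" "(u - v) \<bullet> (u - v) = 2"
    using assms by (simp_all add: inner_add_left inner_add_right inner_diff_left inner_diff_right inner_commute)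
  ultimately show ?thesis by (simp add: roots_design4 assms)
qed

lemma proj_orthonormal:
  assumes E: "subspace E" "span C = E" "finite C" and on: "\<And>b c. b \<in> C \<Longrightarrow> c \<in> C \<Longrightarrow> b \<bullet> c = (if b = c then 1 else 0)"
  shows "proj E x = (\<Sum>b\<in>C. (x \<bullet> b) *\<^sub>R b)"
proof (rule proj_unique[OF E(1)])
  show "(\<Sum>b\<in>C. (x \<bullet> b) *\<^sub>R b) \<in> E" unfolding E(2)[symmetric]
    by (intro span_sum span_scale span_base)
  fix w assume "w \<in> E"
  then have "w \<in> span C" using E(2) by simp
  then show "(x - (\<Sum>b\<in>C. (x \<bullet> b) *\<^sub>R b)) \<bullet> w = 0"
  proof (induction rule: span_induct_alt)
    case (step s c y)
    have "(\<Sum>b\<in>C. (x \<bullet> b) *\<^sub>R b) \<bullet> c = (\<Sum>b\<in>C. if b = c then x \<bullet> c else 0)"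
      unfolding inner_sum_left using on step(1) by (intro sum.cong) auto
    then have "(\<Sum>b\<in>C. (x \<bullet> b) *\<^sub>R b) \<bullet> c = x \<bullet> c" using step(1) E(3) by simp
    then show ?case using step by (simp add: inner_add_right inner_diff_left)
  qed simp
qed

lemma orthonormal_basis:
  fixes E :: "'a::euclidean_space set"
  assumes "subspace E"
  obtains C where "finite C" "card C = dim E" "span C = E" "\<And>b c. b \<in> C \<Longrightarrow> c \<in> C \<Longrightarrow> b \<bullet> c = (if b = c then 1 else 0)"
proof -
  obtain C where C: "C \<subseteq> E" "pairwise orthogonal C" "\<And>x. x \<in> C \<Longrightarrow> norm x = 1" "independent C" "card C = dim E" "span C = E"
    using orthonormal_basis_subspace[OF assms] by metis
  have "b \<bullet> c = (if b = c then 1 else 0)" if "b \<in> C" "c \<in> C" for b c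
  proof (cases "b = c")
    case True
    then show ?thesis using C(3)[OF that(1)] by (simp add: norm_eq_1)
  next
    case False
    then show ?thesis using C(2) that by (auto simp: pairwise_def orthogonal_def)
  qed
  moreover have "finite C" using C(4) by (rule independent_imp_finite)
  ultimately show ?thesis using that C by blast
qed

lemma proj_inner_orthonormal:
  assumes E: "subspace E" "span C = E" "finite C" and on: "\<And>b c. b \<in> C \<Longrightarrow> c \<in> C \<Longrightarrow> b \<bullet> c = (if b = c then 1 else 0)"
  shows "proj E x \<bullet> proj E x = (\<Sum>b\<in>C. (x \<bullet> b)^2)"
proof -
  have p: "proj E x = (\<Sum>b\<in>C. (x \<bullet> b) *\<^sub>R b)" by (rule proj_orthonormal[OF E on])
  have "(x - proj E x) \<bullet> proj E x = 0" by (rule proj_props(2)[OF E(1) proj_props(1)[OF E(1)]])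
  then have "proj E x \<bullet> proj E x = x \<bullet> proj E x" by (simp add: inner_diff_left)
  also have "\<dots> = (\<Sum>b\<in>C. (x \<bullet> b)^2)" unfolding p inner_sum_right by (simp add: power2_eq_square)
  finally show ?thesis .
qed

text \<open>In an orthonormal basis of E the second sum has d diagonal terms 36 and d(d - 1) mixed
  terms 12, where d is the dimension.\<close>

lemma sum_roots_proj:
  assumes E: "subspace E"
  shows "(\<Sum>r\<in>E8_roots. proj E r \<bullet> proj E r) = 60 * real (dim E)"
    and "(\<Sum>r\<in>E8_roots. (proj E r \<bullet> proj E r)^2) = 12 * real (dim E) * (real (dim E) + 2)"
proof -
  obtain C where C: "finite C" "card C = dim E" "span C = E"
    and on: "\<And>b c. b \<in> C \<Longrightarrow> c \<in> C \<Longrightarrow> b \<bullet> c = (if b = c then 1 else 0)"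
    using orthonormal_basis[OF E] by metis
  have z: "proj E r \<bullet> proj E r = (\<Sum>b\<in>C. (r \<bullet> b)^2)" for r
    by (rule proj_inner_orthonormal[OF E C(3,1) on])
  have "(\<Sum>r\<in>E8_roots. proj E r \<bullet> proj E r) = (\<Sum>b\<in>C. \<Sum>r\<in>E8_roots. (r \<bullet> b)^2)"
    unfolding z by (rule sum.swap)
  also have "\<dots> = (\<Sum>b\<in>C. 60)" by (intro sum.cong refl) (simp add: roots_design2 on)
  finally show "(\<Sum>r\<in>E8_roots. proj E r \<bullet> proj E r) = 60 * real (dim E)" by (simp add: C(2))
  have "(\<Sum>r\<in>E8_roots. (proj E r \<bullet> proj E r)^2) = (\<Sum>r\<in>E8_roots. \<Sum>b\<in>C. \<Sum>c\<in>C. (r \<bullet> b)^2 * (r \<bullet> c)^2)"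
    unfolding z by (simp add: power2_eq_square[of "sum _ _"] sum_product)
  also have "\<dots> = (\<Sum>b\<in>C. \<Sum>r\<in>E8_roots. \<Sum>c\<in>C. (r \<bullet> b)^2 * (r \<bullet> c)^2)" by (rule sum.swap)
  also have "\<dots> = (\<Sum>b\<in>C. \<Sum>c\<in>C. \<Sum>r\<in>E8_roots. (r \<bullet> b)^2 * (r \<bullet> c)^2)"
    by (rule sum.cong[OF refl]) (rule sum.swap)
  also have "\<dots> = (\<Sum>b\<in>C. \<Sum>c\<in>C. 12 + (if b = c then 24 else 0))"
  proof (intro sum.cong refl)
    fix b c assume bc: "b \<in> C" "c \<in> C"
    show "(\<Sum>r\<in>E8_roots. (r \<bullet> b)^2 * (r \<bullet> c)^2) = 12 + (if b = c then 24 else 0)"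
    proof (cases "b = c")
      case True
      have "(\<Sum>r\<in>E8_roots. (r \<bullet> b)^2 * (r \<bullet> c)^2) = (\<Sum>r\<in>E8_roots. (r \<bullet> b)^4)"
        by (intro sum.cong refl) (simp add: True power4_eq_xxxx power2_eq_square)
      then show ?thesis using on[OF bc(1,1)] True by (simp add: roots_design4)
    next
      case False
      then show ?thesis using roots_design22[of b c] on bc by simp
    qed
  qed
  also have "\<dots> = (\<Sum>b\<in>C. 12 * real (dim E) + 24)"
    by (intro sum.cong refl) (simp add: sum.distrib C)
  also have "\<dots> = 12 * real (dim E) * (real (dim E) + 2)" by (simp add: C(2) algebra_simps)
  finally show "(\<Sum>r\<in>E8_roots. (proj E r \<bullet> proj E r)^2) = 12 * real (dim E) * (real (dim E) + 2)" .
qed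

text \<open>Cauchy-Schwarz between the two moments of the projected norms bounds the number of
  nonzero projections below by 300 d / (d + 2), which is at least 150 once d >= 2.\<close>

lemma card_roots_nonorthogonal:
  assumes E: "subspace E" "dim E \<ge> 2"
  shows "card {r \<in> E8_roots. proj E r \<noteq> 0} \<ge> 150"
proof -
  let ?d = "real (dim E)" and ?z = "\<lambda>r. proj E r \<bullet> proj E r" and ?i = "\<lambda>r. if proj E r \<noteq> 0 then 1 else (0::real)"
  let ?n = "real (card {r \<in> E8_roots. proj E r \<noteq> 0})"
  have "(\<Sum>r\<in>E8_roots. ?z r) = (\<Sum>r\<in>E8_roots. ?i r * ?z r)" by (intro sum.cong) auto
  then have "(60 * ?d)^2 = (\<Sum>r\<in>E8_roots. ?i r * ?z r)^2" using sum_roots_proj(1)[OF E(1)] by simp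
  also have "\<dots> \<le> (\<Sum>r\<in>E8_roots. (?i r)^2) * (\<Sum>r\<in>E8_roots. (?z r)^2)" by (rule Cauchy_Schwarz_ineq_sum)
  also have "(\<Sum>r\<in>E8_roots. (?i r)^2) = (\<Sum>r\<in>E8_roots. ?i r)" by (intro sum.cong) auto
  also have "\<dots> = ?n" using finite_E8_roots by (simp add: sum.If_cases Int_def)
  finally have le: "(60 * ?d)^2 \<le> ?n * (12 * ?d * (?d + 2))" using sum_roots_proj(2)[OF E(1)] by simp
  have d: "?d \<ge> 2" using E(2) by simp
  have "12 * ?d * (300 * ?d) \<le> 12 * ?d * (?n * (?d + 2))" using le by (simp add: power2_eq_square algebra_simps)
  then have "300 * ?d \<le> ?n * (?d + 2)" by (rule mult_left_le_imp_le) (use d in simp)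
  also have "\<dots> \<le> ?n * (2 * ?d)" using d by (intro mult_left_mono) auto
  finally have "(2 * ?d) * 150 \<le> (2 * ?d) * ?n" by simp
  then have "150 \<le> ?n" by (rule mult_left_le_imp_le) (use d in simp)
  then show ?thesis by simp
qed

text \<open>A maximiser x of the quadratic form on the unit sphere of Y is an eigenvector: moving
  from x in the direction of the defect D would raise the Rayleigh quotient to first order.\<close>

lemma selfadjoint_eigenvector:
  fixes T :: "'a::euclidean_space \<Rightarrow> 'a"
  assumes Y: "subspace Y" "Y \<noteq> {0}" and T: "linear T" "\<And>x. x \<in> Y \<Longrightarrow> T x \<in> Y"
    and sym: "\<And>x y. x \<in> Y \<Longrightarrow> y \<in> Y \<Longrightarrow> T x \<bullet> y = x \<bullet> T y"
  shows "\<exists>x\<in>Y. \<exists>\<mu>. x \<noteq> 0 \<and> T x = \<mu> *\<^sub>R x"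
proof -
  have "compact (sphere 0 1 \<inter> Y)" using closed_subspace[OF Y(1)] by (intro compact_Int_closed) auto
  moreover obtain y where y: "y \<in> Y" "y \<noteq> 0" using Y subspace_0[OF Y(1)] by blast
  then have "y /\<^sub>R norm y \<in> sphere 0 1 \<inter> Y" using subspace_scale[OF Y(1) y(1)] by simp
  then have "sphere 0 1 \<inter> Y \<noteq> {}" by blast
  moreover have "continuous_on (sphere 0 1 \<inter> Y) (\<lambda>x. T x \<bullet> x)"
    by (intro continuous_intros linear_continuous_on linear_conv_bounded_linear[THEN iffD1] T(1))
  ultimately obtain x where x: "x \<in> sphere 0 1 \<inter> Y" and sup: "\<And>y. y \<in> sphere 0 1 \<inter> Y \<Longrightarrow> T y \<bullet> y \<le> T x \<bullet> x"
    using continuous_attains_sup[of "sphere 0 1 \<inter> Y" "\<lambda>x. T x \<bullet> x"] by blast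
  have xY: "x \<in> Y" and xx: "x \<bullet> x = 1" using x by (auto simp: norm_eq_1)
  define \<mu> where "\<mu> = T x \<bullet> x"
  have bound: "T y \<bullet> y \<le> \<mu> * (y \<bullet> y)" if yY: "y \<in> Y" for y
  proof (cases "y = 0")
    case True
    then show ?thesis by simp
  next
    case False
    have "y /\<^sub>R norm y \<in> sphere 0 1 \<inter> Y" using False subspace_scale[OF Y(1) yY] by simp
    from sup[OF this] have "T (y /\<^sub>R norm y) \<bullet> (y /\<^sub>R norm y) \<le> \<mu>" by (simp add: \<mu>_def)
    then have "(T y \<bullet> y) / (norm y * norm y) \<le> \<mu>" by (simp add: linear_cmul[OF T(1)] divide_inverse algebra_simps)
    then show ?thesis using False by (simp add: divide_le_eq power2_norm_eq_inner flip: power2_eq_square)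
  qed
  define D where "D = T x - \<mu> *\<^sub>R x"
  have DY: "D \<in> Y" unfolding D_def by (intro subspace_diff[OF Y(1)] subspace_scale[OF Y(1)] T(2) xY)
  define k where "k = \<mu> * (D \<bullet> D) - T D \<bullet> D"
  have main: "2 * t * (D \<bullet> D) \<le> t^2 * k" for t
  proof -
    have tY: "x + t *\<^sub>R D \<in> Y" by (intro subspace_add[OF Y(1)] subspace_scale[OF Y(1)] DY xY)
    have e1: "T (x + t *\<^sub>R D) \<bullet> (x + t *\<^sub>R D) = \<mu> + 2 * t * (T x \<bullet> D) + t^2 * (T D \<bullet> D)"
      using sym[OF DY xY]
      by (simp add: linear_add[OF T(1)] linear_cmul[OF T(1)] inner_add_left inner_add_right \<mu>_def power2_eq_square inner_commute algebra_simps)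
    have e2: "(x + t *\<^sub>R D) \<bullet> (x + t *\<^sub>R D) = 1 + 2 * t * (x \<bullet> D) + t^2 * (D \<bullet> D)"
      using xx by (simp add: inner_add_left inner_add_right power2_eq_square inner_commute algebra_simps)
    have e3: "D \<bullet> D = T x \<bullet> D - \<mu> * (x \<bullet> D)" by (subst (1) D_def) (simp add: inner_diff_left)
    have "\<mu> + 2 * t * (T x \<bullet> D) + t^2 * (T D \<bullet> D) \<le> \<mu> * (1 + 2 * t * (x \<bullet> D) + t^2 * (D \<bullet> D))"
      using bound[OF tY] unfolding e1 e2 .
    then have "2 * t * (T x \<bullet> D - \<mu> * (x \<bullet> D)) \<le> t^2 * k" unfolding k_def by (simp add: algebra_simps)
    then show ?thesis unfolding e3[symmetric] .
  qed
  have "D = 0"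
  proof (rule ccontr)
    assume "D \<noteq> 0"
    then have d: "D \<bullet> D > 0" by simp
    \<comment> \<open>A step short enough for the quadratic term t^2 k to stay below the linear
      gain.\<close>
    define t where "t = (D \<bullet> D) / (\<bar>k\<bar> + 1)"
    have t: "t > 0" using d by (simp add: t_def)
    have "t * (2 * (D \<bullet> D)) \<le> t * (t * k)" using main[of t] by (simp add: power2_eq_square mult_ac)
    then have "2 * (D \<bullet> D) \<le> t * k" using t by (rule mult_left_le_imp_le)
    also have "\<dots> \<le> t * (\<bar>k\<bar> + 1)" using t by (intro mult_left_mono) auto
    also have "\<dots> = D \<bullet> D" by (simp add: t_def)
    finally show False using d by simp
  qed
  then have "T x = \<mu> *\<^sub>R x" by (simp add: D_def)
  then show ?thesis using xY xx by (intro bexI[of _ x] exI[of _ \<mu>]) auto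
qed

lemma line_isometry:
  fixes V :: "'a::euclidean_space set"
  assumes "subspace V" "dim V = 1" "linear a" "\<And>x y. a x \<bullet> a y = x \<bullet> y" "\<And>x. x \<in> V \<Longrightarrow> a x \<in> V" "x \<in> V"
  shows "a x = x \<or> a x = - x"
proof (cases "x = 0")
  case True
  then show ?thesis using linear_0[OF assms(3)] by simp
next
  case False
  have "dim (span {x}) = dim V" using False assms(2) dim_eq_card_independent[of "{x}"] by simp
  then have "span {x} = V"
    using span_minimal[of "{x}" V] assms(1,6) subspace_dim_equal[OF subspace_span assms(1), of "{x}"] by simp
  then have "a x \<in> span {x}" using assms(5,6) by simp
  then obtain c where c: "a x = c *\<^sub>R x" by (auto simp: span_singleton)
  have "c * c * (x \<bullet> x) = x \<bullet> x" using assms(4)[of x x] by (simp add: c)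
  then have "c * c = 1" using False by simp
  then have "c = 1 \<or> c = -1" by (simp add: square_eq_1_iff)
  then show ?thesis using c by auto
qed

lemma dim_orthogonal_part:
  fixes W :: "'a::euclidean_space set"
  assumes "subspace E" "subspace W" "E \<subseteq> W"
  shows "dim {y \<in> W. \<forall>x\<in>E. y \<bullet> x = 0} + dim E = dim W"
  using dim_subspace_orthogonal_to_vectors[OF assms] by (simp add: orthogonal_def inner_commute)

lemma odd_power_minus:
  assumes "linear b" "b x = - x" "odd n" shows "(b ^^ n) x = - x"
proof -
  have "(b ^^ m) x = (-1) ^ m *\<^sub>R x" for m
  proof (induction m)
    case (Suc m)
    then show ?case using assms(2) by (simp add: linear_cmul[OF assms(1)])
  qed simp
  then show ?thesis using assms(3) by simp
qed

section \<open>Invariant and irreducible subspaces of an Abelian group of isometries\<close>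

context abelian_isometries
begin

definition inv_sub :: "(real^8) set \<Rightarrow> bool" where "inv_sub V \<longleftrightarrow> subspace V \<and> inv_set V"

lemma inv_subD: "inv_sub V \<Longrightarrow> subspace V" "inv_sub V \<Longrightarrow> a \<in> A \<Longrightarrow> x \<in> V \<Longrightarrow> a x \<in> V"
  by (auto simp: inv_sub_def inv_set_def)

lemma inv_sub_orthogonal: "inv_sub W \<Longrightarrow> inv_sub E \<Longrightarrow> inv_sub {y \<in> W. \<forall>x\<in>E. y \<bullet> x = 0}"
proof -
  assume W: "inv_sub W" and E: "inv_sub E"
  have "subspace {y \<in> W. \<forall>x\<in>E. y \<bullet> x = 0}"
    using inv_subD(1)[OF W] by (auto simp: subspace_def inner_add_left)
  moreover have "a y \<bullet> x = 0" if a: "a \<in> A" and y: "\<forall>x\<in>E. y \<bullet> x = 0" and x: "x \<in> E" for a x y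
  proof -
    obtain b where b: "b \<in> A" "\<And>x. a (b x) = x" using inv_app[OF a] by metis
    have "a y \<bullet> x = y \<bullet> b x" using isometry_A[OF a, of y "b x"] b(2) by simp
    also have "\<dots> = 0" using y inv_subD(2)[OF E b(1) x] by blast
    finally show ?thesis .
  qed
  ultimately show ?thesis using inv_subD(2)[OF W] by (auto simp: inv_sub_def inv_set_def)
qed

lemma inv_sub_UNIV: "inv_sub UNIV"
  by (simp add: inv_sub_def inv_set_def)

lemma inv_sub_fixed: "C \<subseteq> A \<Longrightarrow> inv_sub {y. \<forall>c\<in>C. c y = y}"
proof -
  assume C: "C \<subseteq> A"
  have "subspace {y. \<forall>c\<in>C. c y = y}"
    using C linear_A by (auto simp: subspace_def linear_0 linear_add linear_cmul subset_iff)
  moreover have "c (a y) = a y" if "c \<in> C" "a \<in> A" "c y = y" for c a y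
    using comm_app[of c a y] that C by auto
  ultimately show ?thesis by (auto simp: inv_sub_def inv_set_def)
qed

lemma inv_sub_Int: "inv_sub V \<Longrightarrow> inv_sub W \<Longrightarrow> inv_sub (V \<inter> W)"
  by (auto simp: inv_sub_def inv_set_def subspace_inter)

lemma proj_comm: "inv_sub E \<Longrightarrow> a \<in> A \<Longrightarrow> proj E (a x) = a (proj E x)"
proof -
  assume E: "inv_sub E" and a: "a \<in> A"
  show ?thesis
  proof (rule proj_unique[OF inv_subD(1)[OF E]])
    show "a (proj E x) \<in> E" by (intro inv_subD(2)[OF E a] proj_props(1) inv_subD(1)[OF E])
    fix w assume w: "w \<in> E"
    obtain b where b: "b \<in> A" "\<And>x. a (b x) = x" using inv_app[OF a] by metis
    have "(a x - a (proj E x)) \<bullet> w = a (x - proj E x) \<bullet> a (b w)" by (simp add: b linear_diff[OF linear_A[OF a]])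
    also have "\<dots> = (x - proj E x) \<bullet> b w" by (rule isometry_A[OF a])
    also have "\<dots> = 0" by (rule proj_props(2)[OF inv_subD(1)[OF E] inv_subD(2)[OF E b(1) w]])
    finally show "(a x - a (proj E x)) \<bullet> w = 0" .
  qed
qed

definition irred :: "(real^8) set \<Rightarrow> bool" where
  "irred E \<longleftrightarrow> inv_sub E \<and> E \<noteq> {0} \<and> (\<forall>V. inv_sub V \<longrightarrow> V \<subseteq> E \<longrightarrow> V \<noteq> {0} \<longrightarrow> V = E)"

text \<open>By commutativity the fixed space of a is invariant under all of A, so it meets an
  irreducible E in 0 or in all of E.\<close>

lemma irred_fixed:
  assumes E: "irred E" and a: "a \<in> A" and x: "x \<in> E" "x \<noteq> 0" "a x = x" and y: "y \<in> E"
  shows "a y = y"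
proof -
  have "inv_sub ({y. \<forall>c\<in>{a}. c y = y} \<inter> E)" using E a by (intro inv_sub_Int inv_sub_fixed) (auto simp: irred_def)
  moreover have "{y. \<forall>c\<in>{a}. c y = y} \<inter> E \<noteq> {0}" using x by auto
  ultimately have "{y. \<forall>c\<in>{a}. c y = y} \<inter> E = E" using E unfolding irred_def by blast
  then show ?thesis using y by blast
qed

lemma ex_irred:
  assumes V: "inv_sub V" "V \<noteq> {0}" shows "\<exists>E. irred E \<and> E \<subseteq> V"
proof -
  have "\<exists>E. (inv_sub E \<and> E \<noteq> {0} \<and> E \<subseteq> V) \<and> (\<forall>F. inv_sub F \<and> F \<noteq> {0} \<and> F \<subseteq> V \<longrightarrow> dim E \<le> dim F)"
    using V by (intro ex_has_least_nat[of _ V]) auto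
  then obtain E where E: "inv_sub E" "E \<noteq> {0}" "E \<subseteq> V" and least: "\<And>F. inv_sub F \<Longrightarrow> F \<noteq> {0} \<Longrightarrow> F \<subseteq> V \<Longrightarrow> dim E \<le> dim F"
    by blast
  have "F = E" if F: "inv_sub F" "F \<subseteq> E" "F \<noteq> {0}" for F
    using least[of F] F E(3) subspace_dim_equal[OF inv_subD(1)[OF F(1)] inv_subD(1)[OF E(1)] F(2)] by blast
  then show ?thesis using E unfolding irred_def by blast
qed

text \<open>The sum of a and its inverse is self-adjoint and commutes with A, so one of its
  eigenspaces in E is invariant and hence is E. On E this reads a^2 = \<mu> a - 1, a real substitute
  for complex eigenvalues.\<close>

lemma irred_scalar:
  assumes E: "irred E" and a: "a \<in> A" and b: "b \<in> A" "\<And>x. a (b x) = x" "\<And>x. b (a x) = x"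
  shows "\<exists>\<mu>. \<forall>x\<in>E. a x + b x = \<mu> *\<^sub>R x"
proof -
  have Es: "inv_sub E" "E \<noteq> {0}" using E by (auto simp: irred_def)
  let ?T = "\<lambda>x. a x + b x"
  have lT: "linear ?T" by (intro linear_compose_add linear_A a b)
  have "\<exists>x\<in>E. \<exists>\<mu>. x \<noteq> 0 \<and> ?T x = \<mu> *\<^sub>R x"
  proof (rule selfadjoint_eigenvector[OF inv_subD(1)[OF Es(1)] Es(2) lT])
    show "?T x \<in> E" if "x \<in> E" for x
      by (rule subspace_add[OF inv_subD(1)[OF Es(1)] inv_subD(2)[OF Es(1) a that] inv_subD(2)[OF Es(1) b(1) that]])
    have "a x \<bullet> y = x \<bullet> b y" "b x \<bullet> y = x \<bullet> a y" for x y
      using isometry_A[OF a, of x "b y"] isometry_A[OF b(1), of x "a y"] b by simp_all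
    then show "?T x \<bullet> y = x \<bullet> ?T y" for x y by (simp add: inner_add_left inner_add_right)
  qed
  then obtain x \<mu> where x: "x \<in> E" "x \<noteq> 0" "?T x = \<mu> *\<^sub>R x" by blast
  have "inv_sub {y \<in> E. ?T y = \<mu> *\<^sub>R y}"
    unfolding inv_sub_def
  proof
    show "subspace {y \<in> E. ?T y = \<mu> *\<^sub>R y}"
      using inv_subD(1)[OF Es(1)] linear_0[OF lT] linear_add[OF lT] linear_cmul[OF lT]
      by (auto simp: subspace_def scaleR_add_right) (simp add: mult.commute flip: scaleR_add_right)
    show "inv_set {y \<in> E. ?T y = \<mu> *\<^sub>R y}"
      unfolding inv_set_def
    proof (intro ballI CollectI conjI)
      fix c y assume c: "c \<in> A" and y: "y \<in> {y \<in> E. ?T y = \<mu> *\<^sub>R y}"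
      show "c y \<in> E" using inv_subD(2)[OF Es(1) c] y by blast
      have "?T (c y) = c (a y) + c (b y)" by (simp add: comm_app[OF a c] comm_app[OF b(1) c])
      also have "\<dots> = c (?T y)" by (simp add: linear_add[OF linear_A[OF c]])
      also have "\<dots> = \<mu> *\<^sub>R c y" using y by (simp add: linear_cmul[OF linear_A[OF c]])
      finally show "?T (c y) = \<mu> *\<^sub>R c y" .
    qed
  qed
  moreover have "{y \<in> E. ?T y = \<mu> *\<^sub>R y} \<noteq> {0}" using x by auto
  ultimately have "{y \<in> E. ?T y = \<mu> *\<^sub>R y} = E" using E unfolding irred_def by blast
  then show ?thesis by blast
qed

end

section \<open>Fibre counts, hexagonal planes and minimal vectors\<close>

lemma card_le_fibres:
  assumes "finite A" "finite (f ` A)" "\<And>a. a \<in> A \<Longrightarrow> card {b \<in> A. f b = f a} \<le> n"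
  shows "card A \<le> card (f ` A) * n"
proof -
  have "A = (\<Union>y\<in>f ` A. {b \<in> A. f b = y})" by blast
  then have "card A \<le> (\<Sum>y\<in>f ` A. card {b \<in> A. f b = y})"
    using card_UN_le[OF assms(2), of "\<lambda>y. {b \<in> A. f b = y}"] by simp
  also have "\<dots> \<le> (\<Sum>y\<in>f ` A. n)" using assms(3) by (intro sum_mono) auto
  finally show ?thesis by simp
qed

text \<open>The coefficients come from inverting the Gram matrix with diagonal 2m and off-diagonal
  entry -m, whose determinant is 3 m^2.\<close>

lemma proj_hexagonal:
  fixes Y :: "'a::euclidean_space set"
  assumes Y: "subspace Y" "w \<in> Y" "v \<in> Y" "dim Y = 2" and m: "m > 0" and w: "w \<bullet> w = 2 * m" "v \<bullet> v = 2 * m" "v \<bullet> w = - m"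
  shows "proj Y r = ((2 * (r \<bullet> w) + r \<bullet> v) / (3 * m)) *\<^sub>R w + ((r \<bullet> w + 2 * (r \<bullet> v)) / (3 * m)) *\<^sub>R v"
proof (rule proj_unique[OF Y(1)])
  let ?p = "((2 * (r \<bullet> w) + r \<bullet> v) / (3 * m)) *\<^sub>R w + ((r \<bullet> w + 2 * (r \<bullet> v)) / (3 * m)) *\<^sub>R v"
  show "?p \<in> Y" by (intro subspace_add[OF Y(1)] subspace_scale[OF Y(1)] Y)
  have vw: "w \<bullet> v = - m" using w(3) by (simp add: inner_commute)
  have ow: "(r - ?p) \<bullet> w = 0" "(r - ?p) \<bullet> v = 0"
    using m by (simp_all add: inner_diff_left inner_add_left w vw field_simps)
  have ind: "independent {w, v}"
  proof -
    have "w \<noteq> c *\<^sub>R v" for c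
    proof
      assume a: "w = c *\<^sub>R v"
      have "w \<bullet> v = c * (v \<bullet> v)" using arg_cong[OF a, of "\<lambda>z. z \<bullet> v"] by simp
      then have "m * (2 * c + 1) = 0" using vw w(2) by (simp add: algebra_simps)
      then have c: "c = -1/2" using m by simp
      have "w \<bullet> w = c * (v \<bullet> w)" using arg_cong[OF a, of "\<lambda>z. z \<bullet> w"] by simp
      then show False using w c m by simp
    qed
    then have "w \<notin> span {v}" by (auto simp: span_singleton)
    moreover have "v \<noteq> 0" using w(2) m by auto
    ultimately show ?thesis by (simp add: independent_insert)
  qed
  have wv: "w \<noteq> v" using w(2,3) m by auto
  have "span {w, v} = Y"
  proof (rule subspace_dim_equal[OF subspace_span Y(1)])
    show "span {w, v} \<subseteq> Y" using Y by (intro span_minimal) auto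
    show "dim Y \<le> dim (span {w, v})" using ind wv Y(4) dim_eq_card_independent[OF ind] by simp
  qed
  then have "z \<in> span {w, v}" if "z \<in> Y" for z using that by simp
  then show "(r - ?p) \<bullet> z = 0" if "z \<in> Y" for z
    using orthogonal_to_span[of z "{w, v}" "r - ?p"] that ow by (auto simp: orthogonal_def)
qed

text \<open>Here w and v span an A2, and the roots orthogonal to it form an E6 with 72 roots. Only a
  count is made: projected norms are 0, 2/3 or 2, occurring n0, n1, n3 times, and the total 120
  gives n1 = 180 - 3 n3, so n0 = 60 + 2 n3 with n3 <= 6.\<close>

lemma hexagonal_roots:
  assumes Y: "subspace Y" "w \<in> Y" "v \<in> Y" "dim Y = 2" and w: "w \<bullet> w = 2" "v \<bullet> v = 2" "v \<bullet> w = -1"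
    "w \<in> E8_lattice" "v \<in> E8_lattice"
  shows "card {r \<in> E8_roots. proj Y r = 0} \<le> 72"
proof -
  define t where "t r = (r \<bullet> w)^2 + (r \<bullet> w) * (r \<bullet> v) + (r \<bullet> v)^2" for r :: "real^8"
  have pr: "proj Y r = ((2 * (r \<bullet> w) + r \<bullet> v) / 3) *\<^sub>R w + ((r \<bullet> w + 2 * (r \<bullet> v)) / 3) *\<^sub>R v" for r
    using proj_hexagonal[OF Y, of 1 r] w by simp
  have vw: "w \<bullet> v = -1" using w(3) by (simp add: inner_commute)
  have z: "proj Y r \<bullet> proj Y r = 2 / 3 * t r" for r
    unfolding pr t_def by (simp add: inner_add_left inner_add_right w vw power2_eq_square field_simps)
  have int: "\<exists>a b::int. r \<bullet> w = of_int a \<and> r \<bullet> v = of_int b" if "r \<in> E8_lattice" for r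
    using E8_lattice_inner[OF that w(4)] E8_lattice_inner[OF that w(5)] by (metis Ints_cases)
  have le2: "proj Y r \<bullet> proj Y r \<le> r \<bullet> r" for r
  proof -
    have o: "(r - proj Y r) \<bullet> proj Y r = 0" by (rule proj_props(2)[OF Y(1) proj_props(1)[OF Y(1)]])
    have "r \<bullet> r = (r - proj Y r) \<bullet> (r - proj Y r) + 2 * ((r - proj Y r) \<bullet> proj Y r) + proj Y r \<bullet> proj Y r"
      by (simp add: inner_diff_left inner_diff_right inner_commute)
    then show ?thesis using o inner_ge_zero[of "r - proj Y r"] by linarith
  qed
  have rl: "r \<in> E8_lattice" "r \<bullet> r = 2" if "r \<in> E8_roots" for r using that by (auto simp: E8_roots_eq)
  have tvals: "t r = 0 \<or> t r = 1 \<or> t r = 3" if r: "r \<in> E8_roots" for r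
  proof -
    obtain a b :: int where ab: "r \<bullet> w = of_int a" "r \<bullet> v = of_int b" using int[OF rl(1)[OF r]] by blast
    have tr: "t r = of_int (a^2 + a * b + b^2)" by (simp add: t_def ab)
    have "2 / 3 * t r \<le> 2" using le2[of r] z[of r] rl(2)[OF r] by simp
    then have "real_of_int (a^2 + a * b + b^2) \<le> 3" using tr by simp
    then have le3: "a^2 + a * b + b^2 \<le> 3" by linarith
    have ge: "0 \<le> a^2 + a * b + b^2"
    proof -
      have "4 * (a^2 + a * b + b^2) = (2 * a + b)^2 + 3 * b^2" by (simp add: power2_eq_square algebra_simps)
      moreover have "(2 * a + b)^2 + 3 * b^2 \<ge> 0" by simp
      ultimately have "0 \<le> 4 * (a^2 + a * b + b^2)" by (simp only:)
      then show ?thesis by (simp only: zero_le_mult_iff) simp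
    qed
    \<comment> \<open>The form is even only when a and b are both even, and then it is divisible by
      4.\<close>
    have "a^2 + a * b + b^2 \<noteq> 2"
    proof
      assume e: "a^2 + a * b + b^2 = 2"
      then have "even (a^2 + a * b + b^2)" by simp
      then have "even a \<and> even b" by auto
      then obtain c d where "a = 2 * c" "b = 2 * d" by (auto elim!: evenE)
      then have "4 * (c^2 + c * d + d^2) = 2" using e by (simp add: power2_eq_square)
      then show False by presburger
    qed
    then have "a^2 + a * b + b^2 = 0 \<or> a^2 + a * b + b^2 = 1 \<or> a^2 + a * b + b^2 = 3" using le3 ge by linarith
    then show ?thesis unfolding tr by (elim disjE; simp only: of_int_0 of_int_1 of_int_numeral; simp)
  qed
  \<comment> \<open>Candidates for the pairs of inner products of a root in the plane with w and v;
    there are six, as in A2.\<close>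
  define P where "P = {(a::int, b::int). a \<in> {-2..2} \<and> b \<in> {-2..2} \<and> a * a + a * b + b * b = 3}"
  have "P = set (filter (\<lambda>(a, b). a * a + a * b + b * b = 3) (List.product [-2..2] [-2..2]))"
    unfolding P_def set_filter set_product set_upto by auto
  moreover have "card (set (filter (\<lambda>(a::int, b). a * a + a * b + b * b = 3) (List.product [-2..2] [-2..2]))) = 6"
    by code_simp
  ultimately have cP: "card P = 6" by simp
  then have finP: "finite P" by (simp add: card_ge_0_finite)
  define R3 where "R3 = {r \<in> E8_roots. t r = 3}"
  have inY: "r = proj Y r" if "r \<in> R3" for r
  proof -
    have "r \<in> E8_roots" "t r = 3" using that by (auto simp: R3_def)
    then have "proj Y r \<bullet> proj Y r = 2" "r \<bullet> r = 2" using z[of r] rl by auto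
    moreover have "(r - proj Y r) \<bullet> proj Y r = 0" by (rule proj_props(2)[OF Y(1) proj_props(1)[OF Y(1)]])
    ultimately have "(r - proj Y r) \<bullet> (r - proj Y r) = 0"
      by (simp add: inner_diff_left inner_diff_right inner_commute)
    then have "r - proj Y r = 0" by (simp only: inner_eq_zero_iff)
    then show ?thesis by simp
  qed
  have "card R3 \<le> card P"
  proof (rule card_inj_on_le[OF _ _ finP, of "\<lambda>r. (\<lfloor>r \<bullet> w\<rfloor>, \<lfloor>r \<bullet> v\<rfloor>)"])
    show "inj_on (\<lambda>r. (\<lfloor>r \<bullet> w\<rfloor>, \<lfloor>r \<bullet> v\<rfloor>)) R3"
    proof (rule inj_onI)
      fix r s assume rs: "r \<in> R3" "s \<in> R3" "(\<lfloor>r \<bullet> w\<rfloor>, \<lfloor>r \<bullet> v\<rfloor>) = (\<lfloor>s \<bullet> w\<rfloor>, \<lfloor>s \<bullet> v\<rfloor>)"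
      have "r \<in> E8_lattice" "s \<in> E8_lattice" using rs rl by (auto simp: R3_def)
      then obtain a b c d :: int where "r \<bullet> w = of_int a" "r \<bullet> v = of_int b" "s \<bullet> w = of_int c" "s \<bullet> v = of_int d"
        using int by blast
      then have "proj Y r = proj Y s" using rs(3) unfolding pr by simp
      then show "r = s" using inY[OF rs(1)] inY[OF rs(2)] by simp
    qed
    show "(\<lambda>r. (\<lfloor>r \<bullet> w\<rfloor>, \<lfloor>r \<bullet> v\<rfloor>)) ` R3 \<subseteq> P"
    proof (rule image_subsetI)
      fix r assume r: "r \<in> R3"
      then have rr: "r \<in> E8_roots" "t r = 3" by (auto simp: R3_def)
      obtain a b :: int where ab: "r \<bullet> w = of_int a" "r \<bullet> v = of_int b" using int[OF rl(1)[OF rr(1)]] by blast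
      have "\<bar>r \<bullet> w\<bar> \<le> 2" "\<bar>r \<bullet> v\<bar> \<le> 2"
        using Cauchy_Schwarz_ineq2[of r w] Cauchy_Schwarz_ineq2[of r v] rl(2)[OF rr(1)] w by (simp_all add: norm_eq_sqrt_inner)
      then have "\<bar>a\<bar> \<le> 2" "\<bar>b\<bar> \<le> 2" using ab by linarith+
      moreover have "real_of_int (a * a + a * b + b * b) = 3" using rr(2) by (simp add: t_def ab power2_eq_square)
      then have "a * a + a * b + b * b = 3" by linarith
      ultimately show "(\<lfloor>r \<bullet> w\<rfloor>, \<lfloor>r \<bullet> v\<rfloor>) \<in> P" by (auto simp: P_def ab)
    qed
  qed
  then have c3: "card R3 \<le> 6" using cP by simp
  define R1 where "R1 = {r \<in> E8_roots. t r = 1}"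
  define R0 where "R0 = {r \<in> E8_roots. proj Y r = 0}"
  have p0: "proj Y r = 0 \<longleftrightarrow> t r = 0" for r using z[of r] by (metis inner_eq_zero_iff mult_eq_0_iff divide_eq_0_iff zero_neq_numeral)
  have roots: "E8_roots = R0 \<union> (R1 \<union> R3)" using tvals p0 by (auto simp: R0_def R1_def R3_def)
  have fin: "finite R0" "finite R1" "finite R3" using finite_E8_roots by (auto simp: R0_def R1_def R3_def)
  have dis: "R0 \<inter> (R1 \<union> R3) = {}" "R1 \<inter> R3 = {}" using p0 by (auto simp: R0_def R1_def R3_def)
  have c: "card R0 + (card R1 + card R3) = 240"
    using card_E8_roots fin dis unfolding roots by (simp add: card_Un_disjoint)
  have "(\<Sum>r\<in>E8_roots. proj Y r \<bullet> proj Y r) = (\<Sum>r\<in>R0. 0) + ((\<Sum>r\<in>R1. 2/3) + (\<Sum>r\<in>R3. 2))"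
  proof -
    let ?z = "\<lambda>r. proj Y r \<bullet> proj Y r"
    have "sum ?z E8_roots = sum ?z R0 + (sum ?z R1 + sum ?z R3)"
      unfolding roots using fin dis by (simp add: sum.union_disjoint)
    moreover have "sum ?z R0 = (\<Sum>r\<in>R0. 0)" by (rule sum.cong) (auto simp: R0_def)
    moreover have "sum ?z R1 = (\<Sum>r\<in>R1. 2/3)" by (rule sum.cong) (auto simp: R1_def z)
    moreover have "sum ?z R3 = (\<Sum>r\<in>R3. 2)" by (rule sum.cong) (auto simp: R3_def z)
    ultimately show ?thesis by (simp only:)
  qed
  then have "120 = 2/3 * real (card R1) + 2 * real (card R3)" using sum_roots_proj(1)[OF Y(1)] Y(4) by simp
  then have "180 = real (card R1) + 3 * real (card R3)" by linarith
  then have "180 = card R1 + 3 * card R3" by linarith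
  then show ?thesis using c c3 unfolding R0_def by linarith
qed

lemma minimal_vector:
  assumes "v0 \<in> N" "v0 \<noteq> 0" "N \<subseteq> E8_lattice"
  obtains w where "w \<in> N" "w \<noteq> 0" "\<And>x. x \<in> N \<Longrightarrow> x \<noteq> 0 \<Longrightarrow> w \<bullet> w \<le> x \<bullet> x"
proof -
  define f where "f x = nat \<lfloor>x \<bullet> x\<rfloor>" for x :: "real^8"
  have fx: "x \<bullet> x = real (f x)" if x: "x \<in> N" for x
  proof -
    obtain k :: int where "x \<bullet> x = 2 * of_int k" using E8_lattice_even[of x] assms(3) x by blast
    then have k: "x \<bullet> x = of_int (2 * k)" by simp
    then have "2 * k \<ge> 0" using inner_ge_zero[of x] by linarith
    then show ?thesis unfolding f_def k by simp
  qed
  have "\<exists>w. (w \<in> N \<and> w \<noteq> 0) \<and> (\<forall>x. x \<in> N \<and> x \<noteq> 0 \<longrightarrow> f w \<le> f x)"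
    using assms by (intro ex_has_least_nat[of _ v0]) auto
  then obtain w where w: "w \<in> N" "w \<noteq> 0" "\<And>x. x \<in> N \<Longrightarrow> x \<noteq> 0 \<Longrightarrow> f w \<le> f x" by blast
  have "w \<bullet> w \<le> x \<bullet> x" if "x \<in> N" "x \<noteq> 0" for x
    using w(3)[OF that] fx[OF that(1)] fx[OF w(1)] by simp
  then show ?thesis using that w by blast
qed

text \<open>The situation left over when the sum over the odd-order elements is zero and so cannot
  serve as the operator e of the count modulo 2. What is retained is that no nonzero vector is fixed
  by all of B.\<close>

locale odd_free = abelian_isometries +
  fixes B :: "(real^8 \<Rightarrow> real^8) set"
  assumes B_sub: "B \<subseteq> A"
    and B_odd: "b \<in> B \<Longrightarrow> \<exists>n. odd n \<and> b ^^ n = id"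
    and B_free: "(\<And>b. b \<in> B \<Longrightarrow> b x = x) \<Longrightarrow> x = 0"
begin

lemma B_not_minus: "b \<in> B \<Longrightarrow> b x = - x \<Longrightarrow> x = 0"
proof -
  assume b: "b \<in> B" and x: "b x = - x"
  obtain n where n: "odd n" "b ^^ n = id" using B_odd[OF b] by blast
  have "linear b" using b B_sub linear_A by blast
  from odd_power_minus[OF this x n(1)] have "x = - x" using n(2) by simp
  then have "2 *\<^sub>R x = 0" by (simp add: scaleR_2 eq_neg_iff_add_eq_0)
  then show "x = 0" by simp
qed

text \<open>On an invariant line each element of B acts by a sign, and odd order excludes -1, so the
  line would be fixed by B.\<close>

lemma inv_sub_dim:
  assumes V: "inv_sub V" "V \<noteq> {0}" shows "dim V \<ge> 2"
proof (rule ccontr)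
  assume "\<not> dim V \<ge> 2"
  moreover have "dim V \<noteq> 0" using V(2) inv_subD(1)[OF V(1)] by (auto simp: subspace_0)
  ultimately have d: "dim V = 1" by linarith
  obtain x where x: "x \<in> V" "x \<noteq> 0" using V(2) subspace_0[OF inv_subD(1)[OF V(1)]] by blast
  have "b x = x" if b: "b \<in> B" for b
  proof -
    have bA: "b \<in> A" using b B_sub by blast
    have "b x = x \<or> b x = - x"
      by (rule line_isometry[OF inv_subD(1)[OF V(1)] d linear_A[OF bA] isometry_A[OF bA] inv_subD(2)[OF V(1) bA] x(1)])
    then show ?thesis using B_not_minus[OF b] x(2) by blast
  qed
  then show False using B_free x(2) by blast
qed

text \<open>The fixed space of the stabiliser of r: the larger it is, the smaller the space on which
  this stabiliser acts nontrivially.\<close>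

definition fix_sub :: "real^8 \<Rightarrow> (real^8) set" where
  "fix_sub r = {y. \<forall>a\<in>{a \<in> A. a r = r}. a y = y}"

lemma inv_sub_fix_sub: "inv_sub (fix_sub r)"
  unfolding fix_sub_def by (rule inv_sub_fixed) auto

lemma irred_subset_fix_sub:
  assumes E: "irred E" and r: "proj E r \<noteq> 0" shows "E \<subseteq> fix_sub r"
proof
  have Ei: "inv_sub E" using E by (simp add: irred_def)
  fix y assume y: "y \<in> E"
  have "a y = y" if a: "a \<in> A" "a r = r" for a
  proof (rule irred_fixed[OF E a(1) _ r _ y])
    show "proj E r \<in> E" by (rule proj_props(1)[OF inv_subD(1)[OF Ei]])
    show "a (proj E r) = proj E r" using proj_comm[OF Ei a(1), of r] a(2) by simp
  qed
  then show "y \<in> fix_sub r" by (simp add: fix_sub_def)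
qed

text \<open>An irreducible E has dimension at least 2, so at least 150 roots have a nonzero
  projection to E. The stabiliser of such a root fixes the projection and therefore all of E.
  Orthogonal irreducible pieces are added up by induction.\<close>

lemma sum_dim_fix_sub:
  "inv_sub V \<Longrightarrow> 150 * dim V \<le> (\<Sum>r\<in>E8_roots. dim (V \<inter> fix_sub r))"
proof (induction "dim V" arbitrary: V rule: less_induct)
  case less
  show ?case
  proof (cases "V = {0}")
    case True
    then show ?thesis by simp
  next
    case False
    obtain E where E: "irred E" "E \<subseteq> V" using ex_irred[OF less.prems False] by blast
    have Ei: "inv_sub E" "E \<noteq> {0}" using E(1) by (auto simp: irred_def)
    have subs: "subspace E" "subspace V" using inv_subD(1) Ei(1) less.prems by auto
    define V' where "V' = {y \<in> V. \<forall>x\<in>E. y \<bullet> x = 0}"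
    have V': "inv_sub V'" unfolding V'_def by (rule inv_sub_orthogonal[OF less.prems Ei(1)])
    have d: "dim V' + dim E = dim V" unfolding V'_def by (rule dim_orthogonal_part[OF subs E(2)])
    have d2: "dim E \<ge> 2" by (rule inv_sub_dim[OF Ei])
    have IH: "150 * dim V' \<le> (\<Sum>r\<in>E8_roots. dim (V' \<inter> fix_sub r))"
      using d d2 by (intro less.hyps V') simp
    have "150 * dim E \<le> card {r \<in> E8_roots. proj E r \<noteq> 0} * dim E"
      using card_roots_nonorthogonal[OF subs(1) d2] by (rule mult_le_mono1)
    also have "\<dots> = (\<Sum>r\<in>{r \<in> E8_roots. proj E r \<noteq> 0}. dim E)" by simp
    also have "\<dots> = (\<Sum>r\<in>{r \<in> E8_roots. proj E r \<noteq> 0}. dim (E \<inter> fix_sub r))"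
      by (rule sum.cong[OF refl]) (use irred_subset_fix_sub[OF E(1)] in \<open>simp add: Int_absorb2\<close>)
    also have "\<dots> \<le> (\<Sum>r\<in>E8_roots. dim (E \<inter> fix_sub r))"
      by (rule sum_mono2[OF finite_E8_roots]) auto
    finally have E150: "150 * dim E \<le> (\<Sum>r\<in>E8_roots. dim (E \<inter> fix_sub r))" .
    have "dim (E \<inter> fix_sub r) + dim (V' \<inter> fix_sub r) \<le> dim (V \<inter> fix_sub r)" for r
    proof -
      have F: "subspace (fix_sub r)" by (rule inv_subD(1)[OF inv_sub_fix_sub])
      have "dim {y \<in> V \<inter> fix_sub r. \<forall>x\<in>E \<inter> fix_sub r. y \<bullet> x = 0} + dim (E \<inter> fix_sub r) = dim (V \<inter> fix_sub r)"
        by (rule dim_orthogonal_part) (use subs F E(2) in \<open>auto intro: subspace_inter\<close>)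
      moreover have "dim (V' \<inter> fix_sub r) \<le> dim {y \<in> V \<inter> fix_sub r. \<forall>x\<in>E \<inter> fix_sub r. y \<bullet> x = 0}"
        by (rule dim_subset) (auto simp: V'_def)
      ultimately show ?thesis by simp
    qed
    then have "(\<Sum>r\<in>E8_roots. dim (E \<inter> fix_sub r) + dim (V' \<inter> fix_sub r)) \<le> (\<Sum>r\<in>E8_roots. dim (V \<inter> fix_sub r))"
      by (rule sum_mono)
    then have "150 * dim V' + 150 * dim E \<le> (\<Sum>r\<in>E8_roots. dim (V \<inter> fix_sub r))"
      using IH E150 by (simp add: sum.distrib)
    then show ?thesis using d by simp
  qed
qed

text \<open>An average: 150 * 8 = 1200 is 5 for each of the 240 roots.\<close>

lemma ex_root_large_fix_sub: "\<exists>r\<in>E8_roots. dim (fix_sub r) \<ge> 5"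
proof (rule ccontr)
  assume "\<not> ?thesis"
  then have "(\<Sum>r\<in>E8_roots. dim (UNIV \<inter> fix_sub r)) \<le> (\<Sum>r\<in>E8_roots. 4)"
    by (intro sum_mono) (auto simp: not_le)
  moreover have "150 * dim (UNIV :: (real^8) set) \<le> (\<Sum>r\<in>E8_roots. dim (UNIV \<inter> fix_sub r))"
    by (rule sum_dim_fix_sub[OF inv_sub_UNIV])
  ultimately show False by (simp add: card_E8_roots dim_UNIV)
qed

lemma root_in_lattice: "r \<in> E8_roots \<Longrightarrow> r \<in> E8_lattice"
  by (simp add: E8_roots_eq)

lemma root_image: "a \<in> A \<Longrightarrow> r \<in> E8_roots \<Longrightarrow> a r \<in> E8_roots"
  by (simp add: E8_roots_eq lattice_A isometry_A)

lemma card_A_le_orbit: "card A \<le> card ((\<lambda>a. a r) ` A) * card {a \<in> A. a r = r}"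
proof (rule card_le_fibres[OF finite_A])
  show "finite ((\<lambda>a. a r) ` A)" using finite_A by simp
  fix a assume a: "a \<in> A"
  obtain a' where a': "a' \<in> A" "\<And>x. a' (a x) = x" "\<And>x. a (a' x) = x" using inv_app[OF a] by metis
  have "inj_on (\<lambda>b x. a' (b x)) {b \<in> A. b r = a r}"
  proof (rule inj_onI)
    fix b c assume e: "(\<lambda>x. a' (b x)) = (\<lambda>x. a' (c x))"
    have "b x = c x" for x using fun_cong[OF e, of x] a'(3) by metis
    then show "b = c" by blast
  qed
  moreover have "(\<lambda>b x. a' (b x)) ` {b \<in> A. b r = a r} \<subseteq> {a \<in> A. a r = r}"
    using comp_app[OF a'(1)] a'(2) by auto
  ultimately show "card {b \<in> A. b r = a r} \<le> card {a \<in> A. a r = r}"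
    using finite_A by (intro card_inj_on_le[of "\<lambda>b x. a' (b x)"]) auto
qed

text \<open>The order is at most the size of the orbit of r times that of its stabiliser C, which
  acts only on a space Y of dimension at most 3. If C is trivial the orbit gives 240; otherwise Y
  turns out to be the plane of an A2, the orbit has at most 72 elements and C at most 3, which gives
  216.\<close>

theorem no_fixed_bound: "card A \<le> 240"
proof -
  obtain r where r: "r \<in> E8_roots" "dim (fix_sub r) \<ge> 5" using ex_root_large_fix_sub by blast
  define F where "F = fix_sub r"
  define C where "C = {a \<in> A. a r = r}"
  have F: "inv_sub F" unfolding F_def by (rule inv_sub_fix_sub)
  have cF: "c y = y" if "c \<in> C" "y \<in> F" for c y using that by (simp add: F_def fix_sub_def C_def)
  have CA: "C \<subseteq> A" by (auto simp: C_def)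
  have finC: "finite C" using CA finite_A by (rule finite_subset)
  have CI: "a \<in> C" if "a \<in> A" "\<And>y. y \<in> F \<Longrightarrow> a y = y" for a
    using that by (auto simp: C_def F_def fix_sub_def)
  define Y where "Y = {y \<in> UNIV. \<forall>x\<in>F. y \<bullet> x = 0}"
  have Y: "inv_sub Y" unfolding Y_def by (rule inv_sub_orthogonal[OF inv_sub_UNIV F])
  have sY: "subspace Y" by (rule inv_subD(1)[OF Y])
  have dY: "dim Y + dim F = 8"
    using dim_orthogonal_part[OF inv_subD(1)[OF F] subspace_UNIV] unfolding Y_def by (simp add: dim_UNIV)
  then have dY3: "dim Y \<le> 3" using r(2) by (simp add: F_def)
  have rF: "r \<in> F" by (simp add: F_def fix_sub_def)
  have orb: "(\<lambda>a. a r) ` A \<subseteq> {s \<in> E8_roots. proj Y s = 0}"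
  proof (rule image_subsetI)
    fix a assume a: "a \<in> A"
    have aF: "a r \<in> F" by (rule inv_subD(2)[OF F a rF])
    have "proj Y (a r) = 0"
      by (rule proj_orthogonal[OF sY]) (use aF in \<open>auto simp: Y_def inner_commute\<close>)
    then show "a r \<in> {s \<in> E8_roots. proj Y s = 0}" using root_image[OF a r(1)] by simp
  qed
  have orb240: "card ((\<lambda>a. a r) ` A) \<le> 240"
    unfolding card_E8_roots[symmetric] using orb finite_E8_roots by (intro card_mono) auto
  have decomp: "x - proj F x \<in> Y" for x
    using proj_props(2)[OF inv_subD(1)[OF F]] by (auto simp: Y_def)
  have eq_on: "c = d" if c: "c \<in> A" "d \<in> A" "\<And>y. y \<in> F \<Longrightarrow> c y = d y" "\<And>y. y \<in> Y \<Longrightarrow> c y = d y" for c d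
  proof
    fix x
    have "c (proj F x + (x - proj F x)) = d (proj F x + (x - proj F x))"
      unfolding linear_add[OF linear_A[OF c(1)]] linear_add[OF linear_A[OF c(2)]]
      using c(3)[OF proj_props(1)[OF inv_subD(1)[OF F]]] c(4)[OF decomp] by simp
    then show "c x = d x" by simp
  qed
  show ?thesis
  proof (cases "C \<subseteq> {id}")
    case True
    then have "card C \<le> 1" using card_mono[of "{id}" C] by simp
    then have "card ((\<lambda>a. a r) ` A) * card C \<le> 240 * 1" using orb240 by (intro mult_le_mono) auto
    then show ?thesis using card_A_le_orbit[of r] by (simp add: C_def)
  next
    case False
    then obtain c where c: "c \<in> C" "c \<noteq> id" by blast
    have cA: "c \<in> A" using c(1) CA by blast
    obtain x0 where x0: "x0 \<in> E8_lattice" "c x0 \<noteq> x0" using eq_if_eq_on_lattice[OF cA id_A] c(2) by auto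
    have diffY: "a x - x \<in> Y" if a: "a \<in> C" for a x
    proof -
      have aA: "a \<in> A" using a CA by blast
      have "(a x - x) \<bullet> y = 0" if "y \<in> F" for y
        using isometry_A[OF aA, of x y] cF[OF a that] by (simp add: inner_diff_left)
      then show ?thesis by (simp add: Y_def)
    qed
    define N where "N = E8_lattice \<inter> Y"
    have "c x0 - x0 \<in> N" using diffY[OF c(1)] lattice_A[OF cA x0(1)] x0(1) by (simp add: N_def)
    then obtain w where w: "w \<in> N" "w \<noteq> 0" and wmin: "\<And>x. x \<in> N \<Longrightarrow> x \<noteq> 0 \<Longrightarrow> w \<bullet> w \<le> x \<bullet> x"
      using minimal_vector[of "c x0 - x0" N] x0(2) by (auto simp: N_def)
    have wY: "w \<in> Y" and wL: "w \<in> E8_lattice" using w by (auto simp: N_def)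
    have Yn0: "Y \<noteq> {0}" using wY w(2) by blast
    \<comment> \<open>Nonzero invariant subspaces have dimension at least 2, so a proper splitting
      of Y would need dimension at least 4.\<close>
    have irY: "irred Y"
    proof -
      obtain E where E: "irred E" "E \<subseteq> Y" using ex_irred[OF Y Yn0] by blast
      have Ei: "inv_sub E" "E \<noteq> {0}" using E(1) by (auto simp: irred_def)
      have "inv_sub {y \<in> Y. \<forall>x\<in>E. y \<bullet> x = 0}" by (rule inv_sub_orthogonal[OF Y Ei(1)])
      moreover have d: "dim {y \<in> Y. \<forall>x\<in>E. y \<bullet> x = 0} + dim E = dim Y"
        by (rule dim_orthogonal_part[OF inv_subD(1)[OF Ei(1)] sY E(2)])
      moreover have "dim E \<ge> 2" by (rule inv_sub_dim[OF Ei])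
      ultimately have "{y \<in> Y. \<forall>x\<in>E. y \<bullet> x = 0} = {0}" using inv_sub_dim dY3 by fastforce
      then have "dim {y \<in> Y. \<forall>x\<in>E. y \<bullet> x = 0} = 0" by simp
      with d have "dim E = dim Y" by linarith
      then have "E = Y" using subspace_dim_equal[OF inv_subD(1)[OF Ei(1)] sY E(2)] by simp
      then show ?thesis using E(1) by simp
    qed
    have fixY: "a y = y" if "a \<in> A" "x \<in> Y" "x \<noteq> 0" "a x = x" "y \<in> Y" for a x y
      using irred_fixed[OF irY that] .
    obtain g where g: "g \<in> B" "g w \<noteq> w" using B_free w(2) by blast
    have gA: "g \<in> A" using g(1) B_sub by blast
    have g_free: "g y \<noteq> y" if "y \<in> Y" "y \<noteq> 0" for y using fixY[OF gA that _ wY] g(2) by blast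
    \<comment> \<open>In dimension 3 the vectors w and g w span a g-invariant plane, because g^2 w =
      \<mu> g w - w. On the orthogonal line g would be 1 or -1; neither is possible.\<close>
    have dim2: "dim Y = 2"
    proof (rule ccontr)
      assume "dim Y \<noteq> 2"
      then have d3: "dim Y = 3" using dY3 inv_sub_dim[OF Y Yn0] by simp
      obtain g' where g': "g' \<in> A" "\<And>x. g (g' x) = x" "\<And>x. g' (g x) = x" using inv_app[OF gA] by metis
      obtain \<mu> where mu: "\<And>x. x \<in> Y \<Longrightarrow> g x + g' x = \<mu> *\<^sub>R x" using irred_scalar[OF irY gA g'] by blast
      define Q where "Q = span {w, g w}"
      have gw: "g w \<in> Y" by (rule inv_subD(2)[OF Y gA wY])
      have ggw: "g (g w) = \<mu> *\<^sub>R g w - w" using mu[OF gw] g'(3) by (simp add: eq_diff_eq)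
      have Qs: "subspace Q" by (simp add: Q_def)
      have QY: "Q \<subseteq> Y" unfolding Q_def using wY gw sY by (intro span_minimal) auto
      have gQ: "g y \<in> Q" if "y \<in> Q" for y
      proof -
        have "g ` Q = span (g ` {w, g w})" unfolding Q_def by (rule linear_span_image[OF linear_A[OF gA], symmetric])
        also have "\<dots> \<subseteq> Q"
        proof (rule span_minimal[OF _ Qs])
          have "g w \<in> Q" "w \<in> Q" by (auto simp: Q_def intro: span_base)
          then show "g ` {w, g w} \<subseteq> Q" using ggw by (auto intro: subspace_diff[OF Qs] subspace_scale[OF Qs])
        qed
        finally show ?thesis using that by blast
      qed
      have no_line: False
        if V: "subspace V" "dim V = 1" "V \<subseteq> Y" "\<And>y. y \<in> V \<Longrightarrow> g y \<in> V" for V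
      proof -
        have "V \<noteq> {0}" using V(2) by auto
        then obtain y where y: "y \<in> V" "y \<noteq> 0" using subspace_0[OF V(1)] by blast
        have "g y = y \<or> g y = - y" by (rule line_isometry[OF V(1,2) linear_A[OF gA] isometry_A[OF gA] V(4) y(1)])
        then show False using g_free[of y] B_not_minus[OF g(1), of y] y V(3) by blast
      qed
      have "dim Q \<le> card {w, g w}" unfolding Q_def dim_span by (rule dim_le_card') simp
      also have "\<dots> \<le> 2" by (simp add: card_insert_if)
      finally have "dim Q \<le> 2" .
      moreover have "dim Q \<noteq> 0" using w(2) by (auto simp: Q_def)
      moreover have "dim Q \<noteq> 1" using no_line[OF Qs _ QY gQ] by blast
      ultimately have dQ: "dim Q = 2" by linarith
      define V where "V = {y \<in> Y. \<forall>x\<in>Q. y \<bullet> x = 0}"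
      have "dim V + dim Q = dim Y" unfolding V_def by (rule dim_orthogonal_part[OF Qs sY QY])
      then have dV: "dim V = 1" using dQ d3 by simp
      have sV: "subspace V" using sY by (auto simp: V_def subspace_def inner_add_left)
      have gsQ: "g ` Q = Q"
      proof (rule subspace_dim_equal)
        show "subspace (g ` Q)" by (rule linear_subspace_image[OF linear_A[OF gA] Qs])
        show "subspace Q" by (rule Qs)
        show "g ` Q \<subseteq> Q" using gQ by blast
        have "inj g" using g'(3) by (metis injI)
        then show "dim Q \<le> dim (g ` Q)" using dim_image_eq[OF linear_A[OF gA], of Q] by (simp add: inj_on_subset)
      qed
      have "g y \<in> V" if y: "y \<in> V" for y
      proof -
        have "g y \<bullet> x = 0" if x: "x \<in> Q" for x
        proof -
          obtain x' where "x' \<in> Q" "x = g x'" using gsQ x by blast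
          then show ?thesis using isometry_A[OF gA, of y x'] y by (simp add: V_def)
        qed
        then show ?thesis using y inv_subD(2)[OF Y gA] by (auto simp: V_def)
      qed
      then show False using no_line[OF sV dV] by (auto simp: V_def)
    qed
    \<comment> \<open>\<mu> is the trace of a on the plane Y. If it were not an integer, its
      distance to the nearest integer would scale the minimal vector w to a shorter nonzero vector
      of N. Cauchy-Schwarz then bounds \<mu> by 2 in absolute value, and 2 would mean a w =
      w.\<close>
    have trace: "\<exists>k::int. k \<in> {-2,-1,0,1} \<and> (\<forall>x\<in>Y. a (a x) = of_int k *\<^sub>R a x - x)"
      if a: "a \<in> A" "a w \<noteq> w" for a
    proof -
      obtain a' where a': "a' \<in> A" "\<And>x. a (a' x) = x" "\<And>x. a' (a x) = x" using inv_app[OF a(1)] by metis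
      obtain \<mu> where mu: "\<And>x. x \<in> Y \<Longrightarrow> a x + a' x = \<mu> *\<^sub>R x" using irred_scalar[OF irY a(1) a'] by blast
      have aN: "a w \<in> N" "a' w \<in> N" using inv_subD(2)[OF Y] lattice_A a(1) a'(1) wY wL by (auto simp: N_def)
      have muN: "\<mu> *\<^sub>R w \<in> N"
        unfolding mu[OF wY, symmetric] using aN by (auto simp: N_def intro: subspace_add[OF sY])
      define k where "k = round \<mu>"
      have d: "\<bar>\<mu> - of_int k\<bar> \<le> 1/2" unfolding k_def using of_int_round_abs_le[of \<mu>] by (simp add: abs_minus_commute)
      have kN: "(\<mu> - of_int k) *\<^sub>R w \<in> N"
        using muN add_closed_scale_int[OF add_closed_E8_lattice wL, of k] subspace_scale[OF sY wY]
        by (auto simp: N_def scaleR_diff_left intro: subspace_diff[OF sY])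
      have muk: "\<mu> = of_int k"
      proof (rule ccontr)
        assume "\<mu> \<noteq> of_int k"
        then have "w \<bullet> w \<le> ((\<mu> - of_int k) *\<^sub>R w) \<bullet> ((\<mu> - of_int k) *\<^sub>R w)" using kN w(2) by (intro wmin) auto
        also have "\<dots> = (\<mu> - of_int k)^2 * (w \<bullet> w)" by (simp add: power2_eq_square)
        also have "\<dots> \<le> (1/2)^2 * (w \<bullet> w)"
          using d by (intro mult_right_mono) (auto simp: abs_le_square_iff[symmetric])
        finally have "w \<bullet> w \<le> (1/4) * (w \<bullet> w)" by (simp add: power2_eq_square)
        moreover have "w \<bullet> w > 0" using w(2) by simp
        ultimately show False by linarith
      qed
      have iso: "a' w \<bullet> w = a w \<bullet> w" using isometry_A[OF a(1), of "a' w" w] a'(2) by (simp add: inner_commute)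
      have eq: "2 * (a w \<bullet> w) = \<mu> * (w \<bullet> w)" using arg_cong[OF mu[OF wY], of "\<lambda>z. z \<bullet> w"] iso by (simp add: inner_add_left)
      have le: "\<bar>a w \<bullet> w\<bar> \<le> w \<bullet> w"
        using Cauchy_Schwarz_ineq2[of "a w" w] isometry_A[OF a(1), of w w]
        by (simp add: norm_eq_sqrt_inner)
      have ww: "w \<bullet> w > 0" using w(2) by simp
      have "\<bar>\<mu>\<bar> * (w \<bullet> w) = \<bar>\<mu> * (w \<bullet> w)\<bar>" using ww by (simp add: abs_mult)
      also have "\<dots> = 2 * \<bar>a w \<bullet> w\<bar>" unfolding eq[symmetric] by (simp add: abs_mult)
      also have "\<dots> \<le> 2 * (w \<bullet> w)" using le by simp
      finally have "\<bar>\<mu>\<bar> * (w \<bullet> w) \<le> 2 * (w \<bullet> w)" .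
      then have "\<bar>\<mu>\<bar> \<le> 2" using ww by simp
      moreover have "\<mu> \<noteq> 2"
      proof
        assume "\<mu> = 2"
        then have "a w \<bullet> w = w \<bullet> w" using eq by simp
        then have "(a w - w) \<bullet> (a w - w) = 0"
          using isometry_A[OF a(1), of w w] by (simp add: inner_diff_left inner_diff_right inner_commute)
        then show False using a(2) by simp
      qed
      ultimately have "\<bar>k\<bar> \<le> 2" "k \<noteq> 2" using muk by linarith+
      then have "k \<in> {-2,-1,0,1}" by auto
      moreover have "a (a x) = of_int k *\<^sub>R a x - x" if x: "x \<in> Y" for x
        using mu[OF inv_subD(2)[OF Y a(1) x]] a'(3) muk by (simp add: eq_diff_eq)
      ultimately show ?thesis by blast
    qed
    have minus: "a x = - x" if a: "a \<in> A" "a w \<noteq> w" and aa: "\<And>x. x \<in> Y \<Longrightarrow> a (a x) = (-2) *\<^sub>R a x - x" and x: "x \<in> Y" for a x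
    proof -
      let ?u = "a x + x"
      have "a x \<bullet> a (a x) = x \<bullet> a x" by (rule isometry_A[OF a(1)])
      then have "(-2) * (x \<bullet> x) - a x \<bullet> x = x \<bullet> a x"
        using aa[OF x] isometry_A[OF a(1), of x x] by (simp add: inner_diff_right)
      then have "a x \<bullet> x = - (x \<bullet> x)" by (simp add: inner_commute)
      then have "?u \<bullet> ?u = 0" using isometry_A[OF a(1), of x x] by (simp add: inner_add_left inner_add_right inner_commute)
      then have "?u = 0" by (simp only: inner_eq_zero_iff)
      then show ?thesis by (simp only: eq_neg_iff_add_eq_0)
    qed
    have g_pow: "(g ^^ m) w \<noteq> - w" for m
    proof
      assume e: "(g ^^ m) w = - w"
      obtain n where n: "odd n" "g ^^ n = id" using B_odd[OF g(1)] by blast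
      have "((g ^^ m) ^^ n) w = - w" by (rule odd_power_minus[OF linear_A[OF pow_A[OF gA]] e n(1)])
      moreover have "(g ^^ m) ^^ n = (g ^^ n) ^^ m" by (simp add: funpow_mult mult.commute)
      ultimately have "w = - w" using n(2) by simp
      then have "2 *\<^sub>R w = 0" by (simp add: scaleR_2 eq_neg_iff_add_eq_0)
      then show False using w(2) by simp
    qed
    \<comment> \<open>Traces -2, 0 and 1 would make g, g^2 or g^3 send w to -w, which is impossible
      because g has odd order. Only the trace -1 of a cube root of unity remains.\<close>
    have gg: "g (g x) = - g x - x" if x: "x \<in> Y" for x
    proof -
      obtain k :: int where k: "k \<in> {-2,-1,0,1}" "\<And>x. x \<in> Y \<Longrightarrow> g (g x) = of_int k *\<^sub>R g x - x"
        using trace[OF gA g(2)] by blast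
      have "k \<noteq> -2" using minus[OF gA g(2) _ wY] g_pow[of 1] k(2) by auto
      moreover have "k \<noteq> 0" using g_pow[of 2] k(2)[OF wY] by (auto simp: numeral_2_eq_2)
      moreover have "k \<noteq> 1"
      proof
        assume "k = 1"
        then have k1: "g (g y) = g y - y" if "y \<in> Y" for y using k(2)[OF that] by simp
        have "g (g (g w)) = g (g w) - g w" by (rule k1[OF inv_subD(2)[OF Y gA wY]])
        also have "\<dots> = - w" unfolding k1[OF wY] by simp
        finally have "g (g (g w)) = - w" .
        then show False using g_pow[of 3] by (simp add: numeral_3_eq_3)
      qed
      ultimately have "k = -1" using k(1) by blast
      then show ?thesis using k(2)[OF x] by simp
    qed
    define m where "m = (w \<bullet> w) / 2"
    have ww: "w \<bullet> w = 2 * m" by (simp add: m_def)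
    have m0: "m > 0" using w(2) by (simp add: m_def)
    have hex: "h w \<in> Y" "h w \<in> E8_lattice" "h w \<bullet> h w = 2 * m" "h w \<bullet> w = - m"
      if h: "h \<in> A" "\<And>x. x \<in> Y \<Longrightarrow> h (h x) = - h x - x" for h
    proof -
      show "h w \<in> Y" "h w \<in> E8_lattice" using inv_subD(2)[OF Y h(1) wY] lattice_A[OF h(1) wL] by auto
      show hh: "h w \<bullet> h w = 2 * m" using isometry_A[OF h(1), of w w] ww by simp
      have "h (h w) \<bullet> h w = h w \<bullet> w" by (rule isometry_A[OF h(1)])
      then have "- (h w \<bullet> h w) - w \<bullet> h w = h w \<bullet> w" using h(2)[OF wY] by (simp add: inner_diff_left)
      then show "h w \<bullet> w = - m" using hh by (simp add: inner_commute)
    qed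
    \<comment> \<open>N is the hexagonal lattice spanned by w and h w: rounding both coefficients
      leaves a vector with coefficients at most 1/2 in absolute value, whose norm is at most 3/4 of
      the minimum.\<close>
    have basis: "\<exists>p q::int. n = of_int p *\<^sub>R w + of_int q *\<^sub>R h w"
      if h: "h \<in> A" "\<And>x. x \<in> Y \<Longrightarrow> h (h x) = - h x - x" and n: "n \<in> N" for h n
    proof -
      define P where "P = (2 * (n \<bullet> w) + n \<bullet> h w) / (3 * m)"
      define Q where "Q = (n \<bullet> w + 2 * (n \<bullet> h w)) / (3 * m)"
      have nY: "n \<in> Y" and nL: "n \<in> E8_lattice" using n by (auto simp: N_def)
      have nPQ: "n = P *\<^sub>R w + Q *\<^sub>R h w"
        using proj_hexagonal[OF sY wY hex(1)[OF h] dim2 m0 ww hex(3,4)[OF h], of n] proj_self[OF sY nY]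
        by (simp add: P_def Q_def)
      define a where "a = P - of_int (round P)"
      define b where "b = Q - of_int (round Q)"
      have ab: "\<bar>a\<bar> \<le> 1/2" "\<bar>b\<bar> \<le> 1/2"
        using of_int_round_abs_le[of P] of_int_round_abs_le[of Q] by (auto simp: a_def b_def abs_minus_commute)
      define n' where "n' = a *\<^sub>R w + b *\<^sub>R h w"
      have n'e: "n' = n - (of_int (round P) *\<^sub>R w + of_int (round Q) *\<^sub>R h w)"
        by (subst nPQ) (simp add: n'_def a_def b_def algebra_simps)
      have "n' \<in> E8_lattice" unfolding n'e
        by (intro E8_lattice_diff E8_lattice_add nL add_closed_scale_int[OF add_closed_E8_lattice] wL hex(2)[OF h])
      moreover have "n' \<in> Y" unfolding n'_def
        by (intro subspace_add[OF sY] subspace_scale[OF sY] wY hex(1)[OF h])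
      ultimately have n'N: "n' \<in> N" by (simp add: N_def)
      have "n' \<bullet> n' = 2 * m * (a^2 - a * b + b^2)"
        using hex(3,4)[OF h] inner_commute[of w "h w"]
        by (simp add: n'_def inner_add_left inner_add_right ww power2_eq_square algebra_simps)
      moreover have "a^2 - a * b + b^2 \<le> 3/4"
      proof -
        have "a^2 \<le> (1/2)^2" "b^2 \<le> (1/2)^2" using ab by (auto simp: abs_le_square_iff[symmetric])
        moreover have "\<bar>a * b\<bar> \<le> (1/2) * (1/2)" unfolding abs_mult using ab by (intro mult_mono) auto
        then have "- (a * b) \<le> 1/4" by linarith
        ultimately show ?thesis by (simp add: power2_eq_square)
      qed
      ultimately have "n' \<bullet> n' \<le> 2 * m * (3/4)" using m0 by simp
      then have "n' \<bullet> n' < w \<bullet> w" using m0 ww by simp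
      then have "n' = 0" using wmin[OF n'N] by force
      then show ?thesis using n'e by (intro exI[of _ "round P"] exI[of _ "round Q"]) simp
    qed
    \<comment> \<open>For such an s every s y - y lies in N and is minus twice the projection of y
      to Y. Comparing inner products, (w - g w)/3 pairs integrally with the lattice and so lies in
      it, yet its norm 2m/3 is below the minimum 2m.\<close>
    have minus_free: False if s: "s \<in> C" "\<And>x. x \<in> Y \<Longrightarrow> s x = - x" for s
    proof -
      have sA: "s \<in> A" using s(1) CA by blast
      note hg = hex[OF gA gg]
      have third: "(1/3) *\<^sub>R (w - g w) \<in> E8_lattice"
      proof (rule E8_lattice_unimodular)
        fix y assume y: "y \<in> E8_lattice"
        have anti: "s y \<bullet> z = - (y \<bullet> z)" if "z \<in> Y" for z
          using isometry_A[OF sA, of y z] s(2)[OF that] by simp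
        have "s y - y \<in> N" using diffY[OF s(1)] lattice_A[OF sA y] y by (simp add: N_def)
        then obtain p q :: int where pq: "s y - y = of_int p *\<^sub>R w + of_int q *\<^sub>R g w" using basis[OF gA gg] by blast
        have e1: "- (2 * (y \<bullet> w)) = 2 * m * p - m * q"
          using arg_cong[OF pq, of "\<lambda>z. z \<bullet> w"] anti[OF wY] hg(4) by (simp add: inner_diff_left inner_add_left ww algebra_simps)
        have e2: "- (2 * (y \<bullet> g w)) = 2 * m * q - m * p"
          using arg_cong[OF pq, of "\<lambda>z. z \<bullet> g w"] anti[OF hg(1)] hg(3,4) inner_commute[of w "g w"]
          by (simp add: inner_diff_left inner_add_left algebra_simps)
        have e3: "2 * (y \<bullet> w - y \<bullet> g w) = 3 * (m * (q - p))" using e1 e2 by (simp add: algebra_simps)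
        obtain m' :: int where "w \<bullet> w = 2 * of_int m'" using E8_lattice_even[OF wL] .
        then have m': "m = of_int m'" using ww by simp
        obtain d :: int where d: "y \<bullet> w - y \<bullet> g w = of_int d"
          using Ints_diff[OF E8_lattice_inner[OF y wL] E8_lattice_inner[OF y hg(2)]] by (rule Ints_cases)
        have "real_of_int (2 * d) = real_of_int (3 * (m' * (q - p)))" using e3 unfolding d m' by simp
        then have "2 * d = 3 * (m' * (q - p))" by (simp only: of_int_eq_iff)
        then have "3 dvd 2 * d" by (metis dvd_triv_left)
        then have "3 dvd d" by presburger
        then obtain e where "d = 3 * e" by (rule dvdE)
        then have "(1/3) *\<^sub>R (w - g w) \<bullet> y = of_int e"
          using d inner_commute[of w y] inner_commute[of "g w" y] by (simp add: inner_diff_left)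
        then show "(1/3) *\<^sub>R (w - g w) \<bullet> y \<in> \<int>" by simp
      qed
      have "(1/3) *\<^sub>R (w - g w) \<in> Y" by (intro subspace_scale[OF sY] subspace_diff[OF sY] wY hg(1))
      then have tN: "(1/3) *\<^sub>R (w - g w) \<in> N" using third by (simp add: N_def)
      have "w \<bullet> w \<le> ((1/3) *\<^sub>R (w - g w)) \<bullet> ((1/3) *\<^sub>R (w - g w))"
        using g(2) by (intro wmin tN) simp
      also have "\<dots> = 2 * m / 3"
        using hg(3,4) inner_commute[of w "g w"] by (simp add: inner_diff_left inner_diff_right ww)
      finally show False using m0 ww by simp
    qed
    \<comment> \<open>Elements of C may have even order, so the excluded traces now lead to an
      element of C that is -1 on Y: a itself, its square or its cube.\<close>
    have order3: "a (a x) = - a x - x" if a: "a \<in> C" "a \<noteq> id" and x: "x \<in> Y" for a x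
    proof -
      have aA: "a \<in> A" using a(1) CA by blast
      have aw: "a w \<noteq> w"
      proof
        assume "a w = w"
        then have "a y = y" if "y \<in> Y" for y using fixY[OF aA wY w(2) _ that] by blast
        then have "a = id" using cF[OF a(1)] by (intro eq_on[OF aA id_A]) auto
        then show False using a(2) by simp
      qed
      have aF: "a y = y" if "y \<in> F" for y by (rule cF[OF a(1) that])
      have aY: "a y \<in> Y" if "y \<in> Y" for y by (rule inv_subD(2)[OF Y aA that])
      have comps: "(\<lambda>x. a (a x)) \<in> C" "(\<lambda>x. a (a (a x))) \<in> C"
        using comp_app[OF aA aA] comp_app[OF aA comp_app[OF aA aA]] aF by (auto intro!: CI)
      obtain k :: int where k: "k \<in> {-2,-1,0,1}" "\<And>x. x \<in> Y \<Longrightarrow> a (a x) = of_int k *\<^sub>R a x - x"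
        using trace[OF aA aw] by blast
      have "k \<noteq> -2"
      proof
        assume "k = -2"
        then have "a y = - y" if "y \<in> Y" for y using minus[OF aA aw _ that] k(2) by simp
        then show False using minus_free[OF a(1)] by blast
      qed
      moreover have "k \<noteq> 0"
      proof
        assume "k = 0"
        then have "a (a y) = - y" if "y \<in> Y" for y using k(2)[OF that] by simp
        then show False using minus_free[OF comps(1)] by blast
      qed
      moreover have "k \<noteq> 1"
      proof
        assume "k = 1"
        then have k1: "a (a y) = a y - y" if "y \<in> Y" for y using k(2)[OF that] by simp
        have "a (a (a y)) = - y" if y: "y \<in> Y" for y
        proof -
          have "a (a (a y)) = a (a y) - a y" by (rule k1[OF aY[OF y]])
          also have "\<dots> = - y" unfolding k1[OF y] by simp
          finally show ?thesis .
        qed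
        then show False using minus_free[OF comps(2)] by blast
      qed
      ultimately have "k = -1" using k(1) by blast
      then show ?thesis using k(2)[OF x] by simp
    qed
    note cc = order3[OF c]
    note hc = hex[OF cA cc]
    have ccc: "c (c (c w)) = w"
    proof -
      have "c (c (c w)) = - c (c w) - c w" by (rule cc[OF hc(1)])
      also have "\<dots> = w" unfolding cc[OF wY] by simp
      finally show ?thesis .
    qed
    \<comment> \<open>Self-duality once more: c w / m is a lattice vector of norm 2/m, so m = 1.
      Thus w is a root and Y the plane of an A2.\<close>
    have "(1/m) *\<^sub>R c w \<in> E8_lattice"
    proof (rule E8_lattice_unimodular)
      fix y assume y: "y \<in> E8_lattice"
      have "c y - y \<in> N" using diffY[OF c(1)] lattice_A[OF cA y] y by (simp add: N_def)
      then obtain p q :: int where pq: "c y - y = of_int p *\<^sub>R w + of_int q *\<^sub>R c w" using basis[OF cA cc] by blast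
      have cyw: "c y \<bullet> w = - (y \<bullet> c w) - y \<bullet> w"
        using isometry_A[OF cA, of y "c (c w)"] ccc cc[OF wY] by (simp add: inner_diff_right)
      have e1: "- (y \<bullet> c w) - 2 * (y \<bullet> w) = 2 * m * p - m * q"
        using arg_cong[OF pq, of "\<lambda>z. z \<bullet> w"] cyw hc(4) by (simp add: inner_diff_left inner_add_left ww algebra_simps)
      have e2: "y \<bullet> w - y \<bullet> c w = 2 * m * q - m * p"
        using arg_cong[OF pq, of "\<lambda>z. z \<bullet> c w"] isometry_A[OF cA, of y w] hc(3,4) inner_commute[of w "c w"]
        by (simp add: inner_diff_left inner_add_left algebra_simps)
      have "y \<bullet> c w = m * (- q)" using e1 e2 by (simp add: algebra_simps)
      then have "(1/m) *\<^sub>R c w \<bullet> y = of_int (- q)" using m0 by (simp add: inner_commute)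
      then show "(1/m) *\<^sub>R c w \<bullet> y \<in> \<int>" by (simp only: Ints_of_int)
    qed
    moreover have "(1/m) *\<^sub>R c w \<noteq> 0" using hc(3) m0 by auto
    ultimately have "((1/m) *\<^sub>R c w) \<bullet> ((1/m) *\<^sub>R c w) \<ge> 2" by (rule E8_lattice_norm_ge)
    then have "2 \<le> 2 / m" using hc(3) m0 by (simp add: power2_eq_square)
    then have "m \<le> 1" using m0 by (simp add: field_simps)
    moreover have "m \<ge> 1" using E8_lattice_norm_ge[OF wL w(2)] by (simp add: m_def)
    ultimately have m1: "m = 1" by simp
    have "card {s \<in> E8_roots. proj Y s = 0} \<le> 72"
      by (rule hexagonal_roots[OF sY wY hc(1) dim2 _ _ _ wL hc(2)]) (use ww hc(3,4) m1 in simp_all)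
    moreover have "card ((\<lambda>a. a r) ` A) \<le> card {s \<in> E8_roots. proj Y s = 0}"
      using orb finite_E8_roots by (intro card_mono) auto
    ultimately have orb72: "card ((\<lambda>a. a r) ` A) \<le> 72" by simp
    have "C \<subseteq> {id, c, c \<circ> c}"
    proof
      fix d assume d: "d \<in> C"
      have dA: "d \<in> A" using d CA by blast
      have agree: "d = e" if e: "e \<in> C" "z \<in> Y" "z \<noteq> 0" "d z = e z" for e z
      proof -
        have eA: "e \<in> A" using e(1) CA by blast
        obtain e' where e': "e' \<in> A" "\<And>x. e' (e x) = x" "\<And>x. e (e' x) = x" using inv_app[OF eA] by metis
        have "e' (d z) = z" using e(4) e'(2) by simp
        then have "e' (d y) = y" if "y \<in> Y" for y
          using fixY[OF comp_app[OF e'(1) dA] e(2,3) _ that] by simp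
        then have "d y = e y" if "y \<in> Y" for y using that e'(3) by metis
        then show ?thesis using cF[OF d] cF[OF e(1)] by (intro eq_on[OF dA eA]) auto
      qed
      show "d \<in> {id, c, c \<circ> c}"
      proof (cases "d = id")
        case False
        note dd = order3[OF d False]
        \<comment> \<open>On Y both c and d are roots of X^2 + X + 1, which factors as (X - c)(X -
          c^2). Hence u = (d - c^2) w satisfies (d - c) u = 0, and an element is known from its
          value at one nonzero vector of Y.\<close>
        define u where "u = d w - c (c w)"
        have dw: "d w \<in> Y" by (rule inv_subD(2)[OF Y dA wY])
        have uY: "u \<in> Y" unfolding u_def
          by (rule subspace_diff[OF sY dw inv_subD(2)[OF Y cA hc(1)]])
        have "d u = c u"
        proof -
          have "d u = d (d w) - d (c (c w))" by (simp add: u_def linear_diff[OF linear_A[OF dA]])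
          also have "\<dots> = (- d w - w) - d (- c w - w)" using dd[OF wY] cc[OF wY] by simp
          also have "\<dots> = d (c w) - w" by (simp add: linear_diff[OF linear_A[OF dA]] linear_neg[OF linear_A[OF dA]])
          also have "\<dots> = c (d w) - c (c (c w))" using comm_app[OF dA cA] ccc by simp
          also have "\<dots> = c u" by (simp add: u_def linear_diff[OF linear_A[OF cA]])
          finally show ?thesis .
        qed
        show ?thesis
        proof (cases "u = 0")
          case True
          then have "d w = (c \<circ> c) w" by (simp add: u_def)
          moreover have "c \<circ> c \<in> C" using comp_A[OF cA cA] cF[OF c(1)] by (intro CI) auto
          ultimately show ?thesis using agree[OF _ wY w(2)] by blast
        next
          case False
          then show ?thesis using agree[OF c(1) uY _ \<open>d u = c u\<close>] by blast
        qed
      qed simp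
    qed
    then have "card C \<le> card {id, c, c \<circ> c}" by (intro card_mono) auto
    also have "\<dots> \<le> 3" by (simp add: card_insert_if)
    finally have "card C \<le> 3" .
    then have "card ((\<lambda>a. a r) ` A) * card C \<le> 72 * 3" using orb72 by (intro mult_le_mono)
    then show ?thesis using card_A_le_orbit[of r] by (simp add: C_def)
  qed
qed

end

section \<open>Reflections in large 2-groups\<close>

lemma even_card_involution:
  assumes "finite S" "\<And>x. x \<in> S \<Longrightarrow> f x \<in> S" "\<And>x. x \<in> S \<Longrightarrow> f (f x) = x" "\<And>x. x \<in> S \<Longrightarrow> f x \<noteq> x"
  shows "even (card S)"
  using assms
proof (induction "card S" arbitrary: S rule: less_induct)
  case less
  show ?case
  proof (cases "S = {}")
    case False
    then obtain x where x: "x \<in> S" by blast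
    let ?S' = "S - {x, f x}"
    have c: "card ?S' = card S - 2" "2 \<le> card S"
    proof -
      have sub: "{x, f x} \<subseteq> S" using x less.prems(2) by blast
      have two: "card {x, f x} = 2" using less.prems(4)[OF x] by simp
      show "card ?S' = card S - 2" using card_Diff_subset[OF _ sub] two by simp
      show "2 \<le> card S" using card_mono[OF less.prems(1) sub] two by simp
    qed
    have "f y \<in> ?S'" if y: "y \<in> ?S'" for y
    proof -
      have "f y \<noteq> x" using y less.prems(3)[of y] by auto
      moreover have "f y \<noteq> f x" using y x less.prems(3)[of y] less.prems(3)[of x] by auto
      ultimately show ?thesis using y less.prems(2) by blast
    qed
    then have "even (card ?S')" using c less.prems by (intro less.hyps) auto
    then show ?thesis using c by simp
  qed simp
qed

section \<open>Elements of 2-power order and involutions with small eigenspaces\<close>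

context abelian_isometries
begin

lemma involution_power:
  assumes c: "c \<in> A" "c \<noteq> id" "c ^^ (2 ^ K) = id"
  obtains j where "c ^^ (2 ^ j) \<noteq> id" "c ^^ (2 ^ Suc j) = id"
proof -
  define j where "j = (LEAST j. c ^^ (2 ^ j) = id)"
  have j: "c ^^ (2 ^ j) = id" unfolding j_def by (rule LeastI[of "\<lambda>j. c ^^ (2 ^ j) = id", OF c(3)])
  have "j \<noteq> 0" using j c(2) by (intro notI) simp
  then obtain i where i: "j = Suc i" by (cases j) auto
  have "c ^^ (2 ^ i) \<noteq> id" using not_less_Least[of i "\<lambda>j. c ^^ (2 ^ j) = id"] i by (simp add: j_def)
  then show ?thesis using that j i by blast
qed

text \<open>T = c - 1 is nilpotent on the 8-dimensional space of the lattice modulo 2, so T^8 is 0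
  there. By Frobenius c^8 is then congruent to 1 modulo 2, and \<open>isometry_congruent_id\<close>
  applies.\<close>

lemma two_power_congruent:
  assumes c: "c \<in> A" "c ^^ (2 ^ K) = id"
  shows "c ^^ 8 = id \<or> c ^^ 8 = (\<lambda>x. - x)"
proof -
  have zc: "zop c" by (rule zop_base[OF c(1)])
  have zm: "zop (\<lambda>x. - x)" by (rule zop_neg[OF zop_id])
  define T where "T x = c x + - x" for x
  have T: "zop T" unfolding T_def by (rule zop_add[OF zc zm])
  have neg_pow: "((\<lambda>x::real^8. - x) ^^ (2 ^ j)) x = x \<or> j = 0" for j x
  proof (cases j)
    case (Suc i)
    have "((\<lambda>x::real^8. - x) ^^ (2 * n)) x = x" for n by (induction n) auto
    then show ?thesis using Suc by simp
  qed simp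
  define M where "M = {x. (1/2) *\<^sub>R x \<in> E8_lattice}"
  have M: "add_closed M" by (auto simp: M_def add_closed_def scaleR_diff_right)
  have TM: "S x \<in> M" if "zop S" "x \<in> M" for S x
    using zop_lattice[OF that(1), of "(1/2) *\<^sub>R x"] that(2) by (simp add: M_def linear_cmul[OF zop_linear[OF that(1)]])
  have dblM: "2 *\<^sub>R x \<in> M" if "x \<in> E8_lattice" for x using that by (simp add: M_def)
  have frob: "(T ^^ (2 ^ j)) x \<in> M \<longleftrightarrow> (c ^^ (2 ^ j)) x - x \<in> M" if x: "x \<in> E8_lattice" and j: "j \<noteq> 0" for j x
  proof -
    obtain R where R: "zop R" "\<And>x. (T ^^ (2 ^ j)) x = (c ^^ (2 ^ j)) x + ((\<lambda>x. - x) ^^ (2 ^ j)) x + 2 *\<^sub>R R x"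
      using frobenius_add[OF zc zm, of j] unfolding T_def by blast
    have e: "(T ^^ (2 ^ j)) x = ((c ^^ (2 ^ j)) x - x) + 2 *\<^sub>R (x + R x)"
      using R(2)[of x] neg_pow[of j x] j by (simp add: scaleR_2 algebra_simps)
    have m: "2 *\<^sub>R (x + R x) \<in> M" using zop_lattice[OF R(1) x] x by (intro dblM) simp
    show ?thesis
    proof
      assume "(T ^^ (2 ^ j)) x \<in> M"
      from add_closedD(2)[OF M this m] show "(c ^^ (2 ^ j)) x - x \<in> M" by (simp add: e)
    next
      assume "(c ^^ (2 ^ j)) x - x \<in> M"
      from add_closedD(4)[OF M this m] show "(T ^^ (2 ^ j)) x \<in> M" by (simp only: e)
    qed
  qed
  \<comment> \<open>If T^8 x were nonzero modulo 2, the nine vectors x, T x, ..., T^8 x would be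
    independent: in a subset sum with lowest index i0, applying T^(m - 1 - i0) kills every term but
    the lowest, which becomes T^(m - 1) x.\<close>
  have nil8: "(T ^^ 8) x \<in> M" if x: "x \<in> E8_lattice" for x
  proof (rule ccontr)
    assume no8: "(T ^^ 8) x \<notin> M"
    have "c ^^ (2 ^ Suc K) = id" using c(2) by (simp add: mult_2 funpow_add)
    then have "(c ^^ (2 ^ Suc K)) x - x \<in> M" using add_closedD(1)[OF M] by simp
    then have ex: "(T ^^ (2 ^ Suc K)) x \<in> M" using frob[OF x] by blast
    define m where "m = (LEAST m. (T ^^ m) x \<in> M)"
    have mM: "(T ^^ m) x \<in> M" unfolding m_def by (rule LeastI[of "\<lambda>m. (T ^^ m) x \<in> M", OF ex])
    have notM: "(T ^^ i) x \<notin> M" if "i < m" for i using that unfolding m_def by (rule not_less_Least)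
    have upM: "(T ^^ i) x \<in> M" if "i \<ge> m" for i
    proof -
      have "(T ^^ (i - m)) ((T ^^ m) x) \<in> M" by (rule TM[OF zop_pow[OF T] mM])
      then show ?thesis using that by (simp flip: funpow_add[THEN fun_cong, unfolded comp_apply])
    qed
    have m9: "m \<ge> 9"
    proof (rule ccontr)
      assume "\<not> m \<ge> 9" then show False using upM[of 8] no8 by simp
    qed
    have shift: "(T ^^ k) ((T ^^ i) x) = (T ^^ (k + i)) x" for k i by (simp add: funpow_add)
    have inj: "inj_on (\<lambda>i. (T ^^ i) x) {..<9}"
    proof -
      have "(T ^^ i) x \<noteq> (T ^^ j) x" if "i < j" "j < 9" for i j
      proof
        assume e: "(T ^^ i) x = (T ^^ j) x"
        have "(T ^^ (m - 1 - i)) ((T ^^ i) x) = (T ^^ (m - 1)) x" unfolding shift using that m9 by simp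
        moreover have "(T ^^ (m - 1 - i)) ((T ^^ j) x) \<in> M" unfolding shift using that m9 by (intro upM) simp
        ultimately have "(T ^^ (m - 1)) x \<in> M" using e by simp
        then show False using notM[of "m - 1"] m9 by simp
      qed
      then show ?thesis by (intro inj_onI) (metis lessThan_iff nat_neq_iff)
    qed
    have "indep_mod2 E8_lattice ((\<lambda>i. (T ^^ i) x) ` {..<9})"
      unfolding indep_mod2_def
    proof (intro conjI allI impI)
      show "(\<lambda>i. (T ^^ i) x) ` {..<9} \<subseteq> E8_lattice" using zop_lattice[OF zop_pow[OF T] x] by blast
      fix S assume S: "S \<subseteq> (\<lambda>i. (T ^^ i) x) ` {..<9}" "S \<noteq> {}"
      then obtain I where I: "I \<subseteq> {..<9}" "S = (\<lambda>i. (T ^^ i) x) ` I" by (auto simp: subset_image_iff)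
      have finI: "finite I" using I(1) by (rule finite_subset) simp
      have In: "I \<noteq> {}" using S I by blast
      define i0 where "i0 = Min I"
      have i0: "i0 \<in> I" "\<And>i. i \<in> I \<Longrightarrow> i0 \<le> i" using Min_in[OF finI In] finI by (auto simp: i0_def)
      have i09: "i0 < 9" using i0(1) I(1) by blast
      let ?P = "T ^^ (m - 1 - i0)"
      show "(1/2) *\<^sub>R \<Sum>S \<notin> E8_lattice"
      proof
        assume "(1/2) *\<^sub>R \<Sum>S \<in> E8_lattice"
        then have "\<Sum>S \<in> M" by (simp add: M_def)
        then have "?P (\<Sum>S) \<in> M" by (rule TM[OF zop_pow[OF T]])
        moreover have "\<Sum>S = (\<Sum>i\<in>I. (T ^^ i) x)" unfolding I(2)
          using sum.reindex[OF inj_on_subset[OF inj I(1)], of "\<lambda>x. x"] by simp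
        then have "?P (\<Sum>S) = (\<Sum>i\<in>I. (T ^^ (m - 1 - i0 + i)) x)"
          by (simp add: linear_sum[OF zop_linear[OF zop_pow[OF T]]] shift)
        also have "\<dots> = (T ^^ (m - 1 - i0 + i0)) x + (\<Sum>i\<in>I - {i0}. (T ^^ (m - 1 - i0 + i)) x)"
          by (rule sum.remove[OF finI i0(1)])
        also have "m - 1 - i0 + i0 = m - 1" using i09 m9 by simp
        moreover have "(\<Sum>i\<in>I - {i0}. (T ^^ (m - 1 - i0 + i)) x) \<in> M"
        proof (rule add_closed_sum[OF M])
          fix i assume "i \<in> I - {i0}"
          then have "i0 < i" using i0(2)[of i] by auto
          then show "(T ^^ (m - 1 - i0 + i)) x \<in> M" using i09 m9 by (intro upM) simp
        qed
        ultimately have "(T ^^ (m - 1)) x + (\<Sum>i\<in>I - {i0}. (T ^^ (m - 1 - i0 + i)) x) \<in> M" by simp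
        from add_closedD(2)[OF M this \<open>(\<Sum>i\<in>I - {i0}. (T ^^ (m - 1 - i0 + i)) x) \<in> M\<close>]
        have "(T ^^ (m - 1)) x \<in> M" by simp
        then show False using notM[of "m - 1"] m9 by simp
      qed
    qed simp
    from card_indep_mod2_le[OF add_closed_E8_lattice subset_refl this]
    show False by (simp add: card_image[OF inj] dim_E8_lattice)
  qed
  have c8: "c ^^ 8 \<in> A" by (rule pow_A[OF c(1)])
  have "c ^^ 8 = (\<lambda>x. x) \<or> c ^^ 8 = (\<lambda>x. - x)"
  proof (rule isometry_congruent_id[OF linear_A[OF c8] isometry_A[OF c8]])
    fix x assume x: "x \<in> E8_lattice"
    have "(c ^^ (2 ^ 3)) x - x \<in> M" using frob[OF x, of 3] nil8[OF x] by simp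
    then show "(1/2) *\<^sub>R ((c ^^ 8) x - x) \<in> E8_lattice" by (simp add: M_def)
  qed
  then show ?thesis by (simp add: id_def)
qed

text \<open>J is skew on U, so a vector y of U orthogonal to x and J x produces four orthogonal
  vectors x, J x, y, J y.\<close>

lemma complex_structure_dim3:
  assumes J: "J \<in> A" and U: "subspace U" "\<And>x. x \<in> U \<Longrightarrow> J x \<in> U" "\<And>x. x \<in> U \<Longrightarrow> J (J x) = - x"
  shows "dim U \<noteq> 3"
proof
  assume d: "dim U = 3"
  have skew: "J x \<bullet> y = - (x \<bullet> J y)" if "x \<in> U" "y \<in> U" for x y
    using isometry_A[OF J, of "J x" y] U(3)[OF that(1)] isometry_A[OF J, of x y] by simp
  have self: "J x \<bullet> x = 0" if "x \<in> U" for x using skew[OF that that] by (simp add: inner_commute)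
  have nz: "J x \<noteq> 0" if "x \<noteq> 0" for x using isometry_A[OF J, of x x] that by auto
  have "U \<noteq> {0}" using d by auto
  then obtain x where x: "x \<in> U" "x \<noteq> 0" using subspace_0[OF U(1)] by blast
  have Jx: "J x \<in> U" by (rule U(2)[OF x(1)])
  have sub: "span {x, J x} \<subseteq> U" using x Jx U(1) by (intro span_minimal) auto
  have "dim (span {x, J x}) \<le> 2" unfolding dim_span
    by (rule order_trans[OF dim_le_card']) (auto simp: card_insert_if)
  moreover have "dim {y \<in> U. \<forall>z\<in>span {x, J x}. y \<bullet> z = 0} + dim (span {x, J x}) = dim U"
    by (rule dim_orthogonal_part[OF subspace_span U(1) sub])
  ultimately have "dim {y \<in> U. \<forall>z\<in>span {x, J x}. y \<bullet> z = 0} \<noteq> 0" using d by linarith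
  then have "\<not> {y \<in> U. \<forall>z\<in>span {x, J x}. y \<bullet> z = 0} \<subseteq> {0}" by simp
  then obtain y where y: "y \<in> U" "y \<noteq> 0" "\<And>z. z \<in> span {x, J x} \<Longrightarrow> y \<bullet> z = 0" by blast
  have yx: "y \<bullet> x = 0" "y \<bullet> J x = 0" using y(3) by (auto intro: span_base)
  have Jy: "J y \<in> U" by (rule U(2)[OF y(1)])
  have o: "x \<bullet> J x = 0" "x \<bullet> y = 0" "x \<bullet> J y = 0" "J x \<bullet> y = 0" "J x \<bullet> J y = 0" "y \<bullet> J y = 0"
    using self[OF x(1)] self[OF y(1)] yx skew[OF x(1) y(1)] isometry_A[OF J, of x y] by (simp_all add: inner_commute)
  have ne: "x \<noteq> J x" "x \<noteq> y" "x \<noteq> J y" "J x \<noteq> y" "J x \<noteq> J y" "y \<noteq> J y"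
    using o x(2) y(2) nz[OF x(2)] nz[OF y(2)] by auto
  have "pairwise orthogonal {x, J x, y, J y}"
    using o by (auto simp: pairwise_def orthogonal_def inner_commute)
  then have "independent {x, J x, y, J y}"
    by (rule pairwise_orthogonal_independent) (use x y nz in auto)
  then have "card {x, J x, y, J y} \<le> dim U"
    by (intro independent_card_le_dim) (use x y Jx Jy in auto)
  then show False using d ne by simp
qed

text \<open>A quarter turn of a plane that fixes the orthogonal complement is impossible in E8: the
  plane contains a lattice vector a of norm 2, and evenness of the norms of y - J y makes (a - J
  a)/2 integral on the lattice, hence a lattice vector of norm 1.\<close>

lemma complex_structure_dim2:
  assumes J: "J \<in> A" and U: "subspace U" "\<And>x. x \<in> U \<Longrightarrow> J x \<in> U" "\<And>x. x \<in> U \<Longrightarrow> J (J x) = - x"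
    and V: "\<And>y. (\<And>x. x \<in> U \<Longrightarrow> y \<bullet> x = 0) \<Longrightarrow> J y = y"
  shows "dim U \<noteq> 2"
proof
  assume d: "dim U = 2"
  have skew: "J x \<bullet> y = - (x \<bullet> J y)" if "x \<in> U" "y \<in> U" for x y
    using isometry_A[OF J, of "J x" y] U(3)[OF that(1)] isometry_A[OF J, of x y] by simp
  have self: "x \<bullet> J x = 0" if "x \<in> U" for x using skew[OF that that] by (simp add: inner_commute)
  have diff: "y - J y = proj U y - J (proj U y)" and normd: "(y - J y) \<bullet> (y - J y) = 2 * (proj U y \<bullet> proj U y)" for y
  proof -
    have "J (y - proj U y) = y - proj U y" by (rule V) (rule proj_props(2)[OF U(1)])
    then show e: "y - J y = proj U y - J (proj U y)" by (simp add: linear_diff[OF linear_A[OF J]] algebra_simps)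
    show "(y - J y) \<bullet> (y - J y) = 2 * (proj U y \<bullet> proj U y)"
      unfolding e using self[OF proj_props(1)[OF U(1)], of y] isometry_A[OF J, of "proj U y" "proj U y"]
      by (simp add: inner_diff_left inner_diff_right inner_commute)
  qed
  have "U \<noteq> {0}" using d by auto
  then obtain x where x: "x \<in> U" "x \<noteq> 0" using subspace_0[OF U(1)] by blast
  have "(\<Sum>r\<in>E8_roots. (r \<bullet> x)^2) \<noteq> 0" using x(2) by (simp add: roots_design2)
  then obtain r where r: "r \<in> E8_roots" "r \<bullet> x \<noteq> 0"
    by (metis (no_types, lifting) power_zero_numeral sum.neutral)
  have rL: "r \<in> E8_lattice" "r \<bullet> r = 2" using r(1) by (auto simp: E8_roots_eq)
  define u where "u = proj U r"
  have uU: "u \<in> U" unfolding u_def by (rule proj_props(1)[OF U(1)])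
  have ru: "(r - u) \<bullet> y = 0" if "y \<in> U" for y unfolding u_def by (rule proj_props(2)[OF U(1) that])
  have "u \<noteq> 0" using ru[OF x(1)] r(2) by auto
  have r_split: "r \<bullet> r = (r - u) \<bullet> (r - u) + u \<bullet> u"
    using ru[OF uU] by (simp add: inner_diff_left inner_diff_right inner_commute)
  have rJr: "r - J r \<in> E8_lattice" using rL(1) lattice_A[OF J] by simp
  \<comment> \<open>The norm of r - J r is even and twice the norm of u, so u has norm 1 or 2. In
    the first case r - J r is the required vector; in the second r itself lies in U.\<close>
  have "\<exists>a. a \<in> E8_lattice \<and> a \<in> U \<and> a \<bullet> a = 2"
  proof -
    obtain k :: int where "(r - J r) \<bullet> (r - J r) = 2 * of_int k" using E8_lattice_even[OF rJr] .
    then have uk: "u \<bullet> u = of_int k" using normd[of r] by (simp add: u_def)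
    have "u \<bullet> u \<le> 2" using r_split rL(2) inner_ge_zero[of "r - u"] by linarith
    moreover have "u \<bullet> u > 0" using \<open>u \<noteq> 0\<close> by simp
    ultimately have "0 < k" "k \<le> 2" using uk by linarith+
    then have "k = 1 \<or> k = 2" by linarith
    then show ?thesis
    proof
      assume "k = 1"
      then have "(r - J r) \<bullet> (r - J r) = 2" using normd[of r] uk by (simp add: u_def)
      moreover have "r - J r \<in> U" unfolding diff[of r] by (intro subspace_diff[OF U(1)] U(2) proj_props(1)[OF U(1)])
      ultimately show ?thesis using rJr by blast
    next
      assume "k = 2"
      then have "(r - u) \<bullet> (r - u) = 0" using r_split rL(2) uk by simp
      then have "r - u = 0" by (simp only: inner_eq_zero_iff)
      then show ?thesis using uU rL by auto
    qed
  qed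
  then obtain a where a: "a \<in> E8_lattice" "a \<in> U" "a \<bullet> a = 2" by blast
  have Ja: "J a \<in> E8_lattice" "J a \<in> U" "J a \<bullet> J a = 2" "a \<bullet> J a = 0"
    using lattice_A[OF J a(1)] U(2)[OF a(2)] isometry_A[OF J, of a a] self[OF a(2)] a(3) by auto
  have pU: "proj U y = ((y \<bullet> a) / 2) *\<^sub>R a + ((y \<bullet> J a) / 2) *\<^sub>R J a" for y
  proof (rule proj_unique[OF U(1)])
    let ?p = "((y \<bullet> a) / 2) *\<^sub>R a + ((y \<bullet> J a) / 2) *\<^sub>R J a"
    show pin: "?p \<in> U" by (intro subspace_add[OF U(1)] subspace_scale[OF U(1)] a Ja)
    fix w assume w: "w \<in> U"
    have ind: "independent {a, J a}"
      by (rule pairwise_orthogonal_independent) (use a(3) Ja in \<open>auto simp: pairwise_def orthogonal_def inner_commute\<close>)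
    have "a \<noteq> J a" using a(3) Ja(4) by auto
    then have "dim U \<le> dim (span {a, J a})" using d dim_eq_card_independent[OF ind] by simp
    then have "span {a, J a} = U"
      using subspace_dim_equal[OF subspace_span U(1), of "{a, J a}"] span_minimal[of "{a, J a}" U] a Ja U(1) by auto
    then have "w \<in> span {a, J a}" using w by simp
    moreover have "orthogonal (y - ?p) z" if "z \<in> {a, J a}" for z
      using that a(3) Ja(3,4) inner_commute[of "J a" a] by (auto simp: orthogonal_def inner_diff_left inner_add_left)
    ultimately have "orthogonal (y - ?p) w" using orthogonal_to_span by blast
    then show "(y - ?p) \<bullet> w = 0" by (simp add: orthogonal_def)
  qed
  have "(1/2) *\<^sub>R (a - J a) \<in> E8_lattice"
  proof (rule E8_lattice_unimodular)
    fix y assume y: "y \<in> E8_lattice"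
    obtain \<alpha> where \<alpha>: "y \<bullet> a = of_int \<alpha>" using E8_lattice_inner[OF y a(1)] by (rule Ints_cases)
    obtain \<beta> where \<beta>: "y \<bullet> J a = of_int \<beta>" using E8_lattice_inner[OF y Ja(1)] by (rule Ints_cases)
    have yJ: "y - J y \<in> E8_lattice" using y lattice_A[OF J] by simp
    obtain k :: int where k: "(y - J y) \<bullet> (y - J y) = 2 * of_int k" using E8_lattice_even[OF yJ] .
    have "proj U y \<bullet> proj U y = (of_int \<alpha> * of_int \<alpha> + of_int \<beta> * of_int \<beta>) / 2"
      unfolding pU \<alpha> \<beta> using a(3) Ja(3,4) inner_commute[of "J a" a] by (simp add: inner_add_left inner_add_right field_simps)
    then have "real_of_int (\<alpha> * \<alpha> + \<beta> * \<beta>) = real_of_int (2 * k)" using normd[of y] k by simp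
    then have "\<alpha> * \<alpha> + \<beta> * \<beta> = 2 * k" by (simp only: of_int_eq_iff)
    then have "even (\<alpha> * \<alpha> + \<beta> * \<beta>)" by simp
    then have "even (\<alpha> - \<beta>)" by simp
    then obtain e where "\<alpha> - \<beta> = 2 * e" by (rule evenE)
    then have "real_of_int \<alpha> - real_of_int \<beta> = 2 * real_of_int e" by (metis of_int_diff of_int_mult of_int_numeral)
    then have "(1/2) *\<^sub>R (a - J a) \<bullet> y = of_int e"
      using \<alpha> \<beta> inner_commute[of a y] inner_commute[of "J a" y] by (simp add: inner_diff_left)
    then show "(1/2) *\<^sub>R (a - J a) \<bullet> y \<in> \<int>" by simp
  qed
  moreover have nrm: "((1/2) *\<^sub>R (a - J a)) \<bullet> ((1/2) *\<^sub>R (a - J a)) = 1"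
    using a(3) Ja(3,4) inner_commute[of "J a" a] by (simp add: inner_diff_left inner_diff_right)
  moreover have "(1/2) *\<^sub>R (a - J a) \<noteq> 0" using nrm by auto
  ultimately show False using E8_lattice_norm_ge by fastforce
qed

text \<open>All differences y - t y are integral multiples of a shortest lattice vector w on the
  line. Hence w / m, where the norm of w is 2m, lies in the dual and so in the lattice; its norm 2/m
  must be at least 2, which makes w a root.\<close>

lemma line_involution:
  assumes t: "t \<in> A" and U: "subspace U" "dim U = 1" "\<And>x. x \<in> U \<Longrightarrow> t x = - x"
    and V: "\<And>y. (\<And>x. x \<in> U \<Longrightarrow> y \<bullet> x = 0) \<Longrightarrow> t y = y"
  shows "\<exists>r\<in>E8_roots. r \<in> U \<and> t = reflection r"
proof -
  define N where "N = E8_lattice \<inter> U"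
  have diff: "y - t y = 2 *\<^sub>R proj U y" for y
  proof -
    have "t (y - proj U y) = y - proj U y" by (rule V) (rule proj_props(2)[OF U(1)])
    moreover have "t (proj U y) = - proj U y" by (rule U(3)[OF proj_props(1)[OF U(1)]])
    ultimately show ?thesis by (simp add: linear_diff[OF linear_A[OF t]] scaleR_2 algebra_simps)
  qed
  have diffN: "y - t y \<in> N" if y: "y \<in> E8_lattice" for y
  proof -
    have "y - t y \<in> U" unfolding diff by (rule subspace_scale[OF U(1) proj_props(1)[OF U(1)]])
    then show ?thesis using y lattice_A[OF t y] by (simp add: N_def)
  qed
  have "U \<noteq> {0}" using U(2) by auto
  then obtain x where x: "x \<in> U" "x \<noteq> 0" using subspace_0[OF U(1)] by blast
  have "t \<noteq> id"
  proof
    assume "t = id"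
    then have "x = - x" using U(3)[OF x(1)] by simp
    then have "2 *\<^sub>R x = 0" by (simp add: scaleR_2 eq_neg_iff_add_eq_0)
    then show False using x(2) by simp
  qed
  then obtain y0 where y0: "y0 \<in> E8_lattice" "t y0 \<noteq> y0" using eq_if_eq_on_lattice[OF t id_A] by auto
  have "y0 - t y0 \<noteq> 0" using y0(2) by auto
  moreover have "N \<subseteq> E8_lattice" by (auto simp: N_def)
  ultimately obtain w where w: "w \<in> N" "w \<noteq> 0" and wmin: "\<And>x. x \<in> N \<Longrightarrow> x \<noteq> 0 \<Longrightarrow> w \<bullet> w \<le> x \<bullet> x"
    using minimal_vector[OF diffN[OF y0(1)]] by blast
  have wL: "w \<in> E8_lattice" and wU: "w \<in> U" using w(1) by (auto simp: N_def)
  define m where "m = (w \<bullet> w) / 2"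
  have ww: "w \<bullet> w = 2 * m" by (simp add: m_def)
  have m1: "m \<ge> 1" using E8_lattice_norm_ge[OF wL w(2)] by (simp add: m_def)
  have "dim U \<le> dim (span {w})" using U(2) w(2) dim_eq_card_independent[of "{w}"] by simp
  then have Uw: "U = span {w}"
    using subspace_dim_equal[OF subspace_span U(1), of "{w}"] span_minimal[of "{w}" U] wU U(1) by auto
  have pU: "proj U y = ((y \<bullet> w) / (2 * m)) *\<^sub>R w" for y
  proof (rule proj_unique[OF U(1)])
    show "((y \<bullet> w) / (2 * m)) *\<^sub>R w \<in> U" by (rule subspace_scale[OF U(1) wU])
    fix z assume "z \<in> U"
    then obtain c where "z = c *\<^sub>R w" unfolding Uw span_singleton by blast
    then show "(y - ((y \<bullet> w) / (2 * m)) *\<^sub>R w) \<bullet> z = 0" using m1 by (simp add: inner_diff_left ww)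
  qed
  have ty: "y - t y = ((y \<bullet> w) / m) *\<^sub>R w" for y using m1 by (simp add: diff pU)
  have "(1/m) *\<^sub>R w \<in> E8_lattice"
  proof (rule E8_lattice_unimodular)
    fix y assume y: "y \<in> E8_lattice"
    define c where "c = (y \<bullet> w) / m"
    define d where "d = c - of_int (round c)"
    have dd: "\<bar>d\<bar> \<le> 1/2" using of_int_round_abs_le[of c] by (simp add: d_def abs_minus_commute)
    have cN: "c *\<^sub>R w \<in> N" using diffN[OF y] by (simp add: ty c_def)
    have dw: "d *\<^sub>R w = c *\<^sub>R w - of_int (round c) *\<^sub>R w" by (simp add: d_def scaleR_diff_left)
    have "d *\<^sub>R w \<in> E8_lattice" unfolding dw
      using cN add_closed_scale_int[OF add_closed_E8_lattice wL] by (simp add: N_def)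
    then have dN: "d *\<^sub>R w \<in> N" using subspace_scale[OF U(1) wU] by (simp add: N_def)
    have "d = 0"
    proof (rule ccontr)
      assume "d \<noteq> 0"
      then have "w \<bullet> w \<le> (d *\<^sub>R w) \<bullet> (d *\<^sub>R w)" using w(2) by (intro wmin dN) simp
      also have "\<dots> = d^2 * (w \<bullet> w)" by (simp add: power2_eq_square)
      also have "\<dots> \<le> (1/2)^2 * (w \<bullet> w)"
        using dd by (intro mult_right_mono) (auto simp: abs_le_square_iff[symmetric])
      finally have "w \<bullet> w \<le> (1/4) * (w \<bullet> w)" by (simp add: power2_eq_square)
      then show False using ww m1 by simp
    qed
    then have "c = of_int (round c)" by (simp add: d_def)
    then have "(1/m) *\<^sub>R w \<bullet> y = of_int (round c)" by (simp add: c_def inner_commute)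
    then show "(1/m) *\<^sub>R w \<bullet> y \<in> \<int>" by (simp only: Ints_of_int)
  qed
  moreover have "(1/m) *\<^sub>R w \<noteq> 0" using w(2) m1 by simp
  ultimately have "((1/m) *\<^sub>R w) \<bullet> ((1/m) *\<^sub>R w) \<ge> 2" by (rule E8_lattice_norm_ge)
  then have "2 \<le> 2 / m" using ww m1 by (simp add: power2_eq_square)
  then have "m \<le> 1" using m1 by (simp add: field_simps)
  then have m: "m = 1" using m1 by simp
  have "w \<in> E8_roots" using wL ww m by (simp add: E8_roots_eq)
  moreover have "t = reflection w"
  proof
    fix y
    have "y - t y = (y \<bullet> w) *\<^sub>R w" using ty[of y] m by simp
    then have "t y = y - (y \<bullet> w) *\<^sub>R w" by (simp add: algebra_simps)
    then show "t y = reflection w y" by (simp add: reflection_def ww m)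
  qed
  ultimately show ?thesis using wU by blast
qed

end

section \<open>Abelian groups of order at least 256 are 2-groups and contain frames of
  reflections\<close>

context abelian_isometries
begin

lemma group_A: "comm_group \<lparr>carrier = A, mult = (\<circ>), one = id\<rparr>"
proof (rule comm_groupI)
  show "\<exists>y\<in>carrier \<lparr>carrier = A, mult = (\<circ>), one = id\<rparr>. y \<otimes>\<^bsub>\<lparr>carrier = A, mult = (\<circ>), one = id\<rparr>\<^esub> x = \<one>\<^bsub>\<lparr>carrier = A, mult = (\<circ>), one = id\<rparr>\<^esub>"
    if "x \<in> carrier \<lparr>carrier = A, mult = (\<circ>), one = id\<rparr>" for x
    using inv_A that by auto
qed (auto intro: comp_A id_A comm_A simp: comp_assoc)

lemma pow_card: assumes a: "a \<in> A" shows "a ^^ card A = id"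
proof -
  let ?G = "\<lparr>carrier = A, mult = (\<circ>), one = id\<rparr>"
  interpret G: comm_group ?G by (rule group_A)
  have p: "a [^]\<^bsub>?G\<^esub> n = a ^^ n" for n :: nat
    by (induction n) (auto simp: G.nat_pow_0 G.nat_pow_Suc funpow_Suc_right simp del: funpow.simps(2))
  show ?thesis using G.pow_order_eq_1[of a] a finite_A p[of "card A"] by (simp add: order_def)
qed

lemma funpow_comp: "a \<in> A \<Longrightarrow> b \<in> A \<Longrightarrow> (a \<circ> b) ^^ n = a ^^ n \<circ> b ^^ n"
proof (induction n)
  case (Suc n)
  have "(a \<circ> b) ^^ Suc n = a \<circ> b \<circ> (a ^^ n \<circ> b ^^ n)"
    unfolding funpow.simps(2) Suc.IH[OF Suc.prems] ..
  also have "\<dots> = a \<circ> (b \<circ> a ^^ n) \<circ> b ^^ n" by (simp only: comp_assoc)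
  also have "b \<circ> a ^^ n = a ^^ n \<circ> b" by (rule comm_A[OF Suc.prems(2) pow_A[OF Suc.prems(1)]])
  finally show ?case by (simp only: comp_assoc funpow.simps(2))
qed simp

text \<open>Two elements of C with equal squares differ by an element of square 1, which is the
  identity or t.\<close>

lemma square_eq_fibre:
  assumes unique: "\<And>s. s \<in> C \<Longrightarrow> s \<circ> s = id \<Longrightarrow> s = id \<or> s = t" and C: "C \<subseteq> A"
    and closed: "\<And>a b. a \<in> C \<Longrightarrow> b \<in> A \<Longrightarrow> b \<circ> a = id \<Longrightarrow> b \<in> C" "\<And>a b. a \<in> C \<Longrightarrow> b \<in> C \<Longrightarrow> a \<circ> b \<in> C"
    and S: "S \<subseteq> C"
  shows "card S \<le> card ((\<lambda>c. c ^^ 2) ` S) * 2"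
proof (rule card_le_fibres)
  show "finite S" "finite ((\<lambda>c. c ^^ 2) ` S)" using S C finite_A by (auto intro: finite_subset)
  fix a assume a: "a \<in> S"
  have aA: "a \<in> A" using a S C by blast
  obtain a' where a': "a' \<in> A" "a' \<circ> a = id" "a \<circ> a' = id" using inv_A[OF aA] by blast
  have a'C: "a' \<in> C" using closed(1)[OF _ a'(1,2)] a S by blast
  have "b = a \<or> b = a \<circ> t" if b: "b \<in> S" "b ^^ 2 = a ^^ 2" for b
  proof -
    have bA: "b \<in> A" using b S C by blast
    have "(a' \<circ> b) \<circ> (a' \<circ> b) = (a' \<circ> b) ^^ 2" by (simp add: numeral_2_eq_2)
    also have "\<dots> = a' ^^ 2 \<circ> b ^^ 2" by (rule funpow_comp[OF a'(1) bA])
    also have "\<dots> = a' ^^ 2 \<circ> a ^^ 2" by (simp only: b(2))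
    also have "\<dots> = (a' \<circ> a) ^^ 2" by (rule funpow_comp[OF a'(1) aA, symmetric])
    also have "\<dots> = id" by (simp add: a'(2) numeral_2_eq_2)
    finally have "a' \<circ> b = id \<or> a' \<circ> b = t" using unique closed(2)[OF a'C] b S by blast
    moreover have "a \<circ> (a' \<circ> b) = b" by (simp only: comp_assoc[symmetric] a'(3) id_comp)
    ultimately show ?thesis by (metis comp_id)
  qed
  then have "{b \<in> S. b ^^ 2 = a ^^ 2} \<subseteq> {a, a \<circ> t}" by blast
  then have "card {b \<in> S. b ^^ 2 = a ^^ 2} \<le> card {a, a \<circ> t}" by (rule card_mono[rotated]) simp
  also have "\<dots> \<le> 2" by (simp add: card_insert_if)
  finally show "card {b \<in> S. b ^^ 2 = a ^^ 2} \<le> 2" .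
qed

text \<open>An Abelian 2-group with at most one involution is cyclic. Only the consequence for the
  order is needed: j squarings end in the identity, and each loses at most a factor 2.\<close>

lemma card_le_exponent:
  assumes unique: "\<And>s. s \<in> C \<Longrightarrow> s \<circ> s = id \<Longrightarrow> s = id \<or> s = t" and C: "C \<subseteq> A"
    and closed: "\<And>a b. a \<in> C \<Longrightarrow> b \<in> A \<Longrightarrow> b \<circ> a = id \<Longrightarrow> b \<in> C" "\<And>a b. a \<in> C \<Longrightarrow> b \<in> C \<Longrightarrow> a \<circ> b \<in> C"
    and exp: "\<And>c. c \<in> C \<Longrightarrow> c ^^ (2 ^ j) = id"
  shows "card C \<le> 2 ^ j"
proof -
  have pC: "c ^^ (2 ^ i) \<in> C" if "c \<in> C" for c i
  proof (induction i)
    case (Suc i)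
    have "c ^^ (2 ^ Suc i) = c ^^ (2 ^ i) \<circ> c ^^ (2 ^ i)" by (simp only: power_Suc mult_2 funpow_add)
    then show ?case using closed(2)[OF Suc.IH Suc.IH] by (simp only:)
  qed (use that in simp)
  have "card C \<le> card ((\<lambda>c. c ^^ (2 ^ i)) ` C) * 2 ^ i" for i
  proof (induction i)
    case (Suc i)
    let ?S = "(\<lambda>c. c ^^ (2 ^ i)) ` C"
    have "(\<lambda>c. c ^^ 2) ` ?S = (\<lambda>c. c ^^ (2 ^ Suc i)) ` C"
      by (simp add: image_image funpow_mult mult.commute)
    moreover have "card ?S \<le> card ((\<lambda>c. c ^^ 2) ` ?S) * 2"
      by (rule square_eq_fibre[OF unique C closed]) (use pC in auto)
    ultimately have "card ?S * 2 ^ i \<le> (card ((\<lambda>c. c ^^ (2 ^ Suc i)) ` C) * 2) * 2 ^ i" by (simp only: mult_le_mono1)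
    with Suc.IH have "card C \<le> (card ((\<lambda>c. c ^^ (2 ^ Suc i)) ` C) * 2) * 2 ^ i" by (rule order_trans)
    then show ?case by (simp only: power_Suc mult.assoc)
  qed simp
  also have "(\<lambda>c. c ^^ (2 ^ j)) ` C \<subseteq> {id}" using exp by auto
  then have "card ((\<lambda>c. c ^^ (2 ^ j)) ` C) \<le> card {id :: real^8 \<Rightarrow> real^8}" by (rule card_mono[rotated]) simp
  then have "card ((\<lambda>c. c ^^ (2 ^ j)) ` C) * 2 ^ j \<le> 1 * 2 ^ j" by (intro mult_le_mono1) simp
  finally show ?thesis by simp
qed

text \<open>For a nontrivial odd part B the sum over B is either nonzero somewhere on the lattice,
  where \<open>odd_part_bound\<close> applies, or zero, where B satisfies \<open>odd_free\<close>.
  Both keep the order below 256.\<close>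

lemma large_is_two_group:
  assumes "card A \<ge> 256" shows "\<exists>k\<ge>1. \<forall>a\<in>A. a ^^ (2 ^ k) = id"
proof -
  have "card A \<noteq> 0" using assms by simp
  then obtain k0 q where q0: "card A = q * 2 ^ k0" "odd q"
    using prime_power_canonical[of 2 "card A"] by (auto simp: two_is_prime_nat)
  then have q: "card A = 2 ^ k0 * q" "odd q" by (simp_all add: mult.commute)
  \<comment> \<open>One more than the exponent of 2 in the order, so that k >= 1 as the Frobenius
    lemmas demand.\<close>
  define k where "k = Suc k0"
  define B where "B = {a \<in> A. a ^^ q = id}"
  have BA: "B \<subseteq> A" by (auto simp: B_def)
  have finB: "finite B" using BA finite_A by (rule finite_subset)
  have idB: "id \<in> B" using id_A by (simp add: B_def)
  have compB: "a \<circ> b \<in> B" if "a \<in> B" "b \<in> B" for a b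
    using that comp_A funpow_comp[of a b q] by (simp add: B_def)
  have pow: "a ^^ (2 ^ k) \<in> B" if a: "a \<in> A" for a
  proof -
    have "(a ^^ (2 ^ k)) ^^ q = (a ^^ card A) ^^ 2" by (simp add: funpow_mult q(1) k_def mult.commute mult.left_commute)
    also have "\<dots> = id" using pow_card[OF a] by simp
    finally show ?thesis using pow_A[OF a] by (simp add: B_def)
  qed
  \<comment> \<open>Inversion pairs off the nonidentity elements of B; one equal to its inverse
    would satisfy a^q = a, while a^q = id.\<close>
  have oddB: "odd (card B)"
  proof -
    have invB: "inv_into UNIV a \<in> B" "inv_into UNIV (inv_into UNIV a) = a" "bij a" if a: "a \<in> B" for a
    proof -
      have aA: "a \<in> A" using a BA by blast
      obtain a' where a': "a' \<in> A" "a' \<circ> a = id" "a \<circ> a' = id" using inv_A[OF aA] by blast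
      have i: "inv_into UNIV a = a'" by (rule inv_unique_comp[OF a'(3,2)])
      show bij: "bij a" by (rule o_bij[OF a'(2,3)])
      have "a' ^^ q = a' ^^ q \<circ> a ^^ q" using a by (simp add: B_def)
      also have "\<dots> = id" using funpow_comp[OF a'(1) aA, of q] a'(2) by simp
      finally show "inv_into UNIV a \<in> B" using a'(1) i by (simp add: B_def)
      show "inv_into UNIV (inv_into UNIV a) = a" by (rule inv_inv_eq[OF bij])
    qed
    have "even (card (B - {id}))"
    proof (rule even_card_involution[where f="inv_into UNIV"])
      fix a assume a: "a \<in> B - {id}"
      then have aB: "a \<in> B" by blast
      show "inv_into UNIV (inv_into UNIV a) = a" by (rule invB(2)[OF aB])
      have "inv_into UNIV a \<noteq> id"
      proof
        assume "inv_into UNIV a = id"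
        then have "a = inv_into UNIV id" using invB(2)[OF aB] by simp
        then show False using a by simp
      qed
      then show "inv_into UNIV a \<in> B - {id}" using invB(1)[OF aB] by blast
      show "inv_into UNIV a \<noteq> a"
      proof
        assume "inv_into UNIV a = a"
        then have "a \<circ> a = id" using invB(3)[OF aB] by (metis bij_is_inj inv_o_cancel)
        then have a2: "a ^^ 2 = id" by (simp add: numeral_2_eq_2)
        obtain m where m: "q = Suc (2 * m)" using q(2) oddE by (metis Suc_eq_plus1)
        have "a ^^ q = a \<circ> (a ^^ 2) ^^ m" unfolding m by (simp add: funpow_mult)
        then have "a ^^ q = a" using a2 by simp
        then show False using a by (simp add: B_def)
      qed
    qed (use finB in simp)
    moreover have "card B = Suc (card (B - {id}))" using card.remove[OF finB idB] .
    ultimately show ?thesis by simp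
  qed
  have ex: "\<exists>x\<in>E8_lattice. (\<Sum>b\<in>B. b x) \<noteq> 0"
  proof (rule ccontr)
    assume none: "\<not> ?thesis"
    have lin: "linear (\<lambda>x. \<Sum>b\<in>B. b x)" using BA linear_A by (intro linear_compose_sum) auto
    have zero: "(\<Sum>b\<in>B. b x) = 0" for x
      using linear_eq_0_on_span[OF lin, of E8_lattice x] none by (auto simp: span_E8_lattice)
    interpret odd_free A B
    proof
      show "B \<subseteq> A" by (rule BA)
      show "\<exists>n. odd n \<and> b ^^ n = id" if "b \<in> B" for b using that q(2) by (auto simp: B_def)
      show "x = 0" if "\<And>b. b \<in> B \<Longrightarrow> b x = x" for x
      proof -
        have "(\<Sum>b\<in>B. b x) = (\<Sum>b\<in>B. x)" using that by (intro sum.cong) auto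
        also have "\<dots> = real (card B) *\<^sub>R x" by (simp only: sum_constant_scaleR)
        finally have "(\<Sum>b\<in>B. b x) = real (card B) *\<^sub>R x" .
        moreover have "card B \<noteq> 0" by (intro notI) (use oddB in simp)
        ultimately show ?thesis using zero[of x] by simp
      qed
    qed
    show False using no_fixed_bound assms by simp
  qed
  then obtain x1 where x1: "x1 \<in> E8_lattice" "(\<Sum>b\<in>B. b x1) \<noteq> 0" by blast
  have "B = {id}"
  proof (rule ccontr)
    assume "B \<noteq> {id}"
    then obtain o1 where o1: "o1 \<in> B" "o1 \<noteq> id" using idB by blast
    have "o1 \<noteq> (\<lambda>x. - x)"
    proof
      assume e: "o1 = (\<lambda>x. - x)"
      have "linear o1" using o1(1) BA linear_A by blast
      from odd_power_minus[OF this _ q(2), of "axis 1 1"] e have "(o1 ^^ q) (axis 1 1) = - axis 1 1" by simp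
      then have "axis 1 (1::real) = - axis (1::8) 1" using o1(1) by (simp add: B_def)
      from arg_cong[OF this, of "\<lambda>v. v $ 1"] show False by simp
    qed
    then have "card A < 256"
      using odd_part_bound[OF _ BA idB oddB compB pow o1 _ x1] by (simp add: k_def)
    then show False using assms by simp
  qed
  then have "\<forall>a\<in>A. a ^^ (2 ^ k) = id" using pow by blast
  then show ?thesis by (intro exI[of _ k]) (simp add: k_def)
qed

text \<open>t is an involution fixing D whose (-1)-eigenspace U has minimal dimension n. Minimality
  makes t the only involution in the group C of elements acting only on U, and the bound on the
  complement leaves C at least 2^n elements. Hence C has elements of order at least 2^n, which is
  impossible unless n = 1; then t is a reflection.\<close>

lemma ex_reflection:
  assumes big: "card A \<ge> 256" and D: "D \<subseteq> E8_roots" "\<And>d. d \<in> D \<Longrightarrow> reflection d \<in> A" "finite D" "card D < 8"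
  shows "\<exists>r\<in>E8_roots. reflection r \<in> A \<and> (\<forall>d\<in>D. r \<bullet> d = 0)"
proof -
  obtain K where K: "K \<ge> 1" "\<And>a. a \<in> A \<Longrightarrow> a ^^ (2 ^ K) = id" using large_is_two_group[OF big] by blast
  have dd: "d \<bullet> d = 2" if "d \<in> D" for d using D(1) that by (auto simp: E8_roots_eq)
  have refl: "reflection d x = x - (x \<bullet> d) *\<^sub>R d" if "d \<in> D" for d x using dd[OF that] by (simp add: reflection_def)
  \<comment> \<open>a commutes with the reflection in d and so preserves its (-1)-eigenline.\<close>
  have pm: "a d = d \<or> a d = - d" if a: "a \<in> A" and d: "d \<in> D" for a d
  proof -
    have dn: "reflection d d = - d" using refl[OF d] dd[OF d] by (simp add: scaleR_2)
    have "reflection d (a d) = a (reflection d d)" by (rule comm_app[OF D(2)[OF d] a])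
    also have "\<dots> = - a d" unfolding dn by (rule linear_neg[OF linear_A[OF a]])
    finally have "2 *\<^sub>R a d = (a d \<bullet> d) *\<^sub>R d" using refl[OF d, of "a d"] by (simp add: scaleR_2 algebra_simps)
    moreover have "a d = (1/2) *\<^sub>R (2 *\<^sub>R a d)" by simp
    ultimately have "a d = (1/2) *\<^sub>R ((a d \<bullet> d) *\<^sub>R d)" by (simp only:)
    then have ad: "a d = ((a d \<bullet> d) / 2) *\<^sub>R d" by simp
    define c where "c = (a d \<bullet> d) / 2"
    have "(c *\<^sub>R d) \<bullet> (c *\<^sub>R d) = d \<bullet> d" using isometry_A[OF a, of d d] ad by (simp add: c_def)
    then have "c * c = 1" using dd[OF d] by simp
    then have "c = 1 \<or> c = -1" by (simp add: square_eq_1_iff)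
    then show ?thesis using ad by (auto simp: c_def[symmetric])
  qed
  \<comment> \<open>At most 2^7 sign patterns on D are available to at least 256 elements; two that
    agree have a quotient b that fixes D pointwise.\<close>
  have "\<not> inj_on (\<lambda>a. {d \<in> D. a d = d}) A"
  proof
    assume "inj_on (\<lambda>a. {d \<in> D. a d = d}) A"
    then have "card A \<le> card (Pow D)" by (rule card_inj_on_le) (use D(3) in auto)
    also have "\<dots> = 2 ^ card D" by (rule card_Pow[OF D(3)])
    also have "\<dots> \<le> 2 ^ 7" using D(4) by (intro power_increasing) auto
    finally show False using big by simp
  qed
  then obtain a a1 where aa: "a \<in> A" "a1 \<in> A" "a \<noteq> a1" "{d \<in> D. a d = d} = {d \<in> D. a1 d = d}"
    unfolding inj_on_def by blast
  have agree: "a d = a1 d" if "d \<in> D" for d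
    using pm[OF aa(1) that] pm[OF aa(2) that] aa(4) that by (metis (mono_tags, lifting) mem_Collect_eq)
  obtain a' where a': "a' \<in> A" "\<And>x. a' (a1 x) = x" "\<And>x. a1 (a' x) = x" using inv_app[OF aa(2)] by metis
  define b where "b = (\<lambda>x. a' (a x))"
  have bA: "b \<in> A" unfolding b_def by (rule comp_app[OF a'(1) aa(1)])
  have bD: "b d = d" if "d \<in> D" for d using agree[OF that] a'(2) by (simp add: b_def)
  have "b \<noteq> id"
  proof
    assume "b = id"
    then have "a1 (a' (a x)) = a1 x" for x by (simp add: b_def fun_eq_iff)
    then show False using aa(3) a'(3) by (simp add: fun_eq_iff)
  qed
  then obtain j where j: "b ^^ (2 ^ j) \<noteq> id" "b ^^ (2 ^ Suc j) = id"
    using involution_power[OF bA _ K(2)[OF bA]] by blast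
  have bpD: "(b ^^ n) d = d" if "d \<in> D" for n d by (induction n) (simp_all add: bD[OF that])
  define P where "P t \<longleftrightarrow> t \<in> A \<and> t \<circ> t = id \<and> t \<noteq> id \<and> (\<forall>d\<in>D. t d = d)" for t
  have "P (b ^^ (2 ^ j))" unfolding P_def using pow_A[OF bA] j bpD by (simp add: mult_2 funpow_add)
  then have "\<exists>t. P t \<and> (\<forall>s. P s \<longrightarrow> dim {x. t x = - x} \<le> dim {x. s x = - x})"
    using ex_has_least_nat[where m="\<lambda>t. dim {x. t x = - x}" and P=P] by blast
  then obtain t where t: "P t" and least: "\<And>s. P s \<Longrightarrow> dim {x. t x = - x} \<le> dim {x. s x = - x}" by blast
  have tA: "t \<in> A" and tt: "\<And>x. t (t x) = x" and tid: "t \<noteq> id" and tD: "\<And>d. d \<in> D \<Longrightarrow> t d = d"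
    using t by (auto simp: P_def fun_eq_iff)
  define U where "U = {x. t x = - x}"
  define V where "V = {x. t x = x}"
  define n where "n = dim U"
  have lt: "linear t" by (rule linear_A[OF tA])
  have subU: "subspace U" unfolding U_def subspace_def using linear_0[OF lt] linear_add[OF lt] linear_cmul[OF lt] by auto
  have subV: "subspace V" unfolding V_def subspace_def using linear_0[OF lt] linear_add[OF lt] linear_cmul[OF lt] by auto
  have UV: "x \<bullet> y = 0" if "x \<in> U" "y \<in> V" for x y
    using isometry_A[OF tA, of x y] that by (simp add: U_def V_def)
  have inV: "y \<in> V" if "\<And>x. x \<in> U \<Longrightarrow> y \<bullet> x = 0" for y
  proof -
    have "t (y - t y) = - (y - t y)" by (simp add: linear_diff[OF lt] tt)
    then have u: "y - t y \<in> U" by (simp add: U_def)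
    have "(y - t y) \<bullet> (y - t y) = 0"
    proof -
      have "t y \<bullet> (y - t y) = y \<bullet> t (y - t y)" using isometry_A[OF tA, of y "t (y - t y)"] tt by simp
      also have "t (y - t y) = - (y - t y)" using u by (simp add: U_def)
      finally have "t y \<bullet> (y - t y) = - (y \<bullet> (y - t y))" by (simp only: inner_minus_right)
      then have "t y \<bullet> (y - t y) = 0" by (simp only: that[OF u])
      then show ?thesis using that[OF u] by (simp add: inner_diff_left)
    qed
    then have "y - t y = 0" by (simp only: inner_eq_zero_iff)
    then show ?thesis by (simp add: V_def)
  qed
  have Vorth: "V = {y \<in> UNIV. \<forall>x\<in>U. y \<bullet> x = 0}"
  proof (intro subset_antisym subsetI)
    fix y assume "y \<in> V"
    then show "y \<in> {y \<in> UNIV. \<forall>x\<in>U. y \<bullet> x = 0}" using UV[of _ y] by (simp add: inner_commute)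
  qed (use inV in simp)
  have dims: "dim V + n = 8"
    using dim_orthogonal_part[OF subU subspace_UNIV] unfolding Vorth n_def by (simp add: dim_UNIV)
  have split: "x = (1/2) *\<^sub>R (x + t x) + (1/2) *\<^sub>R (x - t x)" "(1/2) *\<^sub>R (x + t x) \<in> V" "(1/2) *\<^sub>R (x - t x) \<in> U" for x
  proof -
    have "x + t x \<in> V" "x - t x \<in> U" by (simp_all add: V_def U_def linear_add[OF lt] linear_diff[OF lt] tt)
    then show "(1/2) *\<^sub>R (x + t x) \<in> V" "(1/2) *\<^sub>R (x - t x) \<in> U" using subspace_scale subU subV by auto
    show "x = (1/2) *\<^sub>R (x + t x) + (1/2) *\<^sub>R (x - t x)" by (simp add: algebra_simps flip: scaleR_add_left)
  qed
  have eq_UV: "a = b" if "a \<in> A" "b \<in> A" "\<And>x. x \<in> U \<Longrightarrow> a x = b x" "\<And>x. x \<in> V \<Longrightarrow> a x = b x" for a b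
  proof
    fix x
    have "a ((1/2) *\<^sub>R (x + t x) + (1/2) *\<^sub>R (x - t x)) = b ((1/2) *\<^sub>R (x + t x) + (1/2) *\<^sub>R (x - t x))"
      using that(3)[OF split(3)] that(4)[OF split(2)]
      by (simp only: linear_add[OF linear_A[OF that(1)]] linear_add[OF linear_A[OF that(2)]])
    then show "a x = b x" using split(1)[of x] by simp
  qed
  have invU: "a x \<in> U" if "a \<in> A" "x \<in> U" for a x
    using that comm_app[OF tA that(1), of x] by (simp add: U_def linear_neg[OF linear_A[OF that(1)]])
  have invV: "a x \<in> V" if "a \<in> A" "x \<in> V" for a x
    using that comm_app[OF tA that(1), of x] by (simp add: V_def)
  define C where "C = {a \<in> A. \<forall>y\<in>V. a y = y}"
  have CA: "C \<subseteq> A" by (auto simp: C_def)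
  have tC: "t \<in> C" using tA by (auto simp: C_def V_def)
  have closed1: "b \<in> C" if "a \<in> C" "b \<in> A" "b \<circ> a = id" for a b
  proof -
    have "b y = y" if y: "y \<in> V" for y
      using fun_cong[OF \<open>b \<circ> a = id\<close>, of y] \<open>a \<in> C\<close> y by (simp add: C_def)
    then show ?thesis using that(2) by (simp add: C_def)
  qed
  have closed2: "a \<circ> b \<in> C" if "a \<in> C" "b \<in> C" for a b using that comp_A by (auto simp: C_def)
  \<comment> \<open>The (-1)-eigenspace of another involution of C lies inside U, equals U by
    minimality, and then the involution is t.\<close>
  have unique: "s = id \<or> s = t" if s: "s \<in> C" "s \<circ> s = id" for s
  proof (rule ccontr)
    assume "\<not> ?thesis"
    then have ns: "s \<noteq> id" "s \<noteq> t" by auto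
    have sA: "s \<in> A" and sV: "\<And>y. y \<in> V \<Longrightarrow> s y = y" using s by (auto simp: C_def)
    have "P s" unfolding P_def using sA s(2) ns(1) sV tD by (auto simp: V_def)
    then have le: "n \<le> dim {x. s x = - x}" unfolding n_def U_def by (rule least)
    have sub: "{x. s x = - x} \<subseteq> U"
    proof
      fix x assume "x \<in> {x. s x = - x}"
      then have sx: "s x = - x" by simp
      have perp: "x \<bullet> y = 0" if "y \<in> V" for y using isometry_A[OF sA, of x y] sx sV[OF that] by simp
      then have "(1/2) *\<^sub>R (x + t x) \<bullet> x = 0" by (subst inner_commute) (rule perp[OF split(2)])
      moreover have "(1/2) *\<^sub>R (x + t x) \<bullet> ((1/2) *\<^sub>R (x - t x)) = 0" using UV[OF split(3) split(2), of x x] by (simp add: inner_commute)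
      ultimately have "(1/2) *\<^sub>R (x + t x) \<bullet> ((1/2) *\<^sub>R (x + t x)) = 0"
        using arg_cong[OF split(1)[of x], of "\<lambda>z. (1/2) *\<^sub>R (x + t x) \<bullet> z"] by (simp only: inner_add_right)
      then have "x + t x = 0" by simp
      then show "x \<in> U" by (simp add: U_def eq_neg_iff_add_eq_0 add.commute)
    qed
    have ls: "linear s" by (rule linear_A[OF sA])
    have "subspace {x. s x = - x}" unfolding subspace_def using linear_0[OF ls] linear_add[OF ls] linear_cmul[OF ls] by auto
    then have "{x. s x = - x} = U" using subspace_dim_equal[OF _ subU sub] le by (simp add: n_def)
    then have "s x = t x" if "x \<in> U" for x using that by (auto simp: U_def)
    moreover have "s x = t x" if "x \<in> V" for x using sV[OF that] that by (simp add: V_def)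
    ultimately have "s = t" by (intro eq_UV[OF sA tA]) auto
    then show False using ns by simp
  qed
  define L where "L = E8_lattice \<inter> V"
  have L: "add_closed L" "L \<subseteq> E8_lattice" "inv_set L"
    using subV invV lattice_A by (auto simp: L_def add_closed_def inv_set_def intro: subspace_0 subspace_diff)
  have agreeV: "a y = b y" if ab: "a \<in> A" "b \<in> A" "restrict a L = restrict b L" and y: "y \<in> V" for a b y
  proof -
    have onL: "a x = b x" if "x \<in> L" for x using fun_cong[OF ab(3), of x] that by simp
    have "a (x + t x) = b (x + t x)" if "x \<in> E8_lattice" for x
      using that lattice_A[OF tA that] by (intro onL) (simp add: L_def V_def linear_add[OF lt] tt)
    moreover have "linear (\<lambda>x. a (x + t x))" "linear (\<lambda>x. b (x + t x))"
      using linear_compose[OF linear_compose_add[OF linear_id lt] linear_A[OF ab(1)]]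
        linear_compose[OF linear_compose_add[OF linear_id lt] linear_A[OF ab(2)]] by (simp_all add: comp_def)
    ultimately have "a (y + t y) = b (y + t y)"
      using linear_eq_on_span[of "\<lambda>x. a (x + t x)" "\<lambda>x. b (x + t x)" E8_lattice y] by (simp add: span_E8_lattice)
    moreover have "y + t y = 2 *\<^sub>R y" using y by (simp add: V_def scaleR_2)
    ultimately show ?thesis by (simp add: linear_cmul[OF linear_A[OF ab(1)]] linear_cmul[OF linear_A[OF ab(2)]])
  qed
  \<comment> \<open>The fibres of restriction to L inject into C because the lattice vectors in V
    span V. With \<open>two_group_bound\<close> for L this gives 2^n <= |C|.\<close>
  have "card A \<le> card ((\<lambda>a. restrict a L) ` A) * card C"
  proof (rule card_le_fibres[OF finite_A])
    show "finite ((\<lambda>a. restrict a L) ` A)" using finite_A by simp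
    fix a assume a: "a \<in> A"
    obtain a' where a': "a' \<in> A" "\<And>x. a' (a x) = x" "\<And>x. a (a' x) = x" using inv_app[OF a] by metis
    have "inj_on (\<lambda>b x. a' (b x)) {b \<in> A. restrict b L = restrict a L}"
    proof (rule inj_onI)
      fix b c assume e: "(\<lambda>x. a' (b x)) = (\<lambda>x. a' (c x))"
      have "b x = c x" for x using fun_cong[OF e, of x] a'(3) by metis
      then show "b = c" by blast
    qed
    moreover have "(\<lambda>b x. a' (b x)) ` {b \<in> A. restrict b L = restrict a L} \<subseteq> C"
    proof (rule image_subsetI)
      fix b assume "b \<in> {b \<in> A. restrict b L = restrict a L}"
      then have b: "b \<in> A" "restrict b L = restrict a L" by auto
      show "(\<lambda>x. a' (b x)) \<in> C"
        using comp_app[OF a'(1) b(1)] agreeV[OF b(1) a b(2)] a'(2) by (simp add: C_def)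
    qed
    ultimately show "card {b \<in> A. restrict b L = restrict a L} \<le> card C"
      using finite_A CA by (intro card_inj_on_le[of "\<lambda>b x. a' (b x)"]) (auto intro: finite_subset)
  qed
  also have "\<dots> \<le> 2 ^ dim V * card C"
  proof (rule mult_le_mono1)
    have "card ((\<lambda>a. restrict a L) ` A) \<le> 2 ^ dim L" by (rule two_group_bound[OF K(1,2) L])
    also have "\<dots> \<le> 2 ^ dim V" using dim_subset[of L V] by (simp add: L_def)
    finally show "card ((\<lambda>a. restrict a L) ` A) \<le> 2 ^ dim V" .
  qed
  finally have "2 ^ dim V * 2 ^ n \<le> 2 ^ dim V * card C" using big dims by (simp flip: power_add)
  then have Cn: "2 ^ n \<le> card C" by simp
  have exp: "\<exists>c\<in>C. c ^^ (2 ^ j) \<noteq> id" if "j < n" for j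
  proof (rule ccontr)
    assume "\<not> ?thesis"
    then have "card C \<le> 2 ^ j" by (intro card_le_exponent[OF unique CA closed1 closed2]) auto
    then have "(2::nat) ^ n \<le> 2 ^ j" by (rule order_trans[OF Cn])
    then show False using that by simp
  qed
  have n0: "n \<noteq> 0"
  proof
    assume "n = 0"
    then have "U \<subseteq> {0}" by (simp add: n_def)
    then have "(1/2) *\<^sub>R (x - t x) = 0" for x using split(3)[of x] by blast
    then show False using tid by (auto simp: fun_eq_iff)
  qed
  have n8: "n \<le> 8" using dims by simp
  \<comment> \<open>For 4 <= n < 8 some c in C has c^8 = -1 although c fixes the nonzero space V.
    For n = 8 some d has nontrivial 16th power although its 8th power is 1 or -1.\<close>
  have "\<not> n \<ge> 4"
  proof
    assume n4: "n \<ge> 4"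
    obtain c where c: "c \<in> C" "c ^^ (2 ^ 3) \<noteq> id" using exp[of 3] n4 by auto
    have c8: "c ^^ 8 = id \<or> c ^^ 8 = (\<lambda>x. - x)" if "c \<in> C" for c
      using two_power_congruent[OF _ K(2), of c] that CA by blast
    show False
    proof (cases "n = 8")
      case True
      then obtain d where d: "d \<in> C" "d ^^ (2 ^ 4) \<noteq> id" using exp[of 4] by auto
      have "d ^^ (2 ^ 4) = d ^^ 8 \<circ> d ^^ 8" by (simp flip: funpow_add)
      then show False using c8[OF d(1)] d(2) by (auto simp: fun_eq_iff)
    next
      case False
      then have "dim V \<noteq> 0" using dims n8 by linarith
      then have "\<not> V \<subseteq> {0}" by simp
      then obtain y where y: "y \<in> V" "y \<noteq> 0" by blast
      have "(c ^^ m) y = y" for m using c(1) y by (induction m) (auto simp: C_def)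
      then have "(c ^^ 8) y = y" .
      moreover have "c ^^ 8 = (\<lambda>x. - x)" using c8[OF c(1)] c(2) by simp
      ultimately have "y = - y" by simp
      then have "2 *\<^sub>R y = 0" by (simp add: scaleR_2 eq_neg_iff_add_eq_0)
      then show False using y(2) by simp
    qed
  qed
  \<comment> \<open>An element of C with nontrivial square has a power J with J^2 = t: a complex
    structure on U that is trivial on V.\<close>
  moreover have "\<not> (n = 2 \<or> n = 3)"
  proof
    assume n23: "n = 2 \<or> n = 3"
    obtain c where c: "c \<in> C" "c ^^ (2 ^ 1) \<noteq> id" using exp[of 1] n23 by auto
    have cA: "c \<in> A" using c(1) CA by blast
    have "c \<noteq> id" using c(2) by auto
    then obtain j where j: "c ^^ (2 ^ j) \<noteq> id" "c ^^ (2 ^ Suc j) = id"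
      using involution_power[OF cA _ K(2)[OF cA]] by blast
    have pC: "c ^^ m \<in> C" for m
    proof (induction m)
      case 0 show ?case using id_A by (auto simp: C_def id_def)
    next
      case (Suc m) show ?case using closed2[OF c(1) Suc.IH] unfolding funpow.simps .
    qed
    have "c ^^ (2 ^ j) \<circ> c ^^ (2 ^ j) = id" using j(2) by (simp add: mult_2 funpow_add)
    then have ct: "c ^^ (2 ^ j) = t" using unique[OF pC] j(1) by blast
    have "j \<noteq> 0" using c(2) j(2) by (intro notI) simp
    then obtain i where i: "j = Suc i" by (cases j) auto
    define J where "J = c ^^ (2 ^ i)"
    have JC: "J \<in> C" unfolding J_def by (rule pC)
    have JA: "J \<in> A" using JC CA by blast
    have JJ: "J (J x) = t x" for x using fun_cong[OF ct, of x] unfolding i J_def by (simp add: mult_2 funpow_add)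
    have JU: "J (J x) = - x" if "x \<in> U" for x using JJ[of x] that by (simp add: U_def)
    have JV: "J y = y" if "\<And>x. x \<in> U \<Longrightarrow> y \<bullet> x = 0" for y using JC inV[OF that] by (simp add: C_def)
    have "dim U \<noteq> 3" by (rule complex_structure_dim3[OF JA subU invU[OF JA] JU])
    moreover have "dim U \<noteq> 2" by (rule complex_structure_dim2[OF JA subU invU[OF JA] JU JV])
    ultimately show False using n23 by (simp add: n_def)
  qed
  ultimately have n1: "dim U = 1" using n0 unfolding n_def by linarith
  have tV: "t y = y" if "\<And>x. x \<in> U \<Longrightarrow> y \<bullet> x = 0" for y using inV[OF that] by (simp add: V_def)
  have "\<exists>r\<in>E8_roots. r \<in> U \<and> t = reflection r"
    by (rule line_involution[OF tA subU n1 _ tV]) (simp_all add: U_def)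
  then obtain r where r: "r \<in> E8_roots" "r \<in> U" "t = reflection r" by blast
  have "r \<bullet> d = 0" if "d \<in> D" for d using UV[OF r(2)] tD[OF that] by (simp add: V_def)
  then show ?thesis using r tA by blast
qed

theorem ex_frame:
  assumes big: "card A \<ge> 256"
  shows "\<exists>\<beta>. root_frame \<beta> \<and> (\<forall>i<8. reflection (\<beta> i) \<in> A)"
proof -
  have "\<exists>D. D \<subseteq> E8_roots \<and> (\<forall>d\<in>D. reflection d \<in> A) \<and> finite D \<and> card D = n \<and> (\<forall>d\<in>D. \<forall>e\<in>D. d \<noteq> e \<longrightarrow> d \<bullet> e = 0)" if "n \<le> 8" for n
    using that
  proof (induction n)
    case 0
    show ?case by (intro exI[of _ "{}"]) simp
  next
    case (Suc n)
    then obtain D where D: "D \<subseteq> E8_roots" "\<forall>d\<in>D. reflection d \<in> A" "finite D" "card D = n" "\<forall>d\<in>D. \<forall>e\<in>D. d \<noteq> e \<longrightarrow> d \<bullet> e = 0"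
      by auto
    obtain r where r: "r \<in> E8_roots" "reflection r \<in> A" "\<forall>d\<in>D. r \<bullet> d = 0"
      using ex_reflection[OF big D(1) _ D(3)] D(2,4) Suc.prems by auto
    have "r \<bullet> r = 2" using r(1) by (simp add: E8_roots_eq)
    then have "r \<notin> D" using r(3) by auto
    then show ?case using D r by (intro exI[of _ "insert r D"]) (auto simp: inner_commute)
  qed
  from this[of 8] obtain D where D: "D \<subseteq> E8_roots" "\<forall>d\<in>D. reflection d \<in> A" "finite D" "card D = 8"
    "\<forall>d\<in>D. \<forall>e\<in>D. d \<noteq> e \<longrightarrow> d \<bullet> e = 0" by auto
  obtain \<beta> where \<beta>: "bij_betw \<beta> {..<8::nat} D"
    using ex_bij_betw_nat_finite[OF D(3)] D(4) by (auto simp: atLeast0LessThan)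
  have bD: "\<beta> i \<in> D" if "i < 8" for i using \<beta> that by (auto simp: bij_betw_def)
  have inj: "\<beta> i \<noteq> \<beta> j" if "i < 8" "j < 8" "i \<noteq> j" for i j
    using \<beta> that by (auto simp: bij_betw_def inj_on_def)
  have "root_frame \<beta>" by unfold_locales (use bD inj D in auto)
  then show ?thesis using bD D(2) by blast
qed

end

section \<open>Maximal Abelian subgroups of the Weyl group\<close>

lemma reflection_root: "a \<in> E8_roots \<Longrightarrow> reflection a x = x - (x \<bullet> a) *\<^sub>R a"
  by (simp add: reflection_def E8_roots_eq)

lemma reflection_reflection: "a \<in> E8_roots \<Longrightarrow> reflection a \<circ> reflection a = id"
  by (simp add: fun_eq_iff reflection_root E8_roots_eq inner_diff_left algebra_simps scaleR_2[symmetric])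

lemma linear_reflection: "linear (reflection a)"
  by (intro linearI) (simp_all add: reflection_def inner_add_left add_divide_distrib algebra_simps)

lemma reflection_inner: "a \<in> E8_roots \<Longrightarrow> reflection a x \<bullet> reflection a y = x \<bullet> y"
  by (simp add: reflection_root E8_roots_eq inner_diff_left inner_diff_right inner_commute[of a x] inner_commute[of a y])

lemma reflection_lattice:
  assumes a: "a \<in> E8_roots" and x: "x \<in> E8_lattice" shows "reflection a x \<in> E8_lattice"
proof -
  have al: "a \<in> E8_lattice" using a by (simp add: E8_roots_eq)
  obtain n where "x \<bullet> a = of_int n" using E8_lattice_inner[OF x al] by (rule Ints_cases)
  then show ?thesis
    using E8_lattice_diff[OF x add_closed_scale_int[OF add_closed_E8_lattice al, of n]] by (simp add: reflection_root[OF a])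
qed

lemma reflection_W: "a \<in> E8_roots \<Longrightarrow> reflection a \<in> W_E8_carrier"
  using W_refl[OF _ W_id] by simp

lemma W_linear: "w \<in> W_E8_carrier \<Longrightarrow> linear w"
  by (induction rule: W_E8_carrier.induct) (use linear_id linear_compose[OF _ linear_reflection] in blast)+

lemma W_inner: "w \<in> W_E8_carrier \<Longrightarrow> w x \<bullet> w y = x \<bullet> y"
  by (induction rule: W_E8_carrier.induct) (simp_all add: reflection_inner)

lemma W_lattice: "w \<in> W_E8_carrier \<Longrightarrow> x \<in> E8_lattice \<Longrightarrow> w x \<in> E8_lattice"
  by (induction rule: W_E8_carrier.induct) (simp_all add: reflection_lattice)

lemma W_root: "w \<in> W_E8_carrier \<Longrightarrow> x \<in> E8_roots \<Longrightarrow> w x \<in> E8_roots"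
  by (simp add: E8_roots_eq W_lattice W_inner)

lemma W_comp: "u \<in> W_E8_carrier \<Longrightarrow> v \<in> W_E8_carrier \<Longrightarrow> u \<circ> v \<in> W_E8_carrier"
  by (induction rule: W_E8_carrier.induct) (auto simp: comp_assoc intro: W_E8_carrier.W_refl)

lemma W_inverse: "w \<in> W_E8_carrier \<Longrightarrow> \<exists>v\<in>W_E8_carrier. v \<circ> w = id \<and> w \<circ> v = id"
proof (induction rule: W_E8_carrier.induct)
  case W_id
  show ?case by (rule bexI[of _ id, OF _ W_E8_carrier.W_id]) simp
next
  case (W_refl a w)
  then obtain v where v: "v \<in> W_E8_carrier" "v \<circ> w = id" "w \<circ> v = id" by blast
  have r: "reflection a (reflection a x) = x" for x
    using reflection_reflection[OF W_refl(1)] by (simp add: fun_eq_iff)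
  have "(v \<circ> reflection a) \<circ> (reflection a \<circ> w) = id" "(reflection a \<circ> w) \<circ> (v \<circ> reflection a) = id"
    using v(2,3) r by (simp_all add: fun_eq_iff)
  then show ?case using W_comp[OF v(1) reflection_W[OF W_refl(1)]] by blast
qed

lemma carrier_W [simp]: "carrier W_E8 = W_E8_carrier"
  and mult_W [simp]: "x \<otimes>\<^bsub>W_E8\<^esub> y = x \<circ> y"
  and one_W [simp]: "\<one>\<^bsub>W_E8\<^esub> = id"
  by (simp_all add: W_E8_def)

interpretation W: group W_E8
proof (rule groupI)
  show "\<exists>y\<in>carrier W_E8. y \<otimes>\<^bsub>W_E8\<^esub> x = \<one>\<^bsub>W_E8\<^esub>" if "x \<in> carrier W_E8" for x
    using W_inverse[of x] that by auto
qed (auto intro: W_comp W_E8_carrier.W_id simp: comp_assoc)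

lemma inv_W: "w \<in> W_E8_carrier \<Longrightarrow> inv\<^bsub>W_E8\<^esub> w \<circ> w = id" "w \<in> W_E8_carrier \<Longrightarrow> w \<circ> inv\<^bsub>W_E8\<^esub> w = id"
  using W.l_inv[of w] W.r_inv[of w] by auto

lemma abelian_isometries_W:
  assumes M: "abelian_subgroup_W M" and fin: "finite M" shows "abelian_isometries M"
proof -
  have sg: "subgroup M W_E8" and cm: "\<And>x y. x \<in> M \<Longrightarrow> y \<in> M \<Longrightarrow> x \<circ> y = y \<circ> x"
    using M by (auto simp: abelian_subgroup_W_def)
  have MW: "w \<in> W_E8_carrier" if "w \<in> M" for w using subgroup.mem_carrier[OF sg that] by simp
  show ?thesis
  proof (rule abelian_isometries.intro)
    show "id \<in> M" using subgroup.one_closed[OF sg] by simp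
    show "a \<circ> b \<in> M" if "a \<in> M" "b \<in> M" for a b using subgroup.m_closed[OF sg that] by simp
    show "\<exists>b\<in>M. b \<circ> a = id \<and> a \<circ> b = id" if "a \<in> M" for a
      using subgroup.m_inv_closed[OF sg that] inv_W[OF MW[OF that]] by blast
    show "finite M" by (rule fin)
    show "a \<circ> b = b \<circ> a" if "a \<in> M" "b \<in> M" for a b by (rule cm[OF that])
    show "linear a" if "a \<in> M" for a by (rule W_linear[OF MW[OF that]])
    show "a x \<bullet> a y = x \<bullet> y" if "a \<in> M" for a x y by (rule W_inner[OF MW[OF that]])
    show "a x \<in> E8_lattice" if "a \<in> M" "x \<in> E8_lattice" for a x by (rule W_lattice[OF MW[OF that(1)] that(2)])
  qed
qed

section \<open>The group of sign changes of a frame\<close>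

context root_frame
begin

definition flips :: "(real^8 \<Rightarrow> real^8) set" where "flips = flip ` Pow {..<8}"

lemma flip_W: assumes "S \<subseteq> {..<8}" shows "flip S \<in> W_E8_carrier"
proof -
  have "finite S" using assms finite_subset by blast
  then show ?thesis using assms
  proof (induction S rule: finite_induct)
    case empty
    show ?case unfolding flip_empty by (rule W_id)
  next
    case (insert i S)
    then have i: "i < 8" "S \<subseteq> {..<8}" and S: "flip S \<in> W_E8_carrier" by auto
    show ?case unfolding flip_insert[OF i insert(2)] by (rule W_refl[OF frame_root[OF i(1)] S])
  qed
qed

lemma flip_flip: "S \<subseteq> {..<8} \<Longrightarrow> flip S \<circ> flip S = id"
  by (simp add: flip_comp flip_empty)

lemma subgroup_flips: "subgroup flips W_E8"
proof (rule W.subgroupI)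
  show "inv\<^bsub>W_E8\<^esub> a \<in> flips" if "a \<in> flips" for a
  proof -
    obtain S where S: "S \<subseteq> {..<8}" "a = flip S" using \<open>a \<in> flips\<close> by (auto simp: flips_def)
    have "inv\<^bsub>W_E8\<^esub> a = a" by (rule W.inv_equality) (use S flip_flip flip_W in auto)
    then show ?thesis using that by simp
  qed
  show "a \<otimes>\<^bsub>W_E8\<^esub> b \<in> flips" if "a \<in> flips" "b \<in> flips" for a b
  proof -
    obtain S T where "S \<subseteq> {..<8}" "a = flip S" "T \<subseteq> {..<8}" "b = flip T" using \<open>a \<in> flips\<close> \<open>b \<in> flips\<close> by (auto simp: flips_def)
    moreover have "S - T \<union> (T - S) \<in> Pow {..<8}" if "S \<subseteq> {..<8::nat}" "T \<subseteq> {..<8}" using that by blast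
    ultimately show ?thesis by (simp add: flip_comp flips_def image_eqI)
  qed
qed (use flip_W in \<open>auto simp: flips_def\<close>)

lemma abelian_flips: "abelian_subgroup_W flips"
proof -
  have "flip S \<circ> flip T = flip T \<circ> flip S" if "S \<subseteq> {..<8}" "T \<subseteq> {..<8}" for S T
    using that by (simp add: flip_comp Un_commute)
  then show ?thesis unfolding abelian_subgroup_W_def using subgroup_flips by (auto simp: flips_def)
qed

lemma card_flips: "card flips = 256"
  by (simp add: flips_def card_image[OF inj_flip] card_Pow)

lemma flips_subset:
  assumes M: "subgroup M W_E8" and refl: "\<And>i. i < 8 \<Longrightarrow> reflection (\<beta> i) \<in> M" shows "flips \<subseteq> M"
proof -
  have "flip S \<in> M" if "S \<subseteq> {..<8}" for S
  proof -
    have "finite S" using that finite_subset by blast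
    then show ?thesis using that
    proof (induction S rule: finite_induct)
      case empty
      show ?case using subgroup.one_closed[OF M] unfolding flip_empty one_W .
    next
      case (insert i S)
      then have i: "i < 8" "S \<subseteq> {..<8}" and S: "flip S \<in> M" by auto
      have "reflection (\<beta> i) \<circ> flip S \<in> M" using subgroup.m_closed[OF M refl[OF i(1)] S] unfolding mult_W .
      then show ?case unfolding flip_insert[OF i insert(2)] .
    qed
  qed
  then show ?thesis by (auto simp: flips_def)
qed

lemma flips_generate: "flips = generate W_E8 ((\<lambda>i. reflection (\<beta> i)) ` {..<8})"
proof (rule subset_antisym)
  have r: "(\<lambda>i. reflection (\<beta> i)) ` {..<8} \<subseteq> carrier W_E8" using frame_root reflection_W by auto
  show "flips \<subseteq> generate W_E8 ((\<lambda>i. reflection (\<beta> i)) ` {..<8})"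
    by (rule flips_subset[OF W.generate_is_subgroup[OF r]]) (auto intro: generate.incl)
  have "(\<lambda>i. reflection (\<beta> i)) ` {..<8} \<subseteq> flips"
  proof
    fix x assume "x \<in> (\<lambda>i. reflection (\<beta> i)) ` {..<8}"
    then obtain i where "i < 8" "x = flip {i}" by (auto simp: flip_singleton)
    then show "x \<in> flips" by (simp add: flips_def)
  qed
  then show "generate W_E8 ((\<lambda>i. reflection (\<beta> i)) ` {..<8}) \<subseteq> flips"
    by (rule W.generate_subgroup_incl[OF _ subgroup_flips])
qed

end

text \<open>The standard frame is a competitor of order 256; as infinite sets have
  \<open>card\<close> 0, M is finite. The count modulo 2 on the whole lattice bounds its order by
  2^8, so the sign changes found inside M are all of M.\<close>

theorem maximal_abelian_flips:
  assumes abel: "abelian_subgroup_W M" and maxord: "\<forall>M'. abelian_subgroup_W M' \<longrightarrow> card M' \<le> card M"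
  shows "\<exists>\<beta>. root_frame \<beta> \<and> M = root_frame.flips \<beta>"
proof -
  have big: "card M \<ge> 256" using maxord std.abelian_flips std.card_flips by metis
  then have fin: "finite M" using card.infinite by fastforce
  interpret abelian_isometries M by (rule abelian_isometries_W[OF abel fin])
  obtain \<beta> where f: "root_frame \<beta>" and r: "\<And>i. i < 8 \<Longrightarrow> reflection (\<beta> i) \<in> M" using ex_frame[OF big] by blast
  interpret root_frame \<beta> by (rule f)
  obtain k where k: "k \<ge> 1" "\<And>a. a \<in> M \<Longrightarrow> a ^^ (2 ^ k) = id" using large_is_two_group[OF big] by blast
  have "inv_set E8_lattice" using lattice_A by (auto simp: inv_set_def)
  from two_group_bound[OF k add_closed_E8_lattice order_refl this]
  have "card M \<le> card flips" by (simp add: card_restrict_lattice dim_E8_lattice card_flips)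
  moreover have "flips \<subseteq> M" using flips_subset r abel by (auto simp: abelian_subgroup_W_def)
  ultimately have "flips = M" using card_seteq[OF fin] by blast
  then show ?thesis using f by blast
qed

section \<open>Orbits on the roots\<close>

lemma carrier_Z2_pow: "carrier (Z2_pow n) = ({..<n} \<rightarrow>\<^sub>E {0, 1})"
proof -
  have "{0..<int 2} = {0, 1}" by (intro subset_antisym subsetI; simp; presburger)
  then show ?thesis by (simp only: Z2_pow_def carrier_product_group carrier_integer_mod_group) simp
qed

lemma mult_Z2_pow: "f \<otimes>\<^bsub>Z2_pow n\<^esub> g = (\<lambda>i\<in>{..<n}. (f i + g i) mod 2)"
  by (simp add: Z2_pow_def)

lemma group_Z2_pow: "group (Z2_pow n)"
  by (simp add: Z2_pow_def)

lemma card_points_fano: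
  assumes "i < 8" shows "card {S \<in> fano_ext_lines. i \<in> S} = 7"
proof -
  have fin: "finite fano_ext_lines" unfolding fano_ext_lines_eq by simp
  have "real (card {S \<in> fano_ext_lines. i \<in> S}) = (\<Sum>S\<in>fano_ext_lines. if i \<in> S then 1 else 0)"
    using fin by (simp add: sum.If_cases Int_def)
  also have "\<dots> = 7"
    unfolding sum_fano_ext_lines using assms unfolding less_8_cases by (elim disjE) simp_all
  finally show ?thesis by linarith
qed

context root_frame
begin

lemma card_blocks: "card blocks = 14"
  using card_roots card_E8_roots by simp

text \<open>Renumbering the frame renames the points but keeps the group, so the block system may be
  brought to a standard form without changing M.\<close>

lemma relabel:
  assumes \<sigma>: "bij_betw \<sigma> {..<8} {..<8}"
  shows "root_frame (\<beta> \<circ> \<sigma>)" "root_frame.flips (\<beta> \<circ> \<sigma>) = flips"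
    and "S \<subseteq> {..<8} \<Longrightarrow> S \<in> root_frame.blocks (\<beta> \<circ> \<sigma>) \<longleftrightarrow> \<sigma> ` S \<in> blocks"
proof -
  have s8: "\<sigma> i < 8" if "i < 8" for i using \<sigma> that by (auto simp: bij_betw_def)
  have inj: "inj_on \<sigma> {..<8}" using \<sigma> by (simp add: bij_betw_def)
  show fr: "root_frame (\<beta> \<circ> \<sigma>)"
  proof
    show "(\<beta> \<circ> \<sigma>) i \<in> E8_roots" if "i < 8" for i using frame_root[OF s8[OF that]] by simp
    show "(\<beta> \<circ> \<sigma>) i \<bullet> (\<beta> \<circ> \<sigma>) j = 0" if "i < 8" "j < 8" "i \<noteq> j" for i j
    proof -
      have "\<sigma> i \<noteq> \<sigma> j" using inj_onD[OF inj, of i j] that by auto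
      then show ?thesis using frame_orth s8 that by simp
    qed
  qed
  interpret r: root_frame "\<beta> \<circ> \<sigma>" by (rule fr)
  have "(\<lambda>i. reflection ((\<beta> \<circ> \<sigma>) i)) ` {..<8} = (\<lambda>i. reflection (\<beta> i)) ` (\<sigma> ` {..<8})"
    by (simp add: image_image)
  then show "r.flips = flips"
    using \<sigma> by (simp only: r.flips_generate flips_generate bij_betw_imp_surj_on[OF \<sigma>])
  assume S: "S \<subseteq> {..<8}"
  have iS: "inj_on \<sigma> S" by (rule inj_on_subset[OF inj S])
  have "r.half S = half (\<sigma> ` S)"
    unfolding r.half_def half_def sum.reindex[OF iS] by (simp only: comp_def)
  moreover have "card (\<sigma> ` S) = card S" by (rule card_image[OF iS])
  moreover have "\<sigma> ` S \<subseteq> {..<8}" using S s8 by auto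
  ultimately show "S \<in> r.blocks \<longleftrightarrow> \<sigma> ` S \<in> blocks" using S by (simp add: r.blocks_def blocks_def)
qed

text \<open>The size is even; 4 would mean equality of the blocks and 0 that they are
  complementary.\<close>

lemma card_Int_blocks:
  assumes A: "A \<in> blocks" and B: "B \<in> blocks" "B \<noteq> A" "B \<noteq> {..<8} - A" shows "card (A \<inter> B) = 2"
proof -
  have A8: "A \<subseteq> {..<8}" "card A = 4" and B8: "B \<subseteq> {..<8}" "card B = 4" using A B by (auto simp: blocks_def)
  have fin: "finite A" "finite B" using A8 B8 finite_subset by blast+
  have le: "card (A \<inter> B) \<le> 4" using card_mono[of A "A \<inter> B"] fin A8 by auto
  have "card (A \<inter> B) \<noteq> 4"
  proof
    assume "card (A \<inter> B) = 4"
    then have "A \<inter> B = A" "A \<inter> B = B"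
      using card_subset_eq[OF fin(1) Int_lower1] card_subset_eq[OF fin(2) Int_lower2] A8 B8 by simp_all
    then show False using B by blast
  qed
  moreover have "card (A \<inter> B) \<noteq> 0"
  proof
    assume "card (A \<inter> B) = 0"
    then have "B \<subseteq> {..<8} - A" using fin B8 by auto
    moreover have "card ({..<8} - A) = 4" using A8 fin by (simp add: card_Diff_subset)
    ultimately have "B = {..<8} - A" using B8 by (intro card_subset_eq) auto
    then show False using B by blast
  qed
  moreover have "even (card (A \<inter> B))" by (rule blocks_even_inter[OF A B(1)])
  ultimately show ?thesis using le by presburger
qed

text \<open>Three blocks in general position; the eight cells of their Venn diagram are single points.\<close>

lemma ex_fano_labelling:
  "\<exists>\<sigma>. bij_betw \<sigma> {..<8} {..<8} \<and> root_frame.blocks (\<beta> \<circ> \<sigma>) = fano_ext_lines"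
proof -
  have large: "\<exists>S\<in>blocks. S \<notin> K" if "finite K" "card K < 14" for K
  proof (rule ccontr)
    assume "\<not> ?thesis"
    then have "blocks \<subseteq> K" by blast
    then have "card blocks \<le> card K" by (rule card_mono[OF that(1)])
    then show False using card_blocks that(2) by linarith
  qed
  obtain A where A: "A \<in> blocks" using large[of "{}"] by auto
  have "card (set [A, {..<8} - A]) < 14" by (rule le_less_trans[OF card_length]) simp
  then obtain B where B: "B \<in> blocks" "B \<notin> set [A, {..<8} - A]" using large by blast
  \<comment> \<open>D must avoid the span of A, B and the full set under symmetric difference; six
    exclusions are harmless against 14 blocks.\<close>
  have cK: "card (set [A, {..<8} - A, B, {..<8} - B, A - B \<union> (B - A), {..<8} - (A - B \<union> (B - A))]) < 14"
    by (rule le_less_trans[OF card_length]) simp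
  obtain D where D: "D \<in> blocks" "D \<notin> set [A, {..<8} - A, B, {..<8} - B, A - B \<union> (B - A), {..<8} - (A - B \<union> (B - A))]"
    using large[OF _ cK] by blast
  have sub: "A \<subseteq> {..<8}" "B \<subseteq> {..<8}" "D \<subseteq> {..<8}" and c4: "card A = 4" "card B = 4" "card D = 4"
    using A B D by (auto simp: blocks_def)
  have fin: "finite A" "finite B" "finite D" using sub finite_subset by blast+
  have ab: "card (A \<inter> B) = 2" by (rule card_Int_blocks[OF A B(1)]) (use B(2) in auto)
  have ad: "card (A \<inter> D) = 2" by (rule card_Int_blocks[OF A D(1)]) (use D(2) in auto)
  have bd: "card (B \<inter> D) = 2" by (rule card_Int_blocks[OF B(1) D(1)]) (use D(2) in auto)
  have split: "card S = card (S \<inter> T) + card (S - T)" if "finite S" for S T :: "nat set"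
    by (rule card_Int_Diff[OF that])
  have a_b: "card (A - B) = 2" using split[OF fin(1), of B] ab c4 by simp
  have b_a: "card (B - A) = 2" using split[OF fin(2), of A] ab c4 by (simp add: Int_commute)
  have sym4: "card (A - B \<union> (B - A)) = 4" using fin a_b b_a by (subst card_Un_disjoint) auto
  have r1: "card (A \<inter> D) = card (A \<inter> B \<inter> D) + card ((A - B) \<inter> D)"
  proof -
    have "A \<inter> D \<inter> B = A \<inter> B \<inter> D" "A \<inter> D - B = (A - B) \<inter> D" by blast+
    then show ?thesis using split[of "A \<inter> D" B] fin by simp
  qed
  have r2: "card (B \<inter> D) = card (A \<inter> B \<inter> D) + card ((B - A) \<inter> D)"
  proof -
    have "B \<inter> D \<inter> A = A \<inter> B \<inter> D" "B \<inter> D - A = (B - A) \<inter> D" by blast+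
    then show ?thesis using split[of "B \<inter> D" A] fin by simp
  qed
  have sd: "card ((A - B \<union> (B - A)) \<inter> D) = card ((A - B) \<inter> D) + card ((B - A) \<inter> D)"
    unfolding Int_Un_distrib2 using fin by (intro card_Un_disjoint) auto
  have finS: "finite (A - B \<union> (B - A))" using fin by blast
  \<comment> \<open>With empty triple intersection D would contain both points of A - B and of B - A
    and be the symmetric difference. A triple intersection of size 2, excluded next, would make D
    its complement.\<close>
  have t0: "card (A \<inter> B \<inter> D) \<noteq> 0"
  proof
    assume "card (A \<inter> B \<inter> D) = 0"
    then have "card ((A - B \<union> (B - A)) \<inter> D) = 4" using sd r1 r2 ad bd by linarith
    then have "(A - B \<union> (B - A)) \<inter> D = A - B \<union> (B - A)" "(A - B \<union> (B - A)) \<inter> D = D"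
      using card_subset_eq[OF finS Int_lower1] card_subset_eq[OF fin(3) Int_lower2] c4 sym4 by (metis, metis)
    then have "D = A - B \<union> (B - A)" by metis
    then show False using D(2) unfolding list.set by blast
  qed
  have t2: "card (A \<inter> B \<inter> D) \<noteq> 2"
  proof
    assume "card (A \<inter> B \<inter> D) = 2"
    then have "card ((A - B \<union> (B - A)) \<inter> D) = 0" using sd r1 r2 ad bd by linarith
    then have "(A - B \<union> (B - A)) \<inter> D = {}" using finite_Int[OF disjI1[OF finS], of D] by (simp only: card_0_eq)
    then have "D \<subseteq> {..<8} - (A - B \<union> (B - A))" using sub by blast
    moreover have "card ({..<8} - (A - B \<union> (B - A))) = 4"
    proof -
      have "A - B \<union> (B - A) \<subseteq> {..<8}" using sub by blast
      from card_Diff_subset[OF finS this] show ?thesis unfolding sym4 by simp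
    qed
    ultimately have "D = {..<8} - (A - B \<union> (B - A))" using c4 by (intro card_subset_eq) simp_all
    then show False using D(2) unfolding list.set by blast
  qed
  have t1: "card (A \<inter> B \<inter> D) = 1" using t0 t2 r1 ad by linarith
  have n1: "card ((A - B) \<inter> D) = 1" "card ((B - A) \<inter> D) = 1" using t1 r1 r2 ad bd by linarith+
  have n2: "card (A \<inter> B - D) = 1" using split[of "A \<inter> B" D] fin ab t1 by simp
  have n3: "card (A - B - D) = 1" using split[of "A - B" D] fin a_b n1 by simp
  have n4: "card (B - A - D) = 1" using split[of "B - A" D] fin b_a n1 by simp
  have n5: "card (D - A - B) = 1"
  proof -
    have "card (D - A) = 2" using split[OF fin(3), of A] ad c4 by (simp add: Int_commute)
    moreover have "(D - A) \<inter> B = (B - A) \<inter> D" by blast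
    ultimately show ?thesis using split[of "D - A" B] fin n1 by simp
  qed
  have n6: "card ({..<8} - A - B - D) = 1"
  proof -
    have "card ({..<8} - A) = 4" using sub fin c4 by (simp add: card_Diff_subset)
    moreover have "({..<8} - A) \<inter> B = B - A" using sub by blast
    ultimately have "card ({..<8} - A - B) = 2" using split[of "{..<8} - A" B] b_a by simp
    moreover have "({..<8} - A - B) \<inter> D = D - A - B" using sub by blast
    ultimately show ?thesis using split[of "{..<8} - A - B" D] n5 by simp
  qed
  \<comment> \<open>The binary digits of \<open>l i\<close> record membership in A, B and D. Since
    each cell has one point, l is a bijection, and it carries A, B, D to the labels with first,
    second or third digit set.\<close>
  define l where "l i = (of_bool (i \<in> A) + 2 * of_bool (i \<in> B) + 4 * of_bool (i \<in> D) :: nat)" for i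
  have ne: "\<exists>x. x \<in> S" if "card S = 1" for S :: "nat set" using that by (auto simp: card_1_singleton_iff)
  have l8: "l ` {..<8} = {..<8}"
  proof (intro subset_antisym subsetI)
    show "x \<in> {..<8}" if "x \<in> l ` {..<8}" for x using that by (auto simp: l_def)
    fix m assume "m \<in> {..<8::nat}"
    moreover have "\<exists>i<8. l i = 0" using ne[OF n6] by (force simp: l_def)
    moreover have "\<exists>i<8. l i = 1" using ne[OF n3] sub by (force simp: l_def)
    moreover have "\<exists>i<8. l i = 2" using ne[OF n4] sub by (force simp: l_def)
    moreover have "\<exists>i<8. l i = 3" using ne[OF n2] sub by (force simp: l_def)
    moreover have "\<exists>i<8. l i = 4" using ne[OF n5] sub by (force simp: l_def)
    moreover have "\<exists>i<8. l i = 5" using ne[OF n1(1)] sub by (force simp: l_def)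
    moreover have "\<exists>i<8. l i = 6" using ne[OF n1(2)] sub by (force simp: l_def)
    moreover have "\<exists>i<8. l i = 7" using ne[OF t1] sub by (force simp: l_def)
    ultimately have "\<exists>i<8. l i = m" unfolding lessThan_iff less_8_cases[of m] by blast
    then show "m \<in> l ` {..<8}" by blast
  qed
  have "inj_on l {..<8}" by (rule eq_card_imp_inj_on) (simp_all add: l8)
  then have bl: "bij_betw l {..<8} {..<8}" using l8 by (simp add: bij_betw_def)
  define \<sigma> where "\<sigma> = inv_into {..<8} l"
  have b\<sigma>: "bij_betw \<sigma> {..<8} {..<8}" unfolding \<sigma>_def by (rule bij_betw_inv_into[OF bl])
  have im: "\<sigma> ` S = T" if "T \<subseteq> {..<8}" "S = l ` T" for S T
    using that bl by (auto simp: \<sigma>_def bij_betw_def inv_into_image_cancel)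
  have lT: "S = l ` T" if "S \<subseteq> {..<8}" "T \<subseteq> {..<8}" "\<And>i. i < 8 \<Longrightarrow> i \<in> T \<longleftrightarrow> l i \<in> S" for S T
  proof (intro subset_antisym subsetI)
    fix m assume m: "m \<in> S"
    then have "m \<in> l ` {..<8}" using that(1) l8 by blast
    then obtain i where "i < 8" "m = l i" by blast
    then show "m \<in> l ` T" using that(3)[of i] m by blast
  qed (use that in auto)
  interpret r: root_frame "\<beta> \<circ> \<sigma>" by (rule relabel(1)[OF b\<sigma>])
  have "S \<in> r.blocks" if "S \<subseteq> {..<8}" "T \<in> blocks" "\<And>i. i < 8 \<Longrightarrow> i \<in> T \<longleftrightarrow> l i \<in> S" for S T
  proof -
    have T: "T \<subseteq> {..<8}" using that(2) by (simp add: blocks_def)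
    show ?thesis using im[OF T lT[OF that(1) T that(3)]] relabel(3)[OF b\<sigma> that(1)] that(2) by simp
  qed
  note bl = this
  have "{1,3,5,7} \<in> r.blocks" by (rule bl[OF _ A]) (auto simp: l_def)
  moreover have "{2,3,6,7} \<in> r.blocks" by (rule bl[OF _ B(1)]) (auto simp: l_def)
  moreover have "{4,5,6,7} \<in> r.blocks" by (rule bl[OF _ D(1)]) (auto simp: l_def)
  ultimately have "r.blocks \<subseteq> fano_ext_lines" by (rule r.blocks_subset_fano)
  moreover have "finite fano_ext_lines" using card_fano_ext_lines card.infinite by fastforce
  ultimately have "r.blocks = fano_ext_lines"
    using card_subset_eq[of fano_ext_lines r.blocks] r.card_blocks card_fano_ext_lines by simp
  then show ?thesis using b\<sigma> by blast
qed

lemma W_flips_iso_Z2_pow: "W_E8\<lparr>carrier := flips\<rparr> \<cong> Z2_pow 8"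
proof -
  let ?h = "\<lambda>f :: nat \<Rightarrow> int. flip {i. i < 8 \<and> f i = 1}"
  have fl: "{i. i < 8 \<and> f i = (1::int)} \<subseteq> {..<8::nat}" for f by auto
  have "?h \<in> iso (Z2_pow 8) (W_E8\<lparr>carrier := flips\<rparr>)"
  proof (rule isoI)
    show "?h \<in> hom (Z2_pow 8) (W_E8\<lparr>carrier := flips\<rparr>)"
    proof (rule homI)
      show "?h f \<in> carrier (W_E8\<lparr>carrier := flips\<rparr>)" for f using fl by (auto simp: flips_def)
      fix f g assume f: "f \<in> carrier (Z2_pow 8)" and g: "g \<in> carrier (Z2_pow 8)"
      have "(i < 8 \<and> (f \<otimes>\<^bsub>Z2_pow 8\<^esub> g) i = 1) \<longleftrightarrow> i \<in> {i. i < 8 \<and> f i = 1} - {i. i < 8 \<and> g i = 1} \<union> ({i. i < 8 \<and> g i = 1} - {i. i < 8 \<and> f i = 1})" for i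
      proof (cases "i < 8")
        case True
        then have "f i = 0 \<or> f i = 1" "g i = 0 \<or> g i = 1" using PiE_mem[of f "{..<8}" _ i] PiE_mem[of g "{..<8}" _ i] f g by (auto simp: carrier_Z2_pow)
        then show ?thesis using True by (auto simp: mult_Z2_pow)
      qed simp
      then have "{i. i < 8 \<and> (f \<otimes>\<^bsub>Z2_pow 8\<^esub> g) i = 1} = {i. i < 8 \<and> f i = 1} - {i. i < 8 \<and> g i = 1} \<union> ({i. i < 8 \<and> g i = 1} - {i. i < 8 \<and> f i = 1})"
        by blast
      moreover have "x \<otimes>\<^bsub>W_E8\<lparr>carrier := flips\<rparr>\<^esub> y = x \<circ> y" for x y by simp
      ultimately show "?h (f \<otimes>\<^bsub>Z2_pow 8\<^esub> g) = ?h f \<otimes>\<^bsub>W_E8\<lparr>carrier := flips\<rparr>\<^esub> ?h g"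
        by (simp only: flip_comp[OF fl fl])
    qed
    show "bij_betw ?h (carrier (Z2_pow 8)) (carrier (W_E8\<lparr>carrier := flips\<rparr>))"
    proof (rule bij_betw_imageI)
      show "inj_on ?h (carrier (Z2_pow 8))"
      proof (rule inj_onI)
        fix f g assume f: "f \<in> carrier (Z2_pow 8)" and g: "g \<in> carrier (Z2_pow 8)" and eq: "?h f = ?h g"
        have s: "{i. i < 8 \<and> f i = 1} = {i. i < 8 \<and> g i = 1}" using inj_onD[OF inj_flip eq] fl by auto
        show "f = g"
        proof (rule PiE_ext)
          show "f \<in> {..<8} \<rightarrow>\<^sub>E {0, 1}" "g \<in> {..<8} \<rightarrow>\<^sub>E {0, 1}" using f g by (simp_all add: carrier_Z2_pow)
          fix i assume i: "i \<in> {..<8::nat}"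
          then have "f i \<in> {0, 1}" "g i \<in> {0, 1}" using f g PiE_mem unfolding carrier_Z2_pow by fastforce+
          moreover have "f i = 1 \<longleftrightarrow> g i = 1" using s i unfolding lessThan_iff by blast
          ultimately show "f i = g i" by (elim insertE emptyE) simp_all
        qed
      qed
      show "?h ` carrier (Z2_pow 8) = carrier (W_E8\<lparr>carrier := flips\<rparr>)"
      proof (intro subset_antisym subsetI)
        fix w assume "w \<in> carrier (W_E8\<lparr>carrier := flips\<rparr>)"
        then obtain S where S: "S \<subseteq> {..<8}" "w = flip S" by (auto simp: flips_def)
        define f where "f = (\<lambda>i\<in>{..<8::nat}. if i \<in> S then 1 else 0 :: int)"
        have "{i. i < 8 \<and> f i = 1} = S" using S(1) by (auto simp: f_def split: if_splits)
        moreover have "f \<in> carrier (Z2_pow 8)" by (auto simp: f_def carrier_Z2_pow)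
        ultimately show "w \<in> ?h ` carrier (Z2_pow 8)" using S(2) by (intro image_eqI[of _ _ f]) auto
      qed (use fl in \<open>auto simp: flips_def\<close>)
    qed
  qed
  then have "Z2_pow 8 \<cong> W_E8\<lparr>carrier := flips\<rparr>" by (auto simp: is_iso_def)
  then show ?thesis by (rule group.iso_sym[OF group_Z2_pow])
qed

text \<open>If the support of a contains distinct i and j, the reflection in a sends \<beta> i to a
  vector not orthogonal to \<beta> j, which no sign change does. So only roots proportional to frame
  roots remain.\<close>

lemma reflections_in_flips:
  "{w \<in> flips. \<exists>a\<in>E8_roots. w = reflection a} = (\<lambda>i. reflection (\<beta> i)) ` {..<8}"
proof (intro subset_antisym subsetI)
  fix w assume "w \<in> {w \<in> flips. \<exists>a\<in>E8_roots. w = reflection a}"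
  then obtain S a where S: "S \<subseteq> {..<8}" "w = flip S" and a: "a \<in> E8_roots" "w = reflection a" by (auto simp: flips_def)
  have "\<not> supp a \<in> blocks"
  proof
    assume "supp a \<in> blocks"
    then have c: "card (supp a) = 4" by (simp add: blocks_def)
    then obtain i where i: "i \<in> supp a" by fastforce
    have "\<not> supp a \<subseteq> {i}" using c card_mono[of "{i}" "supp a"] by auto
    then obtain j where j: "j \<in> supp a" "j \<noteq> i" by blast
    have ij: "i < 8" "j < 8" "a \<bullet> \<beta> i \<noteq> 0" "a \<bullet> \<beta> j \<noteq> 0" using i j by (auto simp: supp_def)
    have o: "\<beta> i \<bullet> \<beta> j = 0" by (rule frame_orth[OF ij(1,2) j(2)[symmetric]])
    have "flip S (\<beta> i) \<bullet> \<beta> j = 0" unfolding flip_inner[OF S(1) ij(2)] o by simp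
    moreover have "reflection a (\<beta> i) \<bullet> \<beta> j = - ((a \<bullet> \<beta> i) * (a \<bullet> \<beta> j))"
      by (simp add: reflection_root[OF a(1)] inner_diff_left o inner_commute[of "\<beta> i" a])
    ultimately show False using S(2) a(2) ij by simp
  qed
  then obtain i where "i < 8" "a = \<beta> i \<or> a = - \<beta> i" using root_cases[OF a(1)] by blast
  then have "reflection a = reflection (\<beta> i)" by (auto simp: reflection_def)
  then show "w \<in> (\<lambda>i. reflection (\<beta> i)) ` {..<8}" using a \<open>i < 8\<close> by blast
next
  fix w assume "w \<in> (\<lambda>i. reflection (\<beta> i)) ` {..<8}"
  then obtain i where i: "i < 8" "w = reflection (\<beta> i)" by blast
  have "flip {i} \<in> flips" using i(1) by (auto simp: flips_def)
  then have "w \<in> flips" using flip_singleton[OF i(1)] i(2) by simp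
  then show "w \<in> {w \<in> flips. \<exists>a\<in>E8_roots. w = reflection a}" using i frame_root by blast
qed

lemma supp_flip: "S \<subseteq> {..<8} \<Longrightarrow> supp (flip S x) = supp x"
  by (auto simp: supp_def flip_inner split: if_splits)

lemma orbit_frame:
  assumes i: "i < 8" and x: "x = \<beta> i \<or> x = - \<beta> i" shows "(\<lambda>w. w x) ` flips = {\<beta> i, - \<beta> i}"
proof -
  have "flip S x = (if i \<in> S then - x else x)" if "S \<subseteq> {..<8}" for S
    by (rule frame_eqI) (use that i x in \<open>auto simp: flip_inner frame_inner\<close>)
  then have "(\<lambda>w. w x) ` flips = (\<lambda>S. if i \<in> S then - x else x) ` Pow {..<8}"
    by (auto simp: flips_def image_image)
  also have "\<dots> = {x, - x}"
  proof (intro subset_antisym subsetI)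
    fix y assume "y \<in> {x, - x}"
    then have "y = (if i \<in> {} then - x else x) \<or> y = (if i \<in> {i} then - x else x)" by auto
    then show "y \<in> (\<lambda>S. if i \<in> S then - x else x) ` Pow {..<8}" using i by blast
  qed auto
  finally show ?thesis using x by auto
qed

definition block_roots :: "nat set \<Rightarrow> (real^8) set" where "block_roots S = {x \<in> E8_roots. supp x = S}"

text \<open>Sign changes compose by symmetric difference, so the roots of the block with negative
  sets T and U are related by the flip at the symmetric difference of T and U.\<close>

lemma orbit_block:
  assumes S: "S \<in> blocks" and x: "x \<in> block_roots S" shows "(\<lambda>w. w x) ` flips = block_roots S"
proof (intro subset_antisym subsetI)
  fix y assume "y \<in> (\<lambda>w. w x) ` flips"
  then obtain T where "T \<subseteq> {..<8}" "y = flip T x" by (auto simp: flips_def)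
  then show "y \<in> block_roots S" using x supp_flip flip_root by (simp add: block_roots_def)
next
  fix y assume y: "y \<in> block_roots S"
  have S8: "S \<subseteq> {..<8}" using S by (simp add: blocks_def)
  obtain T U where T: "T \<subseteq> S" "x = flip T (half S)" and U: "U \<subseteq> S" "y = flip U (half S)"
    using x y unfolding block_roots_def roots_with_supp[OF S] by blast
  have T8: "T \<subseteq> {..<8}" "U \<subseteq> {..<8}" using T U S8 by auto
  have "flip T x = half S" using T(2) fun_cong[OF flip_flip[OF T8(1)], of "half S"] by simp
  then have "y = (flip U \<circ> flip T) x" using U(2) by simp
  then have "y = flip (U - T \<union> (T - U)) x" by (simp only: flip_comp[OF T8(2,1)])
  moreover have "flip (U - T \<union> (T - U)) \<in> flips" using T8 by (auto simp: flips_def)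
  ultimately show "y \<in> (\<lambda>w. w x) ` flips" by blast
qed

lemma card_block_roots: "S \<in> blocks \<Longrightarrow> card (block_roots S) = 16"
  unfolding block_roots_def by (subst roots_with_supp, assumption, subst card_image[OF inj_flip_half])
    (auto simp: blocks_def card_Pow card_ge_0_finite)

lemma block_roots_ne: "S \<in> blocks \<Longrightarrow> \<exists>x. x \<in> block_roots S"
  using card_block_roots[of S] by (cases "block_roots S = {}") auto

lemma inj_block_roots: "inj_on block_roots blocks"
proof (rule inj_onI)
  fix S T assume S: "S \<in> blocks" and eq: "block_roots S = block_roots T"
  obtain x where "x \<in> block_roots S" using block_roots_ne[OF S] by blast
  moreover have "x \<in> block_roots T" using calculation eq by simp
  ultimately show "S = T" by (simp add: block_roots_def)
qed

lemma card_frame_pair: "i < 8 \<Longrightarrow> card {\<beta> i, - \<beta> i} = 2"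
proof -
  assume i: "i < 8"
  have "\<beta> i \<noteq> - \<beta> i"
  proof
    assume "\<beta> i = - \<beta> i"
    from arg_cong[OF this, of "\<lambda>x. x \<bullet> \<beta> i"] show False using i by (simp add: frame_inner)
  qed
  then show ?thesis by simp
qed

lemma root_orbits_flips: "root_orbits flips = {{\<beta> i, - \<beta> i} | i. i < 8} \<union> block_roots ` blocks"
proof (intro subset_antisym subsetI)
  fix Ob assume "Ob \<in> root_orbits flips"
  then obtain x where x: "x \<in> E8_roots" "Ob = (\<lambda>w. w x) ` flips" by (auto simp: root_orbits_def)
  from root_cases[OF x(1)] consider i where "i < 8" "x = \<beta> i \<or> x = - \<beta> i" | "supp x \<in> blocks" by blast
  then show "Ob \<in> {{\<beta> i, - \<beta> i} | i. i < 8} \<union> block_roots ` blocks"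
  proof cases
    case 1
    then show ?thesis using orbit_frame x(2) by blast
  next
    case 2
    then show ?thesis using orbit_block[OF 2, of x] x by (auto simp: block_roots_def)
  qed
next
  fix Ob assume "Ob \<in> {{\<beta> i, - \<beta> i} | i. i < 8} \<union> block_roots ` blocks"
  then consider i where "i < 8" "Ob = {\<beta> i, - \<beta> i}" | S where "S \<in> blocks" "Ob = block_roots S" by blast
  then show "Ob \<in> root_orbits flips"
  proof cases
    case 1
    then show ?thesis using orbit_frame[OF 1(1), of "\<beta> i"] frame_root[OF 1(1)] by (auto simp: root_orbits_def)
  next
    case 2
    obtain x where x: "x \<in> block_roots S" using block_roots_ne[OF 2(1)] by blast
    then show ?thesis using orbit_block[OF 2(1) x] 2(2) by (auto simp: root_orbits_def block_roots_def)
  qed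
qed

lemma small_orbits: "{Ob \<in> root_orbits flips. card Ob = 2} = {{\<beta> i, - \<beta> i} | i. i < 8}"
  and large_orbits: "{Ob \<in> root_orbits flips. card Ob \<noteq> 2} = block_roots ` blocks"
proof -
  have 1: "card Ob = 2" if "Ob \<in> {{\<beta> i, - \<beta> i} | i. i < 8}" for Ob using that card_frame_pair by blast
  have 2: "card Ob = 16" if "Ob \<in> block_roots ` blocks" for Ob using that card_block_roots by blast
  have separate: "{x \<in> P \<union> Q. card x = 2} = P \<and> {x \<in> P \<union> Q. card x \<noteq> 2} = Q"
    if P: "\<And>x. x \<in> P \<Longrightarrow> card x = 2" and Q: "\<And>x. x \<in> Q \<Longrightarrow> card x = 16" for P Q :: "(real^8) set set"
  proof -
    have "card x \<noteq> 2" if "x \<in> Q" for x using Q[OF that] by simp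
    then show ?thesis using P by blast
  qed
  from separate[of "{{\<beta> i, - \<beta> i} | i. i < 8}" "block_roots ` blocks", OF 1 2]
  show "{Ob \<in> root_orbits flips. card Ob = 2} = {{\<beta> i, - \<beta> i} | i. i < 8}"
    "{Ob \<in> root_orbits flips. card Ob \<noteq> 2} = block_roots ` blocks"
    unfolding root_orbits_flips by blast+
qed

lemma block_roots_incident:
  assumes "S \<in> blocks" "i < 8" shows "(\<forall>\<gamma>\<in>block_roots S. \<beta> i \<bullet> \<gamma> \<noteq> 0) \<longleftrightarrow> i \<in> S"
proof -
  have "\<beta> i \<bullet> \<gamma> \<noteq> 0 \<longleftrightarrow> i \<in> S" if "\<gamma> \<in> block_roots S" for \<gamma>
    using that assms(2) by (auto simp: block_roots_def supp_def inner_commute)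
  then show ?thesis using block_roots_ne[OF assms(1)] by blast
qed

lemma strongly_orthogonal:
  assumes "i < 8" "j < 8" "i \<noteq> j" shows "\<beta> i + \<beta> j \<notin> E8_roots" "\<beta> i - \<beta> j \<notin> E8_roots"
  using assms by (simp_all add: E8_roots_eq inner_add_left inner_add_right inner_diff_left inner_diff_right frame_inner)

end

text \<open>A normalised numbering, in which blocks and lines coincide as sets of numbers;
  \<open>ex_fano_frame\<close> reduces every frame to this case.\<close>

locale fano_frame = root_frame +
  assumes blocks_fano: "blocks = fano_ext_lines"

theorem (in root_frame) ex_fano_frame: "\<exists>\<beta>'. fano_frame \<beta>' \<and> root_frame.flips \<beta>' = flips"
  using ex_fano_labelling relabel unfolding fano_frame_def fano_frame_axioms_def by blast

context fano_frame
begin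

theorem orbit_design:
  "(\<forall>i<8. \<beta> i \<in> E8_roots)
        \<and> (\<forall>i<8. \<forall>j<8. i \<noteq> j \<longrightarrow> \<beta> i \<bullet> \<beta> j = 0
                 \<and> \<beta> i + \<beta> j \<notin> E8_roots \<and> \<beta> i - \<beta> j \<notin> E8_roots)
        \<and> flips = generate W_E8 ((\<lambda>i. reflection (\<beta> i)) ` {..<8})
        \<and> {w \<in> flips. \<exists>a\<in>E8_roots. w = reflection a} = (\<lambda>i. reflection (\<beta> i)) ` {..<8}
        \<and> {Ob \<in> root_orbits flips. card Ob = 2} = {{\<beta> i, - \<beta> i} | i. i < 8}
        \<and> (\<forall>Ob \<in> root_orbits flips. card Ob \<noteq> 2 \<longrightarrow> card Ob = 16)
        \<and> card {Ob \<in> root_orbits flips. card Ob \<noteq> 2} = 14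
        \<and> (\<forall>Ob \<in> root_orbits flips. card Ob \<noteq> 2 \<longrightarrow>
              card {i. i < 8 \<and> (\<forall>\<gamma>\<in>Ob. \<beta> i \<bullet> \<gamma> \<noteq> 0)} = 4)
        \<and> (\<forall>i<8. card {Ob \<in> root_orbits flips. card Ob \<noteq> 2 \<and> (\<forall>\<gamma>\<in>Ob. \<beta> i \<bullet> \<gamma> \<noteq> 0)} = 7)
        \<and> (\<exists>f g. bij_betw f {..<8} fano_ext_points
               \<and> bij_betw g {Ob \<in> root_orbits flips. card Ob \<noteq> 2} fano_ext_lines
               \<and> (\<forall>i<8. \<forall>Ob \<in> root_orbits flips. card Ob \<noteq> 2 \<longrightarrow>
                    ((\<forall>\<gamma>\<in>Ob. \<beta> i \<bullet> \<gamma> \<noteq> 0) \<longleftrightarrow> f i \<in> g Ob)))"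
proof (intro conjI)
  have big: "\<exists>S\<in>blocks. Ob = block_roots S" if "Ob \<in> root_orbits flips" "card Ob \<noteq> 2" for Ob
    using large_orbits that by blast
  show "\<forall>i<8. \<beta> i \<in> E8_roots" using frame_root by blast
  show "\<forall>i<8. \<forall>j<8. i \<noteq> j \<longrightarrow> \<beta> i \<bullet> \<beta> j = 0 \<and> \<beta> i + \<beta> j \<notin> E8_roots \<and> \<beta> i - \<beta> j \<notin> E8_roots"
    using frame_orth strongly_orthogonal by blast
  show "\<forall>Ob \<in> root_orbits flips. card Ob \<noteq> 2 \<longrightarrow> card Ob = 16" using big card_block_roots by blast
  show "card {Ob \<in> root_orbits flips. card Ob \<noteq> 2} = 14"
    unfolding large_orbits by (simp add: card_image[OF inj_block_roots] card_blocks)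
  show "\<forall>Ob \<in> root_orbits flips. card Ob \<noteq> 2 \<longrightarrow> card {i. i < 8 \<and> (\<forall>\<gamma>\<in>Ob. \<beta> i \<bullet> \<gamma> \<noteq> 0)} = 4"
  proof (intro ballI impI)
    fix Ob assume "Ob \<in> root_orbits flips" "card Ob \<noteq> 2"
    then obtain S where S: "S \<in> blocks" "Ob = block_roots S" using big by blast
    have "{i. i < 8 \<and> (\<forall>\<gamma>\<in>Ob. \<beta> i \<bullet> \<gamma> \<noteq> 0)} = S"
      using block_roots_incident[OF S(1)] S by (auto simp: blocks_def)
    then show "card {i. i < 8 \<and> (\<forall>\<gamma>\<in>Ob. \<beta> i \<bullet> \<gamma> \<noteq> 0)} = 4" using S(1) by (simp add: blocks_def)
  qed
  show "\<forall>i<8. card {Ob \<in> root_orbits flips. card Ob \<noteq> 2 \<and> (\<forall>\<gamma>\<in>Ob. \<beta> i \<bullet> \<gamma> \<noteq> 0)} = 7"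
  proof (intro allI impI)
    fix i assume i: "(i::nat) < 8"
    have "{Ob \<in> root_orbits flips. card Ob \<noteq> 2 \<and> (\<forall>\<gamma>\<in>Ob. \<beta> i \<bullet> \<gamma> \<noteq> 0)}
        = {Ob \<in> {Ob \<in> root_orbits flips. card Ob \<noteq> 2}. (\<forall>\<gamma>\<in>Ob. \<beta> i \<bullet> \<gamma> \<noteq> 0)}" by blast
    also have "\<dots> = block_roots ` {S \<in> blocks. i \<in> S}"
      unfolding large_orbits using block_roots_incident i by auto
    finally show "card {Ob \<in> root_orbits flips. card Ob \<noteq> 2 \<and> (\<forall>\<gamma>\<in>Ob. \<beta> i \<bullet> \<gamma> \<noteq> 0)} = 7"
      using card_image[OF inj_on_subset[OF inj_block_roots], of "{S \<in> blocks. i \<in> S}"] card_points_fano[OF i]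
      by (simp add: blocks_fano)
  qed
  have bij: "bij_betw block_roots blocks {Ob \<in> root_orbits flips. card Ob \<noteq> 2}"
    unfolding large_orbits by (rule bij_betw_imageI[OF inj_block_roots refl])
  show "\<exists>f g. bij_betw f {..<8} fano_ext_points
               \<and> bij_betw g {Ob \<in> root_orbits flips. card Ob \<noteq> 2} fano_ext_lines
               \<and> (\<forall>i<8. \<forall>Ob \<in> root_orbits flips. card Ob \<noteq> 2 \<longrightarrow>
                    ((\<forall>\<gamma>\<in>Ob. \<beta> i \<bullet> \<gamma> \<noteq> 0) \<longleftrightarrow> f i \<in> g Ob))"
  proof (intro exI conjI)
    \<comment> \<open>In the normalised numbering the isomorphism of designs is the identity on
      points.\<close>
    have "{..<8} = fano_ext_points" by (auto simp: fano_ext_points_def)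
    then show "bij_betw (\<lambda>i. i) {..<8} fano_ext_points" by (simp add: bij_betw_def)
    show "bij_betw (inv_into blocks block_roots) {Ob \<in> root_orbits flips. card Ob \<noteq> 2} fano_ext_lines"
      using bij_betw_inv_into[OF bij] by (simp add: blocks_fano)
    show "\<forall>i<8. \<forall>Ob \<in> root_orbits flips. card Ob \<noteq> 2 \<longrightarrow>
            ((\<forall>\<gamma>\<in>Ob. \<beta> i \<bullet> \<gamma> \<noteq> 0) \<longleftrightarrow> i \<in> inv_into blocks block_roots Ob)"
    proof (intro allI ballI impI)
      fix i Ob assume i: "(i::nat) < 8" and "Ob \<in> root_orbits flips" "card Ob \<noteq> 2"
      then obtain S where S: "S \<in> blocks" "Ob = block_roots S" using big by blast
      then show "(\<forall>\<gamma>\<in>Ob. \<beta> i \<bullet> \<gamma> \<noteq> 0) \<longleftrightarrow> i \<in> inv_into blocks block_roots Ob"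
        using block_roots_incident[OF S(1) i] inv_into_f_f[OF inj_block_roots S(1)] by simp
    qed
  qed
qed (rule flips_generate reflections_in_flips small_orbits)+

end

section \<open>Moebius maps of the projective line over the field with 7 elements\<close>

abbreviation residues7 :: "int list" where "residues7 \<equiv> [0,1,2,3,4,5,6]"

lemma set_residues7: "set residues7 = {0..6}"
  by (intro subset_antisym subsetI; simp; presburger)

lemma SL27_iff: "(a,b,c,d) \<in> carrier SL27 \<longleftrightarrow>
    a \<in> {0..6} \<and> b \<in> {0..6} \<and> c \<in> {0..6} \<and> d \<in> {0..6} \<and> (a * d - b * c) mod 7 = 1"
  by (simp only: SL27_def partial_object.select_convs mem_Collect_eq prod.case)

lemma mult_SL27 [simp]: "x \<otimes>\<^bsub>SL27\<^esub> y = SL27_mult x y"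
  and one_SL27 [simp]: "\<one>\<^bsub>SL27\<^esub> = (1,0,0,1)"
  by (simp_all add: SL27_def)

lemma mod7_range: "x mod 7 \<in> {0..6::int}"
  using pos_mod_bound[of 7 x] pos_mod_sign[of 7 x] by simp

lemma mod7_id: "x \<in> {0..6} \<Longrightarrow> x mod 7 = (x::int)"
  by simp

lemma mod7_linear:
  fixes p q r s :: int
  shows "(p mod 7 * r + q mod 7 * s) mod 7 = (p * r + q * s) mod 7"
    and "(r * (p mod 7) + s * (q mod 7)) mod 7 = (r * p + s * q) mod 7"
    and "(p mod 7 * (s mod 7) - q mod 7 * (r mod 7)) mod 7 = (p * s - q * r) mod 7"
  by (intro mod_add_cong mod_diff_cong mod_mult_cong; simp)+

lemma SL27_mult_closed:
  assumes "A \<in> carrier SL27" "B \<in> carrier SL27" shows "SL27_mult A B \<in> carrier SL27"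
proof -
  obtain a b c d where A: "A = (a,b,c,d)" by (cases A)
  obtain e f g h where B: "B = (e,f,g,h)" by (cases B)
  have d1: "(a * d - b * c) mod 7 = 1" and d2: "(e * h - f * g) mod 7 = 1" using assms A B by (simp_all add: SL27_iff)
  have "((a * e + b * g) mod 7 * ((c * f + d * h) mod 7) - (a * f + b * h) mod 7 * ((c * e + d * g) mod 7)) mod 7
      = ((a * e + b * g) * (c * f + d * h) - (a * f + b * h) * (c * e + d * g)) mod 7"
    by (rule mod7_linear)
  also have "(a * e + b * g) * (c * f + d * h) - (a * f + b * h) * (c * e + d * g) = (a * d - b * c) * (e * h - f * g)"
    by (simp add: algebra_simps)
  also have "\<dots> mod 7 = ((a * d - b * c) mod 7) * ((e * h - f * g) mod 7) mod 7" by (simp only: mod_mult_eq)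
  also have "\<dots> = 1" unfolding d1 d2 by simp
  finally show ?thesis unfolding A B SL27_mult_def prod.case SL27_iff using mod7_range by blast
qed

lemma SL27_mult_assoc: "SL27_mult (SL27_mult A B) C = SL27_mult A (SL27_mult B C)"
proof -
  obtain a b c d where A: "A = (a,b,c,d)" by (cases A)
  obtain e f g h where B: "B = (e,f,g,h)" by (cases B)
  obtain i j k l where C: "C = (i,j,k,l)" by (cases C)
  show ?thesis unfolding A B C SL27_mult_def prod.case prod.inject mod7_linear mod_simps by (simp add: algebra_simps)
qed

interpretation SL: group SL27
proof (rule groupI)
  show "A \<otimes>\<^bsub>SL27\<^esub> B \<in> carrier SL27" if "A \<in> carrier SL27" "B \<in> carrier SL27" for A B
    using SL27_mult_closed[OF that] by simp
  show "\<one>\<^bsub>SL27\<^esub> \<in> carrier SL27" by (simp add: SL27_iff)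
  show "A \<otimes>\<^bsub>SL27\<^esub> B \<otimes>\<^bsub>SL27\<^esub> C = A \<otimes>\<^bsub>SL27\<^esub> (B \<otimes>\<^bsub>SL27\<^esub> C)" for A B C by (simp add: SL27_mult_assoc)
  fix A assume A: "A \<in> carrier SL27"
  obtain a b c d where A': "A = (a,b,c,d)" by (cases A)
  have r: "a \<in> {0..6}" "b \<in> {0..6}" "c \<in> {0..6}" "d \<in> {0..6}" and dt: "(a * d - b * c) mod 7 = 1"
    using A A' by (simp_all add: SL27_iff)
  show "\<one>\<^bsub>SL27\<^esub> \<otimes>\<^bsub>SL27\<^esub> A = A" using r by (simp add: A' SL27_mult_def)
  have "(d * a - (- b mod 7) * (- c mod 7)) mod 7 = (a * d - b * c) mod 7"
  proof -
    have "(d * a - (- b mod 7) * (- c mod 7)) mod 7 = (d * a - (- b) * (- c)) mod 7"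
      by (intro mod_diff_cong mod_mult_cong; simp)
    then show ?thesis by (simp add: mult.commute)
  qed
  then have B: "(d, - b mod 7, - c mod 7, a) \<in> carrier SL27" unfolding SL27_iff using r dt mod7_range by metis
  have "(d * a + (- b mod 7) * c) mod 7 = (d * a + (- b) * c) mod 7" "((- c mod 7) * b + a * d) mod 7 = ((- c) * b + a * d) mod 7"
    "(d * b + (- b mod 7) * d) mod 7 = (d * b + (- b) * d) mod 7" "((- c mod 7) * a + a * c) mod 7 = ((- c) * a + a * c) mod 7"
    by (intro mod_add_cong mod_mult_cong; simp)+
  moreover have "d * a + (- b) * c = a * d - b * c" "(- c) * b + a * d = a * d - b * c" "d * b + (- b) * d = 0" "(- c) * a + a * c = 0"
    by (simp_all add: algebra_simps)
  ultimately have "SL27_mult (d, - b mod 7, - c mod 7, a) A = (1,0,0,1)"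
    unfolding A' SL27_mult_def prod.case using dt by (simp only: mod_0)
  then show "\<exists>B\<in>carrier SL27. B \<otimes>\<^bsub>SL27\<^esub> A = \<one>\<^bsub>SL27\<^esub>" using B by (intro bexI[of _ "(d, - b mod 7, - c mod 7, a)"]) simp_all
qed

abbreviation units7 :: "int list" where "units7 \<equiv> [1,2,3,4,5,6]"

text \<open>Fermat: the fifth power inverts a unit modulo 7, which keeps inverses
  executable.\<close>

lemma units7_inverse: "\<forall>c\<in>set units7. c * c ^ 5 mod 7 = 1" "\<forall>c\<in>set units7. c ^ 5 mod 7 \<in> set units7"
  by code_simp+

lemma set_units7: "set residues7 - {0} = set units7"
  by code_simp

lemma SL27_cell: "\<forall>c\<in>set units7. \<forall>a\<in>set residues7. \<forall>d\<in>set residues7. (a * d - ((a * d - 1) * c ^ 5 mod 7) * c) mod 7 = 1"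
  by code_simp

text \<open>The Bruhat cell of matrices with nonzero lower left entry c: a and d are free, and the
  determinant determines b.\<close>

definition big_cell :: "int \<times> int \<times> int \<Rightarrow> int \<times> int \<times> int \<times> int" where
  "big_cell = (\<lambda>(c,a,d). (a, (a * d - 1) * c ^ 5 mod 7, c, d))"

definition small_cell :: "int \<times> int \<Rightarrow> int \<times> int \<times> int \<times> int" where
  "small_cell = (\<lambda>(a,b). (a, b, 0, a ^ 5 mod 7))"

lemma SL27_cells:
  "carrier SL27 = big_cell ` (set units7 \<times> set residues7 \<times> set residues7) \<union> small_cell ` (set units7 \<times> set residues7)"
proof (intro subset_antisym subsetI)
  fix A assume A: "A \<in> carrier SL27"
  obtain a b c d where A': "A = (a,b,c,d)" by (cases A)
  have r: "a \<in> set residues7" "b \<in> set residues7" "c \<in> set residues7" "d \<in> set residues7" and dt: "(a * d - b * c) mod 7 = 1"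
    using A unfolding A' SL27_iff set_residues7 by blast+
  show "A \<in> big_cell ` (set units7 \<times> set residues7 \<times> set residues7) \<union> small_cell ` (set units7 \<times> set residues7)"
  proof (cases "c = 0")
    case False
    then have c: "c \<in> set units7" using r(3) set_units7 by blast
    have "(a * d - 1) * c ^ 5 mod 7 = (a * d - (a * d - b * c) mod 7) * c ^ 5 mod 7" unfolding dt ..
    also have "\<dots> = (a * d - (a * d - b * c)) * c ^ 5 mod 7" by (intro mod_mult_cong mod_diff_cong) simp_all
    also have "(a * d - (a * d - b * c)) * c ^ 5 = b * (c * c ^ 5)" by (simp add: algebra_simps)
    also have "\<dots> mod 7 = b * (c * c ^ 5 mod 7) mod 7" by (simp only: mod_mult_right_eq)
    also have "\<dots> = b mod 7" using units7_inverse(1) c by (simp only: mult_1_right)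
    also have "\<dots> = b" using r(2) unfolding set_residues7 by (rule mod7_id)
    finally have "A = big_cell (c,a,d)" unfolding A' big_cell_def prod.case by (simp only:)
    then show ?thesis using c r by blast
  next
    case True
    have dt': "a * d mod 7 = 1" using dt unfolding True by simp
    then have "a \<noteq> 0" by auto
    then have a: "a \<in> set units7" using r(1) set_units7 by blast
    have "a ^ 5 mod 7 = (a * d mod 7) * a ^ 5 mod 7" unfolding dt' by (simp only: mult_1_left)
    also have "\<dots> = a * d * a ^ 5 mod 7" by (simp only: mod_mult_left_eq)
    also have "a * d * a ^ 5 = d * (a * a ^ 5)" by (simp add: algebra_simps)
    also have "\<dots> mod 7 = d * (a * a ^ 5 mod 7) mod 7" by (simp only: mod_mult_right_eq)
    also have "\<dots> = d mod 7" using units7_inverse(1) a by (simp only: mult_1_right)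
    also have "\<dots> = d" using r(4) unfolding set_residues7 by (rule mod7_id)
    finally have "A = small_cell (a,b)" unfolding A' small_cell_def prod.case True by (simp only:)
    then show ?thesis using a r by blast
  qed
next
  have units: "x \<in> {0..6}" if "x \<in> set units7" for x using that set_units7 set_residues7 by blast
  fix A assume "A \<in> big_cell ` (set units7 \<times> set residues7 \<times> set residues7) \<union> small_cell ` (set units7 \<times> set residues7)"
  then consider c a d where "c \<in> set units7" "a \<in> set residues7" "d \<in> set residues7" "A = big_cell (c,a,d)"
    | a b where "a \<in> set units7" "b \<in> set residues7" "A = small_cell (a,b)" by blast
  then show "A \<in> carrier SL27"
  proof cases
    case 1
    then show ?thesis unfolding 1(4) big_cell_def prod.case SL27_iff
      using SL27_cell mod7_range units unfolding set_residues7 by blast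
  next
    case 2
    have "(a * (a ^ 5 mod 7) - b * 0) mod 7 = a * a ^ 5 mod 7" by (simp only: mult_zero_right diff_zero mod_mult_right_eq)
    also have "\<dots> = 1" using units7_inverse(1) 2(1) by blast
    finally show ?thesis unfolding 2(3) small_cell_def prod.case SL27_iff
      using mod7_range[of "a ^ 5"] mod7_range[of 0] units[OF 2(1)] 2(2) unfolding set_residues7 mod_0 by blast
  qed
qed

text \<open>The cells contribute 6 * 7 * 7 = 294 and 6 * 7 = 42 matrices.\<close>

lemma card_SL27: "card (carrier SL27) = 336"
proof -
  have "card (set residues7) = 7" "card (set units7) = 6" by code_simp+
  then have c: "card (set units7 \<times> set residues7 \<times> set residues7) = 294" "card (set units7 \<times> set residues7) = 42"
    by (simp_all only: card_cartesian_product)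
  have "inj_on big_cell S" for S by (rule inj_onI) (auto simp: big_cell_def)
  moreover have "inj_on small_cell S" for S by (rule inj_onI) (auto simp: small_cell_def)
  ultimately have "card (big_cell ` (set units7 \<times> set residues7 \<times> set residues7)) = 294" "card (small_cell ` (set units7 \<times> set residues7)) = 42"
    using c by (simp_all only: card_image)
  moreover have "big_cell ` (set units7 \<times> set residues7 \<times> set residues7) \<inter> small_cell ` (set units7 \<times> set residues7) = {}"
  proof -
    have "0 \<notin> set units7" using set_units7 by blast
    then have "big_cell p \<noteq> small_cell q" if "p \<in> set units7 \<times> set residues7 \<times> set residues7" for p q
      using that by (cases p, cases q) (auto simp only: big_cell_def small_cell_def prod.case prod.inject mem_Sigma_iff)
    then show ?thesis by blast
  qed
  ultimately show ?thesis
    unfolding SL27_cells using card_Un_disjoint[of "big_cell ` (set units7 \<times> set residues7 \<times> set residues7)" "small_cell ` (set units7 \<times> set residues7)"]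
    by (simp only: finite_imageI finite_cartesian_product finite_set)
qed

text \<open>A matrix with c nonzero factors as upper, lower, upper unitriangular, and the two upper
  parameters can be solved for explicitly.\<close>

lemma SL27_bruhat:
  "\<forall>c\<in>set units7. \<forall>a\<in>set residues7. \<forall>d\<in>set residues7.
    SL27_mult (SL27_mult (1, (a - 1) * c ^ 5 mod 7, 0, 1) (1, 0, c, 1)) (1, (d - 1) * c ^ 5 mod 7, 0, 1) = big_cell (c,a,d)"
  by code_simp

text \<open>SL(2,7) is generated by two elementary matrices. For c nonzero this is
  \<open>SL27_bruhat\<close>; for c = 0 a multiplication by the lower elementary matrix moves the
  unit a to the lower left corner and is undone by its inverse, the sixth power.\<close>

lemma SL27_induct:
  assumes A: "A \<in> carrier SL27"
    and closed: "\<And>A B. A \<in> X' \<Longrightarrow> B \<in> X' \<Longrightarrow> SL27_mult A B \<in> X'" and one: "(1,0,0,1) \<in> X'"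
    and U: "(1,1,0,1) \<in> X'" and L: "(1,0,1,1) \<in> X'"
  shows "A \<in> X'"
proof -
  have u: "(1,x,0,1) \<in> X'" if "x \<in> set residues7" for x
  proof -
    have 2: "(1,2,0,1) \<in> X'" using closed[OF U U] by (simp add: SL27_mult_def)
    have 3: "(1,3,0,1) \<in> X'" using closed[OF U 2] by (simp add: SL27_mult_def)
    have 4: "(1,4,0,1) \<in> X'" using closed[OF U 3] by (simp add: SL27_mult_def)
    have 5: "(1,5,0,1) \<in> X'" using closed[OF U 4] by (simp add: SL27_mult_def)
    have 6: "(1,6,0,1) \<in> X'" using closed[OF U 5] by (simp add: SL27_mult_def)
    show ?thesis using that unfolding list.set by (elim insertE emptyE) (simp_all only: one U 2 3 4 5 6)
  qed
  have l: "(1,0,x,1) \<in> X'" if "x \<in> set residues7" for x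
  proof -
    have 2: "(1,0,2,1) \<in> X'" using closed[OF L L] by (simp add: SL27_mult_def)
    have 3: "(1,0,3,1) \<in> X'" using closed[OF L 2] by (simp add: SL27_mult_def)
    have 4: "(1,0,4,1) \<in> X'" using closed[OF L 3] by (simp add: SL27_mult_def)
    have 5: "(1,0,5,1) \<in> X'" using closed[OF L 4] by (simp add: SL27_mult_def)
    have 6: "(1,0,6,1) \<in> X'" using closed[OF L 5] by (simp add: SL27_mult_def)
    show ?thesis using that unfolding list.set by (elim insertE emptyE) (simp_all only: one L 2 3 4 5 6)
  qed
  have c0: "(a,b,c,d) \<in> X'" if "(a,b,c,d) \<in> carrier SL27" "c \<noteq> 0" for a b c d
  proof -
    have eq: "SL27_mult (SL27_mult (1, (a - 1) * c ^ 5 mod 7, 0, 1) (1, 0, c, 1)) (1, (d - 1) * c ^ 5 mod 7, 0, 1) = (a,b,c,d)"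
    proof -
      have "(a,b,c,d) \<notin> small_cell ` (set units7 \<times> set residues7)" using that(2) by (auto simp: small_cell_def)
      then have "(a,b,c,d) \<in> big_cell ` (set units7 \<times> set residues7 \<times> set residues7)"
        using that(1) unfolding SL27_cells by blast
      then obtain p where p: "p \<in> set units7 \<times> set residues7 \<times> set residues7" "(a,b,c,d) = big_cell p" by (rule imageE)
      obtain c' a' d' where p': "p = (c',a',d')" by (cases p)
      then have cad: "c' \<in> set units7" "a' \<in> set residues7" "d' \<in> set residues7" "(a,b,c,d) = big_cell (c',a',d')"
        using p unfolding mem_Sigma_iff by (simp_all only: mem_Sigma_iff)
      then have "c' = c" "a' = a" "d' = d" by (simp_all add: big_cell_def)
      then show ?thesis using SL27_bruhat cad by metis
    qed
    have "c \<in> set residues7" using that(1) unfolding SL27_iff set_residues7 by blast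
    then have "SL27_mult (SL27_mult (1, (a - 1) * c ^ 5 mod 7, 0, 1) (1, 0, c, 1)) (1, (d - 1) * c ^ 5 mod 7, 0, 1) \<in> X'"
      by (intro closed u l) (simp_all only: set_residues7 mod7_range)
    then show ?thesis unfolding eq .
  qed
  obtain a b c d where A': "A = (a,b,c,d)" by (cases A)
  show ?thesis
  proof (cases "c = 0")
    case False
    then show ?thesis using c0 A A' by blast
  next
    case True
    have r: "a \<in> {0..6}" "b \<in> {0..6}" "d \<in> {0..6}" and dt: "(a * d) mod 7 = 1" using A A' True by (simp_all add: SL27_iff)
    have "a \<noteq> 0" using dt by auto
    have LA: "SL27_mult (1,0,1,1) A = (a, b, a, (b + d) mod 7)" using r True by (simp add: A' SL27_mult_def)
    have "SL27_mult (1,0,1,1) A \<in> carrier SL27" by (rule SL27_mult_closed[OF _ A]) (simp add: SL27_iff)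
    then have "SL27_mult (1,0,1,1) A \<in> X'" using c0[of a b a "(b + d) mod 7"] \<open>a \<noteq> 0\<close> unfolding LA by blast
    then have "SL27_mult (1,0,6,1) (SL27_mult (1,0,1,1) A) \<in> X'" using closed l[of 6] by simp
    moreover have "SL27_mult (1,0,6,1) (SL27_mult (1,0,1,1) A) = A"
    proof -
      have "SL27_mult (1,0,6,1) (1,0,1,1) = (1,0,0,1)" by (simp add: SL27_mult_def)
      then show ?thesis using SL.l_one[OF A] by (simp add: SL27_mult_assoc[symmetric])
    qed
    ultimately show ?thesis by simp
  qed
qed

definition act7 :: "int \<times> int \<times> int \<times> int \<Rightarrow> int \<times> int \<Rightarrow> int \<times> int" where
  "act7 A v = (case A of (a,b,c,d) \<Rightarrow> case v of (x,y) \<Rightarrow> ((a * x + b * y) mod 7, (c * x + d * y) mod 7))"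

definition scale7 :: "int \<Rightarrow> int \<times> int \<Rightarrow> int \<times> int" where
  "scale7 l v = (case v of (x,y) \<Rightarrow> (l * x mod 7, l * y mod 7))"

definition plane7 :: "(int \<times> int) set" where "plane7 = {0..6} \<times> {0..6} - {(0,0)}"

text \<open>The projective line over the field of order \<open>7\<close>, labelled so that its quadratic-residue
  blocks are the lines of the extended Fano plane; \<open>point7\<close> lists a representative of each label.\<close>

definition label7 :: "int \<times> int \<Rightarrow> nat" where
  "label7 v = (case v of (x,y) \<Rightarrow> if y = 0 then 6 else [0,1,2,4,3,7,5] ! nat (x * y ^ 5 mod 7))"

definition point7 :: "(int \<times> int) list" where
  "point7 = [(0,1),(1,1),(2,1),(4,1),(3,1),(6,1),(1,0),(5,1)]"

text \<open>The permutation of the projective line as the list of its 8 images, so that composition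
  and membership can be evaluated.\<close>

definition moebius :: "int \<times> int \<times> int \<times> int \<Rightarrow> nat list" where
  "moebius A = map (\<lambda>v. label7 (act7 A v)) point7"

definition pcomp :: "nat list \<Rightarrow> nat list \<Rightarrow> nat list" where
  "pcomp p q = map (\<lambda>i. p ! i) q"

lemma act7_mult: "act7 (SL27_mult A B) v = act7 A (act7 B v)"
proof -
  obtain a b c d where A: "A = (a,b,c,d)" by (cases A)
  obtain e f g h where B: "B = (e,f,g,h)" by (cases B)
  obtain x y where v: "v = (x,y)" by (cases v)
  show ?thesis unfolding A B v SL27_mult_def act7_def prod.case prod.inject mod7_linear mod_simps by (simp add: algebra_simps)
qed

lemma act7_scale: "act7 A (scale7 l v) = scale7 l (act7 A v)"
proof -
  obtain a b c d where A: "A = (a,b,c,d)" by (cases A)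
  obtain x y where v: "v = (x,y)" by (cases v)
  show ?thesis unfolding A v scale7_def act7_def prod.case prod.inject mod7_linear mod_simps by (simp add: algebra_simps)
qed

lemma act7_plane:
  assumes A: "A \<in> carrier SL27" and v: "v \<in> plane7" shows "act7 A v \<in> plane7"
proof -
  obtain a b c d where A': "A = (a,b,c,d)" by (cases A)
  obtain x y where v': "v = (x,y)" by (cases v)
  have dt: "(a * d - b * c) mod 7 = 1" using A A' by (simp add: SL27_iff)
  have r: "x mod 7 = x" "y mod 7 = y" "(x, y) \<noteq> (0, 0)" using v v' by (auto simp: plane7_def)
  have "\<not> ((a * x + b * y) mod 7 = 0 \<and> (c * x + d * y) mod 7 = 0)"
  proof
    assume z: "(a * x + b * y) mod 7 = 0 \<and> (c * x + d * y) mod 7 = 0"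
    have "x = (a * d - b * c) mod 7 * x mod 7" "y = (a * d - b * c) mod 7 * y mod 7" unfolding dt using r by simp_all
    moreover have "(a * d - b * c) mod 7 * x mod 7 = (d * (a * x + b * y) - b * (c * x + d * y)) mod 7"
      "(a * d - b * c) mod 7 * y mod 7 = (a * (c * x + d * y) - c * (a * x + b * y)) mod 7"
      unfolding mod_simps by (simp_all add: algebra_simps)
    moreover have "(d * (a * x + b * y) - b * (c * x + d * y)) mod 7 = 0" "(a * (c * x + d * y) - c * (a * x + b * y)) mod 7 = 0"
      using z by (simp_all add: mod_eq_0_iff_dvd)
    ultimately show False using r(3) by simp
  qed
  then show ?thesis unfolding A' v' act7_def prod.case plane7_def using mod7_range by blast
qed

lemma label7_scale:
  "\<forall>l\<in>set units7. \<forall>x\<in>set residues7. \<forall>y\<in>set residues7. label7 (scale7 l (x,y)) = label7 (x,y)"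
  by code_simp

lemma point7_label7:
  "\<forall>x\<in>set residues7. \<forall>y\<in>set residues7. (x,y) = (0,0) \<or>
     label7 (x,y) < 8 \<and> (\<exists>l\<in>set units7. point7 ! label7 (x,y) = scale7 l (x,y))"
  by code_simp

lemma point7_plane: "i < 8 \<Longrightarrow> point7 ! i \<in> plane7"
  unfolding less_8_cases by (elim disjE) (simp_all add: point7_def plane7_def)

lemma length_point7: "length point7 = 8"
  by (simp add: point7_def)

text \<open>Between the two factors a vector is replaced by the listed representative of its point.
  The two differ by a unit scalar, which linear maps respect and labels ignore.\<close>

lemma moebius_mult:
  assumes A: "A \<in> carrier SL27" and B: "B \<in> carrier SL27"
  shows "moebius (SL27_mult A B) = pcomp (moebius A) (moebius B)"
proof (rule nth_equalityI)
  show "length (moebius (SL27_mult A B)) = length (pcomp (moebius A) (moebius B))"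
    by (simp add: moebius_def pcomp_def)
  fix i assume "i < length (moebius (SL27_mult A B))"
  then have i: "i < 8" by (simp add: moebius_def length_point7)
  define v where "v = act7 B (point7 ! i)"
  have v: "v \<in> plane7" unfolding v_def by (rule act7_plane[OF B point7_plane[OF i]])
  obtain x y where xy: "v = (x,y)" by (cases v)
  have xyr: "x \<in> set residues7" "y \<in> set residues7" "(x,y) \<noteq> (0,0)" using v unfolding xy plane7_def set_residues7 by auto
  have l8: "label7 v < 8" and "\<exists>l\<in>set units7. point7 ! label7 v = scale7 l v"
    using bspec[OF bspec[OF point7_label7 xyr(1)] xyr(2)] xyr(3) unfolding xy by blast+
  then obtain l where l: "l \<in> set units7" "point7 ! label7 v = scale7 l v" by blast
  obtain x' y' where w: "act7 A v = (x',y')" by (cases "act7 A v")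
  have "x' \<in> set residues7" "y' \<in> set residues7" using act7_plane[OF A v] unfolding w plane7_def set_residues7 by auto
  then have "label7 (scale7 l (act7 A v)) = label7 (act7 A v)" using label7_scale l(1) unfolding w by blast
  then have "label7 (act7 A (point7 ! label7 v)) = label7 (act7 A v)" unfolding l(2) act7_scale .
  then show "moebius (SL27_mult A B) ! i = pcomp (moebius A) (moebius B) ! i"
    using i l8 by (simp add: moebius_def pcomp_def length_point7 act7_mult v_def)
qed

text \<open>The list at position i sends j to the bitwise sum of i and j: these are the translations
  of F_2^3 with labels read in binary.\<close>

definition shifts :: "nat list list" where
  "shifts = [[0,1,2,3,4,5,6,7],[1,0,3,2,5,4,7,6],[2,3,0,1,6,7,4,5],[3,2,1,0,7,6,5,4],
    [4,5,6,7,0,1,2,3],[5,4,7,6,1,0,3,2],[6,7,4,5,2,3,0,1],[7,6,5,4,3,2,1,0]]"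

text \<open>Evaluated over the two cells. It serves both to find the kernel of the Moebius action
  and to show that its image meets the translations trivially.\<close>

lemma moebius_shift:
  "\<forall>c\<in>set units7. \<forall>a\<in>set residues7. \<forall>d\<in>set residues7. moebius (big_cell (c,a,d)) \<notin> set shifts"
  "\<forall>a\<in>set units7. \<forall>b\<in>set residues7. moebius (small_cell (a,b)) \<in> set shifts \<longrightarrow>
     small_cell (a,b) = (1,0,0,1) \<or> small_cell (a,b) = (6,0,0,6)"
  by code_simp+

lemma moebius_minus_one: "moebius (1,0,0,1) = [0,1,2,3,4,5,6,7]" "moebius (6,0,0,6) = [0,1,2,3,4,5,6,7]"
  by code_simp+

lemma shifts_closed:
  "\<forall>p\<in>set shifts. \<forall>q\<in>set shifts. pcomp p q \<in> set shifts \<and> pcomp p q = pcomp q p"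
  "\<forall>p\<in>set shifts. pcomp p p = [0,1,2,3,4,5,6,7]"
  by code_simp+

text \<open>In the chosen labelling both elementary matrices act as affine maps of F_2^3. The copy
  of PSL(2,7) obtained is transitive on the 8 points, so it is a complement to the translations
  different from a point stabiliser.\<close>

lemma normalises_shifts:
  "\<forall>t\<in>set shifts. \<exists>u\<in>set shifts. pcomp (moebius (1,1,0,1)) t = pcomp u (moebius (1,1,0,1))"
  "\<forall>t\<in>set shifts. \<exists>u\<in>set shifts. pcomp (moebius (1,0,1,1)) t = pcomp u (moebius (1,0,1,1))"
  by code_simp+

section \<open>The automorphism group of the extended Fano plane\<close>

definition fano_list :: "nat list list" where
  "fano_list = [[0,1,2,3],[0,1,4,5],[0,1,6,7],[0,2,4,6],[0,2,5,7],[0,3,4,7],[0,3,5,6],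
     [4,5,6,7],[2,3,6,7],[2,3,4,5],[1,3,5,7],[1,3,4,6],[1,2,5,6],[1,2,4,7]]"

lemma fano_list: "fano_ext_lines = set ` set fano_list"
  by (simp only: fano_ext_lines_eq fano_list_def list.set image_insert image_empty)

text \<open>For a line {a,b,c,d} this is an affine transvection: it fixes the complementary plane
  pointwise and translates the plane {a,b,c,d} by the difference of a and b.\<close>

definition swap2 :: "nat \<Rightarrow> nat \<Rightarrow> nat \<Rightarrow> nat \<Rightarrow> nat list" where
  "swap2 a b c d = map (\<lambda>i. if i = a then b else if i = b then a else if i = c then d else if i = d then c else i)
     [0,1,2,3,4,5,6,7]"

text \<open>A translation is the product of the transvections that perform it on two parallel
  planes.\<close>

lemma swap2_shifts:
  "pcomp (swap2 0 1 2 3) (swap2 4 5 6 7) = [1,0,3,2,5,4,7,6]"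
  "pcomp (swap2 1 3 4 6) (swap2 0 2 5 7) = [2,3,0,1,6,7,4,5]"
  "pcomp (swap2 0 4 3 7) (swap2 1 5 2 6) = [4,5,6,7,0,1,2,3]"
  by code_simp+

text \<open>Explicit factorisations into three transvections, verified by evaluation; they place the
  generators of the Moebius group in any group that contains the elations.\<close>

lemma swap2_moebius:
  "pcomp (swap2 0 4 3 7) (pcomp (swap2 1 2 4 7) (swap2 0 2 5 7)) = moebius (1,1,0,1)"
  "pcomp (swap2 2 3 4 5) (pcomp (swap2 1 5 3 7) (swap2 1 2 5 6)) = moebius (1,0,1,1)"
  by code_simp+

text \<open>Translation by the vector (a, b, c), with a as the lowest binary digit of the position
  in \<open>shifts\<close>.\<close>

definition shift_of :: "int \<Rightarrow> int \<Rightarrow> int \<Rightarrow> nat list" where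
  "shift_of a b c = shifts ! nat (a + 2 * b + 4 * c)"

lemma shift_of_add:
  "\<forall>a\<in>set [0,1]. \<forall>b\<in>set [0,1]. \<forall>c\<in>set [0,1]. \<forall>a'\<in>set [0,1]. \<forall>b'\<in>set [0,1]. \<forall>c'\<in>set [0,1].
     shift_of ((a + a') mod 2) ((b + b') mod 2) ((c + c') mod 2) = pcomp (shift_of a b c) (shift_of a' b' c')
     \<and> (shift_of a b c = shift_of a' b' c' \<longrightarrow> a = a' \<and> b = b' \<and> c = c')"
  by code_simp

lemma
  assumes "a \<in> set [0,1]" "b \<in> set [0,1]" "c \<in> set [0,1]" "a' \<in> set [0,1]" "b' \<in> set [0,1]" "c' \<in> set [0,1]"
  shows shift_of_hom: "shift_of ((a + a') mod 2) ((b + b') mod 2) ((c + c') mod 2) = pcomp (shift_of a b c) (shift_of a' b' c')"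
    and shift_of_inj: "shift_of a b c = shift_of a' b' c' \<Longrightarrow> a = a' \<and> b = b' \<and> c = c'"
  using bspec[OF bspec[OF bspec[OF bspec[OF bspec[OF bspec[OF shift_of_add assms(1)] assms(2)] assms(3)] assms(4)] assms(5)] assms(6)]
  by blast+

lemma shift_of_range:
  "\<forall>a\<in>set [0,1]. \<forall>b\<in>set [0,1]. \<forall>c\<in>set [0,1]. shift_of a b c \<in> set shifts"
  "\<forall>s\<in>set shifts. \<exists>a\<in>set [0,1]. \<exists>b\<in>set [0,1]. \<exists>c\<in>set [0,1]. s = shift_of a b c"
  by code_simp+

lemma moebius_shift_cases:
  assumes A: "A \<in> carrier SL27" and s: "moebius A \<in> set shifts" shows "A = (1,0,0,1) \<or> A = (6,0,0,6)"
proof -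
  have "A \<in> big_cell ` (set units7 \<times> set residues7 \<times> set residues7) \<or> A \<in> small_cell ` (set units7 \<times> set residues7)"
    using A unfolding SL27_cells by (rule UnE) blast+
  then show ?thesis
  proof
    assume "A \<in> big_cell ` (set units7 \<times> set residues7 \<times> set residues7)"
    then obtain p where p: "A = big_cell p" "p \<in> set units7 \<times> set residues7 \<times> set residues7" by (rule imageE)
    obtain c a d where "p = (c,a,d)" by (cases p)
    then show ?thesis using p s moebius_shift(1) by (simp only: mem_Sigma_iff; blast?)
  next
    assume "A \<in> small_cell ` (set units7 \<times> set residues7)"
    then obtain p where p: "A = small_cell p" "p \<in> set units7 \<times> set residues7" by (rule imageE)
    obtain a b where "p = (a,b)" by (cases p)
    then show ?thesis using p s moebius_shift(2) by (simp only: mem_Sigma_iff; blast?)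
  qed
qed

lemma fano_line_card: "S \<in> fano_ext_lines \<Longrightarrow> card S = 4 \<and> S \<subseteq> {..<8}"
  unfolding std_blocks[symmetric] std.blocks_def by blast

text \<open>Otherwise the two lines would meet in exactly three points, an odd number.\<close>

lemma fano_line_unique:
  assumes S: "{a,b,c,d} \<in> fano_ext_lines" and T: "{a,b,c,e} \<in> fano_ext_lines" shows "d = e"
proof (rule ccontr)
  assume de: "d \<noteq> e"
  have c4: "card {a,b,c,d} = 4" "card {a,b,c,e} = 4" using fano_line_card S T by blast+
  have le: "card {a,b,c} \<le> 3" using card_length[of "[a,b,c]"] by simp
  have d: "d \<notin> {a,b,c}"
  proof
    assume "d \<in> {a,b,c}"
    then have "{a,b,c,d} = {a,b,c}" by blast
    then show False using c4(1) le by simp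
  qed
  have e: "e \<notin> {a,b,c}"
  proof
    assume "e \<in> {a,b,c}"
    then have "{a,b,c,e} = {a,b,c}" by blast
    then show False using c4(2) le by simp
  qed
  have "{a,b,c,d} = insert d {a,b,c}" by blast
  then have c3: "card {a,b,c} = 3" using c4(1) card_insert_disjoint[OF _ d] by simp
  have "{a,b,c,d} \<inter> {a,b,c,e} = {a,b,c}" using d e de by blast
  then have "even (card {a,b,c})" using std.blocks_even_inter[of "{a,b,c,d}" "{a,b,c,e}"] S T unfolding std_blocks by metis
  then show False unfolding c3 by simp
qed

text \<open>Of 8 * 7 * 6 * 5 = 1680 ordered quadruples, 14 * 24 = 336 run through a line. The
  difference is the order of the affine group of F_2^3, counted by its affine frames.\<close>

lemma card_nonplanar_quadruples:
  "card ({xs. length xs = 4 \<and> distinct xs \<and> set xs \<subseteq> {..<8}} - {xs. length xs = 4 \<and> distinct xs \<and> set xs \<in> fano_ext_lines}) = 1344"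
proof -
  let ?all = "{xs. length xs = 4 \<and> distinct xs \<and> set xs \<subseteq> {..<8::nat}}"
  let ?in = "\<lambda>S :: nat set. {xs. length xs = 4 \<and> distinct xs \<and> set xs \<subseteq> S}"
  have "card ?all = \<Prod>{card {..<8::nat} - 4 + 1..card {..<8::nat}}" by (rule card_lists_distinct_length_eq) simp_all
  also have "\<dots> = 1680" unfolding card_lessThan by code_simp
  finally have all: "card ?all = 1680" .
  have fa: "finite ?all" using all by (intro card_ge_0_finite) linarith
  have one: "card (?in S) = 24" if "S \<in> fano_ext_lines" for S
  proof -
    have S: "finite S" "card S = 4" using fano_line_card[OF that] finite_subset[of S "{..<8}"] by simp_all
    have "card (?in S) = \<Prod>{card S - 4 + 1..card S}" by (rule card_lists_distinct_length_eq) (simp_all add: S)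
    also have "\<dots> = 24" unfolding S by code_simp
    finally show ?thesis .
  qed
  have eqS: "set xs = S" if "S \<in> fano_ext_lines" "xs \<in> ?in S" for xs S
  proof -
    have "length xs = 4" "distinct xs" and sub: "set xs \<subseteq> S" using that(2) by blast+
    then have c: "card (set xs) = card S" using distinct_card[of xs] fano_line_card[OF that(1)] by simp
    have "finite S" using fano_line_card[OF that(1)] finite_subset[of S "{..<8}"] by simp
    then show ?thesis using sub c by (rule card_subset_eq)
  qed
  have un: "{xs. length xs = 4 \<and> distinct xs \<and> set xs \<in> fano_ext_lines} = (\<Union>S\<in>fano_ext_lines. ?in S)" (is "?L = _")
  proof (intro subset_antisym subsetI)
    fix xs assume "xs \<in> (\<Union>S\<in>fano_ext_lines. ?in S)"
    then obtain S where S: "S \<in> fano_ext_lines" "xs \<in> ?in S" by (rule UN_E)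
    then show "xs \<in> ?L" using eqS[OF S] by simp
  qed blast
  have fin: "finite fano_ext_lines" using card_fano_ext_lines by (intro card_ge_0_finite) linarith
  have "card ?L = (\<Sum>S\<in>fano_ext_lines. card (?in S))" unfolding un
  proof (rule card_UN_disjoint[OF fin])
    have "finite (?in S)" if "S \<in> fano_ext_lines" for S using one[OF that] by (intro card_ge_0_finite) linarith
    then show "\<forall>S\<in>fano_ext_lines. finite (?in S)" by blast
    have "?in S \<inter> ?in T = {}" if "S \<in> fano_ext_lines" "T \<in> fano_ext_lines" "S \<noteq> T" for S T
    proof (rule equals0I)
      fix xs assume "xs \<in> ?in S \<inter> ?in T"
      then have "xs \<in> ?in S" "xs \<in> ?in T" by (rule IntD1, rule IntD2)
      then show False using eqS[OF that(1)] eqS[OF that(2)] that(3) by metis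
    qed
    then show "\<forall>S\<in>fano_ext_lines. \<forall>T\<in>fano_ext_lines. S \<noteq> T \<longrightarrow> ?in S \<inter> ?in T = {}" by (intro ballI impI)
  qed
  also have "\<dots> = 336" using one card_fano_ext_lines by simp
  finally have L: "card ?L = 336" .
  have sub: "?L \<subseteq> ?all"
  proof
    fix xs assume "xs \<in> ?L"
    then show "xs \<in> ?all" using fano_line_card[of "set xs"] by simp
  qed
  show ?thesis unfolding card_Diff_subset[OF finite_subset[OF sub fa] sub] all L by simp
qed

text \<open>The permutation-theoretic content of the normaliser, freed from roots: preserving the
  lines bounds the group from above, containing the elations bounds it from below, and the bounds
  meet.\<close>

locale fano_perms = group P for P :: "nat list monoid" (structure) +
  assumes mult_eq: "p \<otimes> q = pcomp p q"
    and one_eq: "\<one> = [0,1,2,3,4,5,6,7]"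
    and list8: "p \<in> carrier P \<Longrightarrow> length p = 8 \<and> distinct p \<and> set p \<subseteq> {..<8}"
    and lines: "p \<in> carrier P \<Longrightarrow> S \<in> fano_ext_lines \<Longrightarrow> (!) p ` S \<in> fano_ext_lines"
    and swaps: "distinct [a,b,c,d] \<Longrightarrow> set [a,b,c,d] \<in> fano_ext_lines \<Longrightarrow> swap2 a b c d \<in> carrier P"
begin

lemma swap_mem: "distinct [a,b,c,d] \<and> sort [a,b,c,d] \<in> set fano_list \<Longrightarrow> swap2 a b c d \<in> carrier P"
proof (rule swaps)
  assume "distinct [a,b,c,d] \<and> sort [a,b,c,d] \<in> set fano_list"
  then have "set (sort [a,b,c,d]) \<in> fano_ext_lines" unfolding fano_list by blast
  then show "set [a,b,c,d] \<in> fano_ext_lines" by (simp only: set_sort)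
qed simp

lemma pcomp_mem: "p \<in> carrier P \<Longrightarrow> q \<in> carrier P \<Longrightarrow> pcomp p q \<in> carrier P"
  using m_closed mult_eq by metis

lemma shifts_mem: "set shifts \<subseteq> carrier P"
proof -
  have 1: "[1,0,3,2,5,4,7,6] \<in> carrier P"
    unfolding swap2_shifts(1)[symmetric] by (intro pcomp_mem swap_mem; code_simp)
  have 2: "[2,3,0,1,6,7,4,5] \<in> carrier P"
    unfolding swap2_shifts(2)[symmetric] by (intro pcomp_mem swap_mem; code_simp)
  have 4: "[4,5,6,7,0,1,2,3] \<in> carrier P"
    unfolding swap2_shifts(3)[symmetric] by (intro pcomp_mem swap_mem; code_simp)
  have 3: "[3,2,1,0,7,6,5,4] \<in> carrier P" using pcomp_mem[OF 1 2] by (simp add: pcomp_def)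
  have 5: "[5,4,7,6,1,0,3,2] \<in> carrier P" using pcomp_mem[OF 4 1] by (simp add: pcomp_def)
  have 6: "[6,7,4,5,2,3,0,1] \<in> carrier P" using pcomp_mem[OF 4 2] by (simp add: pcomp_def)
  have 7: "[7,6,5,4,3,2,1,0] \<in> carrier P" using pcomp_mem[OF 4 3] by (simp add: pcomp_def)
  have 0: "[0,1,2,3,4,5,6,7] \<in> carrier P" using one_closed unfolding one_eq .
  show ?thesis unfolding shifts_def list.set using 0 1 2 3 4 5 6 7 by (intro insert_subsetI empty_subsetI)
qed

text \<open>The normaliser of the translations, written as p t = u p to avoid inverses, so that the
  condition can be evaluated on lists.\<close>

definition Nz :: "nat list set" where
  "Nz = {p \<in> carrier P. \<forall>t\<in>set shifts. \<exists>u\<in>set shifts. p \<otimes> t = u \<otimes> p}"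

lemma Nz_mult: assumes "p \<in> Nz" "q \<in> Nz" shows "p \<otimes> q \<in> Nz"
proof -
  have p: "p \<in> carrier P" "\<And>t. t \<in> set shifts \<Longrightarrow> \<exists>u\<in>set shifts. p \<otimes> t = u \<otimes> p"
    and q: "q \<in> carrier P" "\<And>t. t \<in> set shifts \<Longrightarrow> \<exists>u\<in>set shifts. q \<otimes> t = u \<otimes> q"
    using assms unfolding Nz_def by blast+
  have "\<exists>u\<in>set shifts. p \<otimes> q \<otimes> t = u \<otimes> (p \<otimes> q)" if t: "t \<in> set shifts" for t
  proof -
    obtain u where u: "u \<in> set shifts" "q \<otimes> t = u \<otimes> q" using q(2)[OF t] by blast
    obtain v where v: "v \<in> set shifts" "p \<otimes> u = v \<otimes> p" using p(2)[OF u(1)] by blast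
    have c: "t \<in> carrier P" "u \<in> carrier P" "v \<in> carrier P" using shifts_mem t u(1) v(1) by blast+
    have "p \<otimes> q \<otimes> t = p \<otimes> (q \<otimes> t)" by (rule m_assoc[OF p(1) q(1) c(1)])
    also have "\<dots> = p \<otimes> u \<otimes> q" unfolding u(2) by (rule m_assoc[OF p(1) c(2) q(1), symmetric])
    also have "\<dots> = v \<otimes> (p \<otimes> q)" unfolding v(2) by (rule m_assoc[OF c(3) p(1) q(1)])
    finally show ?thesis using v(1) by blast
  qed
  then show ?thesis unfolding Nz_def using m_closed[OF p(1) q(1)] by blast
qed

lemma shifts_Nz: "set shifts \<subseteq> Nz"
proof
  fix p assume p: "p \<in> set shifts"
  have "p \<otimes> t = t \<otimes> p" if "t \<in> set shifts" for t unfolding mult_eq using shifts_closed(1) p that by blast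
  then show "p \<in> Nz" unfolding Nz_def using shifts_mem p by blast
qed

text \<open>Membership is multiplicative, so it is enough to treat the two elementary matrices:
  \<open>swap2_moebius\<close> puts them in P and \<open>normalises_shifts\<close> gives the
  normalising condition.\<close>

lemma moebius_Nz: "A \<in> carrier SL27 \<Longrightarrow> moebius A \<in> Nz"
proof -
  assume A: "A \<in> carrier SL27"
  have "A \<in> {A \<in> carrier SL27. moebius A \<in> Nz}"
  proof (rule SL27_induct[OF A])
    fix B C assume "B \<in> {A \<in> carrier SL27. moebius A \<in> Nz}" "C \<in> {A \<in> carrier SL27. moebius A \<in> Nz}"
    then have BC: "B \<in> carrier SL27" "C \<in> carrier SL27" "moebius B \<in> Nz" "moebius C \<in> Nz" by blast+
    show "SL27_mult B C \<in> {A \<in> carrier SL27. moebius A \<in> Nz}"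
      using SL27_mult_closed[OF BC(1,2)] Nz_mult[OF BC(3,4)] unfolding moebius_mult[OF BC(1,2)] mult_eq mem_Collect_eq by (rule conjI)
  next
    have "[0,1,2,3,4,5,6,7] \<in> set shifts" unfolding shifts_def by simp
    then have "moebius (1,0,0,1) \<in> Nz" unfolding moebius_minus_one using shifts_Nz by blast
    then show "(1,0,0,1) \<in> {A \<in> carrier SL27. moebius A \<in> Nz}" using SL.one_closed by simp
  next
    have "moebius (1,1,0,1) \<in> carrier P"
      unfolding swap2_moebius[symmetric] by (intro pcomp_mem swap_mem; code_simp)
    then have "moebius (1,1,0,1) \<in> Nz" unfolding Nz_def mult_eq using normalises_shifts(1) by blast
    then show "(1,1,0,1) \<in> {A \<in> carrier SL27. moebius A \<in> Nz}" by (simp add: SL27_iff)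
  next
    have "moebius (1,0,1,1) \<in> carrier P"
      unfolding swap2_moebius[symmetric] by (intro pcomp_mem swap_mem; code_simp)
    then have "moebius (1,0,1,1) \<in> Nz" unfolding Nz_def mult_eq using normalises_shifts(2) by blast
    then show "(1,0,1,1) \<in> {A \<in> carrier SL27. moebius A \<in> Nz}" by (simp add: SL27_iff)
  qed
  then show ?thesis by blast
qed

lemma Nz_carrier: "Nz \<subseteq> carrier P"
  unfolding Nz_def by blast

lemma group_hom_moebius: "group_hom SL27 P moebius"
proof (intro group_hom.intro group_hom_axioms.intro homI)
  show "moebius A \<in> carrier P" if "A \<in> carrier SL27" for A using moebius_Nz[OF that] Nz_carrier by blast
  show "moebius (A \<otimes>\<^bsub>SL27\<^esub> B) = moebius A \<otimes> moebius B" if "A \<in> carrier SL27" "B \<in> carrier SL27" for A B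
    unfolding mult_eq mult_SL27 by (rule moebius_mult[OF that])
qed (rule SL.is_group is_group)+

text \<open>The images of the affine frame 0, 1, 2, 4 determine those of 3, 5, 6 and finally 7 as
  fourth points of lines, and they are never coplanar.\<close>

lemma finite_carrier: "finite (carrier P)" and card_carrier: "card (carrier P) \<le> 1344"
proof -
  define key where "key p = [p ! 0, p ! 1, p ! 2, p ! (4::nat)]" for p :: "nat list"
  let ?K = "{xs. length xs = 4 \<and> distinct xs \<and> set xs \<subseteq> {..<8}} - {xs. length xs = 4 \<and> distinct xs \<and> set xs \<in> fano_ext_lines}"
  have img: "{p ! a, p ! b, p ! c, p ! d} \<in> fano_ext_lines" if p: "p \<in> carrier P" and l: "{a,b,c,d} \<in> fano_ext_lines" for p a b c d
    using lines[OF p l] by simp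
  have L: "{0,1,2,3} \<in> fano_ext_lines" "{0,1,4,5} \<in> fano_ext_lines" "{0,2,4,6} \<in> fano_ext_lines" "{4,5,6,7} \<in> fano_ext_lines"
    unfolding fano_ext_lines_eq by (simp_all only: insert_iff simp_thms)
  have keyK: "key p \<in> ?K" if p: "p \<in> carrier P" for p
  proof -
    have p8: "length p = 8" "distinct p" "set p \<subseteq> {..<8}" using list8[OF p] by blast+
    have lt: "p ! i < 8" if "i < 8" for i
    proof -
      have "p ! i \<in> set p" using that p8(1) by (intro nth_mem) simp
      then show ?thesis using p8(3) by blast
    qed
    have ne: "p ! i \<noteq> p ! j" if "i < 8" "j < 8" "i \<noteq> j" for i j using nth_eq_iff_index_eq[OF p8(2)] that p8(1) by simp
    have d: "distinct (key p)" unfolding key_def using ne by simp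
    have s: "set (key p) \<subseteq> {..<8}" unfolding key_def using lt by simp
    \<comment> \<open>Otherwise the images of 3 and of 4 would both complete the images of 0, 1, 2
      to a line.\<close>
    have "set (key p) \<notin> fano_ext_lines"
    proof
      assume "set (key p) \<in> fano_ext_lines"
      then have "{p ! 0, p ! 1, p ! 2, p ! 4} \<in> fano_ext_lines" unfolding key_def by simp
      from fano_line_unique[OF this img[OF p L(1)]] show False using ne[of 4 3] by simp
    qed
    then show ?thesis using d s by (simp add: key_def)
  qed
  have inj: "inj_on key (carrier P)"
  proof (rule inj_onI)
    fix p q assume p: "p \<in> carrier P" and q: "q \<in> carrier P" and "key p = key q"
    then have k: "p ! 0 = q ! 0" "p ! 1 = q ! 1" "p ! 2 = q ! 2" "p ! 4 = q ! 4" unfolding key_def by simp_all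
    have k3: "p ! 3 = q ! 3" using img[OF p L(1)] img[OF q L(1)] unfolding k by (rule fano_line_unique)
    have k5: "p ! 5 = q ! 5" using img[OF p L(2)] img[OF q L(2)] unfolding k by (rule fano_line_unique)
    have k6: "p ! 6 = q ! 6" using img[OF p L(3)] img[OF q L(3)] unfolding k by (rule fano_line_unique)
    have k7: "p ! 7 = q ! 7" using img[OF p L(4)] img[OF q L(4)] unfolding k k5 k6 by (rule fano_line_unique)
    have "p ! i = q ! i" if "i < 8" for i using that unfolding less_8_cases by (elim disjE) (simp_all only: k k3 k5 k6 k7)
    then show "p = q" using list8[OF p] list8[OF q] by (intro nth_equalityI) simp_all
  qed
  have sub: "key ` carrier P \<subseteq> ?K" using keyK by blast
  have finK: "finite ?K" using card_nonplanar_quadruples by (intro card_ge_0_finite) linarith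
  show "finite (carrier P)" by (rule inj_on_finite[OF inj sub finK])
  show "card (carrier P) \<le> 1344" using card_inj_on_le[OF inj sub finK] unfolding card_nonplanar_quadruples .
qed

lemma subgroup_shifts: "subgroup (set shifts) P"
proof (rule subgroupI)
  show "set shifts \<subseteq> carrier P" by (rule shifts_mem)
  show "set shifts \<noteq> {}" by (simp add: shifts_def)
  show "p \<otimes> q \<in> set shifts" if "p \<in> set shifts" "q \<in> set shifts" for p q
    unfolding mult_eq using shifts_closed(1) that by blast
  show "inv p \<in> set shifts" if p: "p \<in> set shifts" for p
  proof -
    have "p \<otimes> p = \<one>" unfolding mult_eq one_eq using shifts_closed(2) p by blast
    then have "inv p = p" using inv_equality[of p p] shifts_mem p by blast
    then show ?thesis using p by simp
  qed
qed

lemma Z2_shifts: "P\<lparr>carrier := set shifts\<rparr> \<cong> Z2_pow 3"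
proof -
  let ?h = "\<lambda>f :: nat \<Rightarrow> int. shift_of (f 0) (f 1) (f 2)"
  have val: "f 0 \<in> set [0,1]" "f 1 \<in> set [0,1]" "f 2 \<in> set [0,1]" if "f \<in> carrier (Z2_pow 3)" for f
    using that PiE_mem[of f "{..<3}" "\<lambda>_. {0,1}"] unfolding carrier_Z2_pow list.set by simp_all
  have "?h \<in> iso (Z2_pow 3) (P\<lparr>carrier := set shifts\<rparr>)"
  proof (rule isoI)
    show "?h \<in> hom (Z2_pow 3) (P\<lparr>carrier := set shifts\<rparr>)"
    proof (rule homI)
      show "?h f \<in> carrier (P\<lparr>carrier := set shifts\<rparr>)" if "f \<in> carrier (Z2_pow 3)" for f
      proof -
        have "shift_of (f 0) (f 1) (f 2) \<in> set shifts" using shift_of_range(1) val[OF that] by blast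
        then show ?thesis by simp
      qed
      fix f g assume f: "f \<in> carrier (Z2_pow 3)" and g: "g \<in> carrier (Z2_pow 3)"
      have m: "(f \<otimes>\<^bsub>Z2_pow 3\<^esub> g) 0 = (f 0 + g 0) mod 2" "(f \<otimes>\<^bsub>Z2_pow 3\<^esub> g) 1 = (f 1 + g 1) mod 2"
        "(f \<otimes>\<^bsub>Z2_pow 3\<^esub> g) 2 = (f 2 + g 2) mod 2" by (simp_all add: mult_Z2_pow)
      have "x \<otimes>\<^bsub>P\<lparr>carrier := set shifts\<rparr>\<^esub> y = pcomp x y" for x y by (simp add: mult_eq)
      then show "?h (f \<otimes>\<^bsub>Z2_pow 3\<^esub> g) = ?h f \<otimes>\<^bsub>P\<lparr>carrier := set shifts\<rparr>\<^esub> ?h g"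
        unfolding m using shift_of_hom[OF val[OF f] val[OF g]] by (simp only:)
    qed
    show "bij_betw ?h (carrier (Z2_pow 3)) (carrier (P\<lparr>carrier := set shifts\<rparr>))"
    proof (rule bij_betw_imageI)
      show "inj_on ?h (carrier (Z2_pow 3))"
      proof (rule inj_onI)
        fix f g assume f: "f \<in> carrier (Z2_pow 3)" and g: "g \<in> carrier (Z2_pow 3)" and eq: "?h f = ?h g"
        have e: "f 0 = g 0" "f 1 = g 1" "f 2 = g 2" using shift_of_inj[OF val[OF f] val[OF g] eq] by blast+
        show "f = g"
        proof (rule PiE_ext)
          show "f \<in> {..<3} \<rightarrow>\<^sub>E {0, 1}" "g \<in> {..<3} \<rightarrow>\<^sub>E {0, 1}" using f g by (simp_all only: carrier_Z2_pow)
          fix i assume "i \<in> {..<3::nat}"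
          then have "i = 0 \<or> i = 1 \<or> i = 2" unfolding lessThan_iff by linarith
          then show "f i = g i" using e by (elim disjE) (simp_all only:)
        qed
      qed
      have "s \<in> ?h ` carrier (Z2_pow 3)" if s: "s \<in> set shifts" for s
      proof -
        obtain a b c where abc: "a \<in> set [0,1]" "b \<in> set [0,1]" "c \<in> set [0,1]" "s = shift_of a b c"
          using shift_of_range(2) s by blast
        define f where "f = (\<lambda>i\<in>{..<3::nat}. if i = 0 then a else if i = 1 then b else c)"
        have "f 0 = a" "f 1 = b" "f 2 = c" by (simp_all add: f_def)
        moreover have "f \<in> carrier (Z2_pow 3)" unfolding carrier_Z2_pow f_def using abc by (intro restrict_PiE_iff[THEN iffD2]) auto
        ultimately show ?thesis using abc(4) by (intro image_eqI[of _ _ f]) simp_all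
      qed
      then show "?h ` carrier (Z2_pow 3) = carrier (P\<lparr>carrier := set shifts\<rparr>)"
      proof (intro subset_antisym subsetI)
        fix s assume "s \<in> ?h ` carrier (Z2_pow 3)"
        then obtain f where f: "f \<in> carrier (Z2_pow 3)" "s = ?h f" by blast
        have "shift_of (f 0) (f 1) (f 2) \<in> set shifts" using shift_of_range(1) val[OF f(1)] by blast
        then show "s \<in> carrier (P\<lparr>carrier := set shifts\<rparr>)" unfolding f(2) by simp
      qed simp
    qed
  qed
  then have "Z2_pow 3 \<cong> P\<lparr>carrier := set shifts\<rparr>" unfolding is_iso_def by blast
  then show ?thesis by (rule group.iso_sym[OF group_Z2_pow])
qed

text \<open>The translations and the Moebius group meet trivially, so their product has 8 * 168 =
  1344 elements and exhausts P. As both factors lie in \<open>Nz\<close>, so does P, and the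
  translations are normal.\<close>

theorem split_extension:
  "\<exists>E H. E \<lhd> P \<and> subgroup H P \<and> P\<lparr>carrier := E\<rparr> \<cong> Z2_pow 3 \<and> P\<lparr>carrier := H\<rparr> \<cong> PSL27
     \<and> E \<inter> H = {\<one>} \<and> E <#> H = carrier P"
proof -
  interpret h: group_hom SL27 P moebius by (rule group_hom_moebius)
  define H where "H = moebius ` carrier SL27"
  have sH: "subgroup H P" unfolding H_def by (rule h.img_is_subgroup)
  have gH: "group (P\<lparr>carrier := H\<rparr>)" by (rule subgroup_imp_group[OF sH])
  have one_shift: "\<one> \<in> set shifts" by (rule subgroup.one_closed[OF subgroup_shifts])
  let ?K = "{(1,0,0,1), (6,0,0,6)} :: (int \<times> int \<times> int \<times> int) set"
  have K_mem: "?K \<subseteq> carrier SL27" by (simp add: SL27_iff)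
  have K1: "moebius A = \<one>" if "A \<in> ?K" for A using that moebius_minus_one unfolding one_eq by blast
  interpret g: group_hom SL27 "P\<lparr>carrier := H\<rparr>" moebius
  proof (intro group_hom.intro group_hom_axioms.intro homI)
    show "moebius A \<in> carrier (P\<lparr>carrier := H\<rparr>)" if "A \<in> carrier SL27" for A using that by (simp add: H_def)
    show "moebius (A \<otimes>\<^bsub>SL27\<^esub> B) = moebius A \<otimes>\<^bsub>P\<lparr>carrier := H\<rparr>\<^esub> moebius B" if "A \<in> carrier SL27" "B \<in> carrier SL27" for A B
      using h.hom_mult[OF that] by simp
  qed (rule SL.is_group gH)+
  have ker: "kernel SL27 (P\<lparr>carrier := H\<rparr>) moebius = ?K"
  proof (intro subset_antisym subsetI)
    fix A assume "A \<in> kernel SL27 (P\<lparr>carrier := H\<rparr>) moebius"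
    then have "A \<in> carrier SL27" "moebius A = \<one>" unfolding kernel_def by simp_all
    then show "A \<in> ?K" using moebius_shift_cases[of A] one_shift by simp
  next
    fix A assume "A \<in> ?K"
    then show "A \<in> kernel SL27 (P\<lparr>carrier := H\<rparr>) moebius" unfolding kernel_def using K1[of A] K_mem by auto
  qed
  have "SL27 Mod ?K \<cong> P\<lparr>carrier := H\<rparr>" using g.FactGroup_iso unfolding ker by (simp add: H_def)
  then have iso: "PSL27 \<cong> P\<lparr>carrier := H\<rparr>" unfolding PSL27_def .
  have "?K \<lhd> SL27" using g.normal_kernel unfolding ker .
  then have gPSL: "group PSL27" unfolding PSL27_def by (rule normal.factorgroup_is_group)
  have isoH: "P\<lparr>carrier := H\<rparr> \<cong> PSL27" by (rule group.iso_sym[OF gPSL iso])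
  have "card (rcosets\<^bsub>SL27\<^esub> ?K) * card ?K = 336"
    using SL.lagrange[OF g.subgroup_kernel] card_SL27 unfolding ker order_def by simp
  then have "card (carrier PSL27) = 168" unfolding PSL27_def FactGroup_def by simp
  then have cH: "card H = 168" using iso_same_card[OF iso] by simp
  have int: "set shifts \<inter> H = {\<one>}"
  proof (intro subset_antisym subsetI)
    fix p assume "p \<in> set shifts \<inter> H"
    then obtain A where "A \<in> carrier SL27" "p = moebius A" "moebius A \<in> set shifts" unfolding H_def by blast
    then show "p \<in> {\<one>}" using moebius_shift_cases[of A] K1 by blast
  qed (use one_shift subgroup.one_closed[OF sH] in blast)
  have inj: "inj_on (\<lambda>(e,k). e \<otimes> k) (set shifts \<times> H)"
  proof (rule inj_onI, clarify)
    fix e k e' k' assume e: "e \<in> set shifts" "e' \<in> set shifts" and k: "k \<in> H" "k' \<in> H" and eq: "e \<otimes> k = e' \<otimes> k'"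
    have c: "e \<in> carrier P" "e' \<in> carrier P" "k \<in> carrier P" "k' \<in> carrier P"
      using e k shifts_mem subgroup.mem_carrier[OF sH] by blast+
    have "inv e' \<otimes> e = inv e' \<otimes> (e \<otimes> k) \<otimes> inv k" using c by (simp add: m_assoc)
    also have "\<dots> = k' \<otimes> inv k" unfolding eq using c by (simp add: m_assoc[symmetric])
    finally have q: "inv e' \<otimes> e = k' \<otimes> inv k" .
    have "inv e' \<otimes> e \<in> set shifts"
      by (intro subgroup.m_closed[OF subgroup_shifts] subgroup.m_inv_closed[OF subgroup_shifts] e)
    moreover have "k' \<otimes> inv k \<in> H" by (intro subgroup.m_closed[OF sH] subgroup.m_inv_closed[OF sH] k)
    ultimately have z: "inv e' \<otimes> e = \<one>" "k' \<otimes> inv k = \<one>" using int q by auto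
    have "e = e'" using inv_equality[OF z(1)] c by (metis inv_closed inv_inv)
    moreover have "k' = k" using z(2) c by (metis inv_equality inv_inv inv_closed)
    ultimately show "e = e' \<and> k = k'" by simp
  qed
  have img: "(\<lambda>(e,k). e \<otimes> k) ` (set shifts \<times> H) = set shifts <#> H"
    unfolding set_mult_def by auto
  have "card (set shifts) = 8" by code_simp
  then have card: "card (set shifts <#> H) = 1344" using card_image[OF inj] cH unfolding img by (simp add: card_cartesian_product)
  have sub: "set shifts <#> H \<subseteq> carrier P"
    using shifts_mem subgroup.subset[OF sH] unfolding img[symmetric] by auto
  have prod: "set shifts <#> H = carrier P"
    by (rule card_seteq[OF finite_carrier sub]) (simp only: card card_carrier)
  have nz: "x \<in> Nz" if "x \<in> carrier P" for x
  proof -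
    have "x \<in> (\<lambda>(e,k). e \<otimes> k) ` (set shifts \<times> H)" using that prod img by (simp only:)
    then obtain ek where ek: "x = (\<lambda>(e,k). e \<otimes> k) ek" "ek \<in> set shifts \<times> H" by (rule imageE)
    obtain e k where "ek = (e,k)" by (cases ek)
    then have e: "e \<in> set shifts" and k: "k \<in> H" and x: "x = e \<otimes> k" using ek by (simp_all only: mem_Sigma_iff prod.case)
    have "e \<in> Nz" "k \<in> Nz" using e k shifts_Nz moebius_Nz unfolding H_def by blast+
    then show ?thesis unfolding x by (rule Nz_mult)
  qed
  have "set shifts \<lhd> P"
  proof (rule normal_invI[OF subgroup_shifts])
    fix x t assume x: "x \<in> carrier P" and t: "t \<in> set shifts"
    obtain u where u: "u \<in> set shifts" "x \<otimes> t = u \<otimes> x" using nz[OF x] t unfolding Nz_def by blast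
    have "u \<otimes> x \<otimes> inv x = u" using u(1) x shifts_mem by (simp add: m_assoc subsetD)
    then show "x \<otimes> t \<otimes> inv x \<in> set shifts" using u by simp
  qed
  then show ?thesis using sH Z2_shifts isoH int prod by blast
qed

end

section \<open>The discrete Weyl group\<close>

lemma iso_subgroup_image:
  assumes f: "f \<in> iso P Q" and K: "subgroup K P" shows "P\<lparr>carrier := K\<rparr> \<cong> Q\<lparr>carrier := f ` K\<rparr>"
proof -
  have sub: "K \<subseteq> carrier P" by (rule subgroup.subset[OF K])
  have "f \<in> iso (P\<lparr>carrier := K\<rparr>) (Q\<lparr>carrier := f ` K\<rparr>)"
  proof (rule isoI)
    show "f \<in> hom (P\<lparr>carrier := K\<rparr>) (Q\<lparr>carrier := f ` K\<rparr>)"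
      using f sub by (intro homI) (auto simp: iso_def intro: hom_mult subsetD)
    have "inj_on f (carrier P)" using f by (simp add: iso_def bij_betw_def)
    then show "bij_betw f (carrier (P\<lparr>carrier := K\<rparr>)) (carrier (Q\<lparr>carrier := f ` K\<rparr>))"
      using sub by (simp add: bij_betw_def inj_on_subset)
  qed
  then show ?thesis unfolding is_iso_def by blast
qed

text \<open>The splitting is proved in the model of lists; this carries it to the quotient group,
  which is merely isomorphic to that model.\<close>

lemma split_extension_transport:
  assumes P: "group P" and Q: "group Q" and f: "f \<in> iso P Q"
    and split: "\<exists>E H. E \<lhd> P \<and> subgroup H P \<and> P\<lparr>carrier := E\<rparr> \<cong> A \<and> P\<lparr>carrier := H\<rparr> \<cong> B
     \<and> E \<inter> H = {\<one>\<^bsub>P\<^esub>} \<and> E <#>\<^bsub>P\<^esub> H = carrier P"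
  shows "\<exists>E H. E \<lhd> Q \<and> subgroup H Q \<and> Q\<lparr>carrier := E\<rparr> \<cong> A \<and> Q\<lparr>carrier := H\<rparr> \<cong> B
     \<and> E \<inter> H = {\<one>\<^bsub>Q\<^esub>} \<and> E <#>\<^bsub>Q\<^esub> H = carrier Q"
proof -
  obtain E H where E: "E \<lhd> P" and H: "subgroup H P" and iso: "P\<lparr>carrier := E\<rparr> \<cong> A" "P\<lparr>carrier := H\<rparr> \<cong> B"
    and EH: "E \<inter> H = {\<one>\<^bsub>P\<^esub>}" "E <#>\<^bsub>P\<^esub> H = carrier P"
    using split by (elim exE conjE) (rule that)
  have fh: "f \<in> hom P Q" and bij: "bij_betw f (carrier P) (carrier Q)" using f by (simp_all add: iso_def)
  interpret f: group_hom P Q f by (intro group_hom.intro group_hom_axioms.intro P Q fh)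
  have sE: "subgroup E P" using E by (rule normal_imp_subgroup)
  have sub: "E \<subseteq> carrier P" "H \<subseteq> carrier P" using subgroup.subset sE H by blast+
  have sym: "Q\<lparr>carrier := f ` K\<rparr> \<cong> C" if K: "subgroup K P" "P\<lparr>carrier := K\<rparr> \<cong> C" for K and C :: "'z monoid"
  proof -
    have "Q\<lparr>carrier := f ` K\<rparr> \<cong> P\<lparr>carrier := K\<rparr>"
      by (rule group.iso_sym[OF group.subgroup_imp_group[OF P K(1)] iso_subgroup_image[OF f K(1)]])
    then show ?thesis using K(2) by (rule iso_trans)
  qed
  have "f ` E \<lhd> Q" by (rule iso_normal_subgroup[OF f P Q E])
  moreover have "subgroup (f ` H) Q" by (rule f.subgroup_img_is_subgroup[OF H])
  moreover have "Q\<lparr>carrier := f ` E\<rparr> \<cong> A"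
    by (rule iso_trans[OF group.iso_sym[OF group.subgroup_imp_group[OF P sE] iso_subgroup_image[OF f sE]] iso(1)])
  moreover have "Q\<lparr>carrier := f ` H\<rparr> \<cong> B"
    by (rule iso_trans[OF group.iso_sym[OF group.subgroup_imp_group[OF P H] iso_subgroup_image[OF f H]] iso(2)])
  moreover have "f ` E \<inter> f ` H = {\<one>\<^bsub>Q\<^esub>}"
  proof -
    have "f ` E \<inter> f ` H = f ` (E \<inter> H)"
      using inj_on_image_Int[OF bij_betw_imp_inj_on[OF bij] sub] by simp
    then show ?thesis unfolding EH by simp
  qed
  moreover have "f ` E <#>\<^bsub>Q\<^esub> f ` H = carrier Q"
  proof -
    have m: "f (e \<otimes>\<^bsub>P\<^esub> h) = f e \<otimes>\<^bsub>Q\<^esub> f h" if "e \<in> E" "h \<in> H" for e h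
      using f.hom_mult sub that by blast
    have "f ` (E <#>\<^bsub>P\<^esub> H) = (\<Union>e\<in>E. \<Union>h\<in>H. {f (e \<otimes>\<^bsub>P\<^esub> h)})" unfolding set_mult_def by blast
    also have "\<dots> = (\<Union>e\<in>E. \<Union>h\<in>H. {f e \<otimes>\<^bsub>Q\<^esub> f h})" using m by (intro SUP_cong refl) simp
    also have "\<dots> = f ` E <#>\<^bsub>Q\<^esub> f ` H" unfolding set_mult_def by blast
    finally have "f ` (E <#>\<^bsub>P\<^esub> H) = f ` E <#>\<^bsub>Q\<^esub> f ` H" .
    then show ?thesis unfolding EH using bij by (simp add: bij_betw_def)
  qed
  ultimately show ?thesis by blast
qed

section \<open>The normaliser of the sign changes and its action on the frame lines\<close>

context root_frame
begin

lemma supp_uminus: "supp (- x) = supp x"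
  by (simp add: supp_def)

lemma supp_frame: "j < 8 \<Longrightarrow> supp (\<beta> j) = {j}"
  by (auto simp: supp_def frame_inner split: if_splits)

text \<open>Signed permutations of the frame inside W; by \<open>normalizer_flips\<close> they are
  exactly the normaliser of the sign changes.\<close>

definition monomial :: "(real^8 \<Rightarrow> real^8) \<Rightarrow> bool" where
  "monomial w \<longleftrightarrow> w \<in> W_E8_carrier \<and> (\<forall>i<8. \<exists>j<8. w (\<beta> i) = \<beta> j \<or> w (\<beta> i) = - \<beta> j)"

lemma diagonal_flips:
  assumes w: "w \<in> W_E8_carrier" and d: "\<And>i. i < 8 \<Longrightarrow> w (\<beta> i) = \<beta> i \<or> w (\<beta> i) = - \<beta> i"
  shows "w \<in> flips"
proof -
  define S where "S = {i. i < 8 \<and> w (\<beta> i) = - \<beta> i}"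
  have S: "S \<subseteq> {..<8}" unfolding S_def by auto
  have "w x = flip S x" for x
  proof (rule frame_eqI)
    fix i assume i: "(i::nat) < 8"
    have x: "w x \<bullet> w (\<beta> i) = x \<bullet> \<beta> i" by (rule W_inner[OF w])
    show "w x \<bullet> \<beta> i = flip S x \<bullet> \<beta> i"
    proof (cases "i \<in> S")
      case True
      then have "w (\<beta> i) = - \<beta> i" by (simp add: S_def)
      then have "- (w x \<bullet> \<beta> i) = x \<bullet> \<beta> i" using x by simp
      then show ?thesis using True by (simp add: flip_inner[OF S i])
    next
      case False
      then have "w (\<beta> i) = \<beta> i" using d[OF i] i by (auto simp: S_def)
      then show ?thesis using False x by (simp add: flip_inner[OF S i])
    qed
  qed
  then have "w = flip S" by (rule ext)
  then show ?thesis using S unfolding flips_def by blast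
qed

lemma monomial_comp: "monomial u \<Longrightarrow> monomial w \<Longrightarrow> monomial (u \<circ> w)"
proof -
  assume u: "monomial u" and w: "monomial w"
  have lu: "linear u" using u W_linear unfolding monomial_def by blast
  have "\<exists>j<8. (u \<circ> w) (\<beta> i) = \<beta> j \<or> (u \<circ> w) (\<beta> i) = - \<beta> j" if i: "i < 8" for i
  proof -
    obtain k where k: "k < 8" "w (\<beta> i) = \<beta> k \<or> w (\<beta> i) = - \<beta> k" using w i unfolding monomial_def by blast
    obtain j where j: "j < 8" "u (\<beta> k) = \<beta> j \<or> u (\<beta> k) = - \<beta> j" using u k(1) unfolding monomial_def by blast
    have "(u \<circ> w) (\<beta> i) = u (\<beta> k) \<or> (u \<circ> w) (\<beta> i) = - u (\<beta> k)" using k(2) linear_neg[OF lu, of "\<beta> k"] by auto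
    then show ?thesis using j by (intro exI[of _ j]) auto
  qed
  then show ?thesis using W_comp u w unfolding monomial_def by blast
qed

lemma monomial_inv: assumes w: "monomial w" shows "monomial (inv\<^bsub>W_E8\<^esub> w)"
proof -
  let ?v = "inv\<^bsub>W_E8\<^esub> w"
  have wW: "w \<in> W_E8_carrier" using w by (simp add: monomial_def)
  have vW: "?v \<in> W_E8_carrier" using W.inv_closed[of w] wW by simp
  have vw: "?v (w x) = x" "w (?v x) = x" for x using inv_W[OF wW] by (simp_all add: fun_eq_iff)
  have lv: "linear ?v" by (rule W_linear[OF vW])
  have "\<exists>i<8. ?v (\<beta> j) = \<beta> i \<or> ?v (\<beta> j) = - \<beta> i" if j: "j < 8" for j
  proof -
    have "\<exists>i<8. ?v (\<beta> j) \<bullet> \<beta> i \<noteq> 0"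
    proof (rule ccontr)
      assume "\<not> ?thesis"
      then have "?v (\<beta> j) = 0" by (intro frame_eqI) simp
      then have "\<beta> j = w 0" using vw(2)[of "\<beta> j"] by simp
      then show False using frame_nonzero[OF j] linear_0[OF W_linear[OF wW]] by simp
    qed
    then obtain i where i: "i < 8" "?v (\<beta> j) \<bullet> \<beta> i \<noteq> 0" by blast
    obtain k where k: "k < 8" "w (\<beta> i) = \<beta> k \<or> w (\<beta> i) = - \<beta> k" using w i(1) unfolding monomial_def by blast
    have "\<beta> j \<bullet> w (\<beta> i) \<noteq> 0" using W_inner[OF wW, of "?v (\<beta> j)" "\<beta> i"] vw(2) i(2) by simp
    then have "\<beta> j \<bullet> \<beta> k \<noteq> 0" using k(2) by auto
    then have "j = k" using frame_orth[OF j k(1)] by blast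
    have "?v (\<beta> j) = \<beta> i \<or> ?v (\<beta> j) = - \<beta> i" using k(2)
    proof
      assume "w (\<beta> i) = \<beta> k"
      then show ?thesis using vw(1)[of "\<beta> i"] \<open>j = k\<close> by simp
    next
      assume "w (\<beta> i) = - \<beta> k"
      then have "?v (- \<beta> j) = \<beta> i" using vw(1)[of "\<beta> i"] \<open>j = k\<close> by simp
      then have "- ?v (\<beta> j) = \<beta> i" using linear_neg[OF lv, of "\<beta> j"] by simp
      then have "?v (\<beta> j) = - \<beta> i" by (metis minus_minus)
      then show ?thesis ..
    qed
    then show ?thesis using i(1) by blast
  qed
  then show ?thesis using vW unfolding monomial_def by blast
qed

lemma flips_W: "flips \<subseteq> W_E8_carrier"
  using subgroup.subset[OF subgroup_flips] by simp

lemma monomial_conj: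
  assumes w: "monomial w" and S: "S \<subseteq> {..<8}" shows "w \<circ> flip S \<circ> inv\<^bsub>W_E8\<^esub> w \<in> flips"
proof (rule diagonal_flips)
  let ?v = "inv\<^bsub>W_E8\<^esub> w"
  have wW: "w \<in> W_E8_carrier" and vW: "?v \<in> W_E8_carrier" using w monomial_inv[OF w] by (simp_all add: monomial_def)
  show "w \<circ> flip S \<circ> ?v \<in> W_E8_carrier" by (intro W_comp wW vW flip_W S)
  fix i assume i: "(i::nat) < 8"
  obtain j where j: "j < 8" "?v (\<beta> i) = \<beta> j \<or> ?v (\<beta> i) = - \<beta> j" using monomial_inv[OF w] i unfolding monomial_def by blast
  have "flip S x = x \<or> flip S x = - x" if x: "x = \<beta> j \<or> x = - \<beta> j" for x
  proof -
    have "flip S x = (if j \<in> S then - x else x)"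
      by (rule frame_eqI) (use S j(1) x in \<open>auto simp: flip_inner frame_inner\<close>)
    then show ?thesis by simp
  qed
  from this[OF j(2)] have "flip S (?v (\<beta> i)) = ?v (\<beta> i) \<or> flip S (?v (\<beta> i)) = - ?v (\<beta> i)" .
  then have "w (flip S (?v (\<beta> i))) = w (?v (\<beta> i)) \<or> w (flip S (?v (\<beta> i))) = - w (?v (\<beta> i))"
    using linear_neg[OF W_linear[OF wW], of "?v (\<beta> i)"] by (elim disjE) simp_all
  moreover have "w (?v (\<beta> i)) = \<beta> i" using fun_cong[OF inv_W(2)[OF wW], of "\<beta> i"] by simp
  ultimately show "(w \<circ> flip S \<circ> ?v) (\<beta> i) = \<beta> i \<or> (w \<circ> flip S \<circ> ?v) (\<beta> i) = - \<beta> i" by simp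
qed

text \<open>Conjugation by w turns the reflection in \<beta> i into the reflection in w (\<beta> i);
  if it stays among the sign changes it is a frame reflection. Conversely a signed permutation
  conjugates sign changes to operators that are diagonal on the frame.\<close>

lemma normalizer_flips: "normalizer W_E8 flips = {w. monomial w}"
proof -
  have conj: "w <#\<^bsub>W_E8\<^esub> flips #>\<^bsub>W_E8\<^esub> inv\<^bsub>W_E8\<^esub> w = (\<lambda>f. w \<circ> f \<circ> inv\<^bsub>W_E8\<^esub> w) ` flips" for w
    unfolding l_coset_def r_coset_def mult_W by blast
  have mem: "w \<in> normalizer W_E8 flips \<longleftrightarrow> w \<in> W_E8_carrier \<and> (\<lambda>f. w \<circ> f \<circ> inv\<^bsub>W_E8\<^esub> w) ` flips = flips" for w
    unfolding normalizer_def stabilizer_def using flips_W by (simp add: conj)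
  show ?thesis
  proof (intro subset_antisym subsetI)
    fix w assume "w \<in> normalizer W_E8 flips"
    then have wW: "w \<in> W_E8_carrier" and c: "(\<lambda>f. w \<circ> f \<circ> inv\<^bsub>W_E8\<^esub> w) ` flips = flips" using mem by blast+
    let ?v = "inv\<^bsub>W_E8\<^esub> w"
    have lw: "linear w" by (rule W_linear[OF wW])
    have "\<exists>j<8. w (\<beta> i) = \<beta> j \<or> w (\<beta> i) = - \<beta> j" if i: "i < 8" for i
    proof -
      let ?a = "w (\<beta> i)"
      have a: "?a \<in> E8_roots" by (rule W_root[OF wW frame_root[OF i]])
      have "reflection (\<beta> i) \<in> flips" using reflections_in_flips i by blast
      then have f: "w \<circ> reflection (\<beta> i) \<circ> ?v \<in> flips" using c by blast
      have wv: "w (?v x) = x" for x using inv_W(2)[OF wW] by (simp add: fun_eq_iff)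
      have "(w \<circ> reflection (\<beta> i) \<circ> ?v) x = reflection ?a x" for x
      proof -
        have "?v x \<bullet> \<beta> i = x \<bullet> ?a" using W_inner[OF wW, of "?v x" "\<beta> i"] wv by simp
        then show ?thesis
          by (simp add: reflection_root[OF a] reflection_root[OF frame_root[OF i]] linear_diff[OF lw] linear_cmul[OF lw] wv)
      qed
      then have "w \<circ> reflection (\<beta> i) \<circ> ?v = reflection ?a" by (rule ext)
      then have "reflection ?a \<in> (\<lambda>i. reflection (\<beta> i)) ` {..<8}" using f a reflections_in_flips by auto
      then obtain j where j: "j < 8" "reflection ?a = reflection (\<beta> j)" by blast
      \<comment> \<open>Both reflections are evaluated at \<open>?a\<close> itself, which exhibits
        it as a multiple of \<beta> j.\<close>
      have "?a - (?a \<bullet> \<beta> j) *\<^sub>R \<beta> j = ?a - (?a \<bullet> ?a) *\<^sub>R ?a"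
        using fun_cong[OF j(2), of ?a] by (simp only: reflection_root[OF a] reflection_root[OF frame_root[OF j(1)]])
      then have "(?a \<bullet> \<beta> j) *\<^sub>R \<beta> j = 2 *\<^sub>R ?a" using a by (simp add: E8_roots_eq)
      then have e: "?a = ((?a \<bullet> \<beta> j) / 2) *\<^sub>R \<beta> j"
        by (metis (no_types) divide_inverse_commute inverse_eq_divide scaleR_half_double scaleR_scaleR scaleR_2 scaleR_right_distrib)
      have "?a \<bullet> \<beta> k = 0" if "k < 8" "k \<noteq> j" for k
        by (subst e) (simp add: frame_orth[OF j(1) that(1) that(2)[symmetric]])
      then have "supp ?a \<subseteq> {j}" by (auto simp: supp_def)
      moreover have "supp ?a \<noteq> {}"
      proof
        assume "supp ?a = {}"
        then have "?a = 0" by (intro frame_eqI) (auto simp: supp_def)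
        then show False using a by (simp add: E8_roots_eq)
      qed
      ultimately have "supp ?a = {j}" by blast
      then show ?thesis using supp_eq_singleton[OF _ a] j(1) by blast
    qed
    then show "w \<in> {w. monomial w}" using wW by (simp add: monomial_def)
  next
    fix w assume "w \<in> {w. monomial w}"
    then have w: "monomial w" by simp
    let ?v = "inv\<^bsub>W_E8\<^esub> w"
    have wW: "w \<in> W_E8_carrier" using w by (simp add: monomial_def)
    have sub: "(\<lambda>f. u \<circ> f \<circ> inv\<^bsub>W_E8\<^esub> u) ` flips \<subseteq> flips" if "monomial u" for u
      using monomial_conj[OF that] unfolding flips_def by blast
    have vv: "inv\<^bsub>W_E8\<^esub> ?v = w" using W.inv_inv[of w] wW by simp
    have "f \<in> (\<lambda>f. w \<circ> f \<circ> ?v) ` flips" if f: "f \<in> flips" for f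
    proof (rule image_eqI)
      show "?v \<circ> f \<circ> w \<in> flips" using sub[OF monomial_inv[OF w]] f unfolding vv by blast
      show "f = w \<circ> (?v \<circ> f \<circ> w) \<circ> ?v"
        using fun_cong[OF inv_W(2)[OF wW]] by (simp add: fun_eq_iff)
    qed
    then show "w \<in> normalizer W_E8 flips" using mem wW sub[OF w] by blast
  qed
qed

text \<open>The index of the frame line that contains w (\<beta> i), read off from the support,
  which ignores the sign. It is meaningful for monomial w, whose supports here are
  singletons.\<close>

definition perm_of :: "(real^8 \<Rightarrow> real^8) \<Rightarrow> nat list" where
  "perm_of w = map (\<lambda>i. the_elem (supp (w (\<beta> i)))) [0,1,2,3,4,5,6,7]"

lemma nth_perm_of: "i < 8 \<Longrightarrow> perm_of w ! i = the_elem (supp (w (\<beta> i)))"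
  unfolding less_8_cases perm_of_def by (elim disjE) simp_all

lemma length_perm_of: "length (perm_of w) = 8"
  by (simp add: perm_of_def)

lemma perm_of_eqI: "length p = 8 \<Longrightarrow> (\<And>i. i < 8 \<Longrightarrow> perm_of w ! i = p ! i) \<Longrightarrow> perm_of w = p"
  by (rule nth_equalityI) (simp_all add: length_perm_of)

lemma perm_of_frame:
  assumes "i < 8" "j < 8" "w (\<beta> i) = \<beta> j \<or> w (\<beta> i) = - \<beta> j" shows "perm_of w ! i = j"
  using assms(3) by (elim disjE) (simp_all add: nth_perm_of[OF assms(1)] supp_uminus supp_frame[OF assms(2)])

lemma monomial_perm:
  assumes w: "monomial w" and i: "i < 8"
  shows "perm_of w ! i < 8" "w (\<beta> i) = \<beta> (perm_of w ! i) \<or> w (\<beta> i) = - \<beta> (perm_of w ! i)"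
proof -
  obtain j where j: "j < 8" "w (\<beta> i) = \<beta> j \<or> w (\<beta> i) = - \<beta> j" using w i unfolding monomial_def by blast
  have p: "perm_of w ! i = j" by (rule perm_of_frame[of i j w, OF i j])
  show "perm_of w ! i < 8" "w (\<beta> i) = \<beta> (perm_of w ! i) \<or> w (\<beta> i) = - \<beta> (perm_of w ! i)" unfolding p by (rule j)+
qed

lemma perm_of_comp:
  assumes u: "monomial u" and w: "monomial w" shows "perm_of (u \<circ> w) = pcomp (perm_of u) (perm_of w)"
proof (rule perm_of_eqI)
  show "length (pcomp (perm_of u) (perm_of w)) = 8" by (simp add: pcomp_def length_perm_of)
  fix i assume i: "(i::nat) < 8"
  have lu: "linear u" using u W_linear unfolding monomial_def by blast
  let ?k = "perm_of w ! i"
  have k: "?k < 8" "w (\<beta> i) = \<beta> ?k \<or> w (\<beta> i) = - \<beta> ?k" by (rule monomial_perm[OF w i])+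
  let ?j = "perm_of u ! ?k"
  have j: "?j < 8" "u (\<beta> ?k) = \<beta> ?j \<or> u (\<beta> ?k) = - \<beta> ?j" by (rule monomial_perm[OF u k(1)])+
  have "(u \<circ> w) (\<beta> i) = u (\<beta> ?k) \<or> (u \<circ> w) (\<beta> i) = - u (\<beta> ?k)" using k(2) linear_neg[OF lu, of "\<beta> ?k"] by auto
  then have "(u \<circ> w) (\<beta> i) = \<beta> ?j \<or> (u \<circ> w) (\<beta> i) = - \<beta> ?j" using j(2) by auto
  from perm_of_frame[of i ?j "u \<circ> w", OF i j(1) this] show "perm_of (u \<circ> w) ! i = pcomp (perm_of u) (perm_of w) ! i"
    using i by (simp add: pcomp_def length_perm_of)
qed

lemma monomial_perm_inj:
  assumes w: "monomial w" and ij: "i < 8" "j < 8" "perm_of w ! i = perm_of w ! j" shows "i = j"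
proof (rule ccontr)
  assume ne: "i \<noteq> j"
  have wW: "w \<in> W_E8_carrier" using w by (simp add: monomial_def)
  have "w (\<beta> i) \<bullet> w (\<beta> j) = 0" using W_inner[OF wW] frame_orth[OF ij(1,2) ne] by simp
  moreover have "w (\<beta> i) \<bullet> w (\<beta> j) = 2 \<or> w (\<beta> i) \<bullet> w (\<beta> j) = - 2"
    using monomial_perm(2)[OF w ij(1)] monomial_perm(2)[OF w ij(2)] frame_inner[OF monomial_perm(1)[OF w ij(2)] monomial_perm(1)[OF w ij(2)]]
    unfolding ij(3) by (elim disjE) simp_all
  ultimately show False by simp
qed

lemma perm_of_list: assumes w: "monomial w" shows "length (perm_of w) = 8 \<and> distinct (perm_of w) \<and> set (perm_of w) \<subseteq> {..<8}"
  unfolding distinct_conv_nth using monomial_perm_inj[OF w] monomial_perm(1)[OF w]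
  by (auto simp: length_perm_of in_set_conv_nth)

lemma supp_monomial: assumes w: "monomial w" shows "supp (w x) = (!) (perm_of w) ` supp x"
proof -
  have wW: "w \<in> W_E8_carrier" using w by (simp add: monomial_def)
  have eq: "w x \<bullet> \<beta> (perm_of w ! i) \<noteq> 0 \<longleftrightarrow> x \<bullet> \<beta> i \<noteq> 0" if i: "i < 8" for i
    using monomial_perm(2)[OF w i] W_inner[OF wW, of x "\<beta> i"] by (elim disjE) auto
  have "inj_on ((!) (perm_of w)) {..<8}" by (rule inj_onI) (use monomial_perm_inj[OF w] in simp)
  then have surj: "(!) (perm_of w) ` {..<8} = {..<8}"
    using monomial_perm(1)[OF w] by (intro endo_inj_surj) auto
  show ?thesis
  proof (intro subset_antisym subsetI)
    fix j assume j: "j \<in> supp (w x)"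
    then have "j \<in> (!) (perm_of w) ` {..<8}" unfolding surj by (simp add: supp_def)
    then obtain i where i: "i < 8" "j = perm_of w ! i" by blast
    then have "i \<in> supp x" using j eq[OF i(1)] by (simp add: supp_def)
    then show "j \<in> (!) (perm_of w) ` supp x" using i(2) by blast
  next
    fix j assume "j \<in> (!) (perm_of w) ` supp x"
    then obtain i where i: "i \<in> supp x" "j = perm_of w ! i" by blast
    then have "i < 8" by (simp add: supp_def)
    then show "j \<in> supp (w x)" using i eq monomial_perm(1)[OF w] by (simp add: supp_def)
  qed
qed

text \<open>w maps the root \<open>half S\<close> to a root whose support has four elements, and the
  support of such a root is a block.\<close>

lemma perm_of_blocks:
  assumes w: "monomial w" and S: "S \<in> blocks" shows "(!) (perm_of w) ` S \<in> blocks"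
proof -
  have wW: "w \<in> W_E8_carrier" using w by (simp add: monomial_def)
  have h: "half S \<in> E8_roots" "supp (half S) = S"
    using flip_half_root[OF S, of "{}"] supp_flip_half[OF S, of "{}"] by (simp_all add: flip_empty)
  have r: "w (half S) \<in> E8_roots" by (rule W_root[OF wW h(1)])
  have s: "supp (w (half S)) = (!) (perm_of w) ` S" using supp_monomial[OF w, of "half S"] unfolding h(2) .
  have S4: "card S = 4" "S \<subseteq> {..<8}" using S by (simp_all add: blocks_def)
  have "inj_on ((!) (perm_of w)) S" by (rule inj_onI) (use monomial_perm_inj[OF w] S4(2) in auto)
  then have c: "card (supp (w (half S))) = 4" unfolding s using S4(1) by (simp add: card_image)
  have "\<not> (\<exists>i<8. w (half S) = \<beta> i \<or> w (half S) = - \<beta> i)"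
  proof
    assume "\<exists>i<8. w (half S) = \<beta> i \<or> w (half S) = - \<beta> i"
    then obtain i where "i < 8" "w (half S) = \<beta> i \<or> w (half S) = - \<beta> i" by blast
    then have "supp (w (half S)) = {i}" by (auto simp: supp_frame supp_uminus)
    then show False using c by simp
  qed
  then have "supp (w (half S)) \<in> blocks" using root_cases[OF r] by blast
  then show ?thesis unfolding s .
qed

text \<open>For a block \<open>{a, b, c, d}\<close> the reflections in the orthogonal roots
  \<open>(\<beta> a - \<beta> b + \<beta> c - \<beta> d) / 2\<close> and \<open>(\<beta> a - \<beta> b - \<beta> c + \<beta> d) / 2\<close>
  multiply to the elation exchanging \<open>a\<close> with \<open>b\<close> and \<open>c\<close> with \<open>d\<close>.\<close>

lemma elation:
  assumes d: "distinct [a,b,c,d]" and S: "{a,b,c,d} \<in> blocks"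
  shows "\<exists>w. monomial w \<and> perm_of w = swap2 a b c d"
proof -
  let ?S = "{a,b,c,d}"
  have S8: "?S \<subseteq> {..<8}" using S by (simp only: blocks_def mem_Collect_eq)
  then have lt: "a < 8" "b < 8" "c < 8" "d < 8" by auto
  have T: "{b,d} \<subseteq> {..<8}" "{b,c} \<subseteq> {..<8}" using lt by auto
  define r1 where "r1 = flip {b,d} (half ?S)"
  define r2 where "r2 = flip {b,c} (half ?S)"
  have root: "r1 \<in> E8_roots" "r2 \<in> E8_roots" unfolding r1_def r2_def by (rule flip_half_root[OF S T(1)] flip_half_root[OF S T(2)])+
  have i1: "r1 \<bullet> \<beta> j = (if j = a \<or> j = c then 1 else if j = b \<or> j = d then -1 else 0)" if "j < 8" for j
    unfolding r1_def flip_inner[OF T(1) that] half_inner[OF S8 that] using d by auto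
  have i2: "r2 \<bullet> \<beta> j = (if j = a \<or> j = d then 1 else if j = b \<or> j = c then -1 else 0)" if "j < 8" for j
    unfolding r2_def flip_inner[OF T(2) that] half_inner[OF S8 that] using d by auto
  define w where "w = reflection r1 \<circ> reflection r2"
  have wW: "w \<in> W_E8_carrier" unfolding w_def by (intro W_comp reflection_W root)
  have "(\<Sum>j<8. (r2 \<bullet> \<beta> j) * (r1 \<bullet> \<beta> j)) = (\<Sum>j\<in>?S. (r2 \<bullet> \<beta> j) * (r1 \<bullet> \<beta> j))"
    by (rule sum.mono_neutral_right) (use S8 in \<open>auto simp: i1 i2\<close>)
  also have "\<dots> = 0" using d lt by (simp add: i1 i2)
  \<comment> \<open>The sign patterns (+,-,+,-) and (+,-,-,+) are orthogonal, so the reflections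
    commute and w simply subtracts both components.\<close>
  finally have orth: "r2 \<bullet> r1 = 0" using frame_inner_expansion[of r2 r1] by simp
  have wx: "w x = x - (x \<bullet> r1) *\<^sub>R r1 - (x \<bullet> r2) *\<^sub>R r2" for x
    unfolding w_def by (simp add: reflection_root root inner_diff_left orth algebra_simps)
  have wj: "w (\<beta> i) \<bullet> \<beta> j = \<beta> i \<bullet> \<beta> j - (r1 \<bullet> \<beta> i) * (r1 \<bullet> \<beta> j) - (r2 \<bullet> \<beta> i) * (r2 \<bullet> \<beta> j)" for i j
    unfolding wx by (simp add: inner_diff_left inner_commute[of "\<beta> i" r1] inner_commute[of "\<beta> i" r2])
  have val: "w (\<beta> i) \<bullet> \<beta> j = (if i = j then 2 else 0)
      - (if i = a \<or> i = c then 1 else if i = b \<or> i = d then -1 else 0) * (if j = a \<or> j = c then 1 else if j = b \<or> j = d then -1 else 0)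
      - (if i = a \<or> i = d then 1 else if i = b \<or> i = c then -1 else 0) * (if j = a \<or> j = d then 1 else if j = b \<or> j = c then -1 else 0)"
    if "i < 8" "j < 8" for i j
    unfolding wj frame_inner[OF that] i1[OF that(1)] i1[OF that(2)] i2[OF that(1)] i2[OF that(2)] ..
  have ab: "w (\<beta> a) = \<beta> b"
  proof (rule frame_eqI)
    show "w (\<beta> a) \<bullet> \<beta> j = \<beta> b \<bullet> \<beta> j" if j: "j < 8" for j
      unfolding val[OF lt(1) j] frame_inner[OF lt(2) j]
      by (cases "j = a"; cases "j = b"; cases "j = c"; cases "j = d"; use d in simp)
  qed
  have ba: "w (\<beta> b) = \<beta> a"
  proof (rule frame_eqI)
    show "w (\<beta> b) \<bullet> \<beta> j = \<beta> a \<bullet> \<beta> j" if j: "j < 8" for j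
      unfolding val[OF lt(2) j] frame_inner[OF lt(1) j]
      by (cases "j = a"; cases "j = b"; cases "j = c"; cases "j = d"; use d in simp)
  qed
  have cd: "w (\<beta> c) = \<beta> d"
  proof (rule frame_eqI)
    show "w (\<beta> c) \<bullet> \<beta> j = \<beta> d \<bullet> \<beta> j" if j: "j < 8" for j
      unfolding val[OF lt(3) j] frame_inner[OF lt(4) j]
      by (cases "j = a"; cases "j = b"; cases "j = c"; cases "j = d"; use d in simp)
  qed
  have dc: "w (\<beta> d) = \<beta> c"
  proof (rule frame_eqI)
    show "w (\<beta> d) \<bullet> \<beta> j = \<beta> c \<bullet> \<beta> j" if j: "j < 8" for j
      unfolding val[OF lt(4) j] frame_inner[OF lt(3) j]
      by (cases "j = a"; cases "j = b"; cases "j = c"; cases "j = d"; use d in simp)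
  qed
  have fix': "w (\<beta> i) = \<beta> i" if i: "i < 8" "i \<notin> ?S" for i
  proof (rule frame_eqI)
    show "w (\<beta> i) \<bullet> \<beta> j = \<beta> i \<bullet> \<beta> j" if j: "j < 8" for j
      unfolding val[OF i(1) j] frame_inner[OF i(1) j] using i(2) by simp
  qed
  define s where "s i = (if i = a then b else if i = b then a else if i = c then d else if i = d then c else i)" for i
  have s8: "s i < 8" if "i < 8" for i using that lt by (simp add: s_def)
  have ws: "w (\<beta> i) = \<beta> (s i)" if "i < 8" for i
  proof -
    have "i = a \<or> i = b \<or> i = c \<or> i = d \<or> i \<notin> ?S" by blast
    then show ?thesis by (elim disjE) (use d ab ba cd dc fix'[OF that] in \<open>simp_all add: s_def\<close>)
  qed
  have m: "monomial w" unfolding monomial_def using wW ws s8 by blast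
  have "perm_of w = map s [0,1,2,3,4,5,6,7]"
  proof (rule perm_of_eqI)
    fix i assume i: "(i::nat) < 8"
    have "perm_of w ! i = s i" by (rule perm_of_frame[OF i s8[OF i]]) (simp add: ws[OF i])
    also have "s i = map s [0,1,2,3,4,5,6,7] ! i" using i unfolding less_8_cases by (elim disjE) simp_all
    finally show "perm_of w ! i = map s [0,1,2,3,4,5,6,7] ! i" .
  qed simp
  then show ?thesis using m unfolding swap2_def s_def by blast
qed

text \<open>A concrete model of the normaliser modulo the sign changes: by
  \<open>kernel_perm_of\<close> nothing but signs is forgotten.\<close>

definition perm_group :: "nat list monoid" where
  "perm_group = \<lparr>carrier = perm_of ` {w. monomial w}, mult = pcomp, one = [0,1,2,3,4,5,6,7]\<rparr>"

lemma monomial_id: "monomial id" and perm_of_id: "perm_of id = [0,1,2,3,4,5,6,7]"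
proof -
  show m: "monomial id" unfolding monomial_def using W_id by (intro conjI allI impI) auto
  show "perm_of id = [0,1,2,3,4,5,6,7]" by (simp add: perm_of_def supp_frame)
qed

lemma group_normalizer: "group (W_E8\<lparr>carrier := normalizer W_E8 flips\<rparr>)"
  using W.normalizer_imp_subgroup[of flips] flips_W by (intro W.subgroup_imp_group) simp

lemma perm_of_hom: "perm_of \<in> hom (W_E8\<lparr>carrier := normalizer W_E8 flips\<rparr>) perm_group"
  by (rule homI) (simp_all add: normalizer_flips perm_group_def perm_of_comp)

lemma group_perm_group: "group perm_group"
proof -
  have "perm_group\<lparr>carrier := perm_of ` carrier (W_E8\<lparr>carrier := normalizer W_E8 flips\<rparr>),
      one := perm_of \<one>\<^bsub>W_E8\<lparr>carrier := normalizer W_E8 flips\<rparr>\<^esub>\<rparr> = perm_group"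
    by (simp add: perm_group_def normalizer_flips perm_of_id)
  then show ?thesis using group.hom_imp_img_group[OF group_normalizer perm_of_hom] by simp
qed

lemma kernel_perm_of: "kernel (W_E8\<lparr>carrier := normalizer W_E8 flips\<rparr>) perm_group perm_of = flips"
proof (intro subset_antisym subsetI)
  fix w assume "w \<in> kernel (W_E8\<lparr>carrier := normalizer W_E8 flips\<rparr>) perm_group perm_of"
  then have w: "monomial w" and p: "perm_of w = [0,1,2,3,4,5,6,7]" by (simp_all add: kernel_def normalizer_flips perm_group_def)
  have "perm_of w ! i = i" if "i < 8" for i using that unfolding p less_8_cases by (elim disjE) simp_all
  then have "w (\<beta> i) = \<beta> i \<or> w (\<beta> i) = - \<beta> i" if "i < 8" for i using monomial_perm(2)[OF w that] that by simp
  then show "w \<in> flips" using w by (intro diagonal_flips) (simp_all add: monomial_def)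
next
  fix w assume w: "w \<in> flips"
  then obtain S where S: "S \<subseteq> {..<8}" "w = flip S" by (auto simp: flips_def)
  have e: "w (\<beta> i) = \<beta> i \<or> w (\<beta> i) = - \<beta> i" if i: "i < 8" for i
  proof -
    have "flip S (\<beta> i) = (if i \<in> S then - \<beta> i else \<beta> i)"
      by (rule frame_eqI) (use S(1) i in \<open>auto simp: flip_inner frame_inner\<close>)
    then show ?thesis using S(2) by simp
  qed
  have m: "monomial w" unfolding monomial_def using e w flips_W by blast
  have "perm_of w = [0,1,2,3,4,5,6,7]"
  proof (rule perm_of_eqI)
    fix i assume i: "(i::nat) < 8"
    have "perm_of w ! i = i" by (rule perm_of_frame[of i i w, OF i i e[OF i]])
    also have "i = [0,1,2,3,4,5,6,7] ! i" using i unfolding less_8_cases by (elim disjE) simp_all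
    finally show "perm_of w ! i = [0,1,2,3,4,5,6,7] ! i" .
  qed simp
  then show "w \<in> kernel (W_E8\<lparr>carrier := normalizer W_E8 flips\<rparr>) perm_group perm_of"
    using m by (simp add: kernel_def normalizer_flips perm_group_def)
qed

end

context fano_frame
begin

lemma fano_perms_perm_group: "fano_perms perm_group"
proof (intro fano_perms.intro fano_perms_axioms.intro group_perm_group)
  fix p assume "p \<in> carrier perm_group"
  then obtain w where w: "monomial w" "p = perm_of w" by (auto simp: perm_group_def)
  show "length p = 8 \<and> distinct p \<and> set p \<subseteq> {..<8}" unfolding w(2) by (rule perm_of_list[OF w(1)])
  show "(!) p ` S \<in> fano_ext_lines" if "S \<in> fano_ext_lines" for S
    using perm_of_blocks[OF w(1), of S] that unfolding w(2) blocks_fano by blast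
next
  fix a b c d assume d: "distinct [a,b,c,d]" and S: "set [a,b,c,d] \<in> fano_ext_lines"
  have "{a,b,c,d} \<in> blocks" using S unfolding blocks_fano by simp
  then obtain w where w: "monomial w" "perm_of w = swap2 a b c d" using elation[OF d] by blast
  then have "swap2 a b c d \<in> perm_of ` {w. monomial w}" by (intro image_eqI[of _ _ w]) simp_all
  then show "swap2 a b c d \<in> carrier perm_group" by (simp add: perm_group_def)
qed (simp_all add: perm_group_def)

theorem quotient_splits:
  "\<exists>E H. E \<lhd> (W_E8\<lparr>carrier := normalizer W_E8 flips\<rparr>) Mod flips
           \<and> subgroup H ((W_E8\<lparr>carrier := normalizer W_E8 flips\<rparr>) Mod flips)
           \<and> ((W_E8\<lparr>carrier := normalizer W_E8 flips\<rparr>) Mod flips)\<lparr>carrier := E\<rparr> \<cong> Z2_pow 3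
           \<and> ((W_E8\<lparr>carrier := normalizer W_E8 flips\<rparr>) Mod flips)\<lparr>carrier := H\<rparr> \<cong> PSL27
           \<and> E \<inter> H = {\<one>\<^bsub>(W_E8\<lparr>carrier := normalizer W_E8 flips\<rparr>) Mod flips\<^esub>}
           \<and> E <#>\<^bsub>(W_E8\<lparr>carrier := normalizer W_E8 flips\<rparr>) Mod flips\<^esub> H
               = carrier ((W_E8\<lparr>carrier := normalizer W_E8 flips\<rparr>) Mod flips)"
proof -
  let ?N = "W_E8\<lparr>carrier := normalizer W_E8 flips\<rparr>"
  interpret p: group_hom ?N perm_group perm_of
    by (intro group_hom.intro group_hom_axioms.intro group_normalizer group_perm_group perm_of_hom)
  have img: "perm_of ` carrier ?N = carrier perm_group" by (simp add: perm_group_def normalizer_flips)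
  have iso: "?N Mod flips \<cong> perm_group" using p.FactGroup_iso[OF img] unfolding kernel_perm_of .
  have "flips \<lhd> ?N" using p.normal_kernel unfolding kernel_perm_of .
  then have gQ: "group (?N Mod flips)" by (rule normal.factorgroup_is_group)
  have "perm_group \<cong> ?N Mod flips" by (rule group.iso_sym[OF gQ iso])
  then obtain f where f: "f \<in> iso perm_group (?N Mod flips)" unfolding is_iso_def by blast
  show ?thesis
    by (rule split_extension_transport[OF group_perm_group gQ f fano_perms.split_extension[OF fano_perms_perm_group]])
qed

end

theorem theorem4p6:
  fixes M :: "(real^8 \<Rightarrow> real^8) set"
  assumes abel: "abelian_subgroup_W M"
      and maxord: "\<forall>M'. abelian_subgroup_W M' \<longrightarrow> card M' \<le> card M"
  shows "W_E8\<lparr>carrier := M\<rparr> \<cong> Z2_pow 8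
    \<and> (\<exists>\<beta> :: nat \<Rightarrow> real^8.
          (\<forall>i<8. \<beta> i \<in> E8_roots)
        \<and> (\<forall>i<8. \<forall>j<8. i \<noteq> j \<longrightarrow> \<beta> i \<bullet> \<beta> j = 0
                 \<and> \<beta> i + \<beta> j \<notin> E8_roots \<and> \<beta> i - \<beta> j \<notin> E8_roots)
        \<and> M = generate W_E8 ((\<lambda>i. reflection (\<beta> i)) ` {..<8})
        \<and> {w \<in> M. \<exists>a\<in>E8_roots. w = reflection a} = (\<lambda>i. reflection (\<beta> i)) ` {..<8}
        \<and> {Ob \<in> root_orbits M. card Ob = 2} = {{\<beta> i, - \<beta> i} | i. i < 8}
        \<and> (\<forall>Ob \<in> root_orbits M. card Ob \<noteq> 2 \<longrightarrow> card Ob = 16)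
        \<and> card {Ob \<in> root_orbits M. card Ob \<noteq> 2} = 14
        \<and> (\<forall>Ob \<in> root_orbits M. card Ob \<noteq> 2 \<longrightarrow>
              card {i. i < 8 \<and> (\<forall>\<gamma>\<in>Ob. \<beta> i \<bullet> \<gamma> \<noteq> 0)} = 4)
        \<and> (\<forall>i<8. card {Ob \<in> root_orbits M. card Ob \<noteq> 2 \<and> (\<forall>\<gamma>\<in>Ob. \<beta> i \<bullet> \<gamma> \<noteq> 0)} = 7)
        \<and> (\<exists>f g. bij_betw f {..<8} fano_ext_points
               \<and> bij_betw g {Ob \<in> root_orbits M. card Ob \<noteq> 2} fano_ext_lines
               \<and> (\<forall>i<8. \<forall>Ob \<in> root_orbits M. card Ob \<noteq> 2 \<longrightarrow>
                    ((\<forall>\<gamma>\<in>Ob. \<beta> i \<bullet> \<gamma> \<noteq> 0) \<longleftrightarrow> f i \<in> g Ob))))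
    \<and> (\<exists>E H. E \<lhd> (W_E8\<lparr>carrier := normalizer W_E8 M\<rparr>) Mod M
           \<and> subgroup H ((W_E8\<lparr>carrier := normalizer W_E8 M\<rparr>) Mod M)
           \<and> ((W_E8\<lparr>carrier := normalizer W_E8 M\<rparr>) Mod M)\<lparr>carrier := E\<rparr> \<cong> Z2_pow 3
           \<and> ((W_E8\<lparr>carrier := normalizer W_E8 M\<rparr>) Mod M)\<lparr>carrier := H\<rparr> \<cong> PSL27
           \<and> E \<inter> H = {\<one>\<^bsub>(W_E8\<lparr>carrier := normalizer W_E8 M\<rparr>) Mod M\<^esub>}
           \<and> E <#>\<^bsub>(W_E8\<lparr>carrier := normalizer W_E8 M\<rparr>) Mod M\<^esub> H
               = carrier ((W_E8\<lparr>carrier := normalizer W_E8 M\<rparr>) Mod M))"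
proof -
  obtain \<beta>0 where f0: "root_frame \<beta>0" "M = root_frame.flips \<beta>0" using maximal_abelian_flips[OF abel maxord] by blast
  \<comment> \<open>Only the numbering of the frame changes; the group of sign changes is still
    M.\<close>
  obtain \<beta> where f: "fano_frame \<beta>" and eq: "root_frame.flips \<beta> = root_frame.flips \<beta>0" using root_frame.ex_fano_frame[OF f0(1)] by blast
  have M: "M = root_frame.flips \<beta>" unfolding f0(2) eq ..
  interpret fano_frame \<beta> by (rule f)
  show ?thesis unfolding M
    by (rule conjI[OF W_flips_iso_Z2_pow conjI[OF _ quotient_splits]], rule exI[of _ \<beta>], rule orbit_design)
qed


end
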